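(* There is an isomorphism of operads $\ker\hat\Phi_{\mathrm{geo}}\cong\mathrm{LieAdm}$, where $\hat\Phi_{\mathrm{geo}}:\nabla\mathrm{Trees}\to\nabla\mathrm{Trees}\vee\Bbbk\Diamond$ is the derivation on the operad of Christoffel trees defined in the context and $\mathrm{LieAdm}$ is the operad of Lie-admissible algebras. Moreover, that isomorphism identifies $\ker\hat\Phi_{\mathrm{geo}}$ as the linear span of iterations of covariant derivatives, that is, $\ker\hat\Phi_{\mathrm{geo}}$ is the linear span of all iterated operadic compositions (with all labellings) of the covariant derivative operation $\nabla\in\nabla\mathrm{Trees}(\{1,2\})$.
   Context: $\Bbbk$ is a field of characteristic zero. All operads are symmetric operads in $\Bbbk$-vector spaces, viewed as linear species with partial compositions $\circ_v$; $\vee$ denotes the coproduct of operads. Christoffel trees. A Christoffel tree is a rooted tree with black and white vertices such that every black vertex has at least two input edges (edges coming from its children) and, for each black vertex, exactly two of its input edges are declared special ("thick"). All other edges are ordinary. $\nabla\mathrm{Trees}(S)$ is the vector space with basis all Christoffel trees whose white vertices are in bijection with the finite set $S$. For Christoffel trees $T_1,T_2$ and a white vertex $v$ of $T_1$, $T_1\circ_vT_2=\sum_fT_1\circ_v^fT_2$, the sum over all maps $f$ from the set of input edges of $v$ in $T_1$ to the set of all (black and white) vertices of $T_2$, where $T_1\circ_v^fT_2$ is obtained by replacing $v$ by $T_2$ and attaching each input edge $e$ of $v$ (as an ordinary edge) at the vertex $f(e)$. This makes $\nabla\mathrm{Trees}$ an operad, generated by its binary operations: the tree $1\leftarrow2$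 with white root $1$ and one child $2$, the tree $2\leftarrow1$ with white root $2$ and one child $1$, and the tree $m(1,2)$ with black root having two children, the white vertices $1$ and $2$, attached by the two special edges. The target. $\nabla\mathrm{Trees}\vee\Bbbk\Diamond$ is the coproduct of $\nabla\mathrm{Trees}$ with one arity-zero operation $\Diamond$; concretely it is spanned by Christoffel trees in which some of the non-black vertices are labelled $\Diamond$ (with repetitions allowed) and the others are in bijection with $S$. Write $\Diamond(1,2)$ for the tree with root labelled $\Diamond$ and two children $1$ and $2$ attached by ordinary edges. The map $\hat\Phi_{\mathrm{geo}}$. It is the unique derivation (i.e. $D(\mu\circ_i\nu)=D(\mu)\circ_i\nu+\mu\circ_iD(\nu)$, equivariant) from $\nabla\mathrm{Trees}$ to the $\nabla\mathrm{Trees}$-bimodule $\nabla\mathrm{Trees}\vee\Bbbk\Diamond$ with $\hat\Phi_{\mathrm{geo}}(1\leftarrow2)=\hat\Phi_{\mathrm{geo}}(2\leftarrow1)=\Diamond(1,2)$ and $\hat\Phi_{\mathrm{geo}}(m(1,2))=-2\,\Diamond(1,2)$. Its kernel is a suboperad of $\nabla\mathrm{Trees}$. Covariant derivative. $\nabla=\nabla_1 2:=(2\leftarrow1)+\tfrac12\,m(1,2)$. Lie-admissible algebras. $\mathrm{LieAdm}$ is the operad of algebras with one binary operation $(a,b)\mapsto ab$ such that $[a,b]=ab-ba$ satisfies the Jacobi identity. *)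

theory Defs
  imports Complex_Main "HOL-Library.Multiset" "HOL-Library.FuncSet" "HOL-Library.Poly_Mapping"
begin

section \<open>Free vector spaces\<close>

definition fscale :: "'k::field \<Rightarrow> ('b \<Rightarrow>\<^sub>0 'k) \<Rightarrow> ('b \<Rightarrow>\<^sub>0 'k)" where
  "fscale c x = Poly_Mapping.map (\<lambda>a. c * a) x"

lemma lookup_fscale [simp]: "Poly_Mapping.lookup (fscale c x) b = c * Poly_Mapping.lookup x b"
  by (simp add: fscale_def Poly_Mapping.map.rep_eq when_def)

interpretation fvs: vector_space "fscale :: 'k::field \<Rightarrow> ('b \<Rightarrow>\<^sub>0 'k) \<Rightarrow> ('b \<Rightarrow>\<^sub>0 'k)"
  by standard (auto intro!: poly_mapping_eqI simp: lookup_add algebra_simps)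

abbreviation basis :: "'b \<Rightarrow> ('b \<Rightarrow>\<^sub>0 'k::field)" where
  "basis b \<equiv> Poly_Mapping.single b 1"

definition lin_ext :: "('a \<Rightarrow> ('b \<Rightarrow>\<^sub>0 'k::field)) \<Rightarrow> ('a \<Rightarrow>\<^sub>0 'k) \<Rightarrow> ('b \<Rightarrow>\<^sub>0 'k)" where
  "lin_ext f x = (\<Sum>a\<in>Poly_Mapping.keys x. fscale (Poly_Mapping.lookup x a) (f a))"

definition bilin_ext ::
  "('a \<Rightarrow> 'b \<Rightarrow> ('c \<Rightarrow>\<^sub>0 'k::field)) \<Rightarrow> ('a \<Rightarrow>\<^sub>0 'k) \<Rightarrow> ('b \<Rightarrow>\<^sub>0 'k) \<Rightarrow> ('c \<Rightarrow>\<^sub>0 'k)" where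
  "bilin_ext f x y = lin_ext (\<lambda>a. lin_ext (f a) y) x"

section \<open>Symmetric operads as linear species with partial compositions\<close>

text \<open>
  The finite subsets of \<^typ>\<open>nat\<close> and their bijections form a category equivalent to that of all
  finite sets and bijections, so a linear species is given by its components on finite sets
  \<open>S :: nat set\<close>. A bijection is an \<open>\<sigma> :: nat \<Rightarrow> nat\<close> injective on \<open>S\<close>, acting as
  \<open>op_act P S \<sigma> : P(S) \<rightarrow> P(\<sigma> ` S)\<close>. The partial composition
  \<open>op_comp P S v T : P(S) \<otimes> P(T) \<rightarrow> P((S - {v}) \<union> T)\<close> is meaningful for \<open>v \<in> S\<close> and
  \<open>(S - {v}) \<inter> T = {}\<close>, and \<open>op_unit P s \<in> P({s})\<close>. In all examples below the component on an
  infinite \<open>S\<close> is the zero space, so quantifiers over \<open>S\<close> need no finiteness restriction.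
\<close>

record ('k, 'x) operad =
  op_space :: "nat set \<Rightarrow> 'x set"
  op_zero  :: "nat set \<Rightarrow> 'x"
  op_add   :: "nat set \<Rightarrow> 'x \<Rightarrow> 'x \<Rightarrow> 'x"
  op_scale :: "nat set \<Rightarrow> 'k \<Rightarrow> 'x \<Rightarrow> 'x"
  op_act   :: "nat set \<Rightarrow> (nat \<Rightarrow> nat) \<Rightarrow> 'x \<Rightarrow> 'x"
  op_comp  :: "nat set \<Rightarrow> nat \<Rightarrow> nat set \<Rightarrow> 'x \<Rightarrow> 'x \<Rightarrow> 'x"
  op_unit  :: "nat \<Rightarrow> 'x"

abbreviation composable :: "nat set \<Rightarrow> nat \<Rightarrow> nat set \<Rightarrow> bool" where
  "composable S v T \<equiv> v \<in> S \<and> (S - {v}) \<inter> T = {}"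

definition operad_iso ::
  "('k, 'x) operad \<Rightarrow> ('k, 'y) operad \<Rightarrow> (nat set \<Rightarrow> 'x \<Rightarrow> 'y) \<Rightarrow> bool" where
  "operad_iso P Q \<phi> \<longleftrightarrow>
     (\<forall>S. bij_betw (\<phi> S) (op_space P S) (op_space Q S)) \<and>
     (\<forall>S. \<forall>x\<in>op_space P S. \<forall>y\<in>op_space P S.
        \<phi> S (op_add P S x y) = op_add Q S (\<phi> S x) (\<phi> S y)) \<and>
     (\<forall>S c. \<forall>x\<in>op_space P S. \<phi> S (op_scale P S c x) = op_scale Q S c (\<phi> S x)) \<and>
     (\<forall>S \<sigma>. \<forall>x\<in>op_space P S. inj_on \<sigma> S \<longrightarrow>
        \<phi> (\<sigma> ` S) (op_act P S \<sigma> x) = op_act Q S \<sigma> (\<phi> S x)) \<and>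
     (\<forall>S v T. \<forall>x\<in>op_space P S. \<forall>y\<in>op_space P T. composable S v T \<longrightarrow>
        \<phi> ((S - {v}) \<union> T) (op_comp P S v T x y) = op_comp Q S v T (\<phi> S x) (\<phi> T y)) \<and>
     (\<forall>s. \<phi> {s} (op_unit P s) = op_unit Q s)"

text \<open>
  Derivations from \<open>P\<close> to an operad \<open>M\<close> containing \<open>P\<close> as a suboperad; \<open>M\<close> is regarded as a
  \<open>P\<close>-bimodule through its own compositions. Extensionality makes such a map unique as a function
  once it is unique on the components of \<open>P\<close>.
\<close>

definition derivation ::
  "('k, 'x) operad \<Rightarrow> ('k, 'x) operad \<Rightarrow> (nat set \<Rightarrow> 'x \<Rightarrow> 'x) \<Rightarrow> bool" where
  "derivation P M D \<longleftrightarrow>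
     (\<forall>S. D S \<in> op_space P S \<rightarrow>\<^sub>E op_space M S) \<and>
     (\<forall>S. \<forall>x\<in>op_space P S. \<forall>y\<in>op_space P S.
        D S (op_add P S x y) = op_add M S (D S x) (D S y)) \<and>
     (\<forall>S c. \<forall>x\<in>op_space P S. D S (op_scale P S c x) = op_scale M S c (D S x)) \<and>
     (\<forall>S \<sigma>. \<forall>x\<in>op_space P S. inj_on \<sigma> S \<longrightarrow>
        D (\<sigma> ` S) (op_act P S \<sigma> x) = op_act M S \<sigma> (D S x)) \<and>
     (\<forall>S v T. \<forall>x\<in>op_space P S. \<forall>y\<in>op_space P T. composable S v T \<longrightarrow>
        D ((S - {v}) \<union> T) (op_comp P S v T x y) =
          op_add M ((S - {v}) \<union> T) (op_comp M S v T (D S x) y) (op_comp M S v T x (D T y)))"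

definition kernel_operad ::
  "('k, 'x) operad \<Rightarrow> ('k, 'x) operad \<Rightarrow> (nat set \<Rightarrow> 'x \<Rightarrow> 'x) \<Rightarrow> ('k, 'x) operad" where
  "kernel_operad P M D = P\<lparr>op_space := \<lambda>S. {x \<in> op_space P S. D S x = op_zero M S}\<rparr>"

text \<open>
  The iterated compositions, with all labellings, of one binary operation \<open>g \<in> P({1,2})\<close>; the
  empty iteration is the unit.
\<close>

inductive iterated :: "('k, 'x) operad \<Rightarrow> 'x \<Rightarrow> nat set \<Rightarrow> 'x \<Rightarrow> bool"
  for P :: "('k, 'x) operad" and g :: 'x where
  unit: "iterated P g {s} (op_unit P s)"
| gen: "iterated P g {1, 2} g"
| act: "iterated P g S x \<Longrightarrow> inj_on \<sigma> S \<Longrightarrow> iterated P g (\<sigma> ` S) (op_act P S \<sigma> x)"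
| comp: "iterated P g S x \<Longrightarrow> iterated P g T y \<Longrightarrow> composable S v T \<Longrightarrow>
           iterated P g ((S - {v}) \<union> T) (op_comp P S v T x y)"

text \<open>The two-sided operadic ideal generated by elements \<open>r \<in> P(S)\<close> with \<open>R S r\<close>.\<close>

inductive operad_ideal ::
  "('k, 'x) operad \<Rightarrow> (nat set \<Rightarrow> 'x \<Rightarrow> bool) \<Rightarrow> nat set \<Rightarrow> 'x \<Rightarrow> bool"
  for P :: "('k, 'x) operad" and R :: "nat set \<Rightarrow> 'x \<Rightarrow> bool" where
  gen: "R S r \<Longrightarrow> operad_ideal P R S r"
| zero: "operad_ideal P R S (op_zero P S)"
| add: "operad_ideal P R S x \<Longrightarrow> operad_ideal P R S y \<Longrightarrow> operad_ideal P R S (op_add P S x y)"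
| scale: "operad_ideal P R S x \<Longrightarrow> operad_ideal P R S (op_scale P S c x)"
| act: "operad_ideal P R S x \<Longrightarrow> inj_on \<sigma> S \<Longrightarrow> operad_ideal P R (\<sigma> ` S) (op_act P S \<sigma> x)"
| comp_left: "operad_ideal P R S x \<Longrightarrow> y \<in> op_space P T \<Longrightarrow> composable S v T \<Longrightarrow>
    operad_ideal P R ((S - {v}) \<union> T) (op_comp P S v T x y)"
| comp_right: "x \<in> op_space P S \<Longrightarrow> operad_ideal P R T y \<Longrightarrow> composable S v T \<Longrightarrow>
    operad_ideal P R ((S - {v}) \<union> T) (op_comp P S v T x y)"

definition coset ::
  "('k, 'x) operad \<Rightarrow> (nat set \<Rightarrow> 'x \<Rightarrow> bool) \<Rightarrow> nat set \<Rightarrow> 'x \<Rightarrow> 'x set" where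
  "coset P I S x = {op_add P S x i | i. I S i}"

text \<open>
  The quotient by an ideal; elements are cosets. Each operation is the union of the cosets of the
  results over all representatives, which for an ideal is a single coset.
\<close>

definition quotient_operad ::
  "('k, 'x) operad \<Rightarrow> (nat set \<Rightarrow> 'x \<Rightarrow> bool) \<Rightarrow> ('k, 'x set) operad" where
  "quotient_operad P I =
    \<lparr>op_space = \<lambda>S. coset P I S ` op_space P S,
     op_zero = \<lambda>S. coset P I S (op_zero P S),
     op_add = \<lambda>S X Y. \<Union>x\<in>X. \<Union>y\<in>Y. coset P I S (op_add P S x y),
     op_scale = \<lambda>S c X. \<Union>x\<in>X. coset P I S (op_scale P S c x),
     op_act = \<lambda>S \<sigma> X. \<Union>x\<in>X. coset P I (\<sigma> ` S) (op_act P S \<sigma> x),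
     op_comp = \<lambda>S v T X Y. \<Union>x\<in>X. \<Union>y\<in>Y. coset P I ((S - {v}) \<union> T) (op_comp P S v T x y),
     op_unit = \<lambda>s. coset P I {s} (op_unit P s)\<rparr>"

text \<open>
  The operad with basis \<open>B S\<close> in component \<open>S\<close>, given the relabelling \<open>\<rho>\<close>, the partial compositions
  \<open>\<kappa>\<close> and the units \<open>u\<close> on basis elements.
\<close>

definition operad_on_basis ::
  "(nat set \<Rightarrow> 'b set) \<Rightarrow> ((nat \<Rightarrow> nat) \<Rightarrow> 'b \<Rightarrow> 'b) \<Rightarrow> (nat \<Rightarrow> 'b \<Rightarrow> 'b \<Rightarrow> ('b \<Rightarrow>\<^sub>0 'k)) \<Rightarrow>
   (nat \<Rightarrow> 'b) \<Rightarrow> ('k::field, 'b \<Rightarrow>\<^sub>0 'k) operad" where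
  "operad_on_basis B \<rho> \<kappa> u =
    \<lparr>op_space = \<lambda>S. {x. Poly_Mapping.keys x \<subseteq> B S},
     op_zero = \<lambda>S. 0,
     op_add = \<lambda>S x y. x + y,
     op_scale = \<lambda>S c x. fscale c x,
     op_act = \<lambda>S \<sigma>. lin_ext (\<lambda>b. basis (\<rho> \<sigma> b)),
     op_comp = \<lambda>S v T. bilin_ext (\<kappa> v),
     op_unit = \<lambda>s. basis (u s)\<rparr>"

section \<open>The operad of Lie-admissible algebras\<close>

datatype magma_tree = Leaf nat | Mul magma_tree magma_tree

primrec leaves :: "magma_tree \<Rightarrow> nat list" where
  "leaves (Leaf s) = [s]"
| "leaves (Mul t u) = leaves t @ leaves u"

primrec leaf_map :: "(nat \<Rightarrow> nat) \<Rightarrow> magma_tree \<Rightarrow> magma_tree" where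
  "leaf_map \<sigma> (Leaf s) = Leaf (\<sigma> s)"
| "leaf_map \<sigma> (Mul t u) = Mul (leaf_map \<sigma> t) (leaf_map \<sigma> u)"

primrec leaf_subst :: "nat \<Rightarrow> magma_tree \<Rightarrow> magma_tree \<Rightarrow> magma_tree" where
  "leaf_subst v (Leaf s) w = (if s = v then w else Leaf s)"
| "leaf_subst v (Mul t u) w = Mul (leaf_subst v t w) (leaf_subst v u w)"

text \<open>The free operad on one binary operation without symmetry.\<close>

definition Mag :: "('k::field, magma_tree \<Rightarrow>\<^sub>0 'k) operad" where
  "Mag = operad_on_basis (\<lambda>S. {t. distinct (leaves t) \<and> set (leaves t) = S}) leaf_map
           (\<lambda>v t w. basis (leaf_subst v t w)) Leaf"

definition mag_mul ::
  "(magma_tree \<Rightarrow>\<^sub>0 'k::field) \<Rightarrow> (magma_tree \<Rightarrow>\<^sub>0 'k) \<Rightarrow> (magma_tree \<Rightarrow>\<^sub>0 'k)" where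
  "mag_mul = bilin_ext (\<lambda>t u. basis (Mul t u))"

definition mag_bracket ::
  "(magma_tree \<Rightarrow>\<^sub>0 'k::field) \<Rightarrow> (magma_tree \<Rightarrow>\<^sub>0 'k) \<Rightarrow> (magma_tree \<Rightarrow>\<^sub>0 'k)" where
  "mag_bracket x y = mag_mul x y - mag_mul y x"

definition jacobiator :: "magma_tree \<Rightarrow>\<^sub>0 'k::field" where
  "jacobiator = (let a = basis (Leaf 1); b = basis (Leaf 2); c = basis (Leaf 3) in
     mag_bracket (mag_bracket a b) c + mag_bracket (mag_bracket b c) a
       + mag_bracket (mag_bracket c a) b)"

definition LieAdm_ideal :: "nat set \<Rightarrow> (magma_tree \<Rightarrow>\<^sub>0 'k::field) \<Rightarrow> bool" where
  "LieAdm_ideal = operad_ideal Mag (\<lambda>S r. S = {1, 2, 3} \<and> r = jacobiator)"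

definition LieAdm :: "('k::field, (magma_tree \<Rightarrow>\<^sub>0 'k) set) operad" where
  "LieAdm = quotient_operad Mag LieAdm_ideal"

text \<open>The structure operation \<open>(a\<^sub>1, a\<^sub>2) \<mapsto> a\<^sub>1 a\<^sub>2\<close>.\<close>

definition LieAdm_product :: "(magma_tree \<Rightarrow>\<^sub>0 'k::field) set" where
  "LieAdm_product = coset Mag LieAdm_ideal {1, 2} (basis (Mul (Leaf 1) (Leaf 2)))"

section \<open>Christoffel trees\<close>

text \<open>
  \<open>White i l C\<close> is a white vertex with label \<open>l\<close> and children \<open>C\<close>; \<open>Black i E C\<close> is a black vertex
  whose children along special edges are \<open>E\<close> and along ordinary edges \<open>C\<close>. The component \<open>i\<close> is a
  name for the vertex. Isomorphism classes of Christoffel trees are the trees with \<open>'i = unit\<close>;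
  trees with distinct names serve as representatives in which vertices, and also edges (named by
  their upper end, the child), can be referred to individually.
\<close>

datatype ('i, 'l) ctree =
  White 'i 'l "('i, 'l) ctree multiset"
| Black 'i "('i, 'l) ctree multiset" "('i, 'l) ctree multiset"

primrec root_name :: "('i, 'l) ctree \<Rightarrow> 'i" where
  "root_name (White i l C) = i"
| "root_name (Black i E C) = i"

primrec names :: "('i, 'l) ctree \<Rightarrow> 'i multiset" where
  "names (White i l C) = add_mset i (\<Sum>\<^sub># (image_mset names C))"
| "names (Black i E C) = add_mset i (\<Sum>\<^sub># (image_mset names E) + \<Sum>\<^sub># (image_mset names C))"

primrec white_labels :: "('i, 'l) ctree \<Rightarrow> 'l multiset" where
  "white_labels (White i l C) = add_mset l (\<Sum>\<^sub># (image_mset white_labels C))"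
| "white_labels (Black i E C) =
     \<Sum>\<^sub># (image_mset white_labels E) + \<Sum>\<^sub># (image_mset white_labels C)"

primrec two_special :: "('i, 'l) ctree \<Rightarrow> bool" where
  "two_special (White i l C) \<longleftrightarrow> (\<forall>b\<in>#image_mset two_special C. b)"
| "two_special (Black i E C) \<longleftrightarrow>
     size E = 2 \<and> (\<forall>b\<in>#image_mset two_special E. b) \<and> (\<forall>b\<in>#image_mset two_special C. b)"

text \<open>The input edges of the white vertices labelled \<open>l\<close>.\<close>

primrec input_edges :: "'l \<Rightarrow> ('i, 'l) ctree \<Rightarrow> 'i set" where
  "input_edges l (White i m C) =
     (if m = l then set_mset (image_mset root_name C) else {}) \<union>
     \<Union> (set_mset (image_mset (input_edges l) C))"
| "input_edges l (Black i E C) =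
     \<Union> (set_mset (image_mset (input_edges l) E)) \<union> \<Union> (set_mset (image_mset (input_edges l) C))"

text \<open>\<open>attach g T\<close> adds to every vertex \<open>i\<close> of \<open>T\<close> the further children \<open>g i\<close>, by ordinary edges.\<close>

primrec attach :: "('i \<Rightarrow> ('i, 'l) ctree multiset) \<Rightarrow> ('i, 'l) ctree \<Rightarrow> ('i, 'l) ctree" where
  "attach g (White i l C) = White i l (image_mset (attach g) C + g i)"
| "attach g (Black i E C) = Black i (image_mset (attach g) E) (image_mset (attach g) C + g i)"

text \<open>
  \<open>plug l U f T\<close> is \<open>T \<circ>\<^sub>v\<^sup>f U\<close> where \<open>v\<close> is the vertex of \<open>T\<close> labelled \<open>l\<close>: each input edge \<open>e\<close> of \<open>v\<close>
  is attached at the vertex \<open>f e\<close> of \<open>U\<close>.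
\<close>

primrec plug ::
  "'l \<Rightarrow> ('i, 'l) ctree \<Rightarrow> ('i \<Rightarrow> 'i) \<Rightarrow> ('i, 'l) ctree \<Rightarrow> ('i, 'l) ctree" where
  "plug l U f (White i m C) =
     (if m = l
      then attach (\<lambda>j. filter_mset (\<lambda>c. f (root_name c) = j) (image_mset (plug l U f) C)) U
      else White i m (image_mset (plug l U f) C))"
| "plug l U f (Black i E C) = Black i (image_mset (plug l U f) E) (image_mset (plug l U f) C)"

text \<open>
  The label \<open>Some s\<close> is the input \<open>s\<close>, the label \<open>None\<close> is \<open>\<Diamond>\<close>.
\<close>

type_synonym christoffel_tree = "(unit, nat option) ctree"

definition forget_names :: "('i, 'l) ctree \<Rightarrow> (unit, 'l) ctree" where
  "forget_names T = map_ctree (\<lambda>_. ()) id T"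

definition named_representative :: "christoffel_tree \<Rightarrow> (nat, nat option) ctree" where
  "named_representative T =
     (SOME T'. forget_names T' = T \<and> (\<forall>i. count (names T') i \<le> 1))"

text \<open>
  Representatives are needed because with repeated \<open>\<Diamond>\<close> the sum over maps of edges to vertices counts
  isomorphic results with multiplicity; it does not depend on the choice of representatives.
\<close>

definition tree_comp :: "nat \<Rightarrow> christoffel_tree \<Rightarrow> christoffel_tree \<Rightarrow> (christoffel_tree \<Rightarrow>\<^sub>0 'k::field)"
  where
  "tree_comp v T U =
     (let T' = named_representative T; U' = named_representative U in
      \<Sum>f\<in>input_edges (Some v) T' \<rightarrow>\<^sub>E set_mset (names U').
        basis (forget_names (plug (Some v) U' f T')))"

definition relabel :: "(nat \<Rightarrow> nat) \<Rightarrow> christoffel_tree \<Rightarrow> christoffel_tree" where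
  "relabel \<sigma> = map_ctree id (map_option \<sigma>)"

definition unit_tree :: "nat \<Rightarrow> christoffel_tree" where
  "unit_tree s = White () (Some s) {#}"

definition diamond_trees :: "nat set \<Rightarrow> christoffel_tree set" where
  "diamond_trees S = {T. two_special T \<and> (\<forall>s. count (white_labels T) (Some s) = of_bool (s \<in> S))}"

definition christoffel_trees :: "nat set \<Rightarrow> christoffel_tree set" where
  "christoffel_trees S = {T \<in> diamond_trees S. None \<notin># white_labels T}"

definition nablaTrees :: "('k::field, christoffel_tree \<Rightarrow>\<^sub>0 'k) operad" where
  "nablaTrees = operad_on_basis christoffel_trees relabel tree_comp unit_tree"

text \<open>The coproduct \<open>\<nabla>Trees \<or> \<k>\<Diamond>\<close>, containing \<open>\<nabla>Trees\<close> as the span of the trees without \<open>\<Diamond>\<close>.\<close>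

definition nablaTrees_diamond :: "('k::field, christoffel_tree \<Rightarrow>\<^sub>0 'k) operad" where
  "nablaTrees_diamond = operad_on_basis diamond_trees relabel tree_comp unit_tree"

text \<open>The trees \<open>r \<leftarrow> s\<close>, \<open>m(1,2)\<close> and \<open>\<Diamond>(1,2)\<close>.\<close>

definition arrow_tree :: "nat \<Rightarrow> nat \<Rightarrow> christoffel_tree" where
  "arrow_tree r s = White () (Some r) {#unit_tree s#}"

definition m_tree :: christoffel_tree where
  "m_tree = Black () {#unit_tree 1, unit_tree 2#} {#}"

definition diamond_tree :: christoffel_tree where
  "diamond_tree = White () None {#unit_tree 1, unit_tree 2#}"

section \<open>The derivation and the covariant derivative\<close>

definition Phi_geo :: "nat set \<Rightarrow> (christoffel_tree \<Rightarrow>\<^sub>0 'k::field) \<Rightarrow> (christoffel_tree \<Rightarrow>\<^sub>0 'k)" where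
  "Phi_geo = (THE D. derivation nablaTrees nablaTrees_diamond D \<and>
     D {1, 2} (basis (arrow_tree 1 2)) = basis diamond_tree \<and>
     D {1, 2} (basis (arrow_tree 2 1)) = basis diamond_tree \<and>
     D {1, 2} (basis m_tree) = fscale (- 2) (basis diamond_tree))"

definition nabla :: "christoffel_tree \<Rightarrow>\<^sub>0 'k::field" where
  "nabla = basis (arrow_tree 2 1) + fscale (1 / 2) (basis m_tree)"

definition ker_Phi_geo :: "('k::field, christoffel_tree \<Rightarrow>\<^sub>0 'k) operad" where
  "ker_Phi_geo = kernel_operad nablaTrees nablaTrees_diamond Phi_geo"

end

theory Submission
  imports Defs
begin

text \<open>
  Grafting is a pre-Lie product, so the commutator of \<open>\<nabla>\<close>, being the commutator of grafting, satisfies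
  the Jacobi identity, and \<open>\<nabla>\<close> is annihilated by the derivation; hence the product of \<open>LieAdm\<close> may be
  sent to \<open>\<nabla>\<close>. As \<open>LieAdm\<close> is the coproduct of the Lie operad and the operad of commutative magmas, it
  is spanned by normal forms: left-normed bracket words that start with the letter of smallest label
  and whose letters are labels or commutative products of normal forms. For a suitable weight on
  trees, among the lightest trees in the image of a normal form there is a leading one, which no other
  normal form of the same weight contains; this gives injectivity. Conversely, if the derivation
  annihilates \<open>x\<close>, its vanishing coefficients at trees with a diamond of two children relate the
  coefficients of \<open>x\<close>. Along these relations any tree of lowest weight in \<open>x\<close> can be moved to the leading
  tree of a normal form, so subtracting the right combination of normal forms increases the lowest
  weight, which is bounded.
\<close>

section \<open>Linear maps between free vector spaces\<close>

text \<open>\<open>Phi_geo\<close> is a definite description, so the derivation has to be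
  constructed before its kernel can be studied. The obstacle is that a partial composition is a sum
  over maps between named vertices. It is overcome by writing every operator as
  \<open>loc q\<close>: modify the tree at one vertex by \<open>q\<close> and sum over all vertices.
  Grafting, insertion at a label and the main part of the derivation have this form, and a single
  identity at the root, the hypothesis of \<open>loc_graft\<close>, decides how such an operator
  interacts with grafting. As trees are generated by single vertices, grafting and black vertices
  with two special children, operators need to be compared on these constructions only. In the
  second half, the constant \<open>B\<close> of the weight exceeds the number of labels, so that
  joining two subtrees by a black vertex makes a tree lighter than attaching one of them to the
  other. In a relation at a binary diamond the joined tree therefore has coefficient zero, and what
  is left lets subtrees be rearranged within the lightest part.\<close>

abbreviation lmap :: "(('a \<Rightarrow>\<^sub>0 'k::field) \<Rightarrow> ('b \<Rightarrow>\<^sub>0 'k)) \<Rightarrow> bool" where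
  "lmap \<equiv> Vector_Spaces.linear fscale fscale"

lemma lmap_iff:
  "lmap f \<longleftrightarrow> (\<forall>x y. f (x + y) = f x + f y) \<and> (\<forall>c x. f (fscale c x) = fscale c (f x))"
  by (simp add: Vector_Spaces.linear_iff fvs.vector_space_axioms)

lemma lmapI:
  assumes "\<And>x y. f (x + y) = f x + f y" "\<And>c x. f (fscale c x) = fscale c (f x)"
  shows "lmap f"
  using assms by (simp add: lmap_iff)

lemma lmap_add: "lmap f \<Longrightarrow> f (x + y) = f x + f y"
  and lmap_scale: "lmap f \<Longrightarrow> f (fscale c x) = fscale c (f x)"
  by (simp_all add: lmap_iff)

lemma lmap_zero: "lmap f \<Longrightarrow> f 0 = 0"
  using lmap_scale[of f 0 0] by simp

lemma lmap_uminus: "lmap f \<Longrightarrow> f (- x) = - f x"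
  using lmap_scale[of f "-1" x] by simp

lemma lmap_diff: "lmap f \<Longrightarrow> f (x - y) = f x - f y"
  using lmap_add[of f x "- y"] by (simp add: lmap_uminus)

lemma lmap_sum: "lmap f \<Longrightarrow> f (sum g A) = (\<Sum>a\<in>A. f (g a))"
  by (induction A rule: infinite_finite_induct) (simp_all add: lmap_zero lmap_add)

lemma lmap_sum_mset: "lmap f \<Longrightarrow> f (\<Sum>a\<in>#A. g a) = (\<Sum>a\<in>#A. f (g a))"
  by (induction A) (simp_all add: lmap_zero lmap_add)

lemma lin_ext_superset:
  assumes "finite A" "Poly_Mapping.keys x \<subseteq> A"
  shows "lin_ext f x = (\<Sum>a\<in>A. fscale (Poly_Mapping.lookup x a) (f a))"
  unfolding lin_ext_def using assms
  by (intro sum.mono_neutral_left) (auto simp: in_keys_iff)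

lemma lmap_lin_ext [simp, intro!]: "lmap (lin_ext (f :: 'a \<Rightarrow> ('b \<Rightarrow>\<^sub>0 'c::field)))"
proof (rule lmapI)
  fix x y :: "'a \<Rightarrow>\<^sub>0 'c"
  let ?A = "Poly_Mapping.keys x \<union> Poly_Mapping.keys y"
  have "Poly_Mapping.keys (x + y) \<subseteq> ?A" by (rule keys_add)
  then show "lin_ext f (x + y) = lin_ext f x + lin_ext f y"
    by (simp add: lin_ext_superset[of ?A] lookup_add fvs.scale_left_distrib sum.distrib)
next
  fix c and x :: "'a \<Rightarrow>\<^sub>0 'c"
  have "Poly_Mapping.keys (fscale c x) \<subseteq> Poly_Mapping.keys x"
    by (auto simp: in_keys_iff)
  then show "lin_ext f (fscale c x) = fscale c (lin_ext f x)"
    by (simp add: lin_ext_superset[of "Poly_Mapping.keys x"] fvs.scale_sum_right)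
qed

lemma lin_ext_basis [simp]: "lin_ext f (basis a) = f a"
  by (simp add: lin_ext_def)

lemmas lin_ext_arg_add = lmap_add[OF lmap_lin_ext]
lemmas lin_ext_arg_diff = lmap_diff[OF lmap_lin_ext]
lemmas lin_ext_arg_uminus = lmap_uminus[OF lmap_lin_ext]
lemmas lin_ext_arg_zero = lmap_zero[OF lmap_lin_ext]
lemmas lin_ext_arg_scale = lmap_scale[OF lmap_lin_ext]
lemmas lin_ext_arg_sum = lmap_sum[OF lmap_lin_ext]
lemmas lin_ext_arg_sum_mset = lmap_sum_mset[OF lmap_lin_ext]
lemmas lin_ext_arg = lin_ext_arg_add lin_ext_arg_diff lin_ext_arg_uminus lin_ext_arg_zero
  lin_ext_arg_scale lin_ext_arg_sum lin_ext_arg_sum_mset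

lemma lmap_lin_ext_comp: "lmap g \<Longrightarrow> g (lin_ext f x) = lin_ext (\<lambda>a. g (f a)) x"
  by (simp add: lin_ext_def lmap_sum lmap_scale)

lemma lin_ext_lin_ext: "lin_ext g (lin_ext f x) = lin_ext (\<lambda>a. lin_ext g (f a)) x"
  by (rule lmap_lin_ext_comp) simp

lemma lin_ext_basis_id: "lin_ext basis x = x"
proof (rule poly_mapping_eqI)
  fix b
  show "Poly_Mapping.lookup (lin_ext basis x) b = Poly_Mapping.lookup x b"
    by (simp add: lin_ext_def lookup_sum lookup_single in_keys_iff sum.delta' when_def
        if_distrib cong: if_cong)
qed

lemma lmap_lin_ext_conv: "lmap f \<Longrightarrow> f x = lin_ext (\<lambda>a. f (basis a)) x"
  using lmap_lin_ext_comp[of f basis x] by (simp add: lin_ext_basis_id)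

text \<open>Agreement is asked only on the support of \<open>x\<close>. Identities that hold for
  well-formed trees can thus be carried over to the vectors spanned by such trees.\<close>

lemma lmap_eqI:
  assumes "lmap f" "lmap g" "\<And>a. a \<in> Poly_Mapping.keys x \<Longrightarrow> f (basis a) = g (basis a)"
  shows "f x = g x"
  using assms(3) by (simp add: lmap_lin_ext_conv[OF assms(1), of x]
      lmap_lin_ext_conv[OF assms(2), of x] lin_ext_def)

lemma lin_ext_cong:
  "x = y \<Longrightarrow> (\<And>a. a \<in> Poly_Mapping.keys y \<Longrightarrow> f a = g a) \<Longrightarrow> lin_ext f x = lin_ext g y"
  by (simp add: lin_ext_def)

lemma lin_ext_add: "lin_ext (\<lambda>a. f a + g a) x = lin_ext f x + lin_ext g x"
  by (simp add: lin_ext_def fvs.scale_right_distrib sum.distrib)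

lemma lin_ext_diff: "lin_ext (\<lambda>a. f a - g a) x = lin_ext f x - lin_ext g x"
  by (simp add: lin_ext_def fvs.scale_right_diff_distrib sum_subtractf)

lemma lin_ext_uminus: "lin_ext (\<lambda>a. - f a) x = - lin_ext f x"
  by (simp add: lin_ext_def sum_negf)

lemma lin_ext_zero: "lin_ext (\<lambda>a. 0) x = 0"
  by (simp add: lin_ext_def)

lemma lin_ext_scale: "lin_ext (\<lambda>a. fscale c (f a)) x = fscale c (lin_ext f x)"
  by (simp add: lin_ext_def fvs.scale_sum_right mult.commute)

lemma lin_ext_sum: "lin_ext (\<lambda>a. \<Sum>b\<in>B. f a b) x = (\<Sum>b\<in>B. lin_ext (\<lambda>a. f a b) x)"
  by (induction B rule: infinite_finite_induct) (simp_all add: lin_ext_zero lin_ext_add)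

lemma lin_ext_sum_mset: "lin_ext (\<lambda>a. \<Sum>b\<in>#B. f a b) x = (\<Sum>b\<in>#B. lin_ext (\<lambda>a. f a b) x)"
  by (induction B) (simp_all add: lin_ext_zero lin_ext_add)

lemma lin_ext_swap:
  "lin_ext (\<lambda>a. lin_ext (f a) y) x = lin_ext (\<lambda>b. lin_ext (\<lambda>a. f a b) x) y"
  unfolding lin_ext_def fvs.scale_sum_right
  by (subst sum.swap) (simp add: mult.commute)

lemmas lin_ext_fun = lin_ext_add lin_ext_diff lin_ext_uminus lin_ext_zero lin_ext_scale
  lin_ext_sum lin_ext_sum_mset

lemma lmap_lin_ext_param: "(\<And>a. lmap (f a)) \<Longrightarrow> lmap (\<lambda>y. lin_ext (\<lambda>a. f a y) x)"
  by (intro lmapI) (simp_all add: lmap_add lmap_scale lin_ext_add lin_ext_scale)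

lemma lmap_compose: "lmap f \<Longrightarrow> lmap g \<Longrightarrow> lmap (\<lambda>x. f (g x))"
  by (intro lmapI) (simp_all add: lmap_add lmap_scale)

lemma lmap_plus: "lmap f \<Longrightarrow> lmap g \<Longrightarrow> lmap (\<lambda>x. f x + g x)"
  by (intro lmapI) (simp_all add: lmap_add lmap_scale fvs.scale_right_distrib algebra_simps)

lemma lmap_minus: "lmap f \<Longrightarrow> lmap g \<Longrightarrow> lmap (\<lambda>x. f x - g x)"
  by (intro lmapI) (simp_all add: lmap_add lmap_scale fvs.scale_right_diff_distrib algebra_simps)

lemma lmap_fscale: "lmap f \<Longrightarrow> lmap (\<lambda>x. fscale c (f x))"
  by (intro lmapI) (simp_all add: lmap_add lmap_scale fvs.scale_right_distrib mult.commute)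

lemma lmap_ident: "lmap (\<lambda>x. x)"
  by (intro lmapI) simp_all

lemma lookup_lin_ext:
  "Poly_Mapping.lookup (lin_ext f x) b =
     (\<Sum>a\<in>Poly_Mapping.keys x. Poly_Mapping.lookup x a * Poly_Mapping.lookup (f a) b)"
  by (simp add: lin_ext_def lookup_sum)

lemma keys_lin_ext: "Poly_Mapping.keys (lin_ext f x) \<subseteq> (\<Union>a\<in>Poly_Mapping.keys x. Poly_Mapping.keys (f a))"
proof
  fix b assume "b \<in> Poly_Mapping.keys (lin_ext f x)"
  then have "(\<Sum>a\<in>Poly_Mapping.keys x. Poly_Mapping.lookup x a * Poly_Mapping.lookup (f a) b) \<noteq> 0"
    by (simp add: in_keys_iff lookup_lin_ext)
  then obtain a where "a \<in> Poly_Mapping.keys x" "Poly_Mapping.lookup x a * Poly_Mapping.lookup (f a) b \<noteq> 0"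
    using sum.not_neutral_contains_not_neutral by blast
  then show "b \<in> (\<Union>a\<in>Poly_Mapping.keys x. Poly_Mapping.keys (f a))"
    by (auto simp: in_keys_iff)
qed

lemma keys_fscale: "Poly_Mapping.keys (fscale c x) \<subseteq> Poly_Mapping.keys x"
  by (auto simp: in_keys_iff)

lemma keys_sum_mset:
  "Poly_Mapping.keys (\<Sum>a\<in>#A. f a) \<subseteq> (\<Union>a\<in>set_mset A. Poly_Mapping.keys (f a))"
  by (induction A) (use keys_add in fastforce)+

lemma lookup_sum_mset:
  "Poly_Mapping.lookup (\<Sum>a\<in>#A. f a) b = (\<Sum>a\<in>#A. Poly_Mapping.lookup (f a) b)"
  by (induction A) (simp_all add: lookup_add)

section \<open>Sums over the elements of a multiset together with the remaining elements\<close>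

text \<open>A Leibniz rule over the children of a vertex: each occurrence is visited once with the
  other children at hand, so equal children need no names and are counted with multiplicity.\<close>

definition msum :: "('a \<Rightarrow> 'a multiset \<Rightarrow> 'v::comm_monoid_add) \<Rightarrow> 'a multiset \<Rightarrow> 'v" where
  "msum f M = (\<Sum>x\<in>#M. f x (M - {#x#}))"

lemma msum_empty [simp]: "msum f {#} = 0"
  by (simp add: msum_def)

lemma msum_cong:
  assumes "\<And>x R. M = add_mset x R \<Longrightarrow> f x R = g x R"
  shows "msum f M = msum g M"
  unfolding msum_def by (intro arg_cong[where f = sum_mset] image_mset_cong assms) simp

lemma msum_add_mset [simp]:
  "msum f (add_mset y M) = f y M + msum (\<lambda>x R. f x (add_mset y R)) M"
proof -
  have "(\<Sum>x\<in>#M. f x (add_mset y M - {#x#})) = (\<Sum>x\<in>#M. f x (add_mset y (M - {#x#})))"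
    by (intro arg_cong[where f = sum_mset] image_mset_cong arg_cong[where f = "f _"])
      (auto simp: add_mset_diff_bothsides insert_DiffM multiset_eq_iff)
  then show ?thesis by (simp add: msum_def)
qed

lemma msum_plus: "msum (\<lambda>x R. f x R + g x R) M = msum f M + msum g M"
  by (simp add: msum_def sum_mset.distrib)

lemma msum_zero: "msum (\<lambda>x R. 0) M = 0"
  by (simp add: msum_def)

lemma msum_union:
  "msum f (M + N) = msum (\<lambda>x R. f x (R + N)) M + msum (\<lambda>x R. f x (M + R)) N"
proof (induction M arbitrary: f)
  case empty
  then show ?case by simp
next
  case (add y M)
  show ?case by (simp add: add.IH add_ac msum_plus)
qed

lemma msum_image: "msum f (image_mset h M) = msum (\<lambda>x R. f (h x) (image_mset h R)) M"
  by (induction M arbitrary: f) simp_all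

text \<open>Both sides run over ordered pairs of different occurrences. Exchanging the members of a
  pair is the symmetry behind \<open>dev_dev\<close>.\<close>

lemma msum_swap:
  "msum (\<lambda>x R. msum (\<lambda>y R'. f x y R') R) M = msum (\<lambda>x R. msum (\<lambda>y R'. f y x R') R) M"
proof (induction M arbitrary: f)
  case empty
  then show ?case by simp
next
  case (add z M)
  show ?case
    by (simp add: msum_plus add.IH[of "\<lambda>x y R'. f x y (add_mset z R')"] add_ac)
qed

lemma lmap_msum: "lmap h \<Longrightarrow> h (msum f M) = msum (\<lambda>x R. h (f x R)) M"
  by (simp add: msum_def lmap_sum_mset)

lemmas lin_ext_arg_msum = lmap_msum[OF lmap_lin_ext]

lemma lin_ext_msum: "lin_ext (\<lambda>a. msum (f a) M) x = msum (\<lambda>y R. lin_ext (\<lambda>a. f a y R) x) M"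
  by (simp add: msum_def lin_ext_sum_mset)

lemma msum_diff:
  fixes f :: "'a \<Rightarrow> 'a multiset \<Rightarrow> 'v::ab_group_add"
  shows "msum (\<lambda>x R. f x R - g x R) M = msum f M - msum g M"
  by (induction M arbitrary: f g) (simp_all add: algebra_simps)

lemma msum_sum_mset: "msum (\<lambda>x R. \<Sum>j\<in>#J. f j x R) M = (\<Sum>j\<in>#J. msum (f j) M)"
  by (induction J) (simp_all add: msum_zero msum_plus)

lemma keys_msum:
  "b \<in> Poly_Mapping.keys (msum f M) \<Longrightarrow> \<exists>x R. M = add_mset x R \<and> b \<in> Poly_Mapping.keys (f x R)"
proof -
  assume "b \<in> Poly_Mapping.keys (msum f M)"
  then obtain x where "x \<in># M" "b \<in> Poly_Mapping.keys (f x (M - {#x#}))"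
    unfolding msum_def using keys_sum_mset by fastforce
  then show ?thesis by (metis insert_DiffM)
qed

section \<open>Local modifications of trees\<close>

type_synonym ct = christoffel_tree

text \<open>
  The slots of the root are its input edges with the tree above, marked \<open>True\<close> if special;
  \<open>rebuild T M\<close> has the root of \<open>T\<close> and the slots \<open>M\<close>.
\<close>

fun slots :: "ct \<Rightarrow> (bool \<times> ct) multiset" where
  "slots (White i l C) = image_mset (Pair False) C"
| "slots (Black i E C) = image_mset (Pair True) E + image_mset (Pair False) C"

fun rebuild :: "ct \<Rightarrow> (bool \<times> ct) multiset \<Rightarrow> ct" where
  "rebuild (White i l C) M = White i l (image_mset snd M)"
| "rebuild (Black i E C) M = Black i (image_mset snd (filter_mset fst M)) (image_mset snd (filter_mset (Not \<circ> fst) M))"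

text \<open>A white root has no special edges, and \<open>rebuild\<close> drops the marks there. The
  condition describes the multisets that \<open>slots\<close> recovers from
  \<open>rebuild\<close>.\<close>

definition compatible :: "ct \<Rightarrow> (bool \<times> ct) multiset \<Rightarrow> bool" where
  "compatible T M \<longleftrightarrow> (case T of White i l C \<Rightarrow> \<forall>s\<in>#M. \<not> fst s | Black i E C \<Rightarrow> True)"

lemma compatible_slots: "compatible T (slots T)"
  by (cases T) (auto simp: compatible_def)

lemma compatible_add: "compatible T (add_mset s M) \<longleftrightarrow> compatible T {#s#} \<and> compatible T M"
  by (cases T) (auto simp: compatible_def)

lemma compatible_change: "compatible T {#(b, t)#} \<longleftrightarrow> compatible T {#(b, t')#}"
  by (cases T) (auto simp: compatible_def)

lemma slots_rebuild:
  assumes "compatible T M"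
  shows "slots (rebuild T M) = M"
proof (cases T)
  case (White i l C)
  then have "\<forall>s\<in>#M. \<not> fst s" using assms by (auto simp: compatible_def)
  then have "image_mset (\<lambda>s. (False, snd s)) M = M" by (induction M) auto
  then show ?thesis using White by (simp add: image_mset.compositionality comp_def)
next
  case (Black i E C)
  have "image_mset (Pair True) (image_mset snd (filter_mset fst M)) +
      image_mset (Pair False) (image_mset snd (filter_mset (Not \<circ> fst) M)) = M"
    by (induction M) auto
  then show ?thesis using Black by simp
qed

lemma rebuild_rebuild [simp]: "rebuild (rebuild T M) M' = rebuild T M'"
  by (cases T) simp_all

text \<open>The Leibniz rule at the root: \<open>p\<close> acts on one child, while the root and the
  kind of every edge stay the same.\<close>

definition dev :: "(ct \<Rightarrow> (ct \<Rightarrow>\<^sub>0 'k::field)) \<Rightarrow> ct \<Rightarrow> (ct \<Rightarrow>\<^sub>0 'k)" where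
  "dev p T = msum (\<lambda>s R. lin_ext (\<lambda>t. basis (rebuild T (add_mset (fst s, t) R))) (p (snd s))) (slots T)"

lemma dev_White [simp]:
  "dev p (White i l C) = msum (\<lambda>c R. lin_ext (\<lambda>t. basis (White i l (add_mset t R))) (p c)) C"
  by (simp add: dev_def msum_image image_mset.compositionality comp_def)

lemma dev_Black [simp]:
  "dev p (Black i E C) =
     msum (\<lambda>e R. lin_ext (\<lambda>t. basis (Black i (add_mset t R) C)) (p e)) E +
     msum (\<lambda>c R. lin_ext (\<lambda>t. basis (Black i E (add_mset t R))) (p c)) C"
  by (simp add: dev_def msum_image msum_union image_mset.compositionality comp_def
      filter_mset_image_mset)

text \<open>Records that \<open>dev\<close> evaluates its argument at children of the root only; the
  termination of \<open>loc\<close> rests on this.\<close>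

lemma dev_cong [fundef_cong]:
  assumes "T = T'" "\<And>c. c \<in># image_mset snd (slots T') \<Longrightarrow> p c = p' c"
  shows "dev p T = dev p' T'"
  unfolding dev_def assms(1) using assms(2) by (intro msum_cong) auto

lemma dev_add: "dev (\<lambda>c. p c + p' c) T = dev p T + dev p' T"
  by (simp add: dev_def lin_ext_arg msum_plus)

lemma dev_zero: "dev (\<lambda>c. 0) T = 0"
  by (simp add: dev_def lin_ext_arg msum_zero)

lemma dev_lin_ext: "dev (\<lambda>c. lin_ext (\<lambda>t. P t c) y) T = lin_ext (\<lambda>t. dev (P t) T) y"
  by (simp add: dev_def lin_ext_msum lin_ext_lin_ext)

text \<open>Modifications in two different slots commute, so only those in the same slot remain.\<close>

lemma dev_dev:
  "lin_ext (dev p) (dev p' T) + dev (\<lambda>c. lin_ext p' (p c)) T =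
   lin_ext (dev p') (dev p T) + dev (\<lambda>c. lin_ext p (p' c)) T"
proof -
  \<comment> \<open>\<open>X\<close> collects the terms in which two different slots are modified;
    it is symmetric in \<open>p\<close> and \<open>p'\<close>.\<close>
  define X :: "(ct \<Rightarrow> (ct \<Rightarrow>\<^sub>0 'a)) \<Rightarrow> (ct \<Rightarrow> (ct \<Rightarrow>\<^sub>0 'a)) \<Rightarrow> _" where
    "X p p' = msum (\<lambda>s R. msum (\<lambda>s' R'. lin_ext (\<lambda>t. lin_ext (\<lambda>t'.
        basis (rebuild T (add_mset (fst s, t) (add_mset (fst s', t') R')))) (p (snd s'))) (p' (snd s))) R)
       (slots T)" for p p'
  have eq: "lin_ext (dev p) (dev p' T) = dev (\<lambda>c. lin_ext p (p' c)) T + X p p'" for p p'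
  proof -
    have *: "dev p (rebuild T (add_mset (fst s, t) R)) =
        lin_ext (\<lambda>t. basis (rebuild T (add_mset (fst s, t) R))) (p t) +
        msum (\<lambda>s' R'. lin_ext (\<lambda>t'.
          basis (rebuild T (add_mset (fst s, t) (add_mset (fst s', t') R')))) (p (snd s'))) R"
      if "slots T = add_mset s R" for s R t
    proof -
      have "compatible T (add_mset (fst s, t) R)"
        using compatible_slots[of T] that
        by (metis compatible_add compatible_change prod.collapse)
      then show ?thesis
        by (subst dev_def) (simp add: slots_rebuild add_mset_commute)
    qed
    have "lin_ext (dev p) (dev p' T) =
        msum (\<lambda>s R. lin_ext (\<lambda>t. dev p (rebuild T (add_mset (fst s, t) R))) (p' (snd s))) (slots T)"
      by (subst dev_def) (simp add: lin_ext_arg_msum lin_ext_lin_ext)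
    also have "\<dots> = msum (\<lambda>s R.
        lin_ext (\<lambda>t. basis (rebuild T (add_mset (fst s, t) R))) (lin_ext p (p' (snd s))) +
        msum (\<lambda>s' R'. lin_ext (\<lambda>t. lin_ext (\<lambda>t'.
          basis (rebuild T (add_mset (fst s, t) (add_mset (fst s', t') R')))) (p (snd s'))) (p' (snd s))) R)
        (slots T)"
      by (rule msum_cong) (simp add: * lin_ext_add lin_ext_msum lin_ext_lin_ext)
    also have "\<dots> = dev (\<lambda>c. lin_ext p (p' c)) T + X p p'"
      by (simp add: msum_plus dev_def X_def)
    finally show ?thesis .
  qed
  have "X p p' = X p' p"
    unfolding X_def
    by (subst msum_swap, subst lin_ext_swap) (simp add: add_mset_commute)
  then show ?thesis by (simp add: eq)
qed

section \<open>Operators that act at one vertex, and grafting\<close>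

fun addroot :: "ct \<Rightarrow> ct \<Rightarrow> ct" where
  "addroot y (White i l C) = White i l (add_mset y C)"
| "addroot y (Black i E C) = Black i E (add_mset y C)"

lemma slots_addroot [simp]: "slots (addroot y T) = add_mset (False, y) (slots T)"
  by (cases T) simp_all

lemma rebuild_addroot [simp]: "rebuild (addroot y T) M = rebuild T M"
  by (cases T) simp_all

lemma addroot_rebuild: "addroot y (rebuild T M) = rebuild T (add_mset (False, y) M)"
  by (cases T) simp_all

lemma addroot_eq_rebuild: "addroot y T = rebuild T (add_mset (False, y) (slots T))"
  by (cases T) (simp_all add: image_mset.compositionality comp_def filter_mset_image_mset)

lemma addroot_commute: "addroot y (addroot z T) = addroot z (addroot y T)"
  by (cases T) simp_all

lemma dev_addroot:
  "dev p (addroot y T) =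
     lin_ext (\<lambda>t. basis (addroot t T)) (p y) + lin_ext (\<lambda>t. basis (addroot y t)) (dev p T)"
proof -
  have "lin_ext (\<lambda>t. basis (addroot t T)) (p y) = lin_ext (\<lambda>t. basis (rebuild T (add_mset (False, t) (slots T)))) (p y)"
    by (simp add: addroot_eq_rebuild)
  then show ?thesis
    by (simp add: dev_def lin_ext_arg_msum lin_ext_lin_ext addroot_rebuild add_mset_commute)
qed

text \<open>The sum over all vertices of \<open>T\<close>, where the subtree starting at the vertex
  is replaced by \<open>q\<close> of it.\<close>

function loc :: "(ct \<Rightarrow> (ct \<Rightarrow>\<^sub>0 'k::field)) \<Rightarrow> ct \<Rightarrow> (ct \<Rightarrow>\<^sub>0 'k)" where
  "loc q T = q T + dev (loc q) T"
  by pat_completeness auto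

primrec nvert :: "('i, 'l) ctree \<Rightarrow> nat" where
  "nvert (White i l C) = Suc (\<Sum>\<^sub># (image_mset nvert C))"
| "nvert (Black i E C) = Suc (\<Sum>\<^sub># (image_mset nvert E) + \<Sum>\<^sub># (image_mset nvert C))"

lemma nvert_slots: "(b, c) \<in># slots T \<Longrightarrow> nvert c < nvert T"
proof -
  have *: "nvert c \<le> \<Sum>\<^sub># (image_mset nvert C)" if "c \<in># C" for C :: "ct multiset"
    using that by (induction C) auto
  show "(b, c) \<in># slots T \<Longrightarrow> nvert c < nvert T"
    by (cases T) (auto dest!: *)
qed

termination loc
  by (relation "measure (\<lambda>(q, T). nvert T)") (auto dest: nvert_slots)

declare loc.simps [simp del]

lemma ct_induct [case_names step]:
  assumes "\<And>T. (\<And>b c. (b, c) \<in># slots T \<Longrightarrow> P c) \<Longrightarrow> P T"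
  shows "P T"
  by (induction T rule: measure_induct_rule[of nvert]) (use assms nvert_slots in blast)

lemma dev_cong_slots:
  "(\<And>b c. (b, c) \<in># slots T \<Longrightarrow> p c = p' c) \<Longrightarrow> dev p T = dev p' T"
  by (rule dev_cong) auto

definition graft :: "ct \<Rightarrow> ct \<Rightarrow> (ct \<Rightarrow>\<^sub>0 'k::field)" where
  "graft y = loc (\<lambda>T. basis (addroot y T))"

lemma graft_simps: "graft y T = basis (addroot y T) + dev (graft y) T"
  unfolding graft_def by (rule loc.simps)

text \<open>Whether \<open>loc q\<close> is a derivation of grafting is decided at the root. There
  \<open>y\<close> arrives as a new child or inside a child, and \<open>r\<close> is the defect
  against grafting \<open>y\<close> onto the outcome of \<open>q\<close>. Modifications in different
  slots commute by \<open>dev_dev\<close>, so the induction merely adds up the defects of all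
  vertices; the last term comes from the vertices of \<open>y\<close>.\<close>

theorem loc_graft:
  fixes q :: "ct \<Rightarrow> (ct \<Rightarrow>\<^sub>0 'k::field)"
  assumes q: "\<And>T. q (addroot y T) + lin_ext q (dev (graft y) T) + r T = lin_ext (graft y) (q T)"
  shows "lin_ext (loc q) (graft y T) + loc r T =
    lin_ext (graft y) (loc q T) + lin_ext (\<lambda>t. graft t T) (loc q y)"
proof (induction T rule: ct_induct)
  case (step T)
  let ?E = "loc q" and ?g = "graft y"
  have lq: "lin_ext (loc q) X = lin_ext q X + lin_ext (dev (loc q)) X" for X
    by (subst loc.simps[abs_def]) (simp add: lin_ext_add)
  have lg: "lin_ext ?g X = lin_ext (\<lambda>t. basis (addroot y t)) X + lin_ext (dev ?g) X" for X :: "ct \<Rightarrow>\<^sub>0 'k"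
    by (subst graft_simps[abs_def]) (simp add: lin_ext_add)
  have lgt: "lin_ext (\<lambda>t. graft t T) X = lin_ext (\<lambda>t. basis (addroot t T)) X + lin_ext (\<lambda>t. dev (graft t) T) X" for X :: "ct \<Rightarrow>\<^sub>0 'k"
    by (subst graft_simps) (simp add: lin_ext_add)
  have "dev (\<lambda>c. lin_ext ?E (?g c) + loc r c) T = dev (\<lambda>c. lin_ext ?g (?E c) + lin_ext (\<lambda>t. graft t c) (?E y)) T"
    by (rule dev_cong_slots) (use step in blast)
  then have IH: "dev (\<lambda>c. lin_ext ?E (?g c)) T + dev (loc r) T =
     dev (\<lambda>c. lin_ext ?g (?E c)) T + lin_ext (\<lambda>t. dev (graft t) T) (?E y)"
    by (simp add: dev_add dev_lin_ext)
  have DD: "lin_ext (dev ?E) (dev ?g T) + dev (\<lambda>c. lin_ext ?g (?E c)) T =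
    lin_ext (dev ?g) (dev ?E T) + dev (\<lambda>c. lin_ext ?E (?g c)) T"
    by (rule dev_dev)
  have 1: "lin_ext ?E (?g T) = q (addroot y T) + dev ?E (addroot y T) + lin_ext q (dev ?g T) + lin_ext (dev ?E) (dev ?g T)"
    by (subst graft_simps) (simp add: lin_ext_arg lq loc.simps[of q "addroot y T"])
  have 2: "dev ?E (addroot y T) = lin_ext (\<lambda>t. basis (addroot t T)) (?E y) + lin_ext (\<lambda>t. basis (addroot y t)) (dev ?E T)"
    by (rule dev_addroot)
  have 3: "loc r T = r T + dev (loc r) T" by (rule loc.simps)
  have 4: "lin_ext ?g (?E T) = lin_ext ?g (q T) + lin_ext (\<lambda>t. basis (addroot y t)) (dev ?E T) + lin_ext (dev ?g) (dev ?E T)"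
    by (subst loc.simps) (simp add: lin_ext_arg lg[of "dev ?E T"])
  have "lin_ext (dev ?E) (dev ?g T) =
      lin_ext (dev ?g) (dev ?E T) + dev (\<lambda>c. lin_ext ?E (?g c)) T - dev (\<lambda>c. lin_ext ?g (?E c)) T"
    using DD by (simp add: eq_diff_eq)
  moreover have "dev (loc r) T = dev (\<lambda>c. lin_ext ?g (?E c)) T +
      lin_ext (\<lambda>t. dev (graft t) T) (?E y) - dev (\<lambda>c. lin_ext ?E (?g c)) T"
    using IH by (simp add: eq_diff_eq add.commute)
  ultimately show ?case
    unfolding 1 2 3 4 lgt q[of T, symmetric] by simp
qed

corollary loc_graft_0:
  fixes q :: "ct \<Rightarrow> (ct \<Rightarrow>\<^sub>0 'k::field)"
  assumes "\<And>T. q (addroot y T) + lin_ext q (dev (graft y) T) = lin_ext (graft y) (q T)"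
  shows "lin_ext (loc q) (graft y T) = lin_ext (graft y) (loc q T) + lin_ext (\<lambda>t. graft t T) (loc q y)"
proof -
  have 0: "loc (\<lambda>T. 0) T = (0 :: ct \<Rightarrow>\<^sub>0 'k)" for T
    by (induction T rule: ct_induct) (subst loc.simps, simp cong: dev_cong_slots add: dev_zero)
  show ?thesis using loc_graft[of q y "\<lambda>T. 0" T] assms by (simp add: 0)
qed

lemma lin_ext_loc: "loc (\<lambda>T. lin_ext (\<lambda>t. q t T) x) T = lin_ext (\<lambda>t. loc (q t) T) x"
proof (induction T rule: ct_induct)
  case (step T)
  have "dev (loc (\<lambda>T. lin_ext (\<lambda>t. q t T) x)) T = dev (\<lambda>c. lin_ext (\<lambda>t. loc (q t) c) x) T"
    by (rule dev_cong_slots) (use step in blast)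
  then show ?case
    by (simp add: loc.simps[of _ T] dev_lin_ext lin_ext_add)
qed

text \<open>\<open>graft z\<close> is \<open>loc\<close> of adding the child \<open>z\<close> to the
  root. Since \<open>y\<close> may also be grafted onto this new child, the defect in
  \<open>loc_graft\<close> is the adding of \<open>graft y z\<close>, and \<open>loc\<close> of the
  defect is the second term on the left.\<close>

theorem graft_prelie:
  fixes z y T :: ct
  shows "lin_ext (graft z) (graft y T) + lin_ext (\<lambda>t. graft t T) (graft y z) =
   (lin_ext (graft y) (graft z T) + lin_ext (\<lambda>t. graft t T) (graft z y) :: ct \<Rightarrow>\<^sub>0 'k::field)"
proof -
  have "lin_ext (loc (\<lambda>T. basis (addroot z T))) (graft y T) + loc (\<lambda>T. lin_ext (\<lambda>t. basis (addroot t T)) (graft y z)) T =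
    lin_ext (graft y) (loc (\<lambda>T. basis (addroot z T)) T) + lin_ext (\<lambda>t. graft t T) (loc (\<lambda>T. basis (addroot z T)) y)"
    by (rule loc_graft) (simp add: graft_simps dev_addroot addroot_commute add_ac)
  then show ?thesis by (simp add: graft_def lin_ext_loc)
qed

section \<open>Supports and invariants of local modifications\<close>

lemma keys_lin_extE:
  assumes "b \<in> Poly_Mapping.keys (lin_ext f x)"
  obtains a where "a \<in> Poly_Mapping.keys x" "b \<in> Poly_Mapping.keys (f a)"
  using assms keys_lin_ext by fastforce

lemma keys_lin_ext_basisE:
  assumes "b \<in> Poly_Mapping.keys (lin_ext (\<lambda>t. basis (f t)) x)"
  obtains a where "a \<in> Poly_Mapping.keys x" "b = f a"
  using assms by (auto elim!: keys_lin_extE split: if_splits)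

lemma keys_devE:
  fixes p :: "ct \<Rightarrow> (ct \<Rightarrow>\<^sub>0 'k::field)"
  assumes "t \<in> Poly_Mapping.keys (dev p T)"
  obtains (white) i l c R u where "T = White i l (add_mset c R)" "u \<in> Poly_Mapping.keys (p c)"
      "t = White i l (add_mset u R)"
    | (special) i e R C u where "T = Black i (add_mset e R) C" "u \<in> Poly_Mapping.keys (p e)"
      "t = Black i (add_mset u R) C"
    | (ordinary) i E c R u where "T = Black i E (add_mset c R)" "u \<in> Poly_Mapping.keys (p c)"
      "t = Black i E (add_mset u R)"
proof (cases T)
  case (White i l C)
  with assms show thesis
    by (auto dest!: keys_msum elim!: keys_lin_ext_basisE intro: white)
next
  case (Black i E C)
  then have "t \<in> Poly_Mapping.keys (msum (\<lambda>e R. lin_ext (\<lambda>t. basis (Black i (add_mset t R) C)) (p e)) E) \<or>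
      t \<in> Poly_Mapping.keys (msum (\<lambda>c R. lin_ext (\<lambda>t. basis (Black i E (add_mset t R))) (p c)) C)"
    using assms keys_add by fastforce
  then show thesis
    using Black by (elim disjE) (auto dest!: keys_msum elim!: keys_lin_ext_basisE intro: special ordinary)
qed

text \<open>Each tree in the support comes from one vertex of \<open>T\<close>. The cases walk from
  this vertex down to the root of \<open>T\<close>, so an invariant needs a real check in the case
  \<open>root\<close> only.\<close>

lemma keys_loc_induct [consumes 1, case_names root white special ordinary]:
  fixes q :: "ct \<Rightarrow> (ct \<Rightarrow>\<^sub>0 'k::field)"
  assumes "t \<in> Poly_Mapping.keys (loc q T)"
    and root: "\<And>T t. t \<in> Poly_Mapping.keys (q T) \<Longrightarrow> P T t"
    and white: "\<And>i l c R u. P c u \<Longrightarrow> P (White i l (add_mset c R)) (White i l (add_mset u R))"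
    and special: "\<And>i e R C u. P e u \<Longrightarrow> P (Black i (add_mset e R) C) (Black i (add_mset u R) C)"
    and ordinary: "\<And>i E c R u. P c u \<Longrightarrow> P (Black i E (add_mset c R)) (Black i E (add_mset u R))"
  shows "P T t"
  using assms(1)
proof (induction T arbitrary: t rule: ct_induct)
  case (step T)
  have "t \<in> Poly_Mapping.keys (q T) \<or> t \<in> Poly_Mapping.keys (dev (loc q) T)"
    using step.prems keys_add by (subst (asm) loc.simps) fastforce
  then show ?case
  proof
    assume "t \<in> Poly_Mapping.keys (dev (loc q) T)"
    then show ?thesis
    proof (cases rule: keys_devE)
      case (white i l c R u)
      then show ?thesis using step.IH[of False c u] assms(3) by simp
    next
      case (special i e R C u)
      then show ?thesis using step.IH[of True e u] assms(4) by simp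
    next
      case (ordinary i E c R u)
      then show ?thesis using step.IH[of False c u] assms(5) by simp
    qed
  qed (rule root)
qed

lemma graft_keys_induct [consumes 1, case_names root white special ordinary]:
  fixes y T t :: ct
  assumes "t \<in> Poly_Mapping.keys (graft y T :: ct \<Rightarrow>\<^sub>0 'k::field)"
    and root: "\<And>T. P T (addroot y T)"
    and "\<And>i l c R u. P c u \<Longrightarrow> P (White i l (add_mset c R)) (White i l (add_mset u R))"
    and "\<And>i e R C u. P e u \<Longrightarrow> P (Black i (add_mset e R) C) (Black i (add_mset u R) C)"
    and "\<And>i E c R u. P c u \<Longrightarrow> P (Black i E (add_mset c R)) (Black i E (add_mset u R))"
  shows "P T t"
  using assms(1) unfolding graft_def
  by (rule keys_loc_induct) (use assms in auto)

lemma two_special_simps [simp]: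
  "two_special (White i l C) \<longleftrightarrow> (\<forall>c\<in>#C. two_special c)"
  "two_special (Black i E C) \<longleftrightarrow> size E = 2 \<and> (\<forall>e\<in>#E. two_special e) \<and> (\<forall>c\<in>#C. two_special c)"
  by simp_all

declare two_special.simps [simp del]

lemma white_labels_addroot [simp]: "white_labels (addroot y T) = white_labels y + white_labels T"
  by (cases T) simp_all

lemma two_special_addroot [simp]: "two_special (addroot y T) \<longleftrightarrow> two_special y \<and> two_special T"
  by (cases T) auto

lemma nvert_addroot [simp]: "nvert (addroot y T) = nvert y + nvert T"
  by (cases T) simp_all

lemma white_labels_loc:
  fixes q :: "ct \<Rightarrow> (ct \<Rightarrow>\<^sub>0 'k::field)"
  assumes "t \<in> Poly_Mapping.keys (loc q T)"
    and "\<And>T t. t \<in> Poly_Mapping.keys (q T) \<Longrightarrow> white_labels t + a = white_labels T + b"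
  shows "white_labels t + a = white_labels T + b"
  using assms(1)
proof (induction rule: keys_loc_induct)
  case (root T t)
  then show ?case by (rule assms(2))
qed (simp_all add: ac_simps)

lemma two_special_loc:
  fixes q :: "ct \<Rightarrow> (ct \<Rightarrow>\<^sub>0 'k::field)"
  assumes "t \<in> Poly_Mapping.keys (loc q T)" "two_special T"
    and "\<And>T t. t \<in> Poly_Mapping.keys (q T) \<Longrightarrow> two_special T \<Longrightarrow> two_special t"
  shows "two_special t"
  using assms(1,2) by (induction rule: keys_loc_induct) (auto simp: assms(3))

lemma white_labels_graft:
  "t \<in> Poly_Mapping.keys (graft y T :: ct \<Rightarrow>\<^sub>0 'k::field) \<Longrightarrow> white_labels t = white_labels T + white_labels y"
  by (induction rule: graft_keys_induct) (auto simp: ac_simps)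

lemma nvert_graft:
  "t \<in> Poly_Mapping.keys (graft y T :: ct \<Rightarrow>\<^sub>0 'k::field) \<Longrightarrow> nvert t = nvert T + nvert y"
  by (induction rule: graft_keys_induct) (auto simp: ac_simps)

lemma two_special_graft:
  "t \<in> Poly_Mapping.keys (graft y T :: ct \<Rightarrow>\<^sub>0 'k::field) \<Longrightarrow> two_special T \<Longrightarrow> two_special y \<Longrightarrow> two_special t"
  by (induction rule: graft_keys_induct) auto

primrec ordinary :: "ct \<Rightarrow> ct multiset" where
  "ordinary (White i l C) = C"
| "ordinary (Black i E C) = C"

section \<open>Generation of trees by grafting and black vertices\<close>

lemma linear_combination_induct:
  fixes P :: "('b \<Rightarrow>\<^sub>0 'k::field) \<Rightarrow> bool"
  assumes "P 0" "\<And>x y. P x \<Longrightarrow> P y \<Longrightarrow> P (x + y)" "\<And>c x. P x \<Longrightarrow> P (fscale c x)"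
    and "\<And>t. t \<in> Poly_Mapping.keys x \<Longrightarrow> P (basis t)"
  shows "P x"
proof -
  have "P (\<Sum>t\<in>A. fscale (Poly_Mapping.lookup x t) (basis t))" if "A \<subseteq> Poly_Mapping.keys x" for A
    using that by (induction A rule: infinite_finite_induct) (use assms in auto)
  from this[of "Poly_Mapping.keys x"] show ?thesis
    using lin_ext_basis_id[of x] by (simp add: lin_ext_def)
qed

lemma size_2E:
  assumes "size E = 2"
  obtains x y where "E = {#x, y#}"
proof -
  obtain x E' where E: "E = add_mset x E'" using assms by (cases E) auto
  with assms have "size E' = 1" by simp
  then obtain y where "E' = {#y#}" using size_1_singleton_mset by blast
  then show thesis using E that by blast
qed

text \<open>If the root has an ordinary child \<open>y\<close>, the tree is the grafting of
  \<open>y\<close> onto the rest minus the trees in which \<open>y\<close> sits higher. Those have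
  equally many vertices but one ordinary child of the root less, which explains the lexicographic
  order. The multiset of labels is carried along so that \<open>P\<close> can refer to the component
  that contains the tree.\<close>

theorem tree_generation [consumes 1, case_names zero add scale leaf graft mul]:
  fixes P :: "nat option multiset \<Rightarrow> (ct \<Rightarrow>\<^sub>0 'k::field) \<Rightarrow> bool"
  assumes "two_special T"
    and zero: "\<And>M. P M 0"
    and add: "\<And>M x y. P M x \<Longrightarrow> P M y \<Longrightarrow> P M (x + y)"
    and scale: "\<And>M c x. P M x \<Longrightarrow> P M (fscale c x)"
    and leaf: "\<And>l. P {#l#} (basis (White () l {#}))"
    and graft: "\<And>x y. two_special x \<Longrightarrow> two_special y \<Longrightarrow>
      P (white_labels x) (basis x) \<Longrightarrow> P (white_labels y) (basis y) \<Longrightarrow>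
      P (white_labels x + white_labels y) (graft y x)"
    and mul: "\<And>x y. two_special x \<Longrightarrow> two_special y \<Longrightarrow>
      P (white_labels x) (basis x) \<Longrightarrow> P (white_labels y) (basis y) \<Longrightarrow>
      P (white_labels x + white_labels y) (basis (Black () {#x, y#} {#}))"
  shows "P (white_labels T) (basis T)"
  using assms(1)
proof (induction T rule: wf_induct_rule[OF wf_inv_image[OF wf_lex_prod[OF wf_less wf_less],
        where f = "\<lambda>T. (nvert T, size (ordinary T))"]])
  case (1 T)
  show ?case
  proof (cases "ordinary T = {#}")
    case True
    show ?thesis
    proof (cases T)
      case (White i l C)
      then show ?thesis using True leaf[of l] by simp
    next
      case (Black i E C)
      then obtain x y where E: "E = {#x, y#}"
        using 1(2) by (auto elim: size_2E)
      have "P (white_labels x) (basis x)" "P (white_labels y) (basis y)"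
        using 1 Black E by auto
      then show ?thesis using mul[of x y] Black E True 1 by simp
    qed
  next
    case False
    then obtain y C where C: "ordinary T = add_mset y C" by (meson multiset_cases)
    define T0 where "T0 = (case T of White i l _ \<Rightarrow> White i l C | Black i E _ \<Rightarrow> Black i E C)"
    have T: "T = addroot y T0" and o0: "ordinary T0 = C" using C by (cases T; simp add: T0_def)+
    have ts: "two_special y" "two_special T0" using 1(2) by (simp_all add: T)
    have "0 < nvert T0" "0 < nvert y" by (cases T0; simp) (cases y; simp)
    then have a: "P (white_labels T0) (basis T0)" "P (white_labels y) (basis y)"
      using ts 1(1) by (simp_all add: T)
    have eq: "basis T = graft y T0 + fscale (-1) (dev (graft y) T0 :: ct \<Rightarrow>\<^sub>0 'k)"
      by (simp add: T graft_simps[of y T0])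
    have "P (white_labels T) (dev (graft y) T0)"
    proof (rule linear_combination_induct[of "P (white_labels T)", OF zero add scale])
      fix t assume t: "t \<in> Poly_Mapping.keys (dev (graft y) T0 :: ct \<Rightarrow>\<^sub>0 'k)"
      have "two_special t \<and> white_labels t = white_labels T \<and> nvert t = nvert T \<and> size (ordinary t) < size (ordinary T)"
        using t
        by (cases rule: keys_devE)
          (use ts in \<open>auto simp: T white_labels_graft nvert_graft intro: two_special_graft\<close>)
      then show "P (white_labels T) (basis t)"
        using 1(1)[of t] by auto
    qed
    then show ?thesis
      unfolding eq using graft[OF ts(2,1) a] by (intro add scale) (simp_all add: T add.commute)
  qed
qed

section \<open>Distributing a multiset over a set of places\<close>

abbreviation ins :: "'j \<Rightarrow> 'c \<Rightarrow> ('j \<Rightarrow> 'c multiset) \<Rightarrow> ('j \<Rightarrow> 'c multiset)" where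
  "ins j c g \<equiv> g(j := add_mset c (g j))"

text \<open>The sum over all ways of distributing \<open>C\<close> over the places \<open>J\<close>,
  on top of the distribution \<open>g\<close>. As a fold over a multiset it works with unnamed
  trees; \<open>sum_maps_dst\<close> links it to sums over maps.\<close>

definition dst :: "'j multiset \<Rightarrow> (('j \<Rightarrow> 'c multiset) \<Rightarrow> 'v::comm_monoid_add) \<Rightarrow>
    'c multiset \<Rightarrow> ('j \<Rightarrow> 'c multiset) \<Rightarrow> 'v" where
  "dst J H C = fold_mset (\<lambda>c H g. \<Sum>j\<in>#J. H (ins j c g)) H C"

lemma ins_commute: "ins k d (ins j c g) = ins j c (ins k d g)"
  by (auto simp: fun_eq_iff)

declare fun_upd_apply [simp del]

lemma dst_commute:
  "comp_fun_commute (\<lambda>c (H :: ('j \<Rightarrow> 'c multiset) \<Rightarrow> 'v::comm_monoid_add) g. \<Sum>j\<in>#J. H (ins j c g))"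
proof (unfold_locales, rule ext, rule ext)
  fix c d :: 'c and H :: "('j \<Rightarrow> 'c multiset) \<Rightarrow> 'v" and g
  have "(\<Sum>j\<in>#J. \<Sum>k\<in>#J. H (ins k c (ins j d g))) = (\<Sum>j\<in>#J. \<Sum>k\<in>#J. H (ins j d (ins k c g)))"
    by (intro arg_cong[where f = sum_mset] image_mset_cong arg_cong[where f = H] ins_commute)
  also have "\<dots> = (\<Sum>k\<in>#J. \<Sum>j\<in>#J. H (ins j d (ins k c g)))"
    by (rule sum_mset.swap)
  finally show "((\<lambda>H g. \<Sum>j\<in>#J. H (ins j d g)) \<circ> (\<lambda>H g. \<Sum>j\<in>#J. H (ins j c g))) H g =
     ((\<lambda>H g. \<Sum>j\<in>#J. H (ins j c g)) \<circ> (\<lambda>H g. \<Sum>j\<in>#J. H (ins j d g))) H g"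
    by simp
qed

lemma dst_empty [simp]: "dst J H {#} g = H g"
  by (simp add: dst_def)

lemma dst_add_mset: "dst J H (add_mset c C) g = (\<Sum>j\<in>#J. dst J H C (ins j c g))"
  unfolding dst_def by (subst comp_fun_commute.fold_mset_add_mset[OF dst_commute]) simp

lemma dst_plus: "dst J (\<lambda>g. H g + H' g) C g = dst J H C g + dst J H' C g"
  by (induction C arbitrary: g) (simp_all add: dst_add_mset sum_mset.distrib)

lemma dst_zero: "dst J (\<lambda>g. 0) C g = 0"
  by (induction C arbitrary: g) (simp_all add: dst_add_mset)

lemma dst_hom:
  fixes J :: "'j multiset"
  assumes "h 0 = 0" "\<And>a b. h (a + b) = h a + h b"
  shows "h (dst J H C g) = dst J (\<lambda>g. h (H g)) C g"
proof -
  have h: "h (\<Sum>j\<in>#J. f j) = (\<Sum>j\<in>#J. h (f j))" for f :: "'j \<Rightarrow> _" and J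
    by (induction J) (simp_all add: assms)
  show ?thesis by (induction C arbitrary: g) (simp_all add: dst_add_mset h)
qed

lemma dst_diff:
  fixes H :: "_ \<Rightarrow> 'v::ab_group_add"
  shows "dst J (\<lambda>g. H g - H' g) C g = dst J H C g - dst J H' C g"
  using dst_plus[of J "\<lambda>g. H g - H' g" H' C g] by (simp add: algebra_simps)

lemma dst_msum: "dst J (\<lambda>g. msum (\<lambda>x R. H x R g) M) C g = msum (\<lambda>x R. dst J (H x R) C g) M"
  by (induction M arbitrary: H) (simp_all add: dst_zero dst_plus)

lemma dst_lin_ext: "dst J (\<lambda>g. lin_ext (\<lambda>t. H t g) x) C g = lin_ext (\<lambda>t. dst J (H t) C g) x"
  by (induction C arbitrary: g) (simp_all add: dst_add_mset lin_ext_sum_mset)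

lemma sum_mset_single:
  assumes "\<forall>j. count J j \<le> 1" "k \<in># J"
  shows "(\<Sum>j\<in>#J. if j = k then X j else 0) = X k"
proof -
  obtain K where K: "J = add_mset k K" using assms(2) by (meson multi_member_split)
  have "k \<notin># K" using assms(1)[rule_format, of k] by (simp add: K not_in_iff)
  then have "(\<Sum>j\<in>#K. if j = k then X j else 0) = (\<Sum>j\<in>#K. 0)"
    by (intro arg_cong[where f = sum_mset] image_mset_cong) auto
  then show ?thesis by (simp add: K)
qed

text \<open>The tree \<open>y\<close> can become one more entry to distribute, or be grafted into an
  entry already placed by \<open>g\<close>, or into one still in \<open>C\<close>; \<open>H'\<close>
  takes what happens outside the entries. The induction places the entries of \<open>C\<close> one
  by one.\<close>

lemma graft_dst:
  fixes H :: "('j \<Rightarrow> ct multiset) \<Rightarrow> (ct \<Rightarrow>\<^sub>0 'k::field)"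
  assumes J: "\<forall>j. count J j \<le> 1"
    and H: "\<And>g. lin_ext (graft y) (H g) = (\<Sum>j\<in>#J. H (ins j y g)) +
      (\<Sum>j\<in>#J. msum (\<lambda>c R. lin_ext (\<lambda>t. H (g(j := add_mset t R))) (graft y c)) (g j)) + H' g"
  shows "lin_ext (graft y) (dst J H C g) = dst J H (add_mset y C) g +
    (\<Sum>j\<in>#J. msum (\<lambda>c R. lin_ext (\<lambda>t. dst J H C (g(j := add_mset t R))) (graft y c)) (g j)) +
    msum (\<lambda>c R. lin_ext (\<lambda>t. dst J H (add_mset t R) g) (graft y c)) C + dst J H' C g"
proof (induction C arbitrary: g)
  case empty
  show ?case by (simp add: H dst_add_mset)
next
  case (add d C)
  let ?A = "\<lambda>j g. msum (\<lambda>c R. lin_ext (\<lambda>t. dst J H C (g(j := add_mset t R))) (graft y c)) (g j)"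
  \<comment> \<open>The entry \<open>d\<close> just placed at \<open>k\<close> is among the entries
    at \<open>j\<close> only if \<open>j = k\<close>. As no place occurs twice in \<open>J\<close>,
    this term is counted once.\<close>
  have A: "?A j (ins k d g) = (if j = k then lin_ext (\<lambda>t. dst J H C (ins k t g)) (graft y d) else 0) +
      msum (\<lambda>c R. lin_ext (\<lambda>t. dst J H C (ins k d (g(j := add_mset t R)))) (graft y c)) (g j)" for j k
    by (cases "j = k") (simp_all add: fun_upd_same fun_upd_other fun_upd_twist add_mset_commute)
  have B: "(\<Sum>j\<in>#J. ?A j (ins k d g)) = lin_ext (\<lambda>t. dst J H C (ins k t g)) (graft y d) +
      (\<Sum>j\<in>#J. msum (\<lambda>c R. lin_ext (\<lambda>t. dst J H C (ins k d (g(j := add_mset t R)))) (graft y c)) (g j))"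
    if "k \<in># J" for k
    unfolding A sum_mset.distrib
    using sum_mset_single[OF J that, of "\<lambda>_. lin_ext (\<lambda>t. dst J H C (ins k t g)) (graft y d)"] by simp
  have "(\<Sum>k\<in>#J. \<Sum>j\<in>#J. ?A j (ins k d g)) =
     (\<Sum>k\<in>#J. lin_ext (\<lambda>t. dst J H C (ins k t g)) (graft y d) +
      (\<Sum>j\<in>#J. msum (\<lambda>c R. lin_ext (\<lambda>t. dst J H C (ins k d (g(j := add_mset t R)))) (graft y c)) (g j)))"
    by (intro arg_cong[where f = sum_mset] image_mset_cong B)
  also have "\<dots> = lin_ext (\<lambda>t. dst J H (add_mset t C) g) (graft y d) +
     (\<Sum>j\<in>#J. msum (\<lambda>c R. lin_ext (\<lambda>t. dst J H (add_mset d C) (g(j := add_mset t R))) (graft y c)) (g j))"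
    unfolding sum_mset.distrib dst_add_mset lin_ext_sum_mset msum_sum_mset
    by (intro arg_cong2[where f = "(+)"] refl sum_mset.swap)
  finally have C: "(\<Sum>k\<in>#J. \<Sum>j\<in>#J. ?A j (ins k d g)) = \<dots>" .
  have D: "(\<Sum>k\<in>#J. dst J H (add_mset y C) (ins k d g)) = dst J H (add_mset y (add_mset d C)) g"
    by (subst add_mset_commute) (simp add: dst_add_mset[of J H d])
  have E: "(\<Sum>k\<in>#J. msum (\<lambda>c R. lin_ext (\<lambda>t. dst J H (add_mset t R) (ins k d g)) (graft y c)) C) =
      msum (\<lambda>c R. lin_ext (\<lambda>t. dst J H (add_mset t (add_mset d R)) g) (graft y c)) C"
  proof -
    have "dst J H (add_mset t (add_mset d R)) g = (\<Sum>k\<in>#J. dst J H (add_mset t R) (ins k d g))" for t R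
      by (subst add_mset_commute) (simp add: dst_add_mset[of J H d])
    then show ?thesis by (simp add: lin_ext_sum_mset msum_sum_mset)
  qed
  show ?case
    by (simp add: dst_add_mset[of J H d] dst_add_mset[of J H' d] lin_ext_arg_sum_mset add.IH sum_mset.distrib C D E add_ac)
qed

section \<open>Named trees\<close>

abbreviation distinct_names :: "('i, 'l) ctree \<Rightarrow> bool" where
  "distinct_names T \<equiv> \<forall>j. count (names T) j \<le> 1"

text \<open>Names are needed to address the vertices that receive \<open>g\<close>, not those of the
  attached trees. Forgetting them on the way keeps the result among the unnamed trees, where
  \<open>graft\<close> is defined.\<close>

primrec attach_u :: "('i \<Rightarrow> ct multiset) \<Rightarrow> ('i, nat option) ctree \<Rightarrow> ct" where
  "attach_u g (White i l C) = White () l (image_mset (attach_u g) C + g i)"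
| "attach_u g (Black i E C) = Black () (image_mset (attach_u g) E) (image_mset (attach_u g) C + g i)"

lemma attach_u_cong: "(\<And>j. j \<in># names U \<Longrightarrow> g j = g' j) \<Longrightarrow> attach_u g U = attach_u g' U"
proof (induction U)
  case (White i l C)
  have "attach_u g c = attach_u g' c" if "c \<in># C" for c
    by (rule White.IH[OF that]) (use White.prems that in auto)
  then show ?case using White.prems by (auto intro!: image_mset_cong)
next
  case (Black i E C)
  have "attach_u g c = attach_u g' c" if "c \<in># C" for c
    by (rule Black.IH(2)[OF that]) (use Black.prems that in auto)
  moreover have "attach_u g c = attach_u g' c" if "c \<in># E" for c
    by (rule Black.IH(1)[OF that]) (use Black.prems that in auto)
  ultimately show ?case using Black.prems by (auto intro!: image_mset_cong)
qed

lemma forget_names_simps [simp]: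
  "forget_names (White i l C) = White () l (image_mset forget_names C)"
  "forget_names (Black i E C) = Black () (image_mset forget_names E) (image_mset forget_names C)"
  by (simp_all add: forget_names_def[abs_def])

lemma forget_attach: "forget_names (attach g U) = attach_u (\<lambda>j. image_mset forget_names (g j)) U"
  by (induction U) (auto simp: image_mset.compositionality intro!: image_mset_cong)

lemma attach_u_empty: "attach_u (\<lambda>_. {#}) U = forget_names U"
  by (induction U) (auto intro!: image_mset_cong)

lemma white_labels_forget [simp]: "white_labels (forget_names T) = white_labels T"
proof (induction T)
  case (White i l C)
  then have "image_mset (white_labels \<circ> forget_names) C = image_mset white_labels C"
    by (auto intro!: image_mset_cong)
  then show ?case by (simp add: image_mset.compositionality)
next
  case (Black i E C)
  then have "image_mset (white_labels \<circ> forget_names) C = image_mset white_labels C"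
    "image_mset (white_labels \<circ> forget_names) E = image_mset white_labels E"
    by (auto intro!: image_mset_cong)
  then show ?case by (simp add: image_mset.compositionality)
qed

lemma count_sum_image:
  "count (\<Sum>\<^sub># (image_mset f (add_mset c R))) j = count (f c) j + count (\<Sum>\<^sub># (image_mset f R)) j"
  by simp

lemma not_in_sum_image: "count (\<Sum>\<^sub># (image_mset f R)) j = 0 \<longleftrightarrow> (\<forall>r\<in>#R. j \<notin># f r)"
  by (induction R) (auto simp: not_in_iff)

lemma sum_image_le1:
  assumes "\<forall>j. count (\<Sum>\<^sub># (image_mset f (add_mset c R))) j \<le> 1"
  shows "\<forall>j. count (f c) j \<le> 1" "j \<in># f c \<Longrightarrow> r \<in># R \<Longrightarrow> j \<notin># f r"
    "\<forall>j. count (\<Sum>\<^sub># (image_mset f R)) j \<le> 1"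
proof -
  show "\<forall>j. count (f c) j \<le> 1" "\<forall>j. count (\<Sum>\<^sub># (image_mset f R)) j \<le> 1"
    using assms unfolding count_sum_image by (meson add_leD1 add_leD2)+
  assume "j \<in># f c" "r \<in># R"
  then have "count (f c) j \<ge> 1" by simp
  then have "count (\<Sum>\<^sub># (image_mset f R)) j = 0"
    using assms[rule_format, of j] unfolding count_sum_image by linarith
  then show "j \<notin># f r" using \<open>r \<in># R\<close> unfolding not_in_sum_image by blast
qed

lemma msum_sum_names:
  "msum (\<lambda>c R. \<Sum>j\<in>#f c. \<Phi> j) C = (\<Sum>j\<in># \<Sum>\<^sub># (image_mset f C). \<Phi> j)"
  by (induction C) simp_all

lemma names_sum_le1_cases:
  assumes "distinct_names (White i l C)"
  shows "\<forall>j. count (\<Sum>\<^sub># (image_mset names C)) j \<le> 1" "i \<notin># \<Sum>\<^sub># (image_mset names C)"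
proof -
  have *: "(if i = j then 1 else 0) + count (\<Sum>\<^sub># (image_mset names C)) j \<le> 1" for j
    using assms[rule_format, of j] by (simp split: if_splits)
  show "\<forall>j. count (\<Sum>\<^sub># (image_mset names C)) j \<le> 1" using * by (meson add_leD2)
  show "i \<notin># \<Sum>\<^sub># (image_mset names C)" using *[of i] by (metis add_le_same_cancel1 count_eq_zero_iff le_zero_eq)
qed

lemma names_sum_le1_cases_Black:
  assumes "distinct_names (Black i E C)"
  shows "\<forall>j. count (\<Sum>\<^sub># (image_mset names (E + C))) j \<le> 1" "i \<notin># \<Sum>\<^sub># (image_mset names (E + C))"
  using names_sum_le1_cases[of i undefined "E + C"] assms by simp_all

text \<open>Every vertex of the result is a vertex of \<open>U\<close> or lies in one of the
  attached trees. Distinct names guarantee that a change of \<open>g\<close> at one name alters the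
  tree at one vertex.\<close>

lemma graft_attach:
  assumes "distinct_names U"
  shows "graft y (attach_u g U) = ((\<Sum>j\<in>#names U. basis (attach_u (ins j y g) U)) +
    (\<Sum>j\<in>#names U. msum (\<lambda>c R. lin_ext (\<lambda>t. basis (attach_u (g(j := add_mset t R)) U)) (graft y c)) (g j))
    :: ct \<Rightarrow>\<^sub>0 'k::field)"
  using assms
proof (induction U)
  case (White i l C)
  let ?U = "White i l C"
  \<comment> \<open>All graftings at the vertex \<open>j\<close> or into the trees attached there.
    The names of \<open>U\<close> split into the root and the names of its children, and so does the
    sum over \<open>j\<close>.\<close>
  define \<Phi> :: "_ \<Rightarrow> _ \<Rightarrow> ct \<Rightarrow>\<^sub>0 'k" where "\<Phi> U j = basis (attach_u (ins j y g) U) +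
    msum (\<lambda>c R. lin_ext (\<lambda>t. basis (attach_u (g(j := add_mset t R)) U)) (graft y c)) (g j)" for U j
  note d = names_sum_le1_cases[OF White.prems]
  have root: "attach_u (g(i := X)) ?U = White () l (image_mset (attach_u g) C + X)" for X
  proof -
    have "image_mset (attach_u (g(i := X))) C = image_mset (attach_u g) C"
      by (intro image_mset_cong attach_u_cong fun_upd_other) (use d(2) in auto)
    then show ?thesis by (simp add: fun_upd_same)
  qed
  have child: "lin_ext (\<lambda>t. basis (White () l (add_mset t (image_mset (attach_u g) R + g i)))) (graft y (attach_u g c))
      = (\<Sum>j\<in>#names c. \<Phi> ?U j)" if C: "C = add_mset c R" for c R
  proof -
    note e = sum_image_le1[OF d(1)[unfolded C]]
    have IH: "graft y (attach_u g c) = (\<Sum>j\<in>#names c. \<Phi> c j)"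
      using White.IH[of c] e(1) by (simp add: C \<Phi>_def sum_mset.distrib)
    have upd: "attach_u (g(j := X)) ?U = White () l (add_mset (attach_u (g(j := X)) c) (image_mset (attach_u g) R + g i))"
      if "j \<in># names c" for j X
    proof -
      have "image_mset (attach_u (g(j := X))) R = image_mset (attach_u g) R"
        using e(2)[OF that] by (intro image_mset_cong attach_u_cong fun_upd_other) auto
      moreover have "j \<noteq> i" using d(2) that by (auto simp: C)
      ultimately show ?thesis by (simp add: C fun_upd_other)
    qed
    show ?thesis unfolding IH lin_ext_arg_sum_mset
      by (intro arg_cong[where f = sum_mset] image_mset_cong)
        (simp add: \<Phi>_def lin_ext_arg lin_ext_arg_msum lin_ext_lin_ext upd del: attach_u.simps)
  qed
  have "graft y (attach_u g ?U) = basis (attach_u (ins i y g) ?U) +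
     (msum (\<lambda>c R. lin_ext (\<lambda>t. basis (White () l (add_mset t (image_mset (attach_u g) R + g i)))) (graft y (attach_u g c))) C +
      msum (\<lambda>c R. lin_ext (\<lambda>t. basis (attach_u (g(i := add_mset t R)) ?U)) (graft y c)) (g i))"
    unfolding root by (subst graft_simps) (simp add: msum_union msum_image add_ac)
  also have "msum (\<lambda>c R. lin_ext (\<lambda>t. basis (White () l (add_mset t (image_mset (attach_u g) R + g i)))) (graft y (attach_u g c))) C
      = msum (\<lambda>c R. \<Sum>j\<in>#names c. \<Phi> ?U j) C"
    by (rule msum_cong) (rule child)
  finally show ?case
    unfolding msum_sum_names by (simp add: \<Phi>_def[abs_def] sum_mset.distrib add_ac del: attach_u.simps)
next
  case (Black i E C)
  let ?U = "Black i E C"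
  define \<Phi> :: "_ \<Rightarrow> _ \<Rightarrow> ct \<Rightarrow>\<^sub>0 'k" where "\<Phi> U j = basis (attach_u (ins j y g) U) +
    msum (\<lambda>c R. lin_ext (\<lambda>t. basis (attach_u (g(j := add_mset t R)) U)) (graft y c)) (g j)" for U j
  note d = names_sum_le1_cases_Black[OF Black.prems]
  have root: "attach_u (g(i := X)) ?U = Black () (image_mset (attach_u g) E) (image_mset (attach_u g) C + X)" for X
  proof -
    have "image_mset (attach_u (g(i := X))) C = image_mset (attach_u g) C"
      "image_mset (attach_u (g(i := X))) E = image_mset (attach_u g) E"
      by (intro image_mset_cong attach_u_cong fun_upd_other; use d(2) in auto)+
    then show ?thesis by (simp add: fun_upd_same)
  qed
  have other: "image_mset (attach_u (g(j := X))) R = image_mset (attach_u g) R"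
      if "j \<in># names c" "add_mset c (R + R') = E + C" for j X c R R'
    using sum_image_le1(2)[OF d(1)[folded that(2)], of j] that(1)
    by (intro image_mset_cong attach_u_cong fun_upd_other) auto
  have ji: "j \<noteq> i" if "j \<in># names c" "add_mset c (R + R') = E + C" for j c R R'
    using d(2)[folded that(2)] that(1) by auto
  have IH: "graft y (attach_u g c) = (\<Sum>j\<in>#names c. \<Phi> c j)" if "add_mset c R = E + C" for c R
  proof -
    have "c \<in># E + C" unfolding that[symmetric] by simp
    then show ?thesis
      using Black.IH[of c] sum_image_le1(1)[OF d(1)[folded that]] by (auto simp: \<Phi>_def sum_mset.distrib)
  qed
  have spec: "lin_ext (\<lambda>t. basis (Black () (add_mset t (image_mset (attach_u g) R)) (image_mset (attach_u g) C + g i))) (graft y (attach_u g c))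
      = (\<Sum>j\<in>#names c. \<Phi> ?U j)" if E: "E = add_mset c R" for c R
  proof -
    have upd: "attach_u (g(j := X)) ?U =
        Black () (add_mset (attach_u (g(j := X)) c) (image_mset (attach_u g) R)) (image_mset (attach_u g) C + g i)"
      if "j \<in># names c" for j X
      using other[OF that, of R C] other[OF that, of C R] ji[OF that, of R C]
      by (simp add: E fun_upd_other add.commute)
    show ?thesis unfolding IH[of c "R + C", unfolded E, simplified] lin_ext_arg_sum_mset
      by (intro arg_cong[where f = sum_mset] image_mset_cong)
        (simp add: \<Phi>_def lin_ext_arg lin_ext_arg_msum lin_ext_lin_ext upd del: attach_u.simps)
  qed
  have ord: "lin_ext (\<lambda>t. basis (Black () (image_mset (attach_u g) E) (add_mset t (image_mset (attach_u g) R + g i)))) (graft y (attach_u g c))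
      = (\<Sum>j\<in>#names c. \<Phi> ?U j)" if C: "C = add_mset c R" for c R
  proof -
    have upd: "attach_u (g(j := X)) ?U =
        Black () (image_mset (attach_u g) E) (add_mset (attach_u (g(j := X)) c) (image_mset (attach_u g) R + g i))"
      if "j \<in># names c" for j X
      using other[OF that, of R E] other[OF that, of E R] ji[OF that, of R E]
      by (simp add: C fun_upd_other add.commute)
    show ?thesis unfolding IH[of c "E + R", unfolded C, simplified] lin_ext_arg_sum_mset
      by (intro arg_cong[where f = sum_mset] image_mset_cong)
        (simp add: \<Phi>_def lin_ext_arg lin_ext_arg_msum lin_ext_lin_ext upd del: attach_u.simps)
  qed
  have "graft y (attach_u g ?U) = basis (attach_u (ins i y g) ?U) +
     (msum (\<lambda>c R. lin_ext (\<lambda>t. basis (Black () (add_mset t (image_mset (attach_u g) R)) (image_mset (attach_u g) C + g i))) (graft y (attach_u g c))) E +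
      msum (\<lambda>c R. lin_ext (\<lambda>t. basis (Black () (image_mset (attach_u g) E) (add_mset t (image_mset (attach_u g) R + g i)))) (graft y (attach_u g c))) C +
      msum (\<lambda>c R. lin_ext (\<lambda>t. basis (attach_u (g(i := add_mset t R)) ?U)) (graft y c)) (g i))"
    unfolding root by (subst graft_simps) (simp add: msum_union msum_image add_ac)
  also have "msum (\<lambda>c R. lin_ext (\<lambda>t. basis (Black () (add_mset t (image_mset (attach_u g) R)) (image_mset (attach_u g) C + g i))) (graft y (attach_u g c))) E
      = msum (\<lambda>c R. \<Sum>j\<in>#names c. \<Phi> ?U j) E"
    by (rule msum_cong) (rule spec)
  also have "msum (\<lambda>c R. lin_ext (\<lambda>t. basis (Black () (image_mset (attach_u g) E) (add_mset t (image_mset (attach_u g) R + g i)))) (graft y (attach_u g c))) C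
      = msum (\<lambda>c R. \<Sum>j\<in>#names c. \<Phi> ?U j) C"
    by (rule msum_cong) (rule ord)
  finally show ?case
    unfolding msum_sum_names by (simp add: \<Phi>_def[abs_def] sum_mset.distrib add_ac del: attach_u.simps)
qed

text \<open>The symmetric brace of the pre-Lie structure: the trees of \<open>C\<close> are attached
  independently of each other at arbitrary vertices of \<open>U\<close>.\<close>

definition brace :: "('i, nat option) ctree \<Rightarrow> ct multiset \<Rightarrow> (ct \<Rightarrow>\<^sub>0 'k::field)" where
  "brace U C = dst (names U) (\<lambda>g. basis (attach_u g U)) C (\<lambda>_. {#})"

lemma graft_brace:
  assumes "distinct_names U"
  shows "lin_ext (graft y) (brace U C) =
    brace U (add_mset y C) + msum (\<lambda>c R. lin_ext (\<lambda>t. brace U (add_mset t R)) (graft y c)) C"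
  unfolding brace_def
  using graft_dst[OF assms, of y "\<lambda>g. basis (attach_u g U)" "\<lambda>_. 0" C "\<lambda>_. {#}"]
  by (simp add: graft_attach[OF assms] dst_zero)

section \<open>Substitution\<close>

text \<open>Zero unless the root carries \<open>l\<close>, so that \<open>loc\<close> of it replaces
  one vertex labelled \<open>l\<close> at a time. The children of this vertex are redistributed over
  \<open>U\<close>, which is the sum over maps in the partial composition.\<close>

definition subst_at :: "nat option \<Rightarrow> ('i, nat option) ctree \<Rightarrow> ct \<Rightarrow> (ct \<Rightarrow>\<^sub>0 'k::field)" where
  "subst_at l U T = (case T of White i m C \<Rightarrow> if m = l then brace U C else 0 | Black i E C \<Rightarrow> 0)"

text \<open>At a root labelled \<open>l\<close> the condition of \<open>loc_graft_0\<close> is the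
  brace identity \<open>graft_brace\<close>; at any other root both sides vanish.\<close>

lemma loc_subst_graft:
  assumes "distinct_names U"
  shows "lin_ext (loc (subst_at l U)) (graft y T) =
     lin_ext (graft y) (loc (subst_at l U) T) + lin_ext (\<lambda>t. graft t T) (loc (subst_at l U) y)"
proof (rule loc_graft_0)
  fix T
  show "subst_at l U (addroot y T) + lin_ext (subst_at l U) (dev (graft y) T) =
     lin_ext (graft y) (subst_at l U T)"
    by (cases T)
      (simp_all add: subst_at_def graft_brace[OF assms] lin_ext_arg lin_ext_arg_msum lin_ext_lin_ext
        lin_ext_zero msum_zero)
qed

lemma loc_subst_absent: "l \<notin># white_labels T \<Longrightarrow> loc (subst_at l U) T = (0 :: ct \<Rightarrow>\<^sub>0 'k::field)"
proof (induction T rule: ct_induct)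
  case (step T)
  have "dev (loc (subst_at l U)) T = dev (\<lambda>_. 0 :: ct \<Rightarrow>\<^sub>0 'k) T"
  proof (rule dev_cong_slots)
    fix b c assume "(b, c) \<in># slots T"
    moreover from this have "l \<notin># white_labels c"
      using step.prems by (cases T) auto
    ultimately show "loc (subst_at l U) c = (0 :: ct \<Rightarrow>\<^sub>0 'k)" using step.IH by blast
  qed
  moreover have "subst_at l U T = (0 :: ct \<Rightarrow>\<^sub>0 'k)" using step.prems by (cases T) (auto simp: subst_at_def)
  ultimately show ?case by (simp add: loc.simps dev_zero)
qed

lemma plug_absent: "l \<notin># white_labels T \<Longrightarrow> plug l U f T = T"
  by (induction T) (auto simp: multiset.map_ident_strong)

lemma input_edges_absent: "l \<notin># white_labels T \<Longrightarrow> input_edges l T = {}"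
  by (induction T) auto

lemma sum_distinct_mset:
  assumes "\<forall>j. count J j \<le> 1"
  shows "(\<Sum>j\<in>#J. h j) = (\<Sum>j\<in>set_mset J. h j)"
  using assms
proof (induction J)
  case (add j J)
  have "count J i \<le> 1" for i using add.prems[rule_format, of i] by (simp split: if_splits)
  moreover have "j \<notin># J" using add.prems[rule_format, of j] by (simp add: not_in_iff)
  ultimately show ?case using add.IH by simp
qed simp

lemma sum_PiE_insert:
  assumes "x \<notin> I" "finite I" "finite N"
  shows "(\<Sum>f\<in>insert x I \<rightarrow>\<^sub>E N. h f) = (\<Sum>j\<in>N. \<Sum>f\<in>I \<rightarrow>\<^sub>E N. h (f(x := j)))"
proof -
  have "(\<Sum>f\<in>insert x I \<rightarrow>\<^sub>E N. h f) = (\<Sum>(j, f)\<in>N \<times> (I \<rightarrow>\<^sub>E N). h (f(x := j)))"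
    unfolding PiE_insert_eq
    by (subst sum.reindex[OF inj_combinator[OF assms(1)]]) (simp add: case_prod_beta comp_def)
  then show ?thesis by (simp add: sum.cartesian_product)
qed

text \<open>A map \<open>f\<close> chooses a place for each child. Distinct root names make these
  choices independent, so the maps can be summed child by child, which is the recursion of
  \<open>dst\<close>.\<close>

lemma sum_maps_dst:
  fixes C :: "('i, nat option) ctree multiset"
  assumes J: "\<forall>j. count J j \<le> 1" and "\<forall>j. count (image_mset root_name C) j \<le> 1"
  shows "(\<Sum>f\<in>set_mset (image_mset root_name C) \<rightarrow>\<^sub>E set_mset J.
      H (\<lambda>j. g j + image_mset forget_names (filter_mset (\<lambda>c. f (root_name c) = j) C))) =
    dst J H (image_mset forget_names C) g"
  using assms(2)
proof (induction C arbitrary: g)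
  case empty
  then show ?case by simp
next
  case (add c C)
  let ?I = "set_mset (image_mset root_name C)" and ?r = "root_name c"
  have 1: "\<forall>j. count (image_mset root_name C) j \<le> 1"
  proof
    fix j show "count (image_mset root_name C) j \<le> 1"
      using add.prems[rule_format, of j] by (simp split: if_splits)
  qed
  have "count (image_mset root_name C) ?r = 0"
    using add.prems[rule_format, of ?r] by simp
  then have r: "?r \<notin> ?I" by (simp only: count_eq_zero_iff not_False_eq_True)
  have 2: "(\<lambda>j'. g j' + image_mset forget_names (filter_mset (\<lambda>c. (f(?r := j)) (root_name c) = j') (add_mset c C))) =
      (\<lambda>j'. ins j (forget_names c) g j' + image_mset forget_names (filter_mset (\<lambda>c. f (root_name c) = j') C))" for f j
  proof
    fix j'
    have "filter_mset (\<lambda>c. (f(?r := j)) (root_name c) = j') C = filter_mset (\<lambda>c. f (root_name c) = j') C"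
    proof (intro filter_mset_cong refl)
      fix c' assume "c' \<in># C"
      then have "root_name c' \<in> ?I" by simp
      then have "root_name c' \<noteq> ?r" using r by metis
      then show "((f(?r := j)) (root_name c') = j') = (f (root_name c') = j')" by (simp add: fun_upd_apply)
    qed
    then show "g j' + image_mset forget_names (filter_mset (\<lambda>c. (f(?r := j)) (root_name c) = j') (add_mset c C)) =
      ins j (forget_names c) g j' + image_mset forget_names (filter_mset (\<lambda>c. f (root_name c) = j') C)"
      by (cases "j' = j") (simp_all add: fun_upd_same fun_upd_other)
  qed
  have "set_mset (image_mset root_name (add_mset c C)) = insert ?r ?I" by simp
  then show ?case
    using r by (simp only: sum_PiE_insert finite_set_mset 2 add.IH[OF 1] image_mset_add_mset dst_add_mset
        sum_distinct_mset[OF J] simp_thms if_True)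
qed

lemma count_sum_image_1:
  assumes "count (\<Sum>\<^sub># (image_mset f C)) l = 1"
  obtains c R where "C = add_mset c R" "count (f c) l = 1" "\<forall>r\<in>#R. l \<notin># f r"
proof -
  have "\<exists>c\<in>#C. l \<in># f c" using assms by (metis not_in_sum_image zero_neq_one)
  then obtain c R where C: "C = add_mset c R" "l \<in># f c" by (meson multi_member_split)
  then have "count (f c) l \<ge> 1" by simp
  then have "count (f c) l = 1" "count (\<Sum>\<^sub># (image_mset f R)) l = 0"
    using assms unfolding C(1) count_sum_image by linarith+
  then show thesis using that[OF C(1)] unfolding not_in_sum_image by blast
qed

lemma distinct_names_root_names:
  assumes "\<forall>j. count (\<Sum>\<^sub># (image_mset names C)) j \<le> 1"
  shows "\<forall>j. count (image_mset root_name C) j \<le> 1"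
proof -
  have *: "count {#root_name c#} j \<le> count (names c) j" for c :: "('a, 'b) ctree" and j
    by (cases c) auto
  have "count (image_mset root_name (add_mset c C)) j \<le> count (\<Sum>\<^sub># (image_mset names (add_mset c C))) j"
    if "count (image_mset root_name C) j \<le> count (\<Sum>\<^sub># (image_mset names C)) j" for c j and C :: "('a, 'b) ctree multiset"
    using add_mono[OF *[of c j] that] by (auto split: if_splits)
  then have "count (image_mset root_name C) j \<le> count (\<Sum>\<^sub># (image_mset names C)) j" for j
    by (induction C) simp_all
  then show ?thesis using assms le_trans by blast
qed

lemma loc_at_slot:
  assumes "\<And>r. r \<in># R \<Longrightarrow> loc q r = 0"
  shows "dev (loc q) (White i m (add_mset c R)) = lin_ext (\<lambda>t. basis (White i m (add_mset t R))) (loc q c)"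
    "(\<And>c. c \<in># C \<Longrightarrow> loc q c = 0) \<Longrightarrow>
      dev (loc q) (Black i (add_mset c R) C) = lin_ext (\<lambda>t. basis (Black i (add_mset t R) C)) (loc q c)"
    "(\<And>c. c \<in># C \<Longrightarrow> loc q c = 0) \<Longrightarrow>
      dev (loc q) (Black i C (add_mset c R)) = lin_ext (\<lambda>t. basis (Black i C (add_mset t R))) (loc q c)"
proof -
  have 0: "msum (\<lambda>c R. lin_ext (h R) (loc q c)) R = 0"
    if "\<And>r. r \<in># R \<Longrightarrow> loc q r = 0" for h :: "_ \<Rightarrow> _ \<Rightarrow> (ct \<Rightarrow>\<^sub>0 'a)" and R
  proof -
    have "msum (\<lambda>c R. lin_ext (h R) (loc q c)) R = msum (\<lambda>c R. 0) R"
      using that by (intro msum_cong) (simp add: lin_ext_arg)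
    then show ?thesis by (simp add: msum_zero)
  qed
  show "dev (loc q) (White i m (add_mset c R)) = lin_ext (\<lambda>t. basis (White i m (add_mset t R))) (loc q c)"
    using 0[OF assms, of R "\<lambda>R t. basis (White i m (add_mset t (add_mset c R)))"]
    by (simp add: add_mset_commute)
  assume C: "\<And>c. c \<in># C \<Longrightarrow> loc q c = 0"
  show "dev (loc q) (Black i (add_mset c R) C) = lin_ext (\<lambda>t. basis (Black i (add_mset t R) C)) (loc q c)"
    using 0[OF assms, of R "\<lambda>R t. basis (Black i (add_mset t (add_mset c R)) C)"]
      0[OF C, of C "\<lambda>R t. basis (Black i (add_mset c _) (add_mset t R))"]
    by (simp add: add_mset_commute)
  show "dev (loc q) (Black i C (add_mset c R)) = lin_ext (\<lambda>t. basis (Black i C (add_mset t R))) (loc q c)"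
    using 0[OF assms, of R "\<lambda>R t. basis (Black i C (add_mset t (add_mset c R)))"]
      0[OF C, of C "\<lambda>R t. basis (Black i (add_mset t R) (add_mset c _))"]
    by (simp add: add_mset_commute)
qed

text \<open>Only one branch contains the label \<open>l\<close>, so one summand of
  \<open>loc\<close> survives at each level, and the input edges are those found in this branch. At
  the vertex itself the sum over maps becomes \<open>brace\<close>.\<close>

theorem sum_plug:
  assumes U: "distinct_names U" and "distinct_names T" "count (white_labels T) l = 1"
  shows "(\<Sum>f\<in>input_edges l T \<rightarrow>\<^sub>E set_mset (names U). basis (forget_names (plug l U f T))) =
    (loc (subst_at l U) (forget_names T) :: ct \<Rightarrow>\<^sub>0 'k::field)"
  using assms(2,3)
proof (induction T)
  case (White i m C)
  note d = names_sum_le1_cases[OF White.prems(1)]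
  show ?case
  proof (cases "m = l")
    case True
    then have abs: "\<forall>c\<in>#C. l \<notin># white_labels c"
      using White.prems(2) by (simp add: not_in_sum_image)
    then have "image_mset (plug l U f) C = C" for f
      by (simp add: plug_absent multiset.map_ident_strong)
    moreover have "input_edges l (White i m C) = set_mset (image_mset root_name C)"
      using True abs by (auto simp: input_edges_absent)
    moreover have "loc (subst_at l U) (White () m (image_mset forget_names C)) =
        (brace U (image_mset forget_names C) :: ct \<Rightarrow>\<^sub>0 'k)"
    proof -
      have "dev (loc (subst_at l U)) (White () m (image_mset forget_names C)) =
          dev (\<lambda>_. 0 :: ct \<Rightarrow>\<^sub>0 'k) (White () m (image_mset forget_names C))"
        using abs by (intro dev_cong_slots) (auto simp: loc_subst_absent)
      then show ?thesis using True by (simp add: loc.simps[of _ "White () l _"] subst_at_def dev_zero del: dev_White)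
    qed
    ultimately show ?thesis
      using True sum_maps_dst[OF U distinct_names_root_names[OF d(1)], of "\<lambda>g. basis (attach_u g U)" "\<lambda>_. {#}"]
      by (simp add: brace_def forget_attach)
  next
    case False
    then have "count (\<Sum>\<^sub># (image_mset white_labels C)) l = 1" using White.prems(2) by simp
    then obtain c R where C: "C = add_mset c R" "count (white_labels c) l = 1" "\<forall>r\<in>#R. l \<notin># white_labels r"
      by (rule count_sum_image_1)
    have IH: "(\<Sum>f\<in>input_edges l c \<rightarrow>\<^sub>E set_mset (names U). basis (forget_names (plug l U f c))) =
      (loc (subst_at l U) (forget_names c) :: ct \<Rightarrow>\<^sub>0 'k)"
      using White.IH[of c] C sum_image_le1(1)[OF d(1)[unfolded C(1)]] by simp
    have "image_mset (plug l U f) R = R" for f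
      using C(3) by (simp add: plug_absent multiset.map_ident_strong)
    moreover have "input_edges l (White i m C) = input_edges l c"
      using False C by (auto simp: input_edges_absent)
    moreover have "subst_at l U (White () m X) = (0 :: ct \<Rightarrow>\<^sub>0 'k)" for X
      using False by (simp add: subst_at_def)
    moreover have "dev (loc (subst_at l U)) (White () m (add_mset (forget_names c) (image_mset forget_names R))) =
        lin_ext (\<lambda>t. basis (White () m (add_mset t (image_mset forget_names R)))) (loc (subst_at l U) (forget_names c) :: ct \<Rightarrow>\<^sub>0 'k)"
      by (rule loc_at_slot(1)) (use C(3) in \<open>auto simp: loc_subst_absent\<close>)
    ultimately show ?thesis using False
      by (simp add: C(1) loc.simps[of _ "White () m _"] IH[symmetric] lin_ext_arg_sum del: dev_White)
  qed
next
  case (Black i E C)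
  note d = names_sum_le1_cases_Black[OF Black.prems(1)]
  have "count (\<Sum>\<^sub># (image_mset white_labels E)) l + count (\<Sum>\<^sub># (image_mset white_labels C)) l = 1"
    using Black.prems(2) by simp
  then consider
    "count (\<Sum>\<^sub># (image_mset white_labels E)) l = 1" "count (\<Sum>\<^sub># (image_mset white_labels C)) l = 0"
    | "count (\<Sum>\<^sub># (image_mset white_labels C)) l = 1" "count (\<Sum>\<^sub># (image_mset white_labels E)) l = 0"
    by linarith
  then show ?case
  proof cases
    case 1
    obtain c R where E: "E = add_mset c R" "count (white_labels c) l = 1" "\<forall>r\<in>#R. l \<notin># white_labels r"
      using count_sum_image_1[OF 1(1)] by blast
    have abs: "\<forall>r\<in>#C. l \<notin># white_labels r" using 1(2) by (simp only: not_in_sum_image)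
    have "add_mset c (R + C) = E + C" by (simp add: E)
    then have IH: "(\<Sum>f\<in>input_edges l c \<rightarrow>\<^sub>E set_mset (names U). basis (forget_names (plug l U f c))) =
      (loc (subst_at l U) (forget_names c) :: ct \<Rightarrow>\<^sub>0 'k)"
      using Black.IH(1)[of c] E sum_image_le1(1)[of names c "R + C"] d(1) by simp
    have "image_mset (plug l U f) R = R" "image_mset (plug l U f) C = C" for f
      using E(3) abs by (simp_all add: plug_absent multiset.map_ident_strong)
    moreover have "input_edges l (Black i E C) = input_edges l c"
      using E abs by (auto simp: input_edges_absent)
    moreover have "subst_at l U (Black () X Y) = (0 :: ct \<Rightarrow>\<^sub>0 'k)" for X Y
      by (simp add: subst_at_def)
    moreover have "dev (loc (subst_at l U)) (Black () (add_mset (forget_names c) (image_mset forget_names R)) (image_mset forget_names C)) =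
        lin_ext (\<lambda>t. basis (Black () (add_mset t (image_mset forget_names R)) (image_mset forget_names C)))
          (loc (subst_at l U) (forget_names c) :: ct \<Rightarrow>\<^sub>0 'k)"
      by (rule loc_at_slot(2)) (use E(3) abs in \<open>auto simp: loc_subst_absent\<close>)
    ultimately show ?thesis
      by (simp add: E(1) loc.simps[of _ "Black () _ _"] IH[symmetric] lin_ext_arg_sum del: dev_Black)
  next
    case 2
    obtain c R where C: "C = add_mset c R" "count (white_labels c) l = 1" "\<forall>r\<in>#R. l \<notin># white_labels r"
      using count_sum_image_1[OF 2(1)] by blast
    have abs: "\<forall>r\<in>#E. l \<notin># white_labels r" using 2(2) by (simp only: not_in_sum_image)
    have "add_mset c (E + R) = E + C" by (simp add: C)
    then have IH: "(\<Sum>f\<in>input_edges l c \<rightarrow>\<^sub>E set_mset (names U). basis (forget_names (plug l U f c))) =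
      (loc (subst_at l U) (forget_names c) :: ct \<Rightarrow>\<^sub>0 'k)"
      using Black.IH(2)[of c] C sum_image_le1(1)[of names c "E + R"] d(1) by simp
    have "image_mset (plug l U f) R = R" "image_mset (plug l U f) E = E" for f
      using C(3) abs by (simp_all add: plug_absent multiset.map_ident_strong)
    moreover have "input_edges l (Black i E C) = input_edges l c"
      using C abs by (auto simp: input_edges_absent)
    moreover have "subst_at l U (Black () X Y) = (0 :: ct \<Rightarrow>\<^sub>0 'k)" for X Y
      by (simp add: subst_at_def)
    moreover have "dev (loc (subst_at l U)) (Black () (image_mset forget_names E) (add_mset (forget_names c) (image_mset forget_names R))) =
        lin_ext (\<lambda>t. basis (Black () (image_mset forget_names E) (add_mset t (image_mset forget_names R))))
          (loc (subst_at l U) (forget_names c) :: ct \<Rightarrow>\<^sub>0 'k)"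
      by (rule loc_at_slot(3)) (use C(3) abs in \<open>auto simp: loc_subst_absent\<close>)
    ultimately show ?thesis
      by (simp add: C(1) loc.simps[of _ "Black () _ _"] IH[symmetric] lin_ext_arg_sum del: dev_Black)
  qed
qed

text \<open>The set \<open>X\<close> of forbidden names allows the trees of a forest to be named one
  after another without collisions.\<close>

lemma named_forest_exists:
  fixes C :: "(unit, 'l) ctree multiset"
  assumes "\<And>c X. c \<in># C \<Longrightarrow> finite X \<Longrightarrow>
      \<exists>T' :: (nat, 'l) ctree. forget_names T' = c \<and> distinct_names T' \<and> set_mset (names T') \<inter> X = {}"
    and "finite X"
  shows "\<exists>C' :: (nat, 'l) ctree multiset. image_mset forget_names C' = C \<and>
      (\<forall>j. count (\<Sum>\<^sub># (image_mset names C')) j \<le> 1) \<and> set_mset (\<Sum>\<^sub># (image_mset names C')) \<inter> X = {}"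
  using assms
proof (induction C arbitrary: X)
  case empty
  then show ?case by (intro exI[of _ "{#}"]) simp
next
  case (add c C)
  obtain C' :: "(nat, 'l) ctree multiset" where C': "image_mset forget_names C' = C"
      "\<forall>j. count (\<Sum>\<^sub># (image_mset names C')) j \<le> 1" "set_mset (\<Sum>\<^sub># (image_mset names C')) \<inter> X = {}"
    using add.IH[of X] add.prems by fastforce
  let ?N = "set_mset (\<Sum>\<^sub># (image_mset names C'))"
  obtain T' :: "(nat, 'l) ctree" where T': "forget_names T' = c" "distinct_names T'"
      "set_mset (names T') \<inter> (X \<union> ?N) = {}"
    using add.prems(1)[of c "X \<union> ?N"] add.prems(2) by (metis finite_UnI finite_set_mset union_single_eq_member)
  have "count (names T') j + count (\<Sum>\<^sub># (image_mset names C')) j \<le> 1" for j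
  proof (cases "j \<in># names T'")
    case True
    then have "j \<notin> ?N" using T'(3) by blast
    then have "count (\<Sum>\<^sub># (image_mset names C')) j = 0" by (simp only: count_eq_zero_iff not_False_eq_True)
    then show ?thesis using T'(2) by simp
  next
    case False
    then have "count (names T') j = 0" by (simp only: count_eq_zero_iff not_False_eq_True)
    then show ?thesis using C'(2) by simp
  qed
  then show ?case using C' T' by (intro exI[of _ "add_mset T' C'"]) auto
qed

lemma named_tree_exists:
  fixes T :: "(unit, 'l) ctree"
  assumes "finite X"
  shows "\<exists>T' :: (nat, 'l) ctree. forget_names T' = T \<and> distinct_names T' \<and> set_mset (names T') \<inter> X = {}"
  using assms
proof (induction T arbitrary: X)
  case (White i l C)
  obtain n where n: "n \<notin> X" using ex_new_if_finite[OF infinite_UNIV_nat White.prems] by blast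
  obtain C' :: "(nat, 'l) ctree multiset" where C': "image_mset forget_names C' = C"
      "\<forall>j. count (\<Sum>\<^sub># (image_mset names C')) j \<le> 1" "set_mset (\<Sum>\<^sub># (image_mset names C')) \<inter> insert n X = {}"
    using named_forest_exists[of C "insert n X"] White by (metis finite_insert)
  have "count (\<Sum>\<^sub># (image_mset names C')) n = 0"
    using C'(3) by (simp only: count_eq_zero_iff) blast
  then have "distinct_names (White n l C')" using C'(2) by simp
  then show ?case using C' n by (intro exI[of _ "White n l C'"]) auto
next
  case (Black i E C)
  obtain n where n: "n \<notin> X" using ex_new_if_finite[OF infinite_UNIV_nat Black.prems] by blast
  obtain F :: "(nat, 'l) ctree multiset" where F: "image_mset forget_names F = E + C"
      "\<forall>j. count (\<Sum>\<^sub># (image_mset names F)) j \<le> 1" "set_mset (\<Sum>\<^sub># (image_mset names F)) \<inter> insert n X = {}"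
    using named_forest_exists[of "E + C" "insert n X"] Black by (metis finite_insert union_iff)
  obtain E' C' where EC: "F = E' + C'" "image_mset forget_names E' = E" "image_mset forget_names C' = C"
    using image_mset_eq_plusD[OF F(1)] by blast
  have "count (\<Sum>\<^sub># (image_mset names F)) n = 0"
    using F(3) by (simp only: count_eq_zero_iff) blast
  then have "distinct_names (Black n E' C')" using F(2) by (simp add: EC(1))
  then show ?case using F EC n by (intro exI[of _ "Black n E' C'"]) auto
qed

lemma named_representative:
  "forget_names (named_representative T) = T" "distinct_names (named_representative T)"
proof -
  have "\<exists>T' :: (nat, nat option) ctree. forget_names T' = T \<and> (\<forall>i. count (names T') i \<le> 1)"
    using named_tree_exists[of "{}" T] by blast
  from someI_ex[OF this] show "forget_names (named_representative T) = T" "distinct_names (named_representative T)"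
    unfolding named_representative_def by auto
qed

text \<open>
  \<open>tsub l U T\<close> is the derivation of the grafting product replacing one vertex labelled \<open>l\<close> by \<open>U\<close>;
  it is the partial composition if there is exactly one such vertex.
\<close>

definition tsub :: "nat option \<Rightarrow> ct \<Rightarrow> ct \<Rightarrow> (ct \<Rightarrow>\<^sub>0 'k::field)" where
  "tsub l U = loc (subst_at l (named_representative U))"

theorem tree_comp_eq_tsub:
  assumes "count (white_labels T) (Some v) = 1"
  shows "tree_comp v T U = tsub (Some v) U T"
  unfolding tree_comp_def Let_def tsub_def
  using sum_plug[OF named_representative(2)[of U] named_representative(2)[of T], of "Some v"] assms
  by (metis named_representative(1) white_labels_forget)

lemma tsub_graft:
  "lin_ext (tsub l U) (graft y T) = lin_ext (graft y) (tsub l U T) + lin_ext (\<lambda>t. graft t T) (tsub l U y)"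
  unfolding tsub_def by (rule loc_subst_graft) (rule named_representative)

lemma tsub_absent: "l \<notin># white_labels T \<Longrightarrow> tsub l U T = 0"
  by (simp add: tsub_def loc_subst_absent)

lemma tsub_leaf: "tsub l U (White () m {#}) = (if m = l then basis U else 0)"
  by (simp add: tsub_def loc.simps[of _ "White () m {#}"] subst_at_def brace_def attach_u_empty
      named_representative)

lemma tsub_mul: "tsub l U (Black () {#x, y#} {#}) =
    lin_ext (\<lambda>t. basis (Black () {#t, y#} {#})) (tsub l U x) + lin_ext (\<lambda>t. basis (Black () {#x, t#} {#})) (tsub l U y)"
  by (simp add: tsub_def loc.simps[of _ "Black () _ _"] subst_at_def add_mset_commute)

lemma keys_dst:
  assumes "\<forall>j. count J j \<le> 1" "t \<in> Poly_Mapping.keys (dst J H C g)"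
  shows "\<exists>g'. t \<in> Poly_Mapping.keys (H g') \<and> (\<Sum>j\<in>#J. g' j) = C + (\<Sum>j\<in>#J. g j)"
  using assms(2)
proof (induction C arbitrary: g)
  case empty
  then show ?case by auto
next
  case (add c C)
  obtain k where k: "k \<in># J" "t \<in> Poly_Mapping.keys (dst J H C (ins k c g))"
    using add.prems keys_sum_mset unfolding dst_add_mset by fastforce
  have "(\<Sum>j\<in>#J. ins k c g j) = (\<Sum>j\<in>#J. (if j = k then {#c#} else {#}) + g j)"
    by (intro arg_cong[where f = sum_mset] image_mset_cong) (simp add: fun_upd_apply)
  also have "\<dots> = {#c#} + (\<Sum>j\<in>#J. g j)"
    using sum_mset_single[OF assms(1) k(1), of "\<lambda>_. {#c#}"] by (simp only: sum_mset.distrib)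
  finally show ?case using add.IH[OF k(2)] by auto
qed

lemma msum_commute:
  "msum (\<lambda>x R. msum (\<lambda>y R'. f x R y R') N) M = msum (\<lambda>y R'. msum (\<lambda>x R. f x R y R') M) N"
  unfolding msum_def by (rule sum_mset.swap)

section \<open>Bilinear extensions\<close>

lemma bilin_ext_basis [simp]: "bilin_ext f (basis a) (basis b) = f a b"
  by (simp add: bilin_ext_def)

lemma lmap_bilin_ext_left: "lmap g \<Longrightarrow> lmap (\<lambda>x. bilin_ext f (g x) y)"
  unfolding bilin_ext_def by (rule lmap_compose) simp_all

lemma lmap_bilin_ext_right: "lmap g \<Longrightarrow> lmap (\<lambda>y. bilin_ext f x (g y))"
  unfolding bilin_ext_def by (rule lmap_lin_ext_param, rule lmap_compose) simp_all

lemma lmap_lin_ext_of: "lmap g \<Longrightarrow> lmap (\<lambda>x. lin_ext f (g x))"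
  by (rule lmap_compose) simp_all

lemmas lmap_intros = lmap_ident lmap_plus lmap_minus lmap_fscale lmap_bilin_ext_left
  lmap_bilin_ext_right lmap_lin_ext_of

lemma bilin_ext_left_basis: "bilin_ext f (basis a) y = lin_ext (f a) y"
  by (simp add: bilin_ext_def)

lemma bilin_ext_right_basis: "bilin_ext f x (basis b) = lin_ext (\<lambda>a. f a b) x"
  by (simp add: bilin_ext_def)

lemmas bilin_ext_left_add = lmap_add[OF lmap_bilin_ext_left[OF lmap_ident]]
lemmas bilin_ext_right_add = lmap_add[OF lmap_bilin_ext_right[OF lmap_ident]]
lemmas bilin_ext_left_diff = lmap_diff[OF lmap_bilin_ext_left[OF lmap_ident]]
lemmas bilin_ext_right_diff = lmap_diff[OF lmap_bilin_ext_right[OF lmap_ident]]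
lemmas bilin_ext_left_scale = lmap_scale[OF lmap_bilin_ext_left[OF lmap_ident]]
lemmas bilin_ext_right_scale = lmap_scale[OF lmap_bilin_ext_right[OF lmap_ident]]
lemmas bilin_ext_left_zero = lmap_zero[OF lmap_bilin_ext_left[OF lmap_ident]]
lemmas bilin_ext_right_zero = lmap_zero[OF lmap_bilin_ext_right[OF lmap_ident]]
lemmas bilin_ext_arith = bilin_ext_left_add bilin_ext_right_add bilin_ext_left_diff
  bilin_ext_right_diff bilin_ext_left_scale bilin_ext_right_scale bilin_ext_left_zero
  bilin_ext_right_zero

lemma keys_bilin_extE:
  assumes "t \<in> Poly_Mapping.keys (bilin_ext f x y)"
  obtains a b where "a \<in> Poly_Mapping.keys x" "b \<in> Poly_Mapping.keys y" "t \<in> Poly_Mapping.keys (f a b)"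
  using assms unfolding bilin_ext_def by (auto elim!: keys_lin_extE)

lemma bilin_ext_cong:
  assumes "\<And>a b. a \<in> Poly_Mapping.keys x \<Longrightarrow> b \<in> Poly_Mapping.keys y \<Longrightarrow> f a b = g a b"
  shows "bilin_ext f x y = bilin_ext g x y"
  unfolding bilin_ext_def by (intro lin_ext_cong refl assms)

text \<open>The tree that is grafted onto comes first; with this order the product is right
  pre-Lie.\<close>

definition gr :: "(ct \<Rightarrow>\<^sub>0 'k::field) \<Rightarrow> (ct \<Rightarrow>\<^sub>0 'k) \<Rightarrow> (ct \<Rightarrow>\<^sub>0 'k)" where
  "gr = bilin_ext (\<lambda>T y. graft y T)"

definition mm :: "(ct \<Rightarrow>\<^sub>0 'k::field) \<Rightarrow> (ct \<Rightarrow>\<^sub>0 'k) \<Rightarrow> (ct \<Rightarrow>\<^sub>0 'k)" where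
  "mm = bilin_ext (\<lambda>x y. basis (Black () {#x, y#} {#}))"

definition dd :: "(ct \<Rightarrow>\<^sub>0 'k::field) \<Rightarrow> (ct \<Rightarrow>\<^sub>0 'k) \<Rightarrow> (ct \<Rightarrow>\<^sub>0 'k)" where
  "dd = bilin_ext (\<lambda>x y. basis (White () None {#x, y#}))"

definition sub :: "nat option \<Rightarrow> (ct \<Rightarrow>\<^sub>0 'k::field) \<Rightarrow> (ct \<Rightarrow>\<^sub>0 'k) \<Rightarrow> (ct \<Rightarrow>\<^sub>0 'k)" where
  "sub l u x = bilin_ext (\<lambda>T U. tsub l U T) x u"

lemma lmap_gr_left: "lmap f \<Longrightarrow> lmap (\<lambda>x. gr (f x) y)"
  and lmap_gr_right: "lmap f \<Longrightarrow> lmap (\<lambda>x. gr y (f x))"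
  and lmap_mm_left: "lmap f \<Longrightarrow> lmap (\<lambda>x. mm (f x) y)"
  and lmap_mm_right: "lmap f \<Longrightarrow> lmap (\<lambda>x. mm y (f x))"
  and lmap_dd_left: "lmap f \<Longrightarrow> lmap (\<lambda>x. dd (f x) y)"
  and lmap_dd_right: "lmap f \<Longrightarrow> lmap (\<lambda>x. dd y (f x))"
  and lmap_sub_left: "lmap f \<Longrightarrow> lmap (\<lambda>x. sub l (f x) y)"
  and lmap_sub_right: "lmap f \<Longrightarrow> lmap (\<lambda>x. sub l y (f x))"
  unfolding gr_def mm_def dd_def sub_def by (intro lmap_intros, assumption)+

lemmas ct_lmap_intros = lmap_intros lmap_gr_left lmap_gr_right lmap_mm_left lmap_mm_right
  lmap_dd_left lmap_dd_right lmap_sub_left lmap_sub_right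

lemma gr_basis: "gr (basis T) (basis y) = graft y T"
  and mm_basis: "mm (basis x) (basis y) = basis (Black () {#x, y#} {#})"
  and dd_basis: "dd (basis x) (basis y) = basis (White () None {#x, y#})"
  and sub_basis: "sub l (basis U) (basis T) = tsub l U T"
  by (simp_all add: gr_def mm_def dd_def sub_def)

lemma gr_arith:
  "gr (x + x') y = gr x y + gr x' y" "gr x (y + y') = gr x y + gr x y'"
  "gr (x - x') y = gr x y - gr x' y" "gr x (y - y') = gr x y - gr x y'"
  "gr (fscale c x) y = fscale c (gr x y)" "gr x (fscale c y) = fscale c (gr x y)"
  "gr 0 y = 0" "gr x 0 = 0"
  by (simp_all add: gr_def bilin_ext_arith)

lemma mm_arith:
  "mm (x + x') y = mm x y + mm x' y" "mm x (y + y') = mm x y + mm x y'"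
  "mm (x - x') y = mm x y - mm x' y" "mm x (y - y') = mm x y - mm x y'"
  "mm (fscale c x) y = fscale c (mm x y)" "mm x (fscale c y) = fscale c (mm x y)"
  "mm 0 y = 0" "mm x 0 = 0"
  by (simp_all add: mm_def bilin_ext_arith)

lemma dd_arith:
  "dd (x + x') y = dd x y + dd x' y" "dd x (y + y') = dd x y + dd x y'"
  "dd (x - x') y = dd x y - dd x' y" "dd x (y - y') = dd x y - dd x y'"
  "dd (fscale c x) y = fscale c (dd x y)" "dd x (fscale c y) = fscale c (dd x y)"
  "dd 0 y = 0" "dd x 0 = 0"
  by (simp_all add: dd_def bilin_ext_arith)

lemma sub_arith:
  "sub l (x + x') y = sub l x y + sub l x' y" "sub l x (y + y') = sub l x y + sub l x y'"
  "sub l (x - x') y = sub l x y - sub l x' y" "sub l x (y - y') = sub l x y - sub l x y'"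
  "sub l (fscale c x) y = fscale c (sub l x y)" "sub l x (fscale c y) = fscale c (sub l x y)"
  "sub l 0 y = 0" "sub l x 0 = 0"
  by (simp_all add: sub_def bilin_ext_arith)

lemma bil_eqI:
  assumes "\<And>y. lmap (\<lambda>x. f x y)" "\<And>x. lmap (\<lambda>y. f x y)" "\<And>y. lmap (\<lambda>x. g x y)" "\<And>x. lmap (\<lambda>y. g x y)"
    and "\<And>a b. f (basis a) (basis b) = g (basis a) (basis b)"
  shows "f x y = g x y"
proof -
  have "f (basis a) y = g (basis a) y" for a
    by (rule lmap_eqI[OF assms(2,4)]) (rule assms(5))
  then show ?thesis using lmap_eqI[OF assms(1,3)] by blast
qed

lemma mm_commute: "mm x y = mm y x"
  by (rule bil_eqI[of mm "\<lambda>x y. mm y x"])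
    (intro ct_lmap_intros | simp add: mm_basis add_mset_commute)+

lemma dd_commute: "dd x y = dd y x"
  by (rule bil_eqI[of dd "\<lambda>x y. dd y x"])
    (intro ct_lmap_intros | simp add: dd_basis add_mset_commute)+

lemma add_eq_imp_diff_eq: "a + d = c + b \<Longrightarrow> a - b = c - (d :: 'a :: ab_group_add)"
  by (simp add: algebra_simps)

lemma gr_prelie: "gr (gr x y) z - gr x (gr y z) = gr (gr x z) y - gr x (gr z y)"
proof -
  have 1: "gr (gr (basis T) (basis y)) (basis z) - gr (basis T) (gr (basis y) (basis z)) =
     (gr (gr (basis T) (basis z)) (basis y) - gr (basis T) (gr (basis z) (basis y)) :: ct \<Rightarrow>\<^sub>0 'a)" for T y z
    using graft_prelie[of z y T, where 'k = 'a]
    by (intro add_eq_imp_diff_eq)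
      (simp add: gr_def bilin_ext_left_basis bilin_ext_right_basis)
  have 2: "gr (gr (basis T) y) z - gr (basis T) (gr y z) = gr (gr (basis T) z) y - gr (basis T) (gr z y)" for T
    by (rule bil_eqI[of "\<lambda>y z. gr (gr (basis T) y) z - gr (basis T) (gr y z)"
          "\<lambda>y z. gr (gr (basis T) z) y - gr (basis T) (gr z y)"])
      (intro ct_lmap_intros | rule 1)+
  show ?thesis
    by (rule lmap_eqI[of "\<lambda>x. gr (gr x y) z - gr x (gr y z)" "\<lambda>x. gr (gr x z) y - gr x (gr z y)"])
      (intro ct_lmap_intros | rule 2)+
qed

lemma sub_gr: "sub l u (gr x y) = gr (sub l u x) y + gr x (sub l u y)"
proof -
  have 1: "sub l (basis U) (gr (basis T) (basis y)) =
      gr (sub l (basis U) (basis T)) (basis y) + gr (basis T) (sub l (basis U) (basis y) :: ct \<Rightarrow>\<^sub>0 'a)" for U T y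
    using tsub_graft[of l U y T]
    by (simp add: gr_basis sub_basis)
      (simp add: sub_def gr_def bilin_ext_left_basis bilin_ext_right_basis)
  have 2: "sub l (basis U) (gr x y) = gr (sub l (basis U) x) y + gr x (sub l (basis U) y)" for U
    by (rule bil_eqI[of "\<lambda>x y. sub l (basis U) (gr x y)"
          "\<lambda>x y. gr (sub l (basis U) x) y + gr x (sub l (basis U) y)"])
      (intro ct_lmap_intros | rule 1)+
  show ?thesis
    by (rule lmap_eqI[of "\<lambda>u. sub l u (gr x y)" "\<lambda>u. gr (sub l u x) y + gr x (sub l u y)"])
      (intro ct_lmap_intros | rule 2)+
qed

lemma sub_mm: "sub l u (mm x y) = mm (sub l u x) y + mm x (sub l u y)"
proof -
  have 1: "sub l (basis U) (mm (basis T) (basis y)) =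
      mm (sub l (basis U) (basis T)) (basis y) + mm (basis T) (sub l (basis U) (basis y) :: ct \<Rightarrow>\<^sub>0 'a)" for U T y
    using tsub_mul[of l U T y]
    by (simp add: mm_basis sub_basis)
      (simp add: mm_def bilin_ext_left_basis bilin_ext_right_basis)
  have 2: "sub l (basis U) (mm x y) = mm (sub l (basis U) x) y + mm x (sub l (basis U) y)" for U
    by (rule bil_eqI[of "\<lambda>x y. sub l (basis U) (mm x y)"
          "\<lambda>x y. mm (sub l (basis U) x) y + mm x (sub l (basis U) y)"])
      (intro ct_lmap_intros | rule 1)+
  show ?thesis
    by (rule lmap_eqI[of "\<lambda>u. sub l u (mm x y)" "\<lambda>u. mm (sub l u x) y + mm x (sub l u y)"])
      (intro ct_lmap_intros | rule 2)+
qed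

text \<open>A label other than \<open>None\<close> cannot sit at the diamond, so the insertion only
  sees its two children.\<close>

lemma sub_dd: assumes "l \<noteq> None" shows "sub l u (dd x y) = dd (sub l u x) y + dd x (sub l u y)"
proof -
  have 1: "sub l (basis U) (dd (basis T) (basis y)) =
      dd (sub l (basis U) (basis T)) (basis y) + dd (basis T) (sub l (basis U) (basis y) :: ct \<Rightarrow>\<^sub>0 'a)" for U T y
    using assms[symmetric]
    by (simp add: dd_basis sub_basis)
      (simp add: dd_def bilin_ext_left_basis bilin_ext_right_basis tsub_def loc.simps[of _ "White _ _ _"]
        subst_at_def add_mset_commute)
  have 2: "sub l (basis U) (dd x y) = dd (sub l (basis U) x) y + dd x (sub l (basis U) y)" for U
    by (rule bil_eqI[of "\<lambda>x y. sub l (basis U) (dd x y)"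
          "\<lambda>x y. dd (sub l (basis U) x) y + dd x (sub l (basis U) y)"])
      (intro ct_lmap_intros | rule 1)+
  show ?thesis
    by (rule lmap_eqI[of "\<lambda>u. sub l u (dd x y)" "\<lambda>u. dd (sub l u x) y + dd x (sub l u y)"])
      (intro ct_lmap_intros | rule 2)+
qed

lemma sub_leaf: "sub l u (basis (White () m {#})) = (if m = l then u else 0)"
  using lmap_lin_ext_conv[OF lmap_ident, of u]
  by (simp add: sub_def bilin_ext_left_basis tsub_leaf lin_ext_zero)

section \<open>The derivation\<close>

text \<open>The ordinary children of a vertex are split into a part at place \<open>True\<close>
  that moves to a new diamond and a part at place \<open>False\<close> that stays.\<close>

definition split2 :: "(ct multiset \<Rightarrow> ct multiset \<Rightarrow> 'v::comm_monoid_add) \<Rightarrow> ct multiset \<Rightarrow> 'v" where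
  "split2 H C = dst {#False, True#} (\<lambda>g. H (g True) (g False)) C (\<lambda>_. {#})"

text \<open>The hypothesis of \<open>graft_dst\<close> for two places; \<open>H'\<close> collects
  the graftings into parts of the tree that are not split.\<close>

definition graft_compatible where
  "graft_compatible y H H' \<longleftrightarrow> (\<forall>A B. lin_ext (graft y) (H A B) = H (add_mset y A) B + H A (add_mset y B) +
     msum (\<lambda>c R. lin_ext (\<lambda>t. H (add_mset t R) B) (graft y c)) A +
     msum (\<lambda>c R. lin_ext (\<lambda>t. H A (add_mset t R)) (graft y c)) B + H' A B)"

lemma graft_compatible_add:
  "graft_compatible y H H' \<Longrightarrow> graft_compatible y G G' \<Longrightarrow>
   graft_compatible y (\<lambda>A B. H A B + G A B) (\<lambda>A B. H' A B + G' A B)"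
  by (simp add: graft_compatible_def lin_ext_arg lin_ext_fun msum_plus add_ac)

lemma graft_compatible_diff:
  "graft_compatible y H H' \<Longrightarrow> graft_compatible y G G' \<Longrightarrow>
   graft_compatible y (\<lambda>A B. H A B - G A B) (\<lambda>A B. H' A B - G' A B)"
  by (simp add: graft_compatible_def lin_ext_arg lin_ext_fun msum_diff algebra_simps)

lemma graft_split2:
  assumes "graft_compatible y H H'"
  shows "lin_ext (graft y) (split2 H C) = split2 H (add_mset y C) +
    msum (\<lambda>c R. lin_ext (\<lambda>t. split2 H (add_mset t R)) (graft y c)) C + split2 H' C"
  unfolding split2_def
  by (subst graft_dst[of _ _ _ "\<lambda>g. H' (g True) (g False)"])
    (use assms in \<open>simp_all add: graft_compatible_def fun_upd_same fun_upd_other add_ac\<close>)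

lemma split2_empty [simp]: "split2 H {#} = H {#} {#}"
  by (simp add: split2_def)

lemma split2_diff:
  fixes H :: "_ \<Rightarrow> _ \<Rightarrow> 'v::ab_group_add"
  shows "split2 (\<lambda>A B. H A B - G A B) C = split2 H C - split2 G C"
  by (simp add: split2_def dst_diff)

lemma split2_msum: "split2 (\<lambda>A B. msum (\<lambda>x R. H x R A B) M) C = msum (\<lambda>x R. split2 (H x R) C) M"
  by (simp add: split2_def dst_msum)

lemma split2_lin_ext: "split2 (\<lambda>A B. lin_ext (\<lambda>t. H t A B) x) C = lin_ext (\<lambda>t. split2 (H t) C) x"
  by (simp add: split2_def dst_lin_ext)

abbreviation Dia :: "ct multiset \<Rightarrow> ct" where "Dia \<equiv> White () None"

lemma graft_White: "graft y (White i l C) = basis (White i l (add_mset y C)) +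
    msum (\<lambda>c R. lin_ext (\<lambda>t. basis (White i l (add_mset t R))) (graft y c)) C"
  by (subst graft_simps) simp

lemma graft_Black: "graft y (Black i E C) = basis (Black i E (add_mset y C)) +
    (msum (\<lambda>e R. lin_ext (\<lambda>t. basis (Black i (add_mset t R) C)) (graft y e)) E +
    msum (\<lambda>c R. lin_ext (\<lambda>t. basis (Black i E (add_mset t R))) (graft y c)) C)"
  by (subst graft_simps) simp

lemmas graft_expand = graft_White graft_Black lin_ext_arg lin_ext_arg_msum lin_ext_lin_ext

lemma compatible_White: "graft_compatible y (\<lambda>A B. basis (White () l (add_mset (Dia A) B)) - basis (Dia (add_mset (White () l B) A)))
   (\<lambda>A B. 0)"
proof -
  have "graft_compatible y (\<lambda>A B. basis (White () l (add_mset (Dia A) B))) (\<lambda>A B. 0)"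
    by (simp add: graft_compatible_def graft_expand add_mset_commute add_ac)
  moreover have "graft_compatible y (\<lambda>A B. basis (Dia (add_mset (White () l B) A))) (\<lambda>A B. 0)"
    by (simp add: graft_compatible_def graft_expand add_mset_commute add_ac)
  ultimately show ?thesis using graft_compatible_diff by fastforce
qed

text \<open>For a fixed split, the new diamond sits above the black vertex on an ordinary edge, in
  the middle of one of its special edges, or below it. Besides \<open>A\<close> it carries in the
  second case the special child and in the third the black vertex.\<close>

definition qBlack :: "ct multiset \<Rightarrow> ct multiset \<Rightarrow> ct multiset \<Rightarrow> (ct \<Rightarrow>\<^sub>0 'k::field)" where
  "qBlack E A B = basis (Black () E (add_mset (Dia A) B)) +
     msum (\<lambda>e R. basis (Black () (add_mset (Dia (add_mset e A)) R) B)) E -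
     basis (Dia (add_mset (Black () E B) A))"

text \<open>The special children are not split, so the graftings into them form the second
  component. Where the diamond sits on a special edge, grafting into the child above it and into the
  other special child are separate terms, which \<open>msum_swap\<close> brings together.\<close>

lemma compatible_Black: "graft_compatible y (qBlack E :: _ \<Rightarrow> _ \<Rightarrow> (ct \<Rightarrow>\<^sub>0 'k::field)) (\<lambda>A B. msum (\<lambda>e R. lin_ext (\<lambda>t. qBlack (add_mset t R) A B) (graft y e)) E)"
proof -
  have 1: "graft_compatible y (\<lambda>A B. basis (Black () E (add_mset (Dia A) B)))
      (\<lambda>A B. msum (\<lambda>e R. lin_ext (\<lambda>t. basis (Black () (add_mset t R) (add_mset (Dia A) B))) (graft y e)) E)"
    by (simp add: graft_compatible_def graft_expand add_mset_commute add_ac)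
  have 2: "graft_compatible y (\<lambda>A B. basis (Dia (add_mset (Black () E B) A)))
      (\<lambda>A B. msum (\<lambda>e R. lin_ext (\<lambda>t. basis (Dia (add_mset (Black () (add_mset t R) B) A))) (graft y e)) E)"
    by (simp add: graft_compatible_def graft_expand add_mset_commute add_ac)
  have 3: "graft_compatible y (\<lambda>A B. msum (\<lambda>e R. basis (Black () (add_mset (Dia (add_mset e A)) R) B) :: ct \<Rightarrow>\<^sub>0 'k) E)
      (\<lambda>A B. msum (\<lambda>e R. lin_ext (\<lambda>t. msum (\<lambda>e R. basis (Black () (add_mset (Dia (add_mset e A)) R) B)) (add_mset t R)) (graft y e)) E)"
    unfolding graft_compatible_def
  proof (intro allI)
    fix A B
    let ?T = "\<lambda>e A R B. basis (Black () (add_mset (Dia (add_mset e A)) R) B) :: ct \<Rightarrow>\<^sub>0 'k"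
    have "graft y (Black () (add_mset (Dia (add_mset e A)) R) B) =
        ?T e (add_mset y A) R B + ?T e A R (add_mset y B) +
        msum (\<lambda>c A. lin_ext (\<lambda>t. ?T e (add_mset t A) R B) (graft y c)) A +
        msum (\<lambda>c B. lin_ext (\<lambda>t. ?T e A R (add_mset t B)) (graft y c)) B +
        (lin_ext (\<lambda>t. ?T t A R B) (graft y e) +
        msum (\<lambda>r R. lin_ext (\<lambda>t. ?T e A (add_mset t R) B) (graft y r)) R)" for e R
      by (simp add: graft_expand add_mset_commute add_ac)
    then have L: "lin_ext (graft y) (msum (\<lambda>e R. ?T e A R B) E) =
        msum (\<lambda>e R. ?T e (add_mset y A) R B) E + msum (\<lambda>e R. ?T e A R (add_mset y B)) E +
        msum (\<lambda>e R. msum (\<lambda>c A. lin_ext (\<lambda>t. ?T e (add_mset t A) R B) (graft y c)) A) E +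
        msum (\<lambda>e R. msum (\<lambda>c B. lin_ext (\<lambda>t. ?T e A R (add_mset t B)) (graft y c)) B) E +
        (msum (\<lambda>e R. lin_ext (\<lambda>t. ?T t A R B) (graft y e)) E +
         msum (\<lambda>e R. msum (\<lambda>r R. lin_ext (\<lambda>t. ?T e A (add_mset t R) B) (graft y r)) R) E)"
      by (simp add: lin_ext_arg_msum msum_plus)
    show "lin_ext (graft y) (msum (\<lambda>e R. ?T e A R B) E) =
        msum (\<lambda>e R. ?T e (add_mset y A) R B) E + msum (\<lambda>e R. ?T e A R (add_mset y B)) E +
        msum (\<lambda>c A. lin_ext (\<lambda>t. msum (\<lambda>e R. ?T e (add_mset t A) R B) E) (graft y c)) A +
        msum (\<lambda>c B. lin_ext (\<lambda>t. msum (\<lambda>e R. ?T e A R (add_mset t B)) E) (graft y c)) B +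
        msum (\<lambda>e R. lin_ext (\<lambda>t. msum (\<lambda>e R. ?T e A R B) (add_mset t R)) (graft y e)) E"
      unfolding L lin_ext_msum msum_add_mset lin_ext_add msum_plus
      by (intro arg_cong2[where f = "(+)"] refl msum_commute msum_swap)
  qed
  show ?thesis
    using graft_compatible_diff[OF graft_compatible_add[OF 1 3] 2]
    by (simp add: qBlack_def[abs_def] lin_ext_fun msum_plus msum_diff)
qed

text \<open>
  The contribution of one vertex to the derivation. The formula is the transformation law of Christoffel
  symbols under a change of coordinates, the diamond being its second derivative.
\<close>

definition qd :: "ct \<Rightarrow> (ct \<Rightarrow>\<^sub>0 'k::field)" where
  "qd T = (case T of
     White i l C \<Rightarrow> split2 (\<lambda>A B. basis (White () l (add_mset (Dia A) B)) - basis (Dia (add_mset (White () l B) A))) C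
   | Black i E C \<Rightarrow> split2 (qBlack E) C + fscale 2 (basis (Dia (E + C))))"

lemma qd_White: "qd (White i l C) =
    split2 (\<lambda>A B. basis (White () l (add_mset (Dia A) B)) - basis (Dia (add_mset (White () l B) A))) C"
  and qd_Black: "qd (Black i E C) = split2 (qBlack E) C + fscale 2 (basis (Dia (E + C)))"
  by (simp_all add: qd_def)

text \<open>The root condition of \<open>loc_graft_0\<close>; it makes \<open>delta\<close> a
  derivation of the grafting product.\<close>

lemma graft_qd:
  "qd (addroot y T) + lin_ext qd (dev (graft y) T) = (lin_ext (graft y) (qd T) :: ct \<Rightarrow>\<^sub>0 'k::field)"
proof (cases T)
  case (White i l C)
  have 0: "split2 (\<lambda>A B. 0) C = 0" by (simp add: split2_def dst_zero)
  show ?thesis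
    by (simp only: White addroot.simps dev_White qd_White graft_split2[OF compatible_White] lin_ext_arg_msum lin_ext_lin_ext
        lin_ext_basis 0 add_0_right)
next
  case (Black i E C)
  let ?s = "\<lambda>E C. split2 (qBlack E) C" and ?d = "\<lambda>E C. fscale 2 (basis (Dia (E + C))) :: ct \<Rightarrow>\<^sub>0 'k"
  have s: "lin_ext (graft y) (?s E C) = ?s E (add_mset y C) +
      (msum (\<lambda>e R. lin_ext (\<lambda>t. ?s (add_mset t R) C) (graft y e)) E +
       msum (\<lambda>c R. lin_ext (\<lambda>t. ?s E (add_mset t R)) (graft y c)) C)"
    by (simp only: graft_split2[OF compatible_Black] split2_msum split2_lin_ext add_ac)
  have "graft y (Dia (E + C)) = (basis (Dia (E + add_mset y C)) :: ct \<Rightarrow>\<^sub>0 'k) +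
      (msum (\<lambda>e R. lin_ext (\<lambda>t. basis (Dia (add_mset t R + C))) (graft y e)) E +
       msum (\<lambda>c R. lin_ext (\<lambda>t. basis (Dia (E + add_mset t R))) (graft y c)) C)"
    by (simp add: graft_White msum_union)
  then have d: "lin_ext (graft y) (?d E C) = ?d E (add_mset y C) +
      (msum (\<lambda>e R. lin_ext (\<lambda>t. ?d (add_mset t R) C) (graft y e)) E +
       msum (\<lambda>c R. lin_ext (\<lambda>t. ?d E (add_mset t R)) (graft y c)) C)"
    by (simp only: lin_ext_arg_scale lin_ext_basis fvs.scale_right_distrib
        lmap_msum[OF lmap_fscale[OF lmap_ident]] lin_ext_scale)
  show ?thesis
    unfolding Black addroot.simps dev_Black qd_Black lin_ext_arg_add lin_ext_arg_msum lin_ext_lin_ext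
      lin_ext_basis s d lin_ext_add msum_plus
    by (simp only: add_ac)
qed

definition delta :: "ct \<Rightarrow> (ct \<Rightarrow>\<^sub>0 'k::field)" where
  "delta = loc qd"

text \<open>
  The commutator with the childless diamond cancels the terms in which the diamond has fewer than two
  children.
\<close>

definition Dt :: "ct \<Rightarrow> (ct \<Rightarrow>\<^sub>0 'k::field)" where
  "Dt T = graft (Dia {#}) T - basis (Dia {#T#}) - delta T"

definition D :: "(ct \<Rightarrow>\<^sub>0 'k::field) \<Rightarrow> (ct \<Rightarrow>\<^sub>0 'k)" where
  "D = lin_ext Dt"

lemma delta_graft: "lin_ext delta (graft y T) = lin_ext (graft y) (delta T) + lin_ext (\<lambda>t. graft t T) (delta y)"
  unfolding delta_def by (rule loc_graft_0) (rule graft_qd)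

abbreviation dia :: "ct \<Rightarrow>\<^sub>0 'k::field" where "dia \<equiv> basis (Dia {#})"

lemma D_eq: "D x = gr x dia - gr dia x - lin_ext delta x"
proof (rule lmap_eqI[of D "\<lambda>x. gr x dia - gr dia x - lin_ext delta x"])
  show "lmap D" by (simp add: D_def)
  show "D (basis T) = gr (basis T) dia - gr dia (basis T) - lin_ext delta (basis T)" for T
    by (simp add: D_def Dt_def gr_basis graft_White)
qed (intro ct_lmap_intros)

lemma lmap_D: "lmap f \<Longrightarrow> lmap (\<lambda>x. D (f x))"
  unfolding D_def by (rule lmap_lin_ext_of)

lemma delta_gr: "lin_ext delta (gr x y) = gr (lin_ext delta x) y + gr x (lin_ext delta y)"
proof (rule bil_eqI[of "\<lambda>x y. lin_ext delta (gr x y)" "\<lambda>x y. gr (lin_ext delta x) y + gr x (lin_ext delta y)"])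
  show "lin_ext delta (gr (basis a) (basis b)) =
      gr (lin_ext delta (basis a)) (basis b) + gr (basis a) (lin_ext delta (basis b))" for a b
    unfolding gr_basis delta_graft by (simp add: gr_def bilin_ext_left_basis bilin_ext_right_basis)
qed (intro ct_lmap_intros)+

text \<open>Grafting \<open>y\<close> onto a diamond with child \<open>x\<close> reaches the diamond
  itself or a vertex of \<open>x\<close>, and the difference keeps the former. This associator is
  the source of the binary diamonds in \<open>D_gr\<close>.\<close>

lemma gr_dia: "gr (gr dia x) y - gr dia (gr x y) = dd x y"
proof (rule bil_eqI[of "\<lambda>x y. gr (gr dia x) y - gr dia (gr x y)" dd])
  fix a b
  have "lin_ext (\<lambda>t. graft t (Dia {#})) (graft b a) = (lin_ext (\<lambda>t. basis (Dia {#t#})) (graft b a) :: ct \<Rightarrow>\<^sub>0 'a)"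
    by (intro lin_ext_cong) (simp_all add: graft_White)
  then show "gr (gr dia (basis a)) (basis b) - gr dia (gr (basis a) (basis b)) = (dd (basis a) (basis b) :: ct \<Rightarrow>\<^sub>0 'a)"
    by (simp add: gr_basis dd_basis)
      (simp add: gr_def bilin_ext_left_basis bilin_ext_right_basis graft_White add_mset_commute)
qed (intro ct_lmap_intros)+

text \<open>As \<open>delta\<close> is a derivation, the defect stems from the commutator with
  \<open>dia\<close>. By \<open>gr_prelie\<close> it equals the associator of \<open>dia\<close>,
  \<open>x\<close> and \<open>y\<close>, which is \<open>dd x y\<close>.\<close>

theorem D_gr: "D (gr x y) = gr (D x) y + gr x (D y) + dd x y"
proof -
  have *: "a - x - (d1 + d2) = (a1 - g1 - d1) + (a2 - g2 - d2) + (g1 - x)"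
    if "a - a2 = a1 - g2" for a x d1 d2 a1 a2 g1 g2 :: "ct \<Rightarrow>\<^sub>0 'a"
    using that by (simp add: algebra_simps)
  show ?thesis
    unfolding D_eq delta_gr gr_arith gr_dia[symmetric] by (rule *) (rule gr_prelie)
qed

lemma D_leaf: "D (basis (White () l {#})) = 0"
  by (simp add: D_def Dt_def delta_def loc.simps[of qd] qd_White graft_White)

text \<open>The diamonds that \<open>qd\<close> puts directly above or below the black vertex cancel
  against the commutator with \<open>dia\<close>. Those on the special edges belong to
  \<open>D x\<close> and \<open>D y\<close>, and the doubled binary diamond of \<open>qd\<close>
  remains.\<close>

theorem D_mm: "D (mm x y) = mm (D x) y + mm x (D y) - fscale 2 (dd x y)"
proof (rule bil_eqI[of "\<lambda>x y. D (mm x y)" "\<lambda>x y. mm (D x) y + mm x (D y) - fscale 2 (dd x y)"])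
  fix a b
  have *: "basis (Black () {#a, b#} {#Dia {#}#}) +
        (lin_ext (\<lambda>t. basis (Black () {#t, b#} {#})) (graft (Dia {#}) a) + lin_ext (\<lambda>t. basis (Black () {#t, a#} {#})) (graft (Dia {#}) b)) -
      basis (Dia {#Black () {#a, b#} {#}#}) -
      (qd (Black () {#a, b#} {#}) + (lin_ext (\<lambda>t. basis (Black () {#t, b#} {#})) (delta a) + lin_ext (\<lambda>t. basis (Black () {#t, a#} {#})) (delta b)))
    = (D (mm (basis a) (basis b)) :: ct \<Rightarrow>\<^sub>0 'a)"
    by (simp add: mm_basis D_def Dt_def graft_Black delta_def loc.simps[of qd "Black _ _ _"] add_mset_commute)
  have q: "qd (Black () {#a, b#} {#}) = basis (Black () {#a, b#} {#Dia {#}#}) +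
      (basis (Black () {#Dia {#a#}, b#} {#}) + basis (Black () {#Dia {#b#}, a#} {#})) - basis (Dia {#Black () {#a, b#} {#}#})
      + fscale 2 (basis (Dia {#a, b#}) :: ct \<Rightarrow>\<^sub>0 'a)"
    by (simp add: qd_Black qBlack_def)
  have m: "mm (D (basis a)) (basis b) = lin_ext (\<lambda>t. basis (Black () {#t, b#} {#})) (graft (Dia {#}) a)
      - basis (Black () {#Dia {#a#}, b#} {#}) - (lin_ext (\<lambda>t. basis (Black () {#t, b#} {#})) (delta a) :: ct \<Rightarrow>\<^sub>0 'a)" for a b
    by (simp add: mm_def bilin_ext_right_basis D_def Dt_def lin_ext_arg)
  show "D (mm (basis a) (basis b)) = (mm (D (basis a)) (basis b) + mm (basis a) (D (basis b)) - fscale 2 (dd (basis a) (basis b)) :: ct \<Rightarrow>\<^sub>0 'a)"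
    unfolding *[symmetric] q m mm_commute[of "basis a" "D (basis b)"] dd_basis
    by (simp add: algebra_simps)
qed (intro ct_lmap_intros lmap_D)+

text \<open>As functions of the tree both sides obey the same rules for grafting and for black
  vertices, so \<open>tree_generation\<close> reduces the Leibniz rule for compositions to single
  vertices.\<close>

theorem D_sub:
  assumes "two_special T" "l \<noteq> None"
  shows "D (sub l u (basis T)) = sub l u (D (basis T)) + sub l (D u) (basis T)"
  using assms(1)
proof (rule tree_generation[where P = "\<lambda>M x. D (sub l u x) = sub l u (D x) + sub l (D u) x"])
  note lD = lmap_D[OF lmap_ident]
  fix x y :: "ct \<Rightarrow>\<^sub>0 'a" and c
  show "D (sub l u 0) = sub l u (D 0) + sub l (D u) 0" by (simp add: sub_arith lmap_zero[OF lD])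
  assume x: "D (sub l u x) = sub l u (D x) + sub l (D u) x"
  then show "D (sub l u (fscale c x)) = sub l u (D (fscale c x)) + sub l (D u) (fscale c x)"
    by (simp add: sub_arith lmap_scale[OF lD] fvs.scale_right_distrib)
  assume "D (sub l u y) = sub l u (D y) + sub l (D u) y"
  with x show "D (sub l u (x + y)) = sub l u (D (x + y)) + sub l (D u) (x + y)"
    by (simp add: sub_arith lmap_add[OF lD])
next
  fix m show "D (sub l u (basis (White () m {#}))) =
    sub l u (D (basis (White () m {#}))) + sub l (D u) (basis (White () m {#}) :: ct \<Rightarrow>\<^sub>0 'a)"
    by (simp add: sub_leaf D_leaf sub_arith lmap_zero[OF lmap_D[OF lmap_ident]])
next
  note lD = lmap_D[OF lmap_ident]
  fix x y
  assume IH: "D (sub l u (basis x)) = sub l u (D (basis x)) + sub l (D u) (basis x :: ct \<Rightarrow>\<^sub>0 'a)"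
    "D (sub l u (basis y)) = sub l u (D (basis y)) + sub l (D u) (basis y :: ct \<Rightarrow>\<^sub>0 'a)"
  show "D (sub l u (graft y x)) = sub l u (D (graft y x)) + sub l (D u) (graft y x :: ct \<Rightarrow>\<^sub>0 'a)"
    unfolding gr_basis[symmetric]
    by (simp only: sub_gr D_gr sub_dd[OF assms(2)] sub_arith gr_arith lmap_add[OF lD] IH add_ac)
  show "D (sub l u (basis (Black () {#x, y#} {#}))) =
      sub l u (D (basis (Black () {#x, y#} {#}))) + sub l (D u) (basis (Black () {#x, y#} {#}) :: ct \<Rightarrow>\<^sub>0 'a)"
    unfolding mm_basis[symmetric]
    by (simp add: sub_mm D_mm sub_dd[OF assms(2)] sub_arith mm_arith lmap_add[OF lD] IH fvs.scale_right_distrib)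
qed

section \<open>The operad structure\<close>

lemma white_labels_attach_u:
  "white_labels (attach_u g U) = white_labels U + \<Sum>\<^sub># (image_mset white_labels (\<Sum>j\<in>#names U. g j))"
proof -
  have *: "(\<Sum>c\<in>#C. white_labels (attach_u g c)) = (\<Sum>c\<in>#C. white_labels c) +
      \<Sum>\<^sub># (image_mset white_labels (\<Sum>j\<in>#(\<Sum>c\<in>#C. names c). g j))"
    if "\<And>c. c \<in># C \<Longrightarrow> white_labels (attach_u g c) = white_labels c + \<Sum>\<^sub># (image_mset white_labels (\<Sum>j\<in>#names c. g j))"
    for C :: "('a, nat option) ctree multiset"
    using that by (induction C) simp_all
  show ?thesis
  proof (induction U)
    case (White i l C)
    from *[OF White] show ?case by (simp add: image_mset.compositionality comp_def add_ac)
  next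
    case (Black i E C)
    from *[OF Black(1)] *[OF Black(2)] show ?case by (simp add: image_mset.compositionality comp_def add_ac)
  qed
qed

lemma two_special_forget [simp]: "two_special (forget_names T) \<longleftrightarrow> two_special T"
  by (induction T) auto

lemma two_special_attach_u:
  "two_special U \<Longrightarrow> (\<And>j c. j \<in># names U \<Longrightarrow> c \<in># g j \<Longrightarrow> two_special c) \<Longrightarrow> two_special (attach_u g U)"
proof (induction U)
  case (White i l C)
  have "two_special (attach_u g c)" if "c \<in># C" for c
    by (rule White.IH) (use that White.prems in auto)
  then show ?case using White.prems by auto
next
  case (Black i E C)
  have "two_special (attach_u g c)" if "c \<in># C" for c
    by (rule Black.IH(2)) (use that Black.prems in auto)
  moreover have "two_special (attach_u g c)" if "c \<in># E" for c
    by (rule Black.IH(1)) (use that Black.prems in auto)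
  ultimately show ?case using Black.prems by auto
qed

lemma keys_brace:
  assumes "distinct_names U" "t \<in> Poly_Mapping.keys (brace U C)"
  shows "white_labels t = white_labels U + \<Sum>\<^sub># (image_mset white_labels C)"
    "two_special U \<Longrightarrow> \<forall>c\<in>#C. two_special c \<Longrightarrow> two_special t"
proof -
  obtain g where g: "t = attach_u g U" "(\<Sum>j\<in>#names U. g j) = C"
    using keys_dst[OF assms(1) assms(2)[unfolded brace_def]] by (auto split: if_splits)
  show "white_labels t = white_labels U + \<Sum>\<^sub># (image_mset white_labels C)"
    by (simp add: g white_labels_attach_u)
  have "c \<in># C" if "j \<in># names U" "c \<in># g j" for j c
    using that unfolding g(2)[symmetric] by auto
  then show "two_special U \<Longrightarrow> \<forall>c\<in>#C. two_special c \<Longrightarrow> two_special t"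
    unfolding g(1) by (intro two_special_attach_u) auto
qed

lemma named_representative_labels:
  "white_labels (named_representative U) = white_labels U"
  "two_special (named_representative U) = two_special U"
  by (metis named_representative(1) white_labels_forget, metis named_representative(1) two_special_forget)

lemma keys_tsub:
  assumes "t \<in> Poly_Mapping.keys (tsub l U T)"
  shows "white_labels t + {#l#} = white_labels T + white_labels U"
    "two_special T \<Longrightarrow> two_special U \<Longrightarrow> two_special t"
proof -
  show "white_labels t + {#l#} = white_labels T + white_labels U"
    using assms unfolding tsub_def
  proof (rule white_labels_loc)
    fix T t assume "t \<in> Poly_Mapping.keys (subst_at l (named_representative U) T)"
    then show "white_labels t + {#l#} = white_labels T + white_labels U"
      by (cases T) (auto simp: subst_at_def named_representative_labels
          dest!: keys_brace(1)[OF named_representative(2)] split: if_splits)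
  qed
  show "two_special T \<Longrightarrow> two_special U \<Longrightarrow> two_special t"
  proof (rule two_special_loc[OF assms[unfolded tsub_def]])
    fix T t assume "t \<in> Poly_Mapping.keys (subst_at l (named_representative U) T)"
      "two_special T" "two_special U"
    then show "two_special t"
      by (cases T) (auto simp: subst_at_def named_representative_labels
          dest!: keys_brace(2)[OF named_representative(2)] split: if_splits)
  qed
qed

text \<open>Replacing one vertex labelled \<open>l\<close> by itself, summed over all such vertices,
  multiplies a tree by their number. In this form the claim passes through grafting and black
  vertices, so \<open>tree_generation\<close> applies.\<close>

lemma tsub_unit:
  assumes "two_special T" "count (white_labels T) l = 1"
  shows "tsub l (White () l {#}) T = (basis T :: ct \<Rightarrow>\<^sub>0 'k::field)"
proof -
  let ?P = "\<lambda>M x. sub l (basis (White () l {#})) x = fscale (of_nat (count M l)) (x :: ct \<Rightarrow>\<^sub>0 'k)"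
  have "?P (white_labels T) (basis T)"
    using assms(1)
    by (rule tree_generation[where P = ?P])
      (simp_all add: sub_arith sub_leaf fvs.scale_right_distrib fvs.scale_left_distrib mult.commute
        sub_gr sub_mm gr_arith mm_arith gr_basis[symmetric] mm_basis[symmetric])
  then show ?thesis using assms(2) by (simp add: sub_basis)
qed

definition trees_span :: "('b \<Rightarrow> bool) \<Rightarrow> ('b \<Rightarrow>\<^sub>0 'k::field) set" where
  "trees_span P = {x. \<forall>t\<in>Poly_Mapping.keys x. P t}"

lemma trees_span_arith:
  "0 \<in> trees_span P"
  "x \<in> trees_span P \<Longrightarrow> y \<in> trees_span P \<Longrightarrow> x + y \<in> trees_span P"
  "x \<in> trees_span P \<Longrightarrow> y \<in> trees_span P \<Longrightarrow> x - y \<in> trees_span P"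
  "x \<in> trees_span P \<Longrightarrow> fscale c x \<in> trees_span P"
  using keys_add[of x y] keys_diff[of x y] keys_fscale[of c x] by (auto simp: trees_span_def)

lemma basis_in_trees_span: "basis t \<in> trees_span P \<longleftrightarrow> P t"
  by (simp add: trees_span_def)

lemma lin_ext_in_trees_span:
  "x \<in> trees_span P \<Longrightarrow> (\<And>t. P t \<Longrightarrow> f t \<in> trees_span Q) \<Longrightarrow> lin_ext f x \<in> trees_span Q"
  by (fastforce simp: trees_span_def elim!: keys_lin_extE)

lemma bilin_ext_in_trees_span:
  "x \<in> trees_span P \<Longrightarrow> y \<in> trees_span P' \<Longrightarrow> (\<And>t u. P t \<Longrightarrow> P' u \<Longrightarrow> f t u \<in> trees_span Q) \<Longrightarrow>
   bilin_ext f x y \<in> trees_span Q"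
  unfolding bilin_ext_def
  by (rule lin_ext_in_trees_span[where P = P], assumption, rule lin_ext_in_trees_span[where P = P']) auto

abbreviation nT :: "nat set \<Rightarrow> (ct \<Rightarrow>\<^sub>0 'k::field) set" where
  "nT S \<equiv> trees_span (\<lambda>t. t \<in> christoffel_trees S)"

abbreviation dT :: "nat set \<Rightarrow> (ct \<Rightarrow>\<^sub>0 'k::field) set" where
  "dT S \<equiv> trees_span (\<lambda>t. t \<in> diamond_trees S)"

lemma nT_dT: "x \<in> nT S \<Longrightarrow> x \<in> dT S"
  by (auto simp: trees_span_def christoffel_trees_def)

definition act :: "(nat \<Rightarrow> nat) \<Rightarrow> (ct \<Rightarrow>\<^sub>0 'k::field) \<Rightarrow> (ct \<Rightarrow>\<^sub>0 'k)" where
  "act \<sigma> = lin_ext (\<lambda>b. basis (relabel \<sigma> b))"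

lemma nablaTrees_simps [simp]:
  "op_space nablaTrees S = nT S" "op_zero nablaTrees S = 0" "op_add nablaTrees S x y = x + y"
  "op_scale nablaTrees S c x = fscale c x" "op_act nablaTrees S \<sigma> = act \<sigma>"
  "op_unit nablaTrees s = basis (unit_tree s)"
  by (auto simp: nablaTrees_def operad_on_basis_def trees_span_def act_def)

lemma nablaTrees_diamond_simps [simp]:
  "op_space nablaTrees_diamond S = dT S" "op_zero nablaTrees_diamond S = 0" "op_add nablaTrees_diamond S x y = x + y"
  "op_scale nablaTrees_diamond S c x = fscale c x" "op_act nablaTrees_diamond S \<sigma> = act \<sigma>"
  by (auto simp: nablaTrees_diamond_def operad_on_basis_def trees_span_def act_def)

lemma comp_eq_sub:
  assumes "x \<in> dT S" "v \<in> S"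
  shows "op_comp nablaTrees S v T x y = sub (Some v) y x"
    "op_comp nablaTrees_diamond S v T x y = sub (Some v) y x"
proof -
  have "bilin_ext (tree_comp v) x y = sub (Some v) y x"
    unfolding sub_def
    by (rule bilin_ext_cong, rule tree_comp_eq_tsub) (use assms in \<open>auto simp: trees_span_def diamond_trees_def\<close>)
  then show "op_comp nablaTrees S v T x y = sub (Some v) y x"
    "op_comp nablaTrees_diamond S v T x y = sub (Some v) y x"
    by (simp_all add: nablaTrees_def nablaTrees_diamond_def operad_on_basis_def)
qed

lemma not_None_count: "None \<notin># M \<longleftrightarrow> count M None = 0"
  by (simp add: not_in_iff)

lemma christoffel_trees_iff:
  "T \<in> christoffel_trees S \<longleftrightarrow> two_special T \<and> count (white_labels T) None = 0 \<and>
    (\<forall>s. count (white_labels T) (Some s) = of_bool (s \<in> S))"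
  by (auto simp: christoffel_trees_def diamond_trees_def not_None_count)

lemma diamond_trees_iff:
  "T \<in> diamond_trees S \<longleftrightarrow> two_special T \<and> (\<forall>s. count (white_labels T) (Some s) = of_bool (s \<in> S))"
  by (auto simp: diamond_trees_def)

lemma gr_nT: "x \<in> nT S \<Longrightarrow> y \<in> nT S' \<Longrightarrow> S \<inter> S' = {} \<Longrightarrow> gr x y \<in> nT (S \<union> S')"
  unfolding gr_def
  by (rule bilin_ext_in_trees_span, assumption+)
    (auto simp: trees_span_def christoffel_trees_iff white_labels_graft intro: two_special_graft)

lemma mm_nT: "x \<in> nT S \<Longrightarrow> y \<in> nT S' \<Longrightarrow> S \<inter> S' = {} \<Longrightarrow> mm x y \<in> nT (S \<union> S')"
  unfolding mm_def
  by (rule bilin_ext_in_trees_span, assumption+)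
    (auto simp: trees_span_def christoffel_trees_iff)

lemma sub_nT: "x \<in> nT S \<Longrightarrow> u \<in> nT S' \<Longrightarrow> composable S v S' \<Longrightarrow> sub (Some v) u x \<in> nT ((S - {v}) \<union> S')"
  unfolding sub_def
proof (rule bilin_ext_in_trees_span, assumption+)
  fix t u assume c: "composable S v S'" and tu: "t \<in> christoffel_trees S" "u \<in> christoffel_trees S'"
  show "(tsub (Some v) u t :: ct \<Rightarrow>\<^sub>0 'a) \<in> nT ((S - {v}) \<union> S')"
    unfolding trees_span_def
  proof (intro CollectI ballI)
    fix r assume r: "r \<in> Poly_Mapping.keys (tsub (Some v) u t :: ct \<Rightarrow>\<^sub>0 'a)"
    note k = keys_tsub[OF r]
    have *: "count (white_labels r) l + count {#Some v#} l = count (white_labels t) l + count (white_labels u) l" for l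
      using k(1) by (metis count_union)
    show "r \<in> christoffel_trees ((S - {v}) \<union> S')"
      unfolding christoffel_trees_iff
    proof (intro conjI allI)
      show "two_special r" using k(2) tu by (simp add: christoffel_trees_iff)
      show "count (white_labels r) None = 0" using *[of None] tu by (simp add: christoffel_trees_iff)
      fix s show "count (white_labels r) (Some s) = of_bool (s \<in> (S - {v}) \<union> S')"
        using *[of "Some s"] tu c by (auto simp: christoffel_trees_iff of_bool_def split: if_splits)
    qed
  qed
qed

lemma keys_split2:
  assumes "t \<in> Poly_Mapping.keys (split2 H C)"
  obtains A B where "t \<in> Poly_Mapping.keys (H A B)" "A + B = C"
proof -
  have J: "\<forall>j. count {#False, True#} j \<le> 1" by simp
  obtain g where "t \<in> Poly_Mapping.keys (H (g True) (g False))" "(\<Sum>j\<in>#{#False, True#}. g j) = C"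
    using keys_dst[OF J assms[unfolded split2_def]] by auto
  then show thesis using that by (auto simp: add.commute)
qed

lemma keys_diffE:
  assumes "t \<in> Poly_Mapping.keys (x - y)"
  obtains "t \<in> Poly_Mapping.keys x" | "t \<in> Poly_Mapping.keys y"
  using assms keys_diff by fastforce

lemma keys_addE:
  assumes "t \<in> Poly_Mapping.keys (x + y)"
  obtains "t \<in> Poly_Mapping.keys x" | "t \<in> Poly_Mapping.keys y"
  using assms keys_add by fastforce

lemma keys_qd:
  assumes "t \<in> Poly_Mapping.keys (qd T :: ct \<Rightarrow>\<^sub>0 'k::field)"
  shows "white_labels t = white_labels T + {#None#}" "two_special T \<Longrightarrow> two_special t"
proof -
  have "white_labels t = white_labels T + {#None#} \<and> (two_special T \<longrightarrow> two_special t)"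
  proof (cases T)
    case (White i l C)
    then show ?thesis
      using assms by (auto simp: qd_White elim!: keys_split2 keys_diffE)
  next
    case (Black i E C)
    then have "t \<in> Poly_Mapping.keys (split2 (qBlack E) C + fscale 2 (basis (Dia (E + C))) :: ct \<Rightarrow>\<^sub>0 'k)"
      using assms by (simp add: qd_Black)
    then consider "t \<in> Poly_Mapping.keys (split2 (qBlack E) C :: ct \<Rightarrow>\<^sub>0 'k)" | "t = Dia (E + C)"
      by (auto elim!: keys_addE dest!: subsetD[OF keys_fscale])
    then show ?thesis
    proof cases
      case 1
      then show ?thesis using Black
        by (auto simp: qBlack_def elim!: keys_split2 keys_diffE keys_addE dest!: keys_msum)
    qed (use Black in auto)
  qed
  then show "white_labels t = white_labels T + {#None#}" "two_special T \<Longrightarrow> two_special t" by auto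
qed

lemma delta_dT: "x \<in> nT S \<Longrightarrow> lin_ext delta x \<in> dT S"
proof (rule lin_ext_in_trees_span, assumption)
  fix t assume t: "t \<in> christoffel_trees S"
  show "(delta t :: ct \<Rightarrow>\<^sub>0 'a) \<in> dT S"
    unfolding trees_span_def
  proof (intro CollectI ballI)
    fix r assume r: "r \<in> Poly_Mapping.keys (delta t :: ct \<Rightarrow>\<^sub>0 'a)"
    have "white_labels r + {#} = white_labels t + {#None#}"
      using r unfolding delta_def by (rule white_labels_loc) (simp add: keys_qd(1))
    moreover have "two_special r"
      using r unfolding delta_def by (rule two_special_loc) (use t keys_qd(2) in \<open>auto simp: christoffel_trees_iff\<close>)
    ultimately show "r \<in> diamond_trees S" using t by (simp add: diamond_trees_iff christoffel_trees_iff)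
  qed
qed

lemma D_dT: "x \<in> nT S \<Longrightarrow> D x \<in> dT S"
  unfolding D_eq
proof (intro trees_span_arith delta_dT)
  assume x: "x \<in> nT S"
  have "lin_ext (graft (Dia {#})) x \<in> dT S"
    by (rule lin_ext_in_trees_span[OF x])
      (auto simp: trees_span_def diamond_trees_iff christoffel_trees_iff white_labels_graft intro: two_special_graft)
  moreover have "lin_ext (\<lambda>t. graft t (Dia {#})) x \<in> dT S"
    by (rule lin_ext_in_trees_span[OF x])
      (auto simp: trees_span_def diamond_trees_iff christoffel_trees_iff white_labels_graft intro: two_special_graft)
  ultimately show "gr x dia \<in> dT S" "gr dia x \<in> dT S"
    by (simp_all add: gr_def bilin_ext_left_basis bilin_ext_right_basis)
qed

section \<open>Relabelling\<close>

lemma relabel_simps [simp]: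
  "relabel \<sigma> (White i l C) = White i (map_option \<sigma> l) (image_mset (relabel \<sigma>) C)"
  "relabel \<sigma> (Black i E C) = Black i (image_mset (relabel \<sigma>) E) (image_mset (relabel \<sigma>) C)"
  by (simp_all add: relabel_def[abs_def])

lemma relabel_addroot: "relabel \<sigma> (addroot y T) = addroot (relabel \<sigma> y) (relabel \<sigma> T)"
  by (cases T) simp_all

lemma act_basis [simp]: "act \<sigma> (basis t) = basis (relabel \<sigma> t)"
  by (simp add: act_def)

lemma act_graft: "act \<sigma> (graft y T) = graft (relabel \<sigma> y) (relabel \<sigma> T)"
proof (induction T rule: ct_induct)
  case (step T)
  have IH: "lin_ext (\<lambda>t. h (relabel \<sigma> t)) (graft y c) = lin_ext h (graft (relabel \<sigma> y) (relabel \<sigma> c))"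
    if "(b, c) \<in># slots T" for b c and h :: "ct \<Rightarrow> (ct \<Rightarrow>\<^sub>0 'a)"
    unfolding step[OF that, symmetric] act_def lin_ext_lin_ext lin_ext_basis ..
  have "lin_ext (\<lambda>t. basis (relabel \<sigma> t)) (dev (graft y) T) = (dev (graft (relabel \<sigma> y)) (relabel \<sigma> T) :: ct \<Rightarrow>\<^sub>0 'a)"
  proof (cases T)
    case (White i l C)
    have "msum (\<lambda>c R. lin_ext (\<lambda>t. basis (White () (map_option \<sigma> l) (add_mset (relabel \<sigma> t) (image_mset (relabel \<sigma>) R)))) (graft y c)) C =
       (msum (\<lambda>c R. lin_ext (\<lambda>t. basis (White () (map_option \<sigma> l) (add_mset t (image_mset (relabel \<sigma>) R)))) (graft (relabel \<sigma> y) (relabel \<sigma> c))) C :: ct \<Rightarrow>\<^sub>0 'a)"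
      by (rule msum_cong, rule IH[of False]) (simp add: White)
    then show ?thesis by (simp add: White lin_ext_arg_msum lin_ext_lin_ext msum_image)
  next
    case (Black i E C)
    have "msum (\<lambda>c R. lin_ext (\<lambda>t. basis (Black () (image_mset (relabel \<sigma>) E) (add_mset (relabel \<sigma> t) (image_mset (relabel \<sigma>) R)))) (graft y c)) C =
       (msum (\<lambda>c R. lin_ext (\<lambda>t. basis (Black () (image_mset (relabel \<sigma>) E) (add_mset t (image_mset (relabel \<sigma>) R)))) (graft (relabel \<sigma> y) (relabel \<sigma> c))) C :: ct \<Rightarrow>\<^sub>0 'a)"
      by (rule msum_cong, rule IH[of False]) (simp add: Black)
    moreover have "msum (\<lambda>c R. lin_ext (\<lambda>t. basis (Black () (add_mset (relabel \<sigma> t) (image_mset (relabel \<sigma>) R)) (image_mset (relabel \<sigma>) C))) (graft y c)) E =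
       (msum (\<lambda>c R. lin_ext (\<lambda>t. basis (Black () (add_mset t (image_mset (relabel \<sigma>) R)) (image_mset (relabel \<sigma>) C))) (graft (relabel \<sigma> y) (relabel \<sigma> c))) E :: ct \<Rightarrow>\<^sub>0 'a)"
      by (rule msum_cong, rule IH[of True]) (simp add: Black)
    ultimately show ?thesis by (simp add: Black lin_ext_arg lin_ext_arg_msum lin_ext_lin_ext msum_image)
  qed
  then show ?case
    by (simp add: graft_simps[of _ T] graft_simps[of _ "relabel \<sigma> T"] act_def lin_ext_arg relabel_addroot)
qed

lemma lmap_act: "lmap f \<Longrightarrow> lmap (\<lambda>x. act \<sigma> (f x))"
  unfolding act_def by (rule lmap_lin_ext_of)

lemma act_gr: "act \<sigma> (gr x y) = gr (act \<sigma> x) (act \<sigma> y)"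
  by (rule bil_eqI[of "\<lambda>x y. act \<sigma> (gr x y)" "\<lambda>x y. gr (act \<sigma> x) (act \<sigma> y)"])
    (simp_all add: gr_basis act_graft, (intro ct_lmap_intros lmap_act)+)

lemma act_mm: "act \<sigma> (mm x y) = mm (act \<sigma> x) (act \<sigma> y)"
  by (rule bil_eqI[of "\<lambda>x y. act \<sigma> (mm x y)" "\<lambda>x y. mm (act \<sigma> x) (act \<sigma> y)"])
    (simp_all add: mm_basis, (intro ct_lmap_intros lmap_act)+)

lemma act_dd: "act \<sigma> (dd x y) = dd (act \<sigma> x) (act \<sigma> y)"
  by (rule bil_eqI[of "\<lambda>x y. act \<sigma> (dd x y)" "\<lambda>x y. dd (act \<sigma> x) (act \<sigma> y)"])
    (simp_all add: dd_basis, (intro ct_lmap_intros lmap_act)+)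

lemmas act_add = lmap_add[OF lmap_act[OF lmap_ident]]
lemmas act_diff = lmap_diff[OF lmap_act[OF lmap_ident]]
lemmas act_zero = lmap_zero[OF lmap_act[OF lmap_ident]]
lemmas act_scale = lmap_scale[OF lmap_act[OF lmap_ident]]
lemmas D_add = lmap_add[OF lmap_D[OF lmap_ident]]
lemmas D_zero = lmap_zero[OF lmap_D[OF lmap_ident]]
lemmas D_scale = lmap_scale[OF lmap_D[OF lmap_ident]]

lemma act_D_basis:
  assumes "two_special T"
  shows "act \<sigma> (D (basis T)) = D (act \<sigma> (basis T) :: ct \<Rightarrow>\<^sub>0 'k::field)"
  using assms
proof (rule tree_generation[where P = "\<lambda>M x. act \<sigma> (D x) = D (act \<sigma> x :: ct \<Rightarrow>\<^sub>0 'k)"])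
  fix m show "act \<sigma> (D (basis (White () m {#}))) = D (act \<sigma> (basis (White () m {#})) :: ct \<Rightarrow>\<^sub>0 'k)"
    by (simp add: D_leaf act_zero)
next
  fix x y
  assume IH: "act \<sigma> (D (basis x)) = D (act \<sigma> (basis x) :: ct \<Rightarrow>\<^sub>0 'k)" "act \<sigma> (D (basis y)) = D (act \<sigma> (basis y) :: ct \<Rightarrow>\<^sub>0 'k)"
  show "act \<sigma> (D (graft y x)) = D (act \<sigma> (graft y x) :: ct \<Rightarrow>\<^sub>0 'k)"
    unfolding gr_basis[symmetric] D_gr act_gr act_add act_dd IH ..
  show "act \<sigma> (D (basis (Black () {#x, y#} {#}))) = D (act \<sigma> (basis (Black () {#x, y#} {#})) :: ct \<Rightarrow>\<^sub>0 'k)"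
    unfolding mm_basis[symmetric] D_mm act_mm act_add act_diff act_scale act_dd IH ..
qed (simp_all add: act_add act_zero act_scale D_add D_zero D_scale)

lemma two_special_vector_eqI:
  assumes "lmap f" "lmap g" "x \<in> dT S" "\<And>t. two_special t \<Longrightarrow> f (basis t) = g (basis t)"
  shows "f x = g x"
  by (rule lmap_eqI[OF assms(1,2)]) (use assms(3,4) in \<open>auto simp: trees_span_def diamond_trees_iff\<close>)

lemma act_D: "x \<in> nT S \<Longrightarrow> act \<sigma> (D x) = D (act \<sigma> x)"
  by (rule two_special_vector_eqI[where S = S and f = "\<lambda>x. act \<sigma> (D x)" and g = "\<lambda>x. D (act \<sigma> x)"])
    (assumption | intro lmap_act lmap_D lmap_ident act_D_basis nT_dT)+

lemma D_sub_vector: "x \<in> nT S \<Longrightarrow> l \<noteq> None \<Longrightarrow> D (sub l u x) = sub l u (D x) + sub l (D u) x"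
  by (rule two_special_vector_eqI[where S = S and f = "\<lambda>x. D (sub l u x)" and g = "\<lambda>x. sub l u (D x) + sub l (D u) x"])
    (assumption | intro ct_lmap_intros lmap_D D_sub nT_dT)+

text \<open>A tree has finitely many labels, which forces \<open>S\<close> to be finite. This has to
  be said explicitly, because \<open>mset_set\<close> of an infinite set is empty.\<close>

lemma christoffel_trees_mset:
  "T \<in> christoffel_trees S \<longleftrightarrow> two_special T \<and> finite S \<and> white_labels T = mset_set (Some ` S)"
proof
  assume T: "T \<in> christoffel_trees S"
  have "Some ` S \<subseteq> set_mset (white_labels T)"
  proof
    fix l assume "l \<in> Some ` S"
    then have "count (white_labels T) l = 1" using T by (auto simp: christoffel_trees_iff)
    then show "l \<in># white_labels T" by (metis count_eq_zero_iff zero_neq_one)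
  qed
  then have fin: "finite S" using finite_subset finite_imageD inj_Some finite_set_mset by metis
  have "white_labels T = mset_set (Some ` S)"
  proof (rule multiset_eqI)
    fix l show "count (white_labels T) l = count (mset_set (Some ` S)) l"
      using T fin by (cases l) (auto simp: christoffel_trees_iff count_mset_set')
  qed
  then show "two_special T \<and> finite S \<and> white_labels T = mset_set (Some ` S)"
    using T fin by (simp add: christoffel_trees_iff)
qed (auto simp: christoffel_trees_iff count_mset_set')

lemma white_labels_relabel: "white_labels (relabel \<sigma> t) = image_mset (map_option \<sigma>) (white_labels t)"
proof (induction t)
  case (White i l C)
  then have "image_mset (white_labels \<circ> relabel \<sigma>) C = image_mset (image_mset (map_option \<sigma>) \<circ> white_labels) C"
    by (auto intro: image_mset_cong)
  moreover have "image_mset (map_option \<sigma>) (\<Sum>\<^sub># (image_mset white_labels C)) = (\<Sum>c\<in>#C. image_mset (map_option \<sigma>) (white_labels c))"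
    for C :: "ct multiset" by (induction C) auto
  ultimately show ?case by (simp add: image_mset.compositionality comp_def)
next
  case (Black i E C)
  then have "image_mset (white_labels \<circ> relabel \<sigma>) C = image_mset (image_mset (map_option \<sigma>) \<circ> white_labels) C"
    "image_mset (white_labels \<circ> relabel \<sigma>) E = image_mset (image_mset (map_option \<sigma>) \<circ> white_labels) E"
    by (auto intro: image_mset_cong)
  moreover have "image_mset (map_option \<sigma>) (\<Sum>\<^sub># (image_mset white_labels C)) = (\<Sum>c\<in>#C. image_mset (map_option \<sigma>) (white_labels c))"
    for C :: "ct multiset" by (induction C) auto
  ultimately show ?case by (simp add: image_mset.compositionality comp_def)
qed

lemma two_special_relabel: "two_special (relabel \<sigma> t) = two_special t"
  by (induction t) auto

lemma act_nT: "x \<in> nT S \<Longrightarrow> inj_on \<sigma> S \<Longrightarrow> act \<sigma> x \<in> nT (\<sigma> ` S)"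
  unfolding act_def
proof (rule lin_ext_in_trees_span, assumption)
  fix t assume \<sigma>: "inj_on \<sigma> S" and t: "t \<in> christoffel_trees S"
  have "inj_on (map_option \<sigma>) (Some ` S)" using \<sigma> by (auto simp: inj_on_def)
  then have "image_mset (map_option \<sigma>) (mset_set (Some ` S)) = mset_set (map_option \<sigma> ` Some ` S)"
    by (rule image_mset_mset_set)
  also have "map_option \<sigma> ` Some ` S = Some ` \<sigma> ` S" by (simp add: image_image)
  finally show "basis (relabel \<sigma> t) \<in> nT (\<sigma> ` S)"
    using t by (simp add: basis_in_trees_span christoffel_trees_mset white_labels_relabel two_special_relabel)
qed

lemma derivation_D:
  "derivation (nablaTrees :: ('k::field, ct \<Rightarrow>\<^sub>0 'k) operad) nablaTrees_diamond (\<lambda>S. restrict D (nT S))"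
  unfolding derivation_def nablaTrees_simps nablaTrees_diamond_simps
proof (intro conjI allI ballI impI)
  fix S show "restrict D (nT S) \<in> nT S \<rightarrow>\<^sub>E (dT S :: (ct \<Rightarrow>\<^sub>0 'k) set)" by (auto intro: D_dT)
next
  fix S and x y :: "ct \<Rightarrow>\<^sub>0 'k" assume "x \<in> nT S" "y \<in> nT S"
  then show "restrict D (nT S) (x + y) = restrict D (nT S) x + restrict D (nT S) y"
    by (simp add: trees_span_arith D_add)
next
  fix S c and x :: "ct \<Rightarrow>\<^sub>0 'k" assume "x \<in> nT S"
  then show "restrict D (nT S) (fscale c x) = fscale c (restrict D (nT S) x)"
    by (simp add: trees_span_arith D_scale)
next
  fix S and \<sigma> :: "nat \<Rightarrow> nat" and x :: "ct \<Rightarrow>\<^sub>0 'k" assume x: "x \<in> nT S" and \<sigma>: "inj_on \<sigma> S"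
  then show "restrict D (nT (\<sigma> ` S)) (act \<sigma> x) = act \<sigma> (restrict D (nT S) x)"
    by (simp add: act_D act_nT)
next
  fix S v T and x y :: "ct \<Rightarrow>\<^sub>0 'k" assume *: "x \<in> nT S" "y \<in> nT T" "composable S v T"
  then have "v \<in> S" "sub (Some v) y x \<in> nT ((S - {v}) \<union> T)" by (auto intro: sub_nT)
  then show "restrict D (nT ((S - {v}) \<union> T)) (op_comp nablaTrees S v T x y) =
      op_comp nablaTrees_diamond S v T (restrict D (nT S) x) y + op_comp nablaTrees_diamond S v T x (restrict D (nT T) y)"
    using * by (simp add: comp_eq_sub[where S = S] nT_dT D_dT D_sub_vector[of x S])
qed

section \<open>Uniqueness of the derivation\<close>

lemma sub_absent: "x \<in> dT S \<Longrightarrow> s \<notin> S \<Longrightarrow> sub (Some s) u x = 0"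
proof -
  assume x: "x \<in> dT S" "s \<notin> S"
  have "sub (Some s) u x = bilin_ext (\<lambda>_ _. 0) x u"
    unfolding sub_def
    by (rule bilin_ext_cong, rule tsub_absent)
      (use x in \<open>auto simp: trees_span_def diamond_trees_iff not_in_iff\<close>)
  then show ?thesis by (simp add: bilin_ext_def lin_ext_zero)
qed

abbreviation lf :: "nat \<Rightarrow> (ct \<Rightarrow>\<^sub>0 'k::field)" where "lf s \<equiv> basis (unit_tree s)"

lemma sub_lf: "sub (Some v) u (lf s) = (if s = v then u else 0)"
  by (simp add: unit_tree_def sub_leaf)

lemma lf_nT: "lf s \<in> nT {s}"
  by (auto simp: basis_in_trees_span christoffel_trees_iff unit_tree_def)

lemma act_lf: "act \<sigma> (lf s) = lf (\<sigma> s)"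
  by (simp add: unit_tree_def)

text \<open>The properties by which a bilinear operation is determined from its value at two leaves.
  They hold for the operations to be differentiated and also for \<open>dd\<close>, in which their
  derivatives are expressed.\<close>

definition graft_op :: "((ct \<Rightarrow>\<^sub>0 'k::field) \<Rightarrow> (ct \<Rightarrow>\<^sub>0 'k) \<Rightarrow> (ct \<Rightarrow>\<^sub>0 'k)) \<Rightarrow> bool" where
  "graft_op f \<longleftrightarrow> (\<forall>l u x y. l \<noteq> None \<longrightarrow> sub l u (f x y) = f (sub l u x) y + f x (sub l u y)) \<and>
     (\<forall>x. f 0 x = 0 \<and> f x 0 = 0) \<and> (\<forall>\<sigma> x y. act \<sigma> (f x y) = f (act \<sigma> x) (act \<sigma> y))"

lemma graft_op_gr: "graft_op gr"
  and graft_op_mm: "graft_op mm"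
  and graft_op_dd: "graft_op dd"
  by (simp_all add: graft_op_def sub_gr sub_mm sub_dd gr_arith mm_arith dd_arith act_gr act_mm act_dd)

lemma graft_op_scale: "graft_op f \<Longrightarrow> graft_op (\<lambda>x y. fscale c (f x y))"
  by (simp add: graft_op_def sub_arith fvs.scale_right_distrib act_scale)

lemma graft_op_add: "graft_op f \<Longrightarrow> graft_op g \<Longrightarrow> graft_op (\<lambda>x y. f x y + g x y)"
  by (simp add: graft_op_def sub_arith act_add)

lemma graft_op_flip: "graft_op f \<Longrightarrow> graft_op (\<lambda>x y. f y x)"
  by (simp add: graft_op_def add.commute)

lemma graft_op_sub1: "graft_op f \<Longrightarrow> a \<noteq> b \<Longrightarrow> sub (Some a) x (f (lf a) (lf b)) = f x (lf b)"
  by (simp add: graft_op_def sub_lf)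

lemma graft_op_sub2: "graft_op f \<Longrightarrow> x \<in> dT S \<Longrightarrow> b \<notin> S \<Longrightarrow> sub (Some b) y (f x (lf b)) = f x y"
  by (simp add: graft_op_def sub_lf sub_absent)

lemma fresh_pair:
  assumes "finite (X :: nat set)"
  obtains a b where "a \<notin> X" "b \<notin> X" "a \<noteq> b"
proof -
  obtain a where "a \<notin> X" using ex_new_if_finite[OF infinite_UNIV_nat assms] by blast
  moreover obtain b where "b \<notin> insert a X"
    using ex_new_if_finite[OF infinite_UNIV_nat, of "insert a X"] assms by auto
  ultimately show thesis using that by auto
qed

locale tree_derivation =
  fixes D' :: "nat set \<Rightarrow> (ct \<Rightarrow>\<^sub>0 'k::field) \<Rightarrow> (ct \<Rightarrow>\<^sub>0 'k)"
  assumes der: "derivation nablaTrees nablaTrees_diamond D'"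
begin

lemma space: "x \<in> nT S \<Longrightarrow> D' S x \<in> dT S"
  using der unfolding derivation_def by (auto dest: PiE_mem)

lemma add: "x \<in> nT S \<Longrightarrow> y \<in> nT S \<Longrightarrow> D' S (x + y) = D' S x + D' S y"
  and scale: "x \<in> nT S \<Longrightarrow> D' S (fscale c x) = fscale c (D' S x)"
  using der unfolding derivation_def by simp_all

lemma equivariant: "x \<in> nT S \<Longrightarrow> inj_on \<sigma> S \<Longrightarrow> D' (\<sigma> ` S) (act \<sigma> x) = act \<sigma> (D' S x)"
  using der unfolding derivation_def by simp

lemma comp:
  assumes "x \<in> nT S" "y \<in> nT T" "composable S v T"
  shows "D' ((S - {v}) \<union> T) (sub (Some v) y x) = sub (Some v) y (D' S x) + sub (Some v) (D' T y) x"
proof -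
  have "D' ((S - {v}) \<union> T) (op_comp nablaTrees S v T x y) =
      op_comp nablaTrees_diamond S v T (D' S x) y + op_comp nablaTrees_diamond S v T x (D' T y)"
    using der assms unfolding derivation_def nablaTrees_simps nablaTrees_diamond_simps by blast
  then show ?thesis
    using assms comp_eq_sub[of x S v T] comp_eq_sub[of "D' S x" S v T] space[of x S] by (simp add: nT_dT)
qed

lemma zero: "D' S 0 = 0"
  using scale[of 0 S 0] by (simp add: trees_span_arith)

lemma unit: "D' {s} (lf s) = 0"
proof -
  let ?d = "D' {s} (lf s)"
  have "sub (Some s) (lf s) ?d = ?d"
  proof -
    have "sub (Some s) (lf s) x = (x :: ct \<Rightarrow>\<^sub>0 'k)" if "x \<in> dT {s}" for x
      by (rule lmap_eqI[of "\<lambda>x. sub (Some s) (lf s) x" "\<lambda>x. x"])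
        (use that in \<open>auto intro: ct_lmap_intros simp: sub_basis unit_tree_def tsub_unit trees_span_def diamond_trees_iff\<close>)
    then show ?thesis using space[OF lf_nT] by blast
  qed
  \<comment> \<open>The unit composed with itself is the unit, and the Leibniz rule turns this into
    a doubling.\<close>
  then have "?d = ?d + ?d"
    using comp[OF lf_nT lf_nT, of s s] by (simp add: sub_lf)
  then show ?thesis by simp
qed

text \<open>\<open>f x y\<close> arises from \<open>f\<close> at two leaves by inserting
  \<open>x\<close> and \<open>y\<close>. Compositions need disjoint labels, so the leaves are first
  moved to fresh labels by equivariance; then the Leibniz rule is applied twice.\<close>

lemma op:
  assumes f: "graft_op f" and h: "graft_op h" and fh: "D' {1, 2} (f (lf 1) (lf 2)) = h (lf 1) (lf 2)"
    and f_nT: "\<And>x y S S'. x \<in> nT S \<Longrightarrow> y \<in> nT S' \<Longrightarrow> S \<inter> S' = {} \<Longrightarrow> f x y \<in> nT (S \<union> S')"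
    and xy: "x \<in> nT S" "y \<in> nT S'" "S \<inter> S' = {}" "finite S" "finite S'"
  shows "D' (S \<union> S') (f x y) = h x y + f (D' S x) y + f x (D' S' y)"
proof -
  obtain a b where ab: "a \<notin> S \<union> S'" "b \<notin> S \<union> S'" "a \<noteq> b" using fresh_pair[of "S \<union> S'"] xy by auto
  define \<sigma> where "\<sigma> = (\<lambda>n::nat. if n = 1 then a else b)"
  have \<sigma>: "inj_on \<sigma> {1, 2}" "\<sigma> ` {1, 2} = {a, b}" using ab by (auto simp: \<sigma>_def inj_on_def)
  have K: "f (lf s) (lf t) \<in> nT {s, t}" if "s \<noteq> t" for s t
    using f_nT[OF lf_nT lf_nT, of s t] that by (simp add: insert_commute)
  have act: "act \<sigma> (g (lf 1) (lf 2)) = g (lf a) (lf b)" if "graft_op g" for g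
    using that by (simp add: graft_op_def act_lf \<sigma>_def del: act_basis)
  have DK: "D' {a, b} (f (lf a) (lf b)) = h (lf a) (lf b)"
    using equivariant[OF K[of 1 2] \<sigma>(1)] unfolding \<sigma>(2) act[OF f] fh act[OF h] by simp
  have c1: "composable {a, b} a S" "({a, b} - {a}) \<union> S = insert b S" using ab by auto
  have z: "f x (lf b) \<in> nT (insert b S)" using f_nT[OF xy(1) lf_nT, of b] ab by auto
  have Dz: "D' (insert b S) (f x (lf b)) = h x (lf b) + f (D' S x) (lf b)"
    using comp[OF K[OF ab(3)] xy(1) c1(1)] unfolding c1(2) DK
    by (simp add: graft_op_sub1 f h ab)
  have c2: "composable (insert b S) b S'" "(insert b S - {b}) \<union> S' = S \<union> S'" using ab xy by auto
  show ?thesis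
    using comp[OF z xy(2) c2(1)] unfolding c2(2) Dz
    using ab space[OF xy(1)] nT_dT[OF xy(1)]
    by (simp add: sub_arith graft_op_sub2[OF f] graft_op_sub2[OF h])
qed

end

lemma mset_set_plus_split:
  assumes "A + B = mset_set (Some ` S)" "finite S"
  obtains S1 S2 where "A = mset_set (Some ` S1)" "B = mset_set (Some ` S2)" "S = S1 \<union> S2" "S1 \<inter> S2 = {}"
    "finite S1" "finite S2"
proof -
  have c: "count A l + count B l = of_bool (l \<in> Some ` S)" for l
    using arg_cong[OF assms(1), of "\<lambda>M. count M l"] assms(2) by (simp add: count_mset_set')
  define S1 where "S1 = {s. 0 < count A (Some s)}"
  define S2 where "S2 = {s. 0 < count B (Some s)}"
  have cS: "count A (Some s) + count B (Some s) = of_bool (s \<in> S)" for s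
    using c[of "Some s"] by auto
  have S: "S = S1 \<union> S2" "S1 \<inter> S2 = {}"
  proof -
    have "s \<in> S \<longleftrightarrow> s \<in> S1 \<union> S2" "s \<notin> S1 \<inter> S2" for s
      using cS[of s] by (auto simp: S1_def S2_def of_bool_def simp del: count_greater_zero_iff split: if_splits)
    then show "S = S1 \<union> S2" "S1 \<inter> S2 = {}" by auto
  qed
  moreover have fin: "finite S1" "finite S2" using assms(2) S by auto
  moreover have "A = mset_set (Some ` S1)"
  proof (rule multiset_eqI)
    fix l show "count A l = count (mset_set (Some ` S1)) l"
    proof (cases l)
      case None
      then show ?thesis using c[of None] by (auto simp: count_mset_set')
    next
      case (Some s)
      have "count A (Some s) = of_bool (s \<in> S1)"
        using cS[of s] by (auto simp: S1_def of_bool_def simp del: count_greater_zero_iff split: if_splits)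
      moreover have "Some s \<in> Some ` S1 \<longleftrightarrow> s \<in> S1" by auto
      ultimately show ?thesis using Some fin by (simp add: count_mset_set')
    qed
  qed
  moreover have "B = mset_set (Some ` S2)"
  proof (rule multiset_eqI)
    fix l show "count B l = count (mset_set (Some ` S2)) l"
    proof (cases l)
      case None
      then show ?thesis using c[of None] by (auto simp: count_mset_set')
    next
      case (Some s)
      have "count B (Some s) = of_bool (s \<in> S2)"
        using cS[of s] by (auto simp: S2_def of_bool_def simp del: count_greater_zero_iff split: if_splits)
      moreover have "Some s \<in> Some ` S2 \<longleftrightarrow> s \<in> S2" by auto
      ultimately show ?thesis using Some fin by (simp add: count_mset_set')
    qed
  qed
  ultimately show thesis using that by blast
qed

lemma arrow_tree_eq: "basis (arrow_tree r s) = gr (lf r) (lf s)"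
  by (simp add: arrow_tree_def unit_tree_def gr_basis graft_White)

lemma m_tree_eq: "basis m_tree = mm (lf 1) (lf 2)"
  by (simp add: m_tree_def unit_tree_def mm_basis)

lemma diamond_tree_eq: "basis diamond_tree = dd (lf 1) (lf 2)"
  by (simp add: diamond_tree_def unit_tree_def dd_basis)

lemma D_lf: "D (lf s) = 0"
  by (simp add: unit_tree_def D_leaf)

theorem derivation_unique:
  fixes D' :: "nat set \<Rightarrow> (ct \<Rightarrow>\<^sub>0 'k::field) \<Rightarrow> (ct \<Rightarrow>\<^sub>0 'k)"
  assumes "derivation nablaTrees nablaTrees_diamond D'"
    and "D' {1, 2} (gr (lf 1) (lf 2)) = dd (lf 1) (lf 2)"
    and "D' {1, 2} (mm (lf 1) (lf 2)) = fscale (- 2) (dd (lf 1) (lf 2))"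
    and "x \<in> nT S"
  shows "D' S x = D x"
proof -
  interpret tree_derivation D' by standard (rule assms(1))
  \<comment> \<open>A derivation is known on the components of the operad only. For multisets with a
    repeated label or a diamond \<open>P\<close> therefore claims nothing.\<close>
  define P where "P M x \<longleftrightarrow> (\<forall>S. finite S \<longrightarrow> M = mset_set (Some ` S) \<longrightarrow> x \<in> nT S \<and> D' S x = D x)" for M and x :: "ct \<Rightarrow>\<^sub>0 'k"
  have gen: "P (white_labels t) (basis t)" if "two_special t" for t
    using that
  proof (rule tree_generation[where P = P])
    fix M x y c assume "P M x"
    then show "P M (fscale c x)" by (simp add: P_def scale D_scale trees_span_arith)
    assume "P M y"
    with \<open>P M x\<close> show "P M (x + y)" by (simp add: P_def add D_add trees_span_arith)
  next
    fix M show "P M 0" by (simp add: P_def zero D_zero trees_span_arith)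
  next
    fix l
    show "P {#l#} (basis (White () l {#}))"
      unfolding P_def
    proof (intro allI impI)
      fix S assume "finite (S :: nat set)" "{#l#} = mset_set (Some ` S)"
      then have "Some ` S = {l}" by (metis finite_imageI finite_set_mset_mset_set set_mset_single set_mset_add_mset_insert set_mset_empty)
      then obtain s where "S = {s}" "l = Some s" by (cases l) (auto simp: image_def set_eq_iff)
      then show "basis (White () l {#}) \<in> nT S \<and> D' S (basis (White () l {#})) = D (basis (White () l {#}))"
        using lf_nT[of s] unit[of s] D_lf[of s] by (simp add: unit_tree_def)
    qed
  next
    fix x y assume IH: "P (white_labels x) (basis x)" "P (white_labels y) (basis y)"
    let ?x = "basis x :: ct \<Rightarrow>\<^sub>0 'k" and ?y = "basis y :: ct \<Rightarrow>\<^sub>0 'k"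
    have "gr ?x ?y \<in> nT S \<and> D' S (gr ?x ?y) = D (gr ?x ?y) \<and>
        mm ?x ?y \<in> nT S \<and> D' S (mm ?x ?y) = D (mm ?x ?y)"
      if "finite S" and S: "white_labels x + white_labels y = mset_set (Some ` S)" for S
    proof -
      obtain S1 S2 where S12: "white_labels x = mset_set (Some ` S1)" "white_labels y = mset_set (Some ` S2)"
        "S = S1 \<union> S2" "S1 \<inter> S2 = {}" "finite S1" "finite S2"
        using mset_set_plus_split[OF S \<open>finite S\<close>] .
      have x: "?x \<in> nT S1" "D' S1 ?x = D ?x" and y: "?y \<in> nT S2" "D' S2 ?y = D ?y"
        using IH(1)[unfolded P_def, rule_format, OF S12(5,1)] IH(2)[unfolded P_def, rule_format, OF S12(6,2)] by auto
      have "D' (S1 \<union> S2) (gr ?x ?y) = dd ?x ?y + gr (D' S1 ?x) ?y + gr ?x (D' S2 ?y)"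
        by (rule op[OF graft_op_gr graft_op_dd assms(2)]) (fact gr_nT x(1) y(1) S12(4-6))+
      then have "D' S (gr ?x ?y) = D (gr ?x ?y)"
        by (simp add: S12(3) D_gr x y)
      moreover have "D' (S1 \<union> S2) (mm ?x ?y) = fscale (- 2) (dd ?x ?y) + mm (D' S1 ?x) ?y + mm ?x (D' S2 ?y)"
        by (rule op[OF graft_op_mm graft_op_scale[OF graft_op_dd] assms(3)]) (fact mm_nT x(1) y(1) S12(4-6))+
      then have "D' S (mm ?x ?y) = D (mm ?x ?y)"
        by (simp add: S12(3) D_mm x y)
      ultimately show ?thesis using gr_nT[OF x(1) y(1) S12(4)] mm_nT[OF x(1) y(1) S12(4)] S12(3) by simp
    qed
    then show "P (white_labels x + white_labels y) (graft y x)"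
      "P (white_labels x + white_labels y) (basis (Black () {#x, y#} {#}))"
      unfolding P_def by (simp_all add: gr_basis mm_basis)
  qed
  have *: "(basis t :: ct \<Rightarrow>\<^sub>0 'k) \<in> nT S \<and> D' S (basis t) = D (basis t :: ct \<Rightarrow>\<^sub>0 'k)" if "t \<in> christoffel_trees S" for t
    using gen[of t, unfolded P_def, rule_format, of S] that by (simp add: christoffel_trees_mset)
  have "x \<in> nT S \<and> D' S x = D x"
    by (rule linear_combination_induct[of "\<lambda>x. x \<in> nT S \<and> D' S x = D x"])
      (use * assms(4)[unfolded trees_span_def] in \<open>auto simp: zero add scale D_zero D_add D_scale trees_span_arith\<close>)
  then show ?thesis ..
qed

text \<open>Existence is \<open>derivation_D\<close> and uniqueness
  \<open>derivation_unique\<close>. The restriction provides the default value outside the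
  components, which the extensional function space in \<open>derivation\<close> prescribes.\<close>

theorem Phi_geo_eq: "Phi_geo = (\<lambda>S. restrict D (nT S) :: (ct \<Rightarrow>\<^sub>0 'k::field) \<Rightarrow> _)"
  unfolding Phi_geo_def
proof (rule the_equality)
  have a: "gr (lf 1) (lf 2) \<in> (nT {1, 2} :: (ct \<Rightarrow>\<^sub>0 'k) set)" "gr (lf 2) (lf 1) \<in> (nT {1, 2} :: (ct \<Rightarrow>\<^sub>0 'k) set)"
    "mm (lf 1) (lf 2) \<in> (nT {1, 2} :: (ct \<Rightarrow>\<^sub>0 'k) set)"
    using gr_nT[OF lf_nT lf_nT, of 1 2] gr_nT[OF lf_nT lf_nT, of 2 1] mm_nT[OF lf_nT lf_nT, of 1 2]
    by (simp_all add: insert_commute)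
  show "derivation nablaTrees nablaTrees_diamond (\<lambda>S. restrict D (nT S :: (ct \<Rightarrow>\<^sub>0 'k) set)) \<and>
    restrict D (nT {1, 2}) (basis (arrow_tree 1 2)) = (basis diamond_tree :: ct \<Rightarrow>\<^sub>0 'k) \<and>
    restrict D (nT {1, 2}) (basis (arrow_tree 2 1)) = (basis diamond_tree :: ct \<Rightarrow>\<^sub>0 'k) \<and>
    restrict D (nT {1, 2}) (basis m_tree) = (fscale (- 2) (basis diamond_tree) :: ct \<Rightarrow>\<^sub>0 'k)"
    unfolding arrow_tree_eq m_tree_eq diamond_tree_eq
    using a by (simp add: derivation_D D_gr D_mm D_lf gr_arith mm_arith dd_commute)
next
  fix D' :: "nat set \<Rightarrow> (ct \<Rightarrow>\<^sub>0 'k) \<Rightarrow> (ct \<Rightarrow>\<^sub>0 'k)"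
  assume D': "derivation nablaTrees nablaTrees_diamond D' \<and>
    D' {1, 2} (basis (arrow_tree 1 2)) = basis diamond_tree \<and>
    D' {1, 2} (basis (arrow_tree 2 1)) = basis diamond_tree \<and>
    D' {1, 2} (basis m_tree) = fscale (- 2) (basis diamond_tree)"
  show "D' = (\<lambda>S. restrict D (nT S))"
  proof (intro ext)
    fix S x show "D' S x = restrict D (nT S) x"
    proof (cases "x \<in> nT S")
      case True
      then show ?thesis
        using derivation_unique[of D' x S] D' unfolding arrow_tree_eq m_tree_eq diamond_tree_eq by simp
    next
      case False
      have "D' S \<in> nT S \<rightarrow>\<^sub>E dT S" using D' by (simp add: derivation_def)
      then show ?thesis using PiE_arb[OF _ False] False by simp
    qed
  qed
qed

lemma ker_Phi_geo_simps [simp]: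
  "op_space ker_Phi_geo S = {x \<in> nT S. D x = 0}"
  "op_zero ker_Phi_geo S = 0" "op_add ker_Phi_geo S x y = x + y"
  "op_scale ker_Phi_geo S c x = fscale c x" "op_act ker_Phi_geo S \<sigma> = act \<sigma>"
  "op_unit ker_Phi_geo s = lf s" "op_comp ker_Phi_geo = op_comp nablaTrees"
  by (auto simp: ker_Phi_geo_def kernel_operad_def Phi_geo_eq)

section \<open>The covariant derivative as a bilinear operation\<close>

text \<open>The covariant derivative of \<open>y\<close> along \<open>x\<close>, hence
  \<open>x\<close> is grafted onto \<open>y\<close>.\<close>

definition nab :: "(ct \<Rightarrow>\<^sub>0 'k::field) \<Rightarrow> (ct \<Rightarrow>\<^sub>0 'k) \<Rightarrow> (ct \<Rightarrow>\<^sub>0 'k)" where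
  "nab x y = gr y x + fscale (1 / 2) (mm x y)"

lemma nabla_eq: "nabla = nab (lf 1) (lf 2)"
  by (simp add: nabla_def nab_def arrow_tree_eq m_tree_eq)

lemma nab_arith:
  "nab (x + x') y = nab x y + nab x' y" "nab x (y + y') = nab x y + nab x y'"
  "nab (x - x') y = nab x y - nab x' y" "nab x (y - y') = nab x y - nab x y'"
  "nab (fscale c x) y = fscale c (nab x y)" "nab x (fscale c y) = fscale c (nab x y)"
  "nab 0 y = 0" "nab x 0 = 0"
  by (simp_all add: nab_def gr_arith mm_arith fvs.scale_right_distrib fvs.scale_right_diff_distrib mult.commute)

lemma lmap_nab_left: "lmap f \<Longrightarrow> lmap (\<lambda>x. nab (f x) y)"
  and lmap_nab_right: "lmap f \<Longrightarrow> lmap (\<lambda>x. nab y (f x))"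
  unfolding nab_def by (intro ct_lmap_intros, assumption, assumption)+

lemma graft_op_nab: "graft_op nab"
  using graft_op_add[OF graft_op_flip[OF graft_op_gr] graft_op_scale[OF graft_op_mm]]
  by (simp add: nab_def[abs_def])

lemma sub_nab: "l \<noteq> None \<Longrightarrow> sub l u (nab x y) = nab (sub l u x) y + nab x (sub l u y)"
  using graft_op_nab unfolding graft_op_def by blast

lemma act_nab: "act \<sigma> (nab x y) = nab (act \<sigma> x) (act \<sigma> y)"
  using graft_op_nab unfolding graft_op_def by blast

lemma nab_nT: "x \<in> nT S \<Longrightarrow> y \<in> nT S' \<Longrightarrow> S \<inter> S' = {} \<Longrightarrow> nab x y \<in> nT (S \<union> S')"
  unfolding nab_def using gr_nT[of y S' x S] mm_nT[of x S y S']
  by (intro trees_span_arith) (auto simp: Un_commute)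

text \<open>Grafting contributes \<open>dd\<close>, and half of the contribution of the black vertex
  is its negative. So \<open>D\<close> is a derivation of \<open>nab\<close> and vanishes on all
  that is built from leaves by \<open>nab\<close>.\<close>

lemma D_nab: "D (nab x y :: ct \<Rightarrow>\<^sub>0 'k::field_char_0) = nab (D x) y + nab x (D y)"
proof -
  have "fscale (1 / 2) (fscale 2 (dd x y)) = dd x y" by simp
  then show ?thesis
    by (simp add: nab_def D_gr D_mm D_add D_scale fvs.scale_right_distrib fvs.scale_right_diff_distrib dd_commute[of y x])
qed

section \<open>Iterated covariant derivatives\<close>

lemma iterated_kernel:
  fixes x :: "ct \<Rightarrow>\<^sub>0 'k::field_char_0"
  shows "iterated nablaTrees nabla S x \<Longrightarrow> x \<in> nT S \<and> D x = 0"
proof (induction rule: iterated.induct)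
  case (unit s)
  then show ?case by (simp add: lf_nT D_lf)
next
  case gen
  have "nab (lf 1) (lf 2) \<in> (nT {1, 2} :: (ct \<Rightarrow>\<^sub>0 'k) set)"
    using nab_nT[OF lf_nT lf_nT, of 1 2] by (simp add: insert_commute)
  then show ?case by (simp add: nabla_eq D_nab D_lf nab_arith)
next
  case (act S x \<sigma>)
  then show ?case using act_D[of x S \<sigma>] by (simp add: act_nT act_zero)
next
  case (comp S x T y v)
  then show ?case
    using sub_nT[of x S y T v] D_sub_vector[of x S "Some v" y]
    by (simp add: comp_eq_sub[of x S v T] nT_dT sub_arith)
qed

text \<open>As in \<open>op\<close>, the product is \<open>nabla\<close>, moved to fresh labels,
  composed with \<open>x\<close> and \<open>y\<close>.\<close>

lemma iterated_nab:
  fixes x y :: "ct \<Rightarrow>\<^sub>0 'k::field_char_0"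
  assumes x: "iterated nablaTrees nabla S x" and y: "iterated nablaTrees nabla S' y"
    and S: "S \<inter> S' = {}" "finite S" "finite S'"
  shows "iterated nablaTrees nabla (S \<union> S') (nab x y)"
proof -
  note it = iterated.intros[of nablaTrees "nabla :: ct \<Rightarrow>\<^sub>0 'k"]
  obtain a b where ab: "a \<notin> S \<union> S'" "b \<notin> S \<union> S'" "a \<noteq> b" using fresh_pair[of "S \<union> S'"] S by auto
  define \<sigma> where "\<sigma> = (\<lambda>n::nat. if n = 1 then a else b)"
  have \<sigma>: "inj_on \<sigma> {1, 2}" "\<sigma> ` {1, 2} = {a, b}" using ab by (auto simp: \<sigma>_def inj_on_def)
  have "act \<sigma> nabla = (nab (lf a) (lf b) :: ct \<Rightarrow>\<^sub>0 'k)"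
    by (simp add: nabla_eq act_nab act_lf \<sigma>_def del: act_basis)
  then have K: "iterated nablaTrees nabla {a, b} (nab (lf a) (lf b) :: ct \<Rightarrow>\<^sub>0 'k)"
    using it(3)[OF it(2) \<sigma>(1)] \<sigma>(2) by simp
  have c1: "composable {a, b} a S" "({a, b} - {a}) \<union> S = insert b S" using ab by auto
  have z: "iterated nablaTrees nabla (insert b S) (nab x (lf b))"
    using it(4)[OF K x c1(1)] iterated_kernel[OF K]
    unfolding c1(2) by (simp add: comp_eq_sub[of _ "{a, b}"] nT_dT graft_op_sub1[OF graft_op_nab ab(3)])
  have c2: "composable (insert b S) b S'" "(insert b S - {b}) \<union> S' = S \<union> S'" using ab S by auto
  show ?thesis
    using it(4)[OF z y c2(1)] iterated_kernel[OF z] iterated_kernel[OF x] ab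
    unfolding c2(2) by (simp add: comp_eq_sub[of _ "insert b S"] nT_dT graft_op_sub2[OF graft_op_nab, of x S])
qed

section \<open>From magma trees to Christoffel trees\<close>

abbreviation MT :: "nat set \<Rightarrow> (magma_tree \<Rightarrow>\<^sub>0 'k::field) set" where
  "MT S \<equiv> trees_span (\<lambda>t. distinct (leaves t) \<and> set (leaves t) = S)"

definition mact :: "(nat \<Rightarrow> nat) \<Rightarrow> (magma_tree \<Rightarrow>\<^sub>0 'k::field) \<Rightarrow> (magma_tree \<Rightarrow>\<^sub>0 'k)" where
  "mact \<sigma> = lin_ext (\<lambda>b. basis (leaf_map \<sigma> b))"

definition mcomp :: "nat \<Rightarrow> (magma_tree \<Rightarrow>\<^sub>0 'k::field) \<Rightarrow> (magma_tree \<Rightarrow>\<^sub>0 'k) \<Rightarrow> (magma_tree \<Rightarrow>\<^sub>0 'k)" where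
  "mcomp v = bilin_ext (\<lambda>t w. basis (leaf_subst v t w))"

lemma Mag_simps [simp]:
  "op_space Mag S = MT S" "op_zero Mag S = 0" "op_add Mag S x y = x + y"
  "op_scale Mag S c x = fscale c x" "op_act Mag S \<sigma> = mact \<sigma>"
  "op_comp Mag S v T = mcomp v" "op_unit Mag s = basis (Leaf s)"
  by (auto simp: Mag_def operad_on_basis_def trees_span_def mact_def mcomp_def)

primrec phi_tree :: "magma_tree \<Rightarrow> (ct \<Rightarrow>\<^sub>0 'k::field)" where
  "phi_tree (Leaf s) = lf s"
| "phi_tree (Mul t u) = nab (phi_tree t) (phi_tree u)"

definition phi :: "(magma_tree \<Rightarrow>\<^sub>0 'k::field) \<Rightarrow> (ct \<Rightarrow>\<^sub>0 'k)" where
  "phi = lin_ext phi_tree"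

lemma lmap_phi: "lmap f \<Longrightarrow> lmap (\<lambda>x. phi (f x))"
  unfolding phi_def by (rule lmap_lin_ext_of)

lemmas phi_add = lmap_add[OF lmap_phi[OF lmap_ident]]
lemmas phi_diff = lmap_diff[OF lmap_phi[OF lmap_ident]]
lemmas phi_zero = lmap_zero[OF lmap_phi[OF lmap_ident]]
lemmas phi_scale = lmap_scale[OF lmap_phi[OF lmap_ident]]

lemma phi_basis [simp]: "phi (basis t) = phi_tree t"
  by (simp add: phi_def)

lemma iterated_phi_tree:
  "distinct (leaves t) \<Longrightarrow> iterated nablaTrees nabla (set (leaves t)) (phi_tree t :: ct \<Rightarrow>\<^sub>0 'k::field_char_0)"
proof (induction t)
  case (Leaf s)
  then show ?case using iterated.unit[of nablaTrees nabla s] by simp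
next
  case (Mul t u)
  then show ?case using iterated_nab[of "set (leaves t)" "phi_tree t" "set (leaves u)" "phi_tree u"] by simp
qed

lemma phi_tree_nT: "distinct (leaves t) \<Longrightarrow> (phi_tree t :: ct \<Rightarrow>\<^sub>0 'k::field_char_0) \<in> nT (set (leaves t))"
  using iterated_kernel iterated_phi_tree by blast

lemma phi_nT: "x \<in> MT S \<Longrightarrow> phi x \<in> (nT S :: (ct \<Rightarrow>\<^sub>0 'k::field_char_0) set)"
  unfolding phi_def by (rule lin_ext_in_trees_span, assumption) (auto intro: phi_tree_nT)

lemma D_phi:
  assumes "x \<in> MT S"
  shows "D (phi x) = (0 :: ct \<Rightarrow>\<^sub>0 'k::field_char_0)"
proof -
  have "D (phi x) = lin_ext (\<lambda>t. D (phi_tree t)) x"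
    unfolding phi_def by (rule lmap_lin_ext_comp) (rule lmap_D[OF lmap_ident])
  also have "\<dots> = lin_ext (\<lambda>t. 0) x"
    using assms by (intro lin_ext_cong refl) (auto simp: trees_span_def dest: iterated_kernel[OF iterated_phi_tree])
  finally show ?thesis by (simp add: lin_ext_zero)
qed

lemma leaf_subst_absent: "v \<notin> set (leaves t) \<Longrightarrow> leaf_subst v t w = t"
  by (induction t) auto

lemma phi_tree_subst:
  "distinct (leaves t) \<Longrightarrow> v \<in> set (leaves t) \<Longrightarrow>
   phi_tree (leaf_subst v t w) = (sub (Some v) (phi_tree w) (phi_tree t) :: ct \<Rightarrow>\<^sub>0 'k::field_char_0)"
proof (induction t)
  case (Leaf s)
  then show ?case by (simp add: sub_lf)
next
  case (Mul t u)
  have n: "sub (Some v) (phi_tree w) (nab x y) = nab (sub (Some v) (phi_tree w) x) y + nab x (sub (Some v) (phi_tree w) y)"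
    for x y :: "ct \<Rightarrow>\<^sub>0 'k" by (rule sub_nab) simp
  have 0: "sub (Some v) (phi_tree w) (phi_tree t) = (0 :: ct \<Rightarrow>\<^sub>0 'k)" if "distinct (leaves t)" "v \<notin> set (leaves t)" for t
    by (rule sub_absent[OF nT_dT[OF phi_tree_nT]]) (use that in auto)
  show ?case
  proof (cases "v \<in> set (leaves t)")
    case True
    then have "v \<notin> set (leaves u)" using Mul.prems by auto
    then show ?thesis using Mul True 0[of u] by (auto simp: n nab_arith leaf_subst_absent)
  next
    case False
    then show ?thesis using Mul 0[of t] by (auto simp: n nab_arith leaf_subst_absent)
  qed
qed

lemma phi_comp:
  assumes "x \<in> MT S" "v \<in> S"
  shows "phi (mcomp v x y) = (sub (Some v) (phi y) (phi x) :: ct \<Rightarrow>\<^sub>0 'k::field_char_0)"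
proof -
  have "phi (mcomp v x y) = lin_ext (\<lambda>t. lin_ext (\<lambda>w. phi_tree (leaf_subst v t w)) y) x"
    by (simp add: phi_def mcomp_def bilin_ext_def lin_ext_lin_ext)
  also have "\<dots> = lin_ext (\<lambda>t. lin_ext (\<lambda>w. sub (Some v) (phi_tree w) (phi_tree t)) y) x"
    using assms by (intro lin_ext_cong refl phi_tree_subst) (auto simp: trees_span_def)
  also have "\<dots> = sub (Some v) (phi y) (phi x)"
    by (simp add: phi_def lmap_lin_ext_comp[OF lmap_sub_left[OF lmap_ident]] lmap_lin_ext_comp[OF lmap_sub_right[OF lmap_ident]])
  finally show ?thesis .
qed

lemma phi_tree_leaf_map: "phi_tree (leaf_map \<sigma> t) = act \<sigma> (phi_tree t)"
  by (induction t) (simp_all add: act_nab act_lf del: act_basis)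

lemma phi_act: "phi (mact \<sigma> x) = act \<sigma> (phi x)"
  by (simp add: phi_def mact_def lin_ext_lin_ext phi_tree_leaf_map lmap_lin_ext_comp[OF lmap_act[OF lmap_ident]])

lemma mag_arith:
  "mag_mul (x + x') y = mag_mul x y + mag_mul x' y" "mag_mul x (y + y') = mag_mul x y + mag_mul x y'"
  "mag_mul (x - x') y = mag_mul x y - mag_mul x' y" "mag_mul x (y - y') = mag_mul x y - mag_mul x y'"
  "mag_mul (fscale c x) y = fscale c (mag_mul x y)" "mag_mul x (fscale c y) = fscale c (mag_mul x y)"
  "mag_mul 0 y = 0" "mag_mul x 0 = 0"
  by (simp_all add: mag_mul_def bilin_ext_arith)

lemma phi_mul: "phi (mag_mul x y) = nab (phi x) (phi y)"
  by (rule bil_eqI[of "\<lambda>x y. phi (mag_mul x y)" "\<lambda>x y. nab (phi x) (phi y)"])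
    (simp_all add: mag_mul_def, (intro lmap_phi lmap_intros lmap_nab_left lmap_nab_right)+)

text \<open>A black vertex is symmetric in its special children and drops out of the commutator,
  which leaves the commutator of grafting.\<close>

lemma phi_bracket: "phi (mag_bracket x y) = gr (phi y) (phi x) - gr (phi x) (phi y)"
  by (simp add: mag_bracket_def phi_diff phi_mul nab_def mm_commute)

definition jac :: "(magma_tree \<Rightarrow>\<^sub>0 'k::field) \<Rightarrow> (magma_tree \<Rightarrow>\<^sub>0 'k) \<Rightarrow> (magma_tree \<Rightarrow>\<^sub>0 'k) \<Rightarrow> (magma_tree \<Rightarrow>\<^sub>0 'k)" where
  "jac a b c = mag_bracket (mag_bracket a b) c + mag_bracket (mag_bracket b c) a + mag_bracket (mag_bracket c a) b"

lemma jacobiator_eq: "jacobiator = jac (basis (Leaf 1)) (basis (Leaf 2)) (basis (Leaf 3))"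
  by (simp add: jacobiator_def jac_def Let_def)

lemma phi_jac: "phi (jac a b c) = 0"
proof -
  \<comment> \<open>The Jacobi expression of a commutator is an alternating sum of six associators;
    they cancel in pairs by \<open>gr_prelie\<close>.\<close>
  define assoc where "assoc x y z = gr (gr x y) z - gr x (gr y z)" for x y z :: "ct \<Rightarrow>\<^sub>0 'a"
  have "assoc x y z - assoc x z y = 0" for x y z
    using gr_prelie[of x y z] by (simp add: assoc_def)
  moreover have "phi (jac a b c) = (assoc (phi a) (phi b) (phi c) - assoc (phi a) (phi c) (phi b)) -
      (assoc (phi b) (phi a) (phi c) - assoc (phi b) (phi c) (phi a)) +
      (assoc (phi c) (phi a) (phi b) - assoc (phi c) (phi b) (phi a))"
    by (simp add: jac_def assoc_def phi_add phi_bracket gr_arith algebra_simps)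
  ultimately show ?thesis by simp
qed

section \<open>The ideal of the Jacobi identity\<close>

abbreviation LI :: "nat set \<Rightarrow> (magma_tree \<Rightarrow>\<^sub>0 'k::field) \<Rightarrow> bool" where "LI \<equiv> LieAdm_ideal"

lemma LI_intros:
  fixes x y :: "magma_tree \<Rightarrow>\<^sub>0 'k::field"
  shows
  "LI {1, 2, 3} (jacobiator :: magma_tree \<Rightarrow>\<^sub>0 'k)" "LI S (0 :: magma_tree \<Rightarrow>\<^sub>0 'k)" "LI S x \<Longrightarrow> LI S y \<Longrightarrow> LI S (x + y)" "LI S x \<Longrightarrow> LI S (fscale c x)"
  "LI S x \<Longrightarrow> inj_on \<sigma> S \<Longrightarrow> LI (\<sigma> ` S) (mact \<sigma> x)"
  "LI S x \<Longrightarrow> y \<in> MT T \<Longrightarrow> composable S v T \<Longrightarrow> LI ((S - {v}) \<union> T) (mcomp v x y)"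
  "x \<in> MT S \<Longrightarrow> LI T y \<Longrightarrow> composable S v T \<Longrightarrow> LI ((S - {v}) \<union> T) (mcomp v x y)"
  using operad_ideal.zero[where P = "Mag :: ('k, magma_tree \<Rightarrow>\<^sub>0 'k) operad"]
    operad_ideal.add[where P = "Mag :: ('k, magma_tree \<Rightarrow>\<^sub>0 'k) operad"]
    operad_ideal.scale[where P = "Mag :: ('k, magma_tree \<Rightarrow>\<^sub>0 'k) operad"]
    operad_ideal.act[where P = "Mag :: ('k, magma_tree \<Rightarrow>\<^sub>0 'k) operad"]
    operad_ideal.comp_left[where P = "Mag :: ('k, magma_tree \<Rightarrow>\<^sub>0 'k) operad"]
    operad_ideal.comp_right[where P = "Mag :: ('k, magma_tree \<Rightarrow>\<^sub>0 'k) operad"]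
  unfolding LieAdm_ideal_def by (simp_all add: operad_ideal.gen)

lemma LI_diff: "LI S x \<Longrightarrow> LI S y \<Longrightarrow> LI S (x - y)"
  using LI_intros(3)[of S x "fscale (-1) y"] LI_intros(4)[of S y "-1"] by simp

lemma mul_MT: "x \<in> MT S \<Longrightarrow> y \<in> MT T \<Longrightarrow> S \<inter> T = {} \<Longrightarrow> mag_mul x y \<in> MT (S \<union> T)"
  unfolding mag_mul_def
  by (rule bilin_ext_in_trees_span, assumption+) (auto simp: basis_in_trees_span)

lemma bracket_MT: "x \<in> MT S \<Longrightarrow> y \<in> MT T \<Longrightarrow> S \<inter> T = {} \<Longrightarrow> mag_bracket x y \<in> MT (S \<union> T)"
  unfolding mag_bracket_def using mul_MT[of x S y T] mul_MT[of y T x S]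
  by (auto intro!: trees_span_arith simp: Un_commute Int_commute)

lemma leaves_subst:
  "distinct (leaves t) \<Longrightarrow> v \<in> set (leaves t) \<Longrightarrow> distinct (leaves w) \<Longrightarrow> (set (leaves t) - {v}) \<inter> set (leaves w) = {} \<Longrightarrow>
   distinct (leaves (leaf_subst v t w)) \<and> set (leaves (leaf_subst v t w)) = (set (leaves t) - {v}) \<union> set (leaves w)"
proof (induction t)
  case (Mul t u)
  show ?case
  proof (cases "v \<in> set (leaves t)")
    case True
    then have "v \<notin> set (leaves u)" using Mul.prems by auto
    moreover have "distinct (leaves (leaf_subst v t w)) \<and> set (leaves (leaf_subst v t w)) = (set (leaves t) - {v}) \<union> set (leaves w)"
      using Mul True by auto
    ultimately show ?thesis using Mul.prems by (auto simp: leaf_subst_absent)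
  next
    case False
    then have "distinct (leaves (leaf_subst v u w)) \<and> set (leaves (leaf_subst v u w)) = (set (leaves u) - {v}) \<union> set (leaves w)"
      using Mul by auto
    then show ?thesis using Mul.prems False by (auto simp: leaf_subst_absent)
  qed
qed auto

lemma mcomp_MT: "x \<in> MT S \<Longrightarrow> y \<in> MT T \<Longrightarrow> composable S v T \<Longrightarrow> mcomp v x y \<in> MT ((S - {v}) \<union> T)"
  unfolding mcomp_def
  by (rule bilin_ext_in_trees_span, assumption+) (use leaves_subst in \<open>auto simp: basis_in_trees_span\<close>)

lemma LI_phi:
  fixes x :: "magma_tree \<Rightarrow>\<^sub>0 'k::field_char_0"
  shows "LI S x \<Longrightarrow> x \<in> MT S \<and> phi x = 0"
  unfolding LieAdm_ideal_def
proof (induction rule: operad_ideal.induct)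
  case (gen S r)
  have "basis (Leaf n) \<in> (MT {n} :: (magma_tree \<Rightarrow>\<^sub>0 'k) set)" for n by (simp add: basis_in_trees_span)
  note l = this[of 1] this[of 2] this[of 3]
  have "jacobiator \<in> (MT {1, 2, 3} :: (magma_tree \<Rightarrow>\<^sub>0 'k) set)"
    unfolding jacobiator_eq jac_def
    using bracket_MT[OF bracket_MT[OF l(1,2)] l(3)] bracket_MT[OF bracket_MT[OF l(2,3)] l(1)]
      bracket_MT[OF bracket_MT[OF l(3,1)] l(2)]
    by (intro trees_span_arith) (simp_all add: insert_commute)
  then show ?case using gen by (simp add: jacobiator_eq phi_jac)
next
  case (act S x \<sigma>)
  then have "mact \<sigma> x \<in> MT (\<sigma> ` S)"
  proof -
    have "leaves (leaf_map \<sigma> t) = map \<sigma> (leaves t)" for t by (induction t) auto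
    then show ?thesis
      using act unfolding mact_def
      by (intro lin_ext_in_trees_span[where P = "\<lambda>t. distinct (leaves t) \<and> set (leaves t) = S"])
        (auto simp: basis_in_trees_span distinct_map)
  qed
  then show ?case using act by (simp add: phi_act act_zero)
next
  case (comp_left S x y T v)
  then show ?case using phi_comp[of x S v y] by (simp add: mcomp_MT sub_arith)
next
  case (comp_right x S T y v)
  then show ?case using phi_comp[of x S v y] by (simp add: mcomp_MT sub_arith)
qed (simp_all add: trees_span_arith phi_zero phi_add phi_scale)

text \<open>Multiplication is a composition of three elements, so it preserves the ideal.\<close>

lemma mul_eq_comp:
  assumes "x \<in> MT S" "b \<notin> S" "a \<noteq> b"
  shows "mcomp b (mcomp a (basis (Mul (Leaf a) (Leaf b))) x) y = mag_mul x y"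
proof -
  have "mcomp b (mcomp a (basis (Mul (Leaf a) (Leaf b))) x) y =
      lin_ext (\<lambda>w. lin_ext (\<lambda>u. basis (leaf_subst b (Mul w (Leaf b)) u)) y) x"
    using assms(3) by (simp add: mcomp_def bilin_ext_left_basis) (simp add: bilin_ext_def lin_ext_lin_ext)
  also have "\<dots> = mag_mul x y"
    unfolding mag_mul_def bilin_ext_def using assms
    by (intro lin_ext_cong refl) (auto simp: trees_span_def leaf_subst_absent)
  finally show ?thesis .
qed

lemma LI_mul:
  assumes x: "x \<in> MT S" and y: "y \<in> MT T" and ST: "S \<inter> T = {}" "finite S" "finite T"
    and "LI S x \<or> LI T y"
  shows "LI (S \<union> T) (mag_mul x y)"
proof -
  obtain a b where ab: "a \<notin> S \<union> T" "b \<notin> S \<union> T" "a \<noteq> b" using fresh_pair[of "S \<union> T"] ST by auto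
  let ?K = "basis (Mul (Leaf a) (Leaf b)) :: magma_tree \<Rightarrow>\<^sub>0 'a"
  have K: "?K \<in> MT {a, b}" using ab by (auto simp: basis_in_trees_span)
  have c1: "composable {a, b} a S" "({a, b} - {a}) \<union> S = insert b S" using ab by auto
  have c2: "composable (insert b S) b T" "(insert b S - {b}) \<union> T = S \<union> T" using ab ST by auto
  have z: "mcomp a ?K x \<in> MT (insert b S)" using mcomp_MT[OF K x c1(1)] unfolding c1(2) .
  have "LI (S \<union> T) (mcomp b (mcomp a ?K x) y)"
    using assms(6)
  proof
    assume "LI S x"
    then have "LI (insert b S) (mcomp a ?K x)" using LI_intros(7)[OF K _ c1(1)] unfolding c1(2) by blast
    then show ?thesis using LI_intros(6)[OF _ y c2(1)] unfolding c2(2) by blast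
  next
    assume "LI T y"
    then show ?thesis using LI_intros(7)[OF z _ c2(1)] unfolding c2(2) by blast
  qed
  then show ?thesis using mul_eq_comp[OF x, of b a y] ab by simp
qed

lemma LI_bracket:
  assumes x: "x \<in> MT S" and y: "y \<in> MT T" and ST: "S \<inter> T = {}" "finite S" "finite T"
    and "LI S x \<or> LI T y"
  shows "LI (S \<union> T) (mag_bracket x y)"
  unfolding mag_bracket_def
  using LI_mul[OF assms] LI_mul[of y T x S] assms by (intro LI_diff) (auto simp: Un_commute Int_commute)

lemma bracket_arith:
  "mag_bracket (x + x') y = mag_bracket x y + mag_bracket x' y" "mag_bracket x (y + y') = mag_bracket x y + mag_bracket x y'"
  "mag_bracket (x - x') y = mag_bracket x y - mag_bracket x' y" "mag_bracket x (y - y') = mag_bracket x y - mag_bracket x y'"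
  "mag_bracket (fscale c x) y = fscale c (mag_bracket x y)" "mag_bracket x (fscale c y) = fscale c (mag_bracket x y)"
  "mag_bracket 0 y = 0" "mag_bracket x 0 = 0"
  by (simp_all add: mag_bracket_def mag_arith fvs.scale_right_diff_distrib algebra_simps)

lemma jac_arith:
  "jac (x + x') y z = jac x y z + jac x' y z" "jac x (y + y') z = jac x y z + jac x y' z"
  "jac x y (z + z') = jac x y z + jac x y z'"
  "jac (fscale c x) y z = fscale c (jac x y z)" "jac x (fscale c y) z = fscale c (jac x y z)"
  "jac x y (fscale c z) = fscale c (jac x y z)"
  "jac 0 y z = 0" "jac x 0 z = 0" "jac x y 0 = 0"
  by (simp_all add: jac_def bracket_arith fvs.scale_right_distrib algebra_simps)

lemma jac_basis: "jac (basis t) (basis u) (basis w) =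
    basis (Mul (Mul t u) w) - basis (Mul (Mul u t) w) - (basis (Mul w (Mul t u)) - basis (Mul w (Mul u t))) +
    (basis (Mul (Mul u w) t) - basis (Mul (Mul w u) t) - (basis (Mul t (Mul u w)) - basis (Mul t (Mul w u)))) +
    (basis (Mul (Mul w t) u) - basis (Mul (Mul t w) u) - (basis (Mul u (Mul w t)) - basis (Mul u (Mul t w))))"
  by (simp add: jac_def mag_bracket_def mag_mul_def bilin_ext_arith)

lemma mcomp_basis: "mcomp v (basis t) (basis w) = basis (leaf_subst v t w)"
  by (simp add: mcomp_def)

lemma mcomp_left: "mcomp v (x + y) w = mcomp v x w + mcomp v y w" "mcomp v (x - y) w = mcomp v x w - mcomp v y w"
  by (simp_all add: mcomp_def bilin_ext_arith)

text \<open>The generating relation is moved to three fresh labels, at which the trees are then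
  inserted one after another. Freshness keeps each composition meaningful and protects the trees
  already inserted.\<close>

lemma LI_jac_basis:
  assumes t: "distinct (leaves t)" "distinct (leaves u)" "distinct (leaves w)"
    and d: "set (leaves t) \<inter> set (leaves u) = {}" "set (leaves t) \<inter> set (leaves w) = {}" "set (leaves u) \<inter> set (leaves w) = {}"
  shows "LI (set (leaves t) \<union> set (leaves u) \<union> set (leaves w)) (jac (basis t) (basis u) (basis w))"
proof -
  let ?X = "set (leaves t) \<union> set (leaves u) \<union> set (leaves w)"
  obtain a b where ab: "a \<notin> ?X" "b \<notin> ?X" "a \<noteq> b" using fresh_pair[of ?X] by auto
  obtain c where c: "c \<notin> insert a (insert b ?X)"
    using ex_new_if_finite[OF infinite_UNIV_nat, of "insert a (insert b ?X)"] by auto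
  let ?l = "\<lambda>n. basis (Leaf n) :: magma_tree \<Rightarrow>\<^sub>0 'a" and ?b = "\<lambda>t. basis t :: magma_tree \<Rightarrow>\<^sub>0 'a"
  define \<sigma> where "\<sigma> = (\<lambda>n::nat. if n = 1 then a else if n = 2 then b else c)"
  have \<sigma>: "inj_on \<sigma> {1, 2, 3}" "\<sigma> ` {1, 2, 3} = {a, b, c}" using ab c by (auto simp: \<sigma>_def inj_on_def)
  have "mact \<sigma> jacobiator = jac (?l a) (?l b) (?l c)"
    by (simp add: jacobiator_eq jac_basis mact_def lin_ext_arg \<sigma>_def)
  then have 0: "LI {a, b, c} (jac (?l a) (?l b) (?l c))"
    using LI_intros(5)[OF LI_intros(1) \<sigma>(1)] \<sigma>(2) by metis
  have M: "?b v \<in> MT (set (leaves v))" if "distinct (leaves v)" for v using that by (simp add: basis_in_trees_span)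
  have c1: "composable {a, b, c} a (set (leaves t))" "({a, b, c} - {a}) \<union> set (leaves t) = {b, c} \<union> set (leaves t)"
    using ab c by auto
  have 1: "LI ({b, c} \<union> set (leaves t)) (jac (?b t) (?l b) (?l c))"
    using LI_intros(6)[OF 0 M[OF t(1)] c1(1)] ab c unfolding c1(2)
    by (simp add: jac_basis mcomp_left mcomp_basis)
  have c2: "composable ({b, c} \<union> set (leaves t)) b (set (leaves u))"
      "({b, c} \<union> set (leaves t) - {b}) \<union> set (leaves u) = {c} \<union> set (leaves t) \<union> set (leaves u)"
    using ab c d by auto
  have 2: "LI ({c} \<union> set (leaves t) \<union> set (leaves u)) (jac (?b t) (?b u) (?l c))"
    using LI_intros(6)[OF 1 M[OF t(2)] c2(1)] ab c unfolding c2(2)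
    by (simp add: jac_basis mcomp_left mcomp_basis leaf_subst_absent)
  have c3: "composable ({c} \<union> set (leaves t) \<union> set (leaves u)) c (set (leaves w))"
      "({c} \<union> set (leaves t) \<union> set (leaves u) - {c}) \<union> set (leaves w) = ?X"
    using ab c d by auto
  show ?thesis
    using LI_intros(6)[OF 2 M[OF t(3)] c3(1)] ab c unfolding c3(2)
    by (simp add: jac_basis mcomp_left mcomp_basis leaf_subst_absent)
qed

lemma LI_jac:
  fixes x y z :: "magma_tree \<Rightarrow>\<^sub>0 'k::field"
  assumes x: "x \<in> MT S" and y: "y \<in> MT T" and z: "z \<in> MT W" and d: "S \<inter> T = {}" "S \<inter> W = {}" "T \<inter> W = {}"
  shows "LI (S \<union> T \<union> W) (jac x y z)"
proof (rule linear_combination_induct[of "\<lambda>x. LI (S \<union> T \<union> W) (jac x y z)"])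
  fix t assume t: "t \<in> Poly_Mapping.keys x"
  show "LI (S \<union> T \<union> W) (jac (basis t) y z)"
  proof (rule linear_combination_induct[of "\<lambda>y. LI (S \<union> T \<union> W) (jac (basis t) y z)"])
    fix u assume u: "u \<in> Poly_Mapping.keys y"
    show "LI (S \<union> T \<union> W) (jac (basis t) (basis u) z)"
    proof (rule linear_combination_induct[of "\<lambda>z. LI (S \<union> T \<union> W) (jac (basis t) (basis u) z)"])
      fix w assume "w \<in> Poly_Mapping.keys z"
      then show "LI (S \<union> T \<union> W) (jac (basis t) (basis u) (basis w))"
        using LI_jac_basis[of t u w] t u assms by (auto simp: trees_span_def)
    qed (simp_all add: jac_arith LI_intros)
  qed (simp_all add: jac_arith LI_intros)
qed (simp_all add: jac_arith LI_intros)

section \<open>Normal forms in the free Lie-admissible algebra\<close>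

text \<open>
  \<open>LieAdm\<close> is the coproduct of the Lie operad and the operad of a commutative magma; \<open>Br\<close> stands for
  the bracket and \<open>Sy\<close> for the commutative product. In a normal form, brackets are left-normed and
  start with the letter containing the smallest label.
\<close>

datatype bt = Lf nat | Br bt bt | Sy bt bt

primrec labs :: "bt \<Rightarrow> nat set" where
  "labs (Lf s) = {s}"
| "labs (Br t u) = labs t \<union> labs u"
| "labs (Sy t u) = labs t \<union> labs u"

primrec first :: "bt \<Rightarrow> nat" where
  "first (Lf s) = s"
| "first (Br t u) = first t"
| "first (Sy t u) = first t"

primrec is_Br :: "bt \<Rightarrow> bool" where
  "is_Br (Lf s) \<longleftrightarrow> False"
| "is_Br (Br t u) \<longleftrightarrow> True"
| "is_Br (Sy t u) \<longleftrightarrow> False"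

primrec normal :: "bt \<Rightarrow> bool" where
  "normal (Lf s) \<longleftrightarrow> True"
| "normal (Br t u) \<longleftrightarrow> normal t \<and> normal u \<and> \<not> is_Br u \<and> labs t \<inter> labs u = {} \<and> first t < first u"
| "normal (Sy t u) \<longleftrightarrow> normal t \<and> normal u \<and> labs t \<inter> labs u = {} \<and> first t < first u"

definition NF :: "nat set \<Rightarrow> bt set" where
  "NF S = {N. normal N \<and> labs N = S}"

lemma first_in_labs: "first N \<in> labs N"
  by (induction N) auto

lemma finite_labs: "finite (labs N)"
  by (induction N) auto

text \<open>In both products the factor with the smaller first label stands on the left, so the
  leftmost label is the smallest of all.\<close>

lemma first_le: "normal N \<Longrightarrow> s \<in> labs N \<Longrightarrow> first N \<le> s"
  by (induction N) force+

lemma first_eq_Min: "normal N \<Longrightarrow> first N = Min (labs N)"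
  by (metis Min_eqI finite_labs first_in_labs first_le)

primrec evM :: "bt \<Rightarrow> (magma_tree \<Rightarrow>\<^sub>0 'k::field)" where
  "evM (Lf s) = basis (Leaf s)"
| "evM (Br t u) = mag_bracket (evM t) (evM u)"
| "evM (Sy t u) = mag_mul (evM t) (evM u) + mag_mul (evM u) (evM t)"

lemma evM_MT: "normal N \<Longrightarrow> evM N \<in> MT (labs N)"
proof (induction N)
  case (Sy t u)
  then show ?case
    using mul_MT[of "evM t" "labs t" "evM u" "labs u"] mul_MT[of "evM u" "labs u" "evM t" "labs t"]
    by (auto intro!: trees_span_arith simp: Un_commute Int_commute)
qed (auto simp: basis_in_trees_span intro: bracket_MT)

text \<open>What reduces to normal forms modulo the ideal. Congruences in the free magma are used
  instead of cosets, so that the bilinear calculus stays available.\<close>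

definition Sp :: "nat set \<Rightarrow> (magma_tree \<Rightarrow>\<^sub>0 'k::field) set" where
  "Sp S = {x. \<exists>z\<in>fvs.span (evM ` NF S). LI S (x - z)}"

lemma span_MT: "z \<in> fvs.span (evM ` NF S) \<Longrightarrow> z \<in> MT S"
  by (induction rule: fvs.span_induct_alt) (auto simp: NF_def intro!: trees_span_arith evM_MT)

lemma Sp_ideal: "LI S x \<Longrightarrow> x \<in> Sp S"
  unfolding Sp_def by (auto intro!: bexI[of _ 0] fvs.span_zero)

lemma Sp_add: "x \<in> Sp S \<Longrightarrow> y \<in> Sp S \<Longrightarrow> x + y \<in> Sp S"
proof -
  assume "x \<in> Sp S" "y \<in> Sp S"
  then obtain z z' where z: "z \<in> fvs.span (evM ` NF S)" "LI S (x - z)" "z' \<in> fvs.span (evM ` NF S)" "LI S (y - z')"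
    by (auto simp: Sp_def)
  have e: "x + y - (z + z') = (x - z) + (y - z')" by simp
  have "LI S (x + y - (z + z'))" unfolding e by (rule LI_intros(3)[OF z(2,4)])
  then show ?thesis unfolding Sp_def using fvs.span_add[OF z(1,3)] by blast
qed

lemma Sp_scale: "x \<in> Sp S \<Longrightarrow> fscale c x \<in> Sp S"
proof -
  assume "x \<in> Sp S"
  then obtain z where z: "z \<in> fvs.span (evM ` NF S)" "LI S (x - z)"
    by (auto simp: Sp_def)
  have "LI S (fscale c x - fscale c z)" using LI_intros(4)[OF z(2), of c] by (simp add: fvs.scale_right_diff_distrib)
  then show ?thesis unfolding Sp_def using fvs.span_scale[OF z(1)] by blast
qed

lemma Sp_diff: "x \<in> Sp S \<Longrightarrow> y \<in> Sp S \<Longrightarrow> x - y \<in> Sp S"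
  using Sp_add[of x S "fscale (-1) y"] Sp_scale[of y S "-1"] by simp

lemma Sp_normal: "N \<in> NF S \<Longrightarrow> evM N \<in> Sp S"
  unfolding Sp_def by (rule CollectI, rule bexI[of _ "evM N"]) (auto simp: LI_intros intro: fvs.span_base)

lemma Sp_linear:
  assumes lin: "lmap g"
    and ideal: "\<And>x. x \<in> MT S \<Longrightarrow> LI S x \<Longrightarrow> LI S' (g x)"
    and nf: "\<And>N. N \<in> NF S \<Longrightarrow> g (evM N) \<in> Sp S'"
    and x: "x \<in> Sp S" "x \<in> MT S"
  shows "g x \<in> Sp S'"
proof -
  obtain z where z: "z \<in> fvs.span (evM ` NF S)" "LI S (x - z)" using x by (auto simp: Sp_def)
  have "g z \<in> Sp S'"
    using z(1)
  proof (induction rule: fvs.span_induct_alt)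
    case base
    then show ?case by (simp add: lmap_zero[OF lin] Sp_ideal LI_intros)
  next
    case (step c e w)
    then show ?case using nf by (auto simp: lmap_add[OF lin] lmap_scale[OF lin] intro!: Sp_add Sp_scale)
  qed
  moreover have "g x = g z + g (x - z)" by (simp add: lmap_diff[OF lin])
  moreover have "LI S' (g (x - z))"
    using ideal[of "x - z"] z(2) span_MT[OF z(1)] x by (auto intro: trees_span_arith)
  ultimately show ?thesis by (simp add: Sp_add Sp_ideal)
qed

lemma Sp_bilinear:
  assumes lin: "\<And>y. lmap (\<lambda>x. f x y)" "\<And>x. lmap (f x)"
    and ideal: "\<And>x y. x \<in> MT S \<Longrightarrow> y \<in> MT T \<Longrightarrow> LI S x \<or> LI T y \<Longrightarrow> LI (S \<union> T) (f x y)"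
    and nf: "\<And>N N'. N \<in> NF S \<Longrightarrow> N' \<in> NF T \<Longrightarrow> f (evM N) (evM N') \<in> Sp (S \<union> T)"
    and x: "x \<in> Sp S" "x \<in> MT S" and y: "y \<in> Sp T" "y \<in> MT T"
  shows "f x y \<in> Sp (S \<union> T)"
proof (rule Sp_linear[where g = "\<lambda>x. f x y", OF lin(1) _ _ x])
  show "LI (S \<union> T) (f x y)" if "x \<in> MT S" "LI S x" for x
    using ideal that y by blast
  show "f (evM N) y \<in> Sp (S \<union> T)" if "N \<in> NF S" for N
    by (rule Sp_linear[where g = "f (evM N)", OF lin(2) _ _ y])
      (use ideal[of "evM N"] nf that evM_MT in \<open>auto simp: NF_def\<close>)
qed

lemma lmap_bracket: "lmap (\<lambda>x. mag_bracket x y)" "lmap (mag_bracket x)"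
  by (intro lmapI; simp add: bracket_arith)+

lemma lmap_mul: "lmap (\<lambda>x. mag_mul x y)" "lmap (mag_mul x)"
  by (intro lmapI; simp add: mag_arith)+

lemma bracket_antisym: "mag_bracket x y = fscale (-1) (mag_bracket y x)"
  by (simp add: mag_bracket_def)

lemma NF_finite: "N \<in> NF S \<Longrightarrow> finite S"
  using finite_labs by (auto simp: NF_def)

lemma evM_NF_MT: "N \<in> NF S \<Longrightarrow> evM N \<in> MT S"
  using evM_MT by (auto simp: NF_def)

text \<open>If the right factor is itself a bracket of \<open>u1\<close> and \<open>u2\<close>, the
  Jacobi identity replaces it by bracketing with \<open>u1\<close> and \<open>u2\<close> in both
  orders. The right factors become smaller, while the smallest label stays in the leftmost
  letter.\<close>

lemma bracket_Sp:
  "N \<in> NF S \<Longrightarrow> N' \<in> NF T \<Longrightarrow> S \<inter> T = {} \<Longrightarrow> first N < first N' \<Longrightarrow>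
   (mag_bracket (evM N) (evM N') :: magma_tree \<Rightarrow>\<^sub>0 'k::field) \<in> Sp (S \<union> T)"
proof (induction N' arbitrary: N S T rule: measure_induct_rule[of size])
  case (less N')
  have fin: "finite S" "finite T" using less.prems NF_finite by blast+
  show ?case
  proof (cases "is_Br N'")
    case False
    then have "Br N N' \<in> NF (S \<union> T)" using less.prems by (auto simp: NF_def)
    then show ?thesis using Sp_normal[of "Br N N'" "S \<union> T"] by simp
  next
    case True
    then obtain u1 u2 where N': "N' = Br u1 u2" by (cases N') auto
    define U1 U2 where "U1 = labs u1" and "U2 = labs u2"
    have u: "u1 \<in> NF U1" "u2 \<in> NF U2" "T = U1 \<union> U2" "U1 \<inter> U2 = {}" "first u1 < first u2"
      using less.prems by (auto simp: N' NF_def U1_def U2_def)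
    have d: "S \<inter> U1 = {}" "S \<inter> U2 = {}" "U2 \<inter> U1 = {}" using less.prems u by auto
    have fin: "finite S" "finite U1" "finite U2" using fin u by auto
    note M = evM_NF_MT[OF less.prems(1)] evM_NF_MT[OF u(1)] evM_NF_MT[OF u(2)]
    have step: "mag_bracket (mag_bracket (evM N) (evM u)) (evM u') \<in> (Sp (S \<union> U \<union> U') :: (magma_tree \<Rightarrow>\<^sub>0 'k) set)"
      if u: "u \<in> NF U" "u' \<in> NF U'" and d: "S \<inter> U = {}" "S \<inter> U' = {}" "U \<inter> U' = {}" and f: "first N < first u" "first N < first u'"
        and sz: "size u < size N'" "size u' < size N'" for u u' U U'
    proof (rule Sp_linear[where g = "\<lambda>x. mag_bracket x (evM u')" and S = "S \<union> U", OF lmap_bracket(1)])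
      have fin: "finite S" "finite U" "finite U'" using less.prems u NF_finite by blast+
      show "LI (S \<union> U \<union> U') (mag_bracket x (evM u'))" if "x \<in> MT (S \<union> U)" "LI (S \<union> U) x"
        for x :: "magma_tree \<Rightarrow>\<^sub>0 'k"
        using LI_bracket[OF that(1) evM_NF_MT[OF u(2)]] that(2) d fin by blast
      show "mag_bracket (evM n) (evM u') \<in> (Sp (S \<union> U \<union> U') :: (magma_tree \<Rightarrow>\<^sub>0 'k) set)" if "n \<in> NF (S \<union> U)" for n
      proof (rule less.IH[OF sz(2) that u(2)])
        show "(S \<union> U) \<inter> U' = {}" using d by auto
        \<comment> \<open>The inner bracket is only congruent to a combination of normal forms
          \<open>n\<close>. Their labels include \<open>first N\<close>, so their first label is
          still small enough for the induction.\<close>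
        have "first n \<le> first N"
          using first_le[of n "first N"] first_in_labs[of N] that less.prems(1) by (auto simp: NF_def)
        then show "first n < first u'" using f by simp
      qed
      show "mag_bracket (evM N) (evM u) \<in> (Sp (S \<union> U) :: (magma_tree \<Rightarrow>\<^sub>0 'k) set)"
        by (rule less.IH) (use less.prems u d f sz in auto)
      show "mag_bracket (evM N) (evM u) \<in> (MT (S \<union> U) :: (magma_tree \<Rightarrow>\<^sub>0 'k) set)"
        using bracket_MT evM_NF_MT less.prems(1) u(1) d(1) by blast
    qed
    have f: "first N < first u1" "first N < first u2" using less.prems(4) u(5) by (simp_all add: N')
    have "mag_bracket (mag_bracket (evM N) (evM u1)) (evM u2) \<in> (Sp (S \<union> T) :: (magma_tree \<Rightarrow>\<^sub>0 'k) set)"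
      using step[OF u(1,2)] d u f N' by (simp add: Un_assoc Int_commute)
    moreover have "mag_bracket (mag_bracket (evM N) (evM u2)) (evM u1) \<in> (Sp (S \<union> T) :: (magma_tree \<Rightarrow>\<^sub>0 'k) set)"
      using step[OF u(2,1)] d u f N' by (simp add: Un_ac)
    moreover have "LI (S \<union> T) (jac (evM N) (evM u1) (evM u2) :: magma_tree \<Rightarrow>\<^sub>0 'k)"
      using LI_jac[OF M] d u by (simp add: Un_assoc Int_commute)
    moreover have "mag_bracket (evM N) (evM N') =
        mag_bracket (mag_bracket (evM N) (evM u1)) (evM u2) - mag_bracket (mag_bracket (evM N) (evM u2)) (evM u1) -
        (jac (evM N) (evM u1) (evM u2) :: magma_tree \<Rightarrow>\<^sub>0 'k)"
      by (simp add: N' jac_def mag_bracket_def mag_arith)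
    ultimately show ?thesis by (simp add: Sp_diff Sp_ideal)
  qed
qed

text \<open>The product is half the sum of commutator and anticommutator. The anticommutator is a
  normal form up to the order of its factors, and the commutator reduces by
  \<open>bracket_Sp\<close>.\<close>

lemma mul_Sp:
  assumes "N \<in> NF S" "N' \<in> NF T" "S \<inter> T = {}"
  shows "(mag_mul (evM N) (evM N') :: magma_tree \<Rightarrow>\<^sub>0 'k::field_char_0) \<in> Sp (S \<union> T)"
proof -
  have "first N \<in> S" "first N' \<in> T" using assms first_in_labs by (auto simp: NF_def)
  then consider "first N < first N'" | "first N' < first N" using assms(3) by (metis IntI empty_iff linorder_neqE_nat)
  then have "mag_bracket (evM N) (evM N') \<in> (Sp (S \<union> T) :: (magma_tree \<Rightarrow>\<^sub>0 'k) set) \<and>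
      mag_mul (evM N) (evM N') + mag_mul (evM N') (evM N) \<in> (Sp (S \<union> T) :: (magma_tree \<Rightarrow>\<^sub>0 'k) set)"
  proof cases
    case 1
    then have "Sy N N' \<in> NF (S \<union> T)" using assms by (auto simp: NF_def)
    then show ?thesis using Sp_normal[of "Sy N N'" "S \<union> T"] bracket_Sp[OF assms 1] by simp
  next
    case 2
    then have "Sy N' N \<in> NF (S \<union> T)" using assms by (auto simp: NF_def)
    moreover have "mag_bracket (evM N') (evM N) \<in> (Sp (S \<union> T) :: (magma_tree \<Rightarrow>\<^sub>0 'k) set)"
      using bracket_Sp[OF assms(2,1) _ 2] assms(3) by (simp add: Un_commute Int_commute)
    then have "mag_bracket (evM N) (evM N') \<in> (Sp (S \<union> T) :: (magma_tree \<Rightarrow>\<^sub>0 'k) set)"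
      by (subst bracket_antisym) (rule Sp_scale)
    ultimately show ?thesis using Sp_normal[of "Sy N' N" "S \<union> T"] by (simp add: add.commute)
  qed
  moreover have "mag_mul (evM N) (evM N') = fscale (1 / 2) (mag_bracket (evM N) (evM N') +
      (mag_mul (evM N) (evM N') + mag_mul (evM N') (evM N)) :: magma_tree \<Rightarrow>\<^sub>0 'k)"
  proof -
    have "a = fscale (1 / 2) ((a - b) + (a + b))" for a b :: "magma_tree \<Rightarrow>\<^sub>0 'k"
    proof -
      have "(a - b) + (a + b) = fscale 1 a + fscale 1 a" by simp
      also have "\<dots> = fscale 2 a" by (simp only: fvs.scale_left_distrib[symmetric]) simp
      finally show ?thesis by simp
    qed
    then show ?thesis unfolding mag_bracket_def by blast
  qed
  ultimately show ?thesis using Sp_scale Sp_add by metis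
qed

theorem MT_Sp: "x \<in> MT S \<Longrightarrow> x \<in> (Sp S :: (magma_tree \<Rightarrow>\<^sub>0 'k::field_char_0) set)"
proof -
  have tree: "basis t \<in> (Sp (set (leaves t)) :: (magma_tree \<Rightarrow>\<^sub>0 'k) set)" if "distinct (leaves t)" for t
    using that
  proof (induction t)
    case (Leaf s)
    have "Lf s \<in> NF {s}" by (simp add: NF_def)
    then show ?case using Sp_normal[of "Lf s" "{s}"] by simp
  next
    case (Mul t u)
    let ?t = "basis t :: magma_tree \<Rightarrow>\<^sub>0 'k" and ?u = "basis u :: magma_tree \<Rightarrow>\<^sub>0 'k"
    have "mag_mul ?t ?u \<in> Sp (set (leaves t) \<union> set (leaves u))"
    proof (rule Sp_bilinear[of mag_mul])
      show "lmap (\<lambda>x. mag_mul x y)" "lmap (mag_mul x)" for x y by (rule lmap_mul)+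
      show "LI (set (leaves t) \<union> set (leaves u)) (mag_mul x y)"
        if "x \<in> MT (set (leaves t))" "y \<in> MT (set (leaves u))" "LI (set (leaves t)) x \<or> LI (set (leaves u)) y" for x y
        using LI_mul[OF that(1,2) _ _ _ that(3)] Mul.prems by simp
      show "mag_mul (evM N) (evM N') \<in> (Sp (set (leaves t) \<union> set (leaves u)) :: (magma_tree \<Rightarrow>\<^sub>0 'k) set)"
        if "N \<in> NF (set (leaves t))" "N' \<in> NF (set (leaves u))" for N N'
        using mul_Sp[OF that] Mul.prems by simp
    qed (use Mul in \<open>auto simp: basis_in_trees_span\<close>)
    then show ?case by (simp add: mag_mul_def)
  qed
  show "x \<in> MT S \<Longrightarrow> x \<in> Sp S"
    by (rule linear_combination_induct[of "\<lambda>x. x \<in> Sp S"])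
      (use tree in \<open>auto simp: trees_span_def intro: Sp_add Sp_scale Sp_ideal LI_intros(2)\<close>)
qed

section \<open>Leading trees of normal forms\<close>

text \<open>The image of \<open>evM\<close> under \<open>phi\<close>, see \<open>phi_evM\<close>. In
  \<open>Sy\<close> the two halves of the black vertex add up to a whole one.\<close>

primrec ev :: "bt \<Rightarrow> (ct \<Rightarrow>\<^sub>0 'k::field)" where
  "ev (Lf s) = lf s"
| "ev (Br t u) = gr (ev u) (ev t) - gr (ev t) (ev u)"
| "ev (Sy t u) = gr (ev u) (ev t) + gr (ev t) (ev u) + mm (ev t) (ev u)"

lemma phi_evM: "phi (evM N) = (ev N :: ct \<Rightarrow>\<^sub>0 'k::field_char_0)"
proof (induction N)
  case (Sy t u)
  have "nab x y + nab y x = gr y x + gr x y + mm x y" for x y :: "ct \<Rightarrow>\<^sub>0 'k"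
  proof -
    have "fscale (1/2) (mm x y) + fscale (1/2) (mm x y) = mm x y"
      by (simp only: fvs.scale_left_distrib[symmetric]) simp
    then show ?thesis by (simp add: nab_def mm_commute[of y x] algebra_simps)
  qed
  then show ?case using Sy by (simp add: phi_add phi_mul)
qed (simp_all add: phi_bracket)

lemma ev_nT: "normal N \<Longrightarrow> (ev N :: ct \<Rightarrow>\<^sub>0 'k::field_char_0) \<in> nT (labs N)"
  using phi_nT[OF evM_MT] phi_evM by metis

text \<open>
  Special edges cost the number of white vertices above them, and each black vertex is rewarded by
  \<open>B\<close>, which is to be larger than the number of white vertices. So trees with more black vertices are
  lighter, and grafting is lightest along ordinary edges from the root.
\<close>

primrec wt :: "nat \<Rightarrow> ct \<Rightarrow> int" where
  "wt B (White i l C) = \<Sum>\<^sub># (image_mset (wt B) C)"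
| "wt B (Black i E C) = \<Sum>\<^sub># (image_mset (wt B) E) + int (size (\<Sum>\<^sub># (image_mset white_labels E))) +
     \<Sum>\<^sub># (image_mset (wt B) C) - int B"

text \<open>The labels of the first letter when the tree is read as a word along ordinary edges from
  the root. Lightest graftings preserve them, which tells which factor of a bracket has provided the
  root.\<close>

primrec root_labels :: "ct \<Rightarrow> nat option multiset" where
  "root_labels (White i l C) = {#l#}"
| "root_labels (Black i E C) = \<Sum>\<^sub># (image_mset white_labels E)"

text \<open>On a \<open>ladder\<close> this puts \<open>y\<close> on top of the chain of ordinary
  edges that starts at the root.\<close>

primrec ext :: "ct \<Rightarrow> ct \<Rightarrow> ct" where
  "ext y (White i l C) = White i l (if C = {#} then {#y#} else image_mset (ext y) C)"
| "ext y (Black i E C) = Black i E (if C = {#} then {#y#} else image_mset (ext y) C)"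

text \<open>The ordinary edges met from the root on form a single chain, as is natural for a word;
  what hangs from special edges is arbitrary.\<close>

inductive ladder :: "ct \<Rightarrow> bool" where
  "ladder (White i l {#})"
| "ladder (Black i E {#})"
| "ladder c \<Longrightarrow> ladder (White i l {#c#})"
| "ladder c \<Longrightarrow> ladder (Black i E {#c#})"

lemma ladder_White: "ladder (White i l C) \<longleftrightarrow> C = {#} \<or> (\<exists>c. C = {#c#} \<and> ladder c)"
  by (subst ladder.simps) auto

lemma ladder_Black: "ladder (Black i E C) \<longleftrightarrow> C = {#} \<or> (\<exists>c. C = {#c#} \<and> ladder c)"
  by (subst ladder.simps) auto

text \<open>The leading tree: a left-normed bracket becomes a chain of ordinary edges with the first
  letter at the root, a commutative product becomes a black vertex.\<close>

primrec lt :: "bt \<Rightarrow> ct" where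
  "lt (Lf s) = unit_tree s"
| "lt (Br t u) = ext (lt u) (lt t)"
| "lt (Sy t u) = Black () {#lt t, lt u#} {#}"

lemma white_labels_nonempty: "two_special T \<Longrightarrow> white_labels T \<noteq> {#}"
proof (induction T)
  case (Black i E C)
  then obtain x y where "E = {#x, y#}" by (auto elim: size_2E)
  then show ?case using Black by auto
qed simp

lemma size_white_labels_pos: "two_special T \<Longrightarrow> 0 < size (white_labels T)"
  using white_labels_nonempty by (simp add: nonempty_has_size)

text \<open>Each special edge below the place of \<open>y\<close> costs the number of labels of
  \<open>y\<close>, which is positive; otherwise grafting is free. In the free case nothing above a
  special edge of the root changes.\<close>

lemma graft_wt:
  assumes "t \<in> Poly_Mapping.keys (graft y T :: ct \<Rightarrow>\<^sub>0 'k::field)" "two_special y"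
  shows "wt B T + wt B y \<le> wt B t" "wt B t = wt B T + wt B y \<Longrightarrow> root_labels t = root_labels T"
proof -
  have pos: "0 < size (white_labels y)" using assms(2) by (rule size_white_labels_pos)
  have "wt B T + wt B y \<le> wt B t \<and> (wt B t = wt B T + wt B y \<longrightarrow> root_labels t = root_labels T) \<and>
      size (white_labels t) = size (white_labels T) + size (white_labels y)"
    using assms(1)
  proof (induction rule: graft_keys_induct)
    case (root T)
    then show ?case by (cases T) auto
  qed (use pos in auto)
  then show "wt B T + wt B y \<le> wt B t" "wt B t = wt B T + wt B y \<Longrightarrow> root_labels t = root_labels T" by auto
qed

lemma lookup_lin_ext_inj:
  assumes "\<And>a b. f a = f b \<Longrightarrow> a = b"
  shows "Poly_Mapping.lookup (lin_ext (\<lambda>t. basis (f t)) x) (f d) = Poly_Mapping.lookup x d"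
proof -
  have "Poly_Mapping.lookup (lin_ext (\<lambda>t. basis (f t)) x) (f d) =
      (\<Sum>a\<in>Poly_Mapping.keys x. if a = d then Poly_Mapping.lookup x a else 0)"
    unfolding lookup_lin_ext by (intro sum.cong refl) (auto simp: lookup_single when_def dest: assms)
  then show ?thesis by (simp add: in_keys_iff)
qed

lemma lookup_eq_0: "t \<notin> Poly_Mapping.keys x \<Longrightarrow> Poly_Mapping.lookup x t = 0"
  by (simp add: in_keys_iff)

lemma size_cases: "C = {#} \<or> (\<exists>c. C = {#c#}) \<or> 2 \<le> size C"
proof (cases C)
  case (add c C')
  then show ?thesis by (cases C') auto
qed simp

text \<open>The assumption on the weight rules out places above a special edge. At an inner vertex
  of the chain \<open>y\<close> would create a branching, so a ladder can only arise at the top of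
  the chain, and in one way.\<close>

lemma graft_lookup_ladder:
  assumes "ladder L" "two_special y" "wt B L = wt B X + wt B y"
  shows "Poly_Mapping.lookup (graft y X :: ct \<Rightarrow>\<^sub>0 'k::field) L = of_bool (ladder X \<and> L = ext y X)"
  using assms(1,3)
proof (induction X arbitrary: L rule: ct_induct)
  case (step X)
  show ?case
  proof (cases X)
    case (White i l C)
    show ?thesis
    proof (cases "C = {#} \<or> (\<exists>c. C = {#c#})")
      case False
      then have sz: "size C \<ge> 2"
        using size_cases[of C] by blast
      have "L \<notin> Poly_Mapping.keys (graft y X :: ct \<Rightarrow>\<^sub>0 'k)"
      proof
        assume "L \<in> Poly_Mapping.keys (graft y X :: ct \<Rightarrow>\<^sub>0 'k)"
        then obtain D where "L = White i l D" "size D \<ge> 2"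
          unfolding White graft_White using sz by (auto elim!: keys_addE keys_lin_ext_basisE dest!: keys_msum)
        then show False using step.prems(1) by (auto simp: ladder_White)
      qed
      then show ?thesis using False by (auto simp: White ladder_White lookup_eq_0)
    next
      case True
      then show ?thesis
      proof
        assume "C = {#}"
        then show ?thesis by (simp add: White graft_White lookup_single when_def ladder_White eq_commute)
      next
        assume "\<exists>c. C = {#c#}"
        then obtain c where C: "C = {#c#}" by blast
        have 1: "Poly_Mapping.lookup (basis (White i l {#y, c#}) :: ct \<Rightarrow>\<^sub>0 'k) L = 0"
          using step.prems(1) by (auto simp: lookup_single when_def ladder_White)
        show ?thesis
        proof (cases "\<exists>d. L = White i l {#d#}")
          case True
          then obtain d where L: "L = White i l {#d#}" by blast
          have "Poly_Mapping.lookup (graft y c :: ct \<Rightarrow>\<^sub>0 'k) d = of_bool (ladder c \<and> d = ext y c)"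
            using step.IH[of False c d] step.prems by (simp add: White C L ladder_White)
          then show ?thesis
            using 1 lookup_lin_ext_inj[of "\<lambda>t. White i l {#t#}" "graft y c :: ct \<Rightarrow>\<^sub>0 'k" d]
            by (cases "ladder c \<and> d = ext y c") (auto simp: White C L graft_White lookup_add ladder_White)
        next
          case False
          then have "L \<notin> Poly_Mapping.keys (lin_ext (\<lambda>t. basis (White i l {#t#})) (graft y c) :: ct \<Rightarrow>\<^sub>0 'k)"
            by (auto elim!: keys_lin_ext_basisE)
          then show ?thesis using 1 False by (simp add: White C graft_White lookup_add lookup_eq_0)
        qed
      qed
    qed
  next
    case (Black i E C)
    let ?s = "msum (\<lambda>e R. lin_ext (\<lambda>t. basis (Black i (add_mset t R) C)) (graft y e)) E :: ct \<Rightarrow>\<^sub>0 'k"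
    have s: "Poly_Mapping.lookup ?s L = 0"
    proof (rule lookup_eq_0, rule notI)
      assume "L \<in> Poly_Mapping.keys ?s"
      then obtain e R u where E: "E = add_mset e R" "u \<in> Poly_Mapping.keys (graft y e :: ct \<Rightarrow>\<^sub>0 'k)"
        "L = Black i (add_mset u R) C" by (auto dest!: keys_msum elim!: keys_lin_ext_basisE)
      then show False
        using step.prems(2) graft_wt(1)[OF E(2) assms(2), of B] white_labels_graft[OF E(2)]
          size_white_labels_pos[OF assms(2)] by (simp add: Black)
    qed
    show ?thesis
    proof (cases "C = {#} \<or> (\<exists>c. C = {#c#})")
      case False
      then have sz: "size C \<ge> 2"
        using size_cases[of C] by blast
      have "L \<notin> Poly_Mapping.keys (graft y X :: ct \<Rightarrow>\<^sub>0 'k)"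
      proof
        assume "L \<in> Poly_Mapping.keys (graft y X :: ct \<Rightarrow>\<^sub>0 'k)"
        then obtain D E' where "L = Black i E' D" "size D \<ge> 2"
          unfolding Black graft_Black using sz by (auto elim!: keys_addE keys_lin_ext_basisE dest!: keys_msum)
        then show False using step.prems(1) by (auto simp: ladder_Black)
      qed
      then show ?thesis using False by (auto simp: Black ladder_Black lookup_eq_0)
    next
      case True
      then show ?thesis
      proof
        assume "C = {#}"
        then show ?thesis using s
          by (cases "L = Black i E {#y#}") (auto simp: Black graft_Black lookup_add lookup_single when_def ladder_Black)
      next
        assume "\<exists>c. C = {#c#}"
        then obtain c where C: "C = {#c#}" by blast
        have 1: "Poly_Mapping.lookup (basis (Black i E {#y, c#}) :: ct \<Rightarrow>\<^sub>0 'k) L = 0"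
          using step.prems(1) by (auto simp: lookup_single when_def ladder_Black)
        show ?thesis
        proof (cases "\<exists>d. L = Black i E {#d#}")
          case True
          then obtain d where L: "L = Black i E {#d#}" by blast
          have "Poly_Mapping.lookup (graft y c :: ct \<Rightarrow>\<^sub>0 'k) d = of_bool (ladder c \<and> d = ext y c)"
            using step.IH[of False c d] step.prems by (simp add: Black C L ladder_Black)
          then show ?thesis
            using 1 s lookup_lin_ext_inj[of "\<lambda>t. Black i E {#t#}" "graft y c :: ct \<Rightarrow>\<^sub>0 'k" d]
            by (cases "ladder c \<and> d = ext y c") (auto simp: Black C L graft_Black lookup_add ladder_Black)
        next
          case False
          then have "L \<notin> Poly_Mapping.keys (lin_ext (\<lambda>t. basis (Black i E {#t#})) (graft y c) :: ct \<Rightarrow>\<^sub>0 'k)"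
            by (auto elim!: keys_lin_ext_basisE)
          then show ?thesis using 1 s False by (simp add: Black C graft_Black lookup_add lookup_eq_0)
        qed
      qed
    qed
  qed
qed

section \<open>Chains of ordinary edges and leading trees\<close>

lemma ordinary_ext: "ordinary (ext y X) \<noteq> {#}"
  by (cases X) auto

lemma root_labels_ext: "root_labels (ext y X) = root_labels X"
  by (cases X) auto

lemma ladder_ext: "ladder X \<Longrightarrow> ladder y \<Longrightarrow> ladder (ext y X)"
  by (induction rule: ladder.induct) (auto intro: ladder.intros)

lemma wt_ext: "ladder X \<Longrightarrow> wt B (ext y X) = wt B X + wt B y"
  by (induction rule: ladder.induct) auto

lemma white_labels_ext: "ladder X \<Longrightarrow> white_labels (ext y X) = white_labels X + white_labels y"
  by (induction rule: ladder.induct) auto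

lemma two_special_ext: "ladder X \<Longrightarrow> two_special X \<Longrightarrow> two_special y \<Longrightarrow> two_special (ext y X)"
  by (induction rule: ladder.induct) auto

text \<open>As \<open>Y\<close> and \<open>Y'\<close> have no ordinary edges at their roots, the
  chain ends exactly where they begin, so the last letter can be cut off unambiguously.\<close>

lemma ext_inj:
  assumes "ladder X" "ladder X'" "ordinary Y = {#}" "ordinary Y' = {#}" "ext Y X = ext Y' X'"
  shows "X = X' \<and> Y = Y'"
  using assms
proof (induction arbitrary: X' rule: ladder.induct)
  case (1 i l)
  obtain C where X': "X' = White i l C" using 1(4) by (cases X') simp_all
  then consider "C = {#}" | c' where "C = {#c'#}" "ladder c'" using 1(1) by (auto simp: ladder_White)
  then show ?case
  proof cases
    case 1
    then show ?thesis using \<open>ext Y _ = ext Y' X'\<close> X' by simp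
  next
    case 2
    then show ?thesis using \<open>ext Y _ = ext Y' X'\<close> \<open>ordinary Y = {#}\<close> ordinary_ext[of Y' c'] X' by simp
  qed
next
  case (2 i E)
  obtain C where X': "X' = Black i E C" using 2(4) by (cases X') simp_all
  then consider "C = {#}" | c' where "C = {#c'#}" "ladder c'" using 2(1) by (auto simp: ladder_Black)
  then show ?case
  proof cases
    case 1
    then show ?thesis using \<open>ext Y _ = ext Y' X'\<close> X' by simp
  next
    case 2
    then show ?thesis using \<open>ext Y _ = ext Y' X'\<close> \<open>ordinary Y = {#}\<close> ordinary_ext[of Y' c'] X' by simp
  qed
next
  case (3 c i l)
  obtain C where X': "X' = White i l C" using "3.prems"(4) by (cases X') simp_all
  then consider "C = {#}" | c' where "C = {#c'#}" "ladder c'" using "3.prems"(1) by (auto simp: ladder_White)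
  then show ?case
  proof cases
    case 1
    then show ?thesis using \<open>ext Y _ = ext Y' X'\<close> \<open>ordinary Y' = {#}\<close> ordinary_ext[of Y c] X' by auto
  next
    case 2
    then show ?thesis using \<open>ext Y _ = ext Y' X'\<close> "3.IH"[of c'] "3.prems" X' by simp
  qed
next
  case (4 c i E)
  obtain C where X': "X' = Black i E C" using "4.prems"(4) by (cases X') simp_all
  then consider "C = {#}" | c' where "C = {#c'#}" "ladder c'" using "4.prems"(1) by (auto simp: ladder_Black)
  then show ?case
  proof cases
    case 1
    then show ?thesis using \<open>ext Y _ = ext Y' X'\<close> \<open>ordinary Y' = {#}\<close> ordinary_ext[of Y c] X' by auto
  next
    case 2
    then show ?thesis using \<open>ext Y _ = ext Y' X'\<close> "4.IH"[of c'] "4.prems" X' by simp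
  qed
qed

lemma lt_properties:
  "normal N \<Longrightarrow> ladder (lt N) \<and> two_special (lt N) \<and> white_labels (lt N) = mset_set (Some ` labs N) \<and>
    Some (first N) \<in># root_labels (lt N) \<and> (\<not> is_Br N \<longrightarrow> ordinary (lt N) = {#})"
proof (induction N)
  case (Lf s)
  then show ?case by (auto simp: unit_tree_def intro: ladder.intros)
next
  case (Br t u)
  have "mset_set (Some ` (labs t \<union> labs u)) = mset_set (Some ` labs t) + mset_set (Some ` labs u)"
    unfolding image_Un using Br.prems finite_labs by (intro mset_set_Union) auto
  then show ?case
    using Br by (auto simp: ladder_ext two_special_ext white_labels_ext root_labels_ext)
next
  case (Sy t u)
  have "mset_set (Some ` (labs t \<union> labs u)) = mset_set (Some ` labs t) + mset_set (Some ` labs u)"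
    unfolding image_Un using Sy.prems finite_labs by (intro mset_set_Union) auto
  then show ?case
    using Sy finite_labs first_in_labs by (auto simp: intro: ladder.intros)
qed

lemma lt_christoffel: "normal N \<Longrightarrow> lt N \<in> christoffel_trees (labs N)"
  using lt_properties finite_labs by (auto simp: christoffel_trees_mset)

lemma christoffel_trees_unique: "T \<in> christoffel_trees S \<Longrightarrow> T \<in> christoffel_trees S' \<Longrightarrow> S = S'"
proof -
  have "S = {s. Some s \<in># white_labels T}" if "T \<in> christoffel_trees S" for S
    using that by (auto simp: christoffel_trees_mset)
  then show "T \<in> christoffel_trees S \<Longrightarrow> T \<in> christoffel_trees S' \<Longrightarrow> S = S'" by metis
qed

lemma size_christoffel: "T \<in> christoffel_trees S \<Longrightarrow> size (white_labels T) = card S"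
  by (auto simp: christoffel_trees_mset card_image)

lemma pair_mset_eq: "{#a, b#} = {#c, d#} \<longleftrightarrow> (a = c \<and> b = d) \<or> (a = d \<and> b = c)"
  by (auto simp: add_eq_conv_ex)

lemma lookup_bilin_ext:
  "Poly_Mapping.lookup (bilin_ext f x y) L =
    (\<Sum>a\<in>Poly_Mapping.keys x. \<Sum>b\<in>Poly_Mapping.keys y. Poly_Mapping.lookup x a * Poly_Mapping.lookup y b * Poly_Mapping.lookup (f a b) L)"
  by (simp add: bilin_ext_def lookup_lin_ext sum_distrib_left mult.assoc)

lemma lookup_bilin_ext_unique:
  assumes "\<And>a b. a \<in> Poly_Mapping.keys x \<Longrightarrow> b \<in> Poly_Mapping.keys y \<Longrightarrow>
      Poly_Mapping.lookup (f a b) L = of_bool (a = a0 \<and> b = b0)"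
  shows "Poly_Mapping.lookup (bilin_ext f x y) L = Poly_Mapping.lookup x a0 * Poly_Mapping.lookup y b0"
proof -
  have "Poly_Mapping.lookup (bilin_ext f x y) L =
      (\<Sum>a\<in>Poly_Mapping.keys x. \<Sum>b\<in>Poly_Mapping.keys y. if b = b0 then if a = a0 then Poly_Mapping.lookup x a * Poly_Mapping.lookup y b else 0 else 0)"
    unfolding lookup_bilin_ext by (intro sum.cong refl) (simp add: assms)
  also have "\<dots> = (\<Sum>a\<in>Poly_Mapping.keys x. if a = a0 then Poly_Mapping.lookup x a * Poly_Mapping.lookup y b0 else 0)"
    by (intro sum.cong refl) (auto simp: in_keys_iff)
  also have "\<dots> = Poly_Mapping.lookup x a0 * Poly_Mapping.lookup y b0"
    by (auto simp: in_keys_iff)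
  finally show ?thesis .
qed

text \<open>The coefficient of the leading tree. Each bracket contributes a sign, since its leading
  tree comes from the negative term \<open>gr (ev t) (ev u)\<close>.\<close>

primrec sg :: "bt \<Rightarrow> 'k::field" where
  "sg (Lf s) = 1"
| "sg (Br t u) = - sg t * sg u"
| "sg (Sy t u) = sg t * sg u"

lemma sg_nonzero: "sg N \<noteq> 0"
  by (induction N) auto

lemma ev_keysD: "normal N \<Longrightarrow> t \<in> Poly_Mapping.keys (ev N :: ct \<Rightarrow>\<^sub>0 'k::field_char_0) \<Longrightarrow> t \<in> christoffel_trees (labs N)"
  using ev_nT[of N] by (auto simp: trees_span_def)

lemma gr_keys_wt:
  assumes "normal t" "normal u" "T \<in> Poly_Mapping.keys (gr (ev t) (ev u) :: ct \<Rightarrow>\<^sub>0 'k::field_char_0)"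
    and "\<And>X. X \<in> Poly_Mapping.keys (ev t :: ct \<Rightarrow>\<^sub>0 'k) \<Longrightarrow> wt B (lt t) \<le> wt B X"
    and "\<And>X. X \<in> Poly_Mapping.keys (ev u :: ct \<Rightarrow>\<^sub>0 'k) \<Longrightarrow> wt B (lt u) \<le> wt B X"
  shows "wt B (lt t) + wt B (lt u) \<le> wt B T"
    "wt B T = wt B (lt t) + wt B (lt u) \<Longrightarrow> set_mset (root_labels T) \<subseteq> Some ` labs t"
proof -
  obtain X Y where XY: "X \<in> Poly_Mapping.keys (ev t :: ct \<Rightarrow>\<^sub>0 'k)" "Y \<in> Poly_Mapping.keys (ev u :: ct \<Rightarrow>\<^sub>0 'k)"
      "T \<in> Poly_Mapping.keys (graft Y X :: ct \<Rightarrow>\<^sub>0 'k)"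
    using assms(3) unfolding gr_def by (elim keys_bilin_extE)
  have ts: "two_special Y" using ev_keysD[OF assms(2) XY(2)] by (simp add: christoffel_trees_iff)
  note w = graft_wt[OF XY(3) ts, of B] assms(4)[OF XY(1)] assms(5)[OF XY(2)]
  then show "wt B (lt t) + wt B (lt u) \<le> wt B T" by linarith
  assume "wt B T = wt B (lt t) + wt B (lt u)"
  then have "root_labels T = root_labels X" using w by linarith
  moreover have "set_mset (root_labels X) \<subseteq> set_mset (white_labels X)" by (cases X) auto
  moreover have "white_labels X = mset_set (Some ` labs t)" "finite (labs t)"
    using ev_keysD[OF assms(1) XY(1)] by (auto simp: christoffel_trees_mset)
  ultimately show "set_mset (root_labels T) \<subseteq> Some ` labs t" by auto
qed

lemma size_labels_lt: "normal N \<Longrightarrow> size (white_labels (lt N)) = card (labs N)"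
  using lt_christoffel size_christoffel by blast

lemma wt_Br: "normal (Br t u) \<Longrightarrow> wt B (lt (Br t u)) = wt B (lt t) + wt B (lt u)"
  using lt_properties[of t] by (simp add: wt_ext)

lemma wt_Sy: "normal (Sy t u) \<Longrightarrow>
    wt B (lt (Sy t u)) = wt B (lt t) + wt B (lt u) + int (card (labs t)) + int (card (labs u)) - int B"
  using size_labels_lt[of t] size_labels_lt[of u] by simp

lemma card_labs_Un: "labs t \<inter> labs u = {} \<Longrightarrow> card (labs t \<union> labs u) = card (labs t) + card (labs u)"
  using finite_labs by (simp add: card_Un_disjoint)

text \<open>For a commutative product the black vertex gains \<open>B\<close> and costs fewer than
  \<open>B\<close> labels, so it beats both graftings. Hence the lightest trees of a letter have no
  ordinary edges at the root.\<close>

lemma ev_keys_wt: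
  assumes "normal N" "card (labs N) < B" "T \<in> Poly_Mapping.keys (ev N :: ct \<Rightarrow>\<^sub>0 'k::field_char_0)"
  shows "wt B (lt N) \<le> wt B T \<and> (wt B T = wt B (lt N) \<longrightarrow> \<not> is_Br N \<longrightarrow> ordinary T = {#})"
  using assms
proof (induction N arbitrary: T)
  case (Lf s)
  then show ?case by (simp add: unit_tree_def)
next
  case (Br t u)
  have n: "normal t" "normal u" "card (labs t) < B" "card (labs u) < B"
    using Br.prems by (auto simp: card_labs_Un)
  have k: "T \<in> Poly_Mapping.keys (gr (ev u) (ev t) :: ct \<Rightarrow>\<^sub>0 'k) \<or> T \<in> Poly_Mapping.keys (gr (ev t) (ev u) :: ct \<Rightarrow>\<^sub>0 'k)"
    using Br.prems(3) by (auto elim: keys_diffE)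
  have IH: "wt B (lt t) \<le> wt B X" if "X \<in> Poly_Mapping.keys (ev t :: ct \<Rightarrow>\<^sub>0 'k)" for X
    using Br.IH(1)[OF n(1,3) that] by blast
  have IH': "wt B (lt u) \<le> wt B X" if "X \<in> Poly_Mapping.keys (ev u :: ct \<Rightarrow>\<^sub>0 'k)" for X
    using Br.IH(2)[OF n(2,4) that] by blast
  have "wt B (lt t) + wt B (lt u) \<le> wt B T"
    using k
  proof
    assume "T \<in> Poly_Mapping.keys (gr (ev u) (ev t) :: ct \<Rightarrow>\<^sub>0 'k)"
    from gr_keys_wt(1)[OF n(2,1) this IH' IH] show ?thesis by linarith
  next
    assume "T \<in> Poly_Mapping.keys (gr (ev t) (ev u) :: ct \<Rightarrow>\<^sub>0 'k)"
    from gr_keys_wt(1)[OF n(1,2) this IH IH'] show ?thesis .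
  qed
  then show ?case using wt_Br[OF Br.prems(1), of B] by simp
next
  case (Sy t u)
  have n: "normal t" "normal u" "card (labs t) < B" "card (labs u) < B" "card (labs t) + card (labs u) < B"
    using Sy.prems by (auto simp: card_labs_Un)
  have "T \<in> Poly_Mapping.keys (gr (ev u) (ev t) :: ct \<Rightarrow>\<^sub>0 'k) \<or> T \<in> Poly_Mapping.keys (gr (ev t) (ev u) :: ct \<Rightarrow>\<^sub>0 'k) \<or>
     T \<in> Poly_Mapping.keys (mm (ev t) (ev u) :: ct \<Rightarrow>\<^sub>0 'k)"
    using Sy.prems(3) by (auto elim!: keys_addE)
  moreover have IH: "wt B (lt t) \<le> wt B X" if "X \<in> Poly_Mapping.keys (ev t :: ct \<Rightarrow>\<^sub>0 'k)" for X
    using Sy.IH(1)[OF n(1,3) that] by blast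
  moreover have IH': "wt B (lt u) \<le> wt B X" if "X \<in> Poly_Mapping.keys (ev u :: ct \<Rightarrow>\<^sub>0 'k)" for X
    using Sy.IH(2)[OF n(2,4) that] by blast
  ultimately show ?case
  proof (elim disjE)
    assume "T \<in> Poly_Mapping.keys (mm (ev t) (ev u) :: ct \<Rightarrow>\<^sub>0 'k)"
    then obtain X Y where XY: "X \<in> Poly_Mapping.keys (ev t :: ct \<Rightarrow>\<^sub>0 'k)" "Y \<in> Poly_Mapping.keys (ev u :: ct \<Rightarrow>\<^sub>0 'k)"
       "T = Black () {#X, Y#} {#}"
      unfolding mm_def by (auto elim!: keys_bilin_extE split: if_splits)
    have "wt B (lt t) \<le> wt B X" "wt B (lt u) \<le> wt B Y" using Sy.IH XY n by auto
    moreover have "size (white_labels X) = card (labs t)" "size (white_labels Y) = card (labs u)"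
      using XY ev_keysD n size_christoffel by blast+
    ultimately show ?thesis using wt_Sy[OF Sy.prems(1), of B] by (simp add: XY(3))
  next
    assume "T \<in> Poly_Mapping.keys (gr (ev u) (ev t) :: ct \<Rightarrow>\<^sub>0 'k)"
    from gr_keys_wt(1)[OF n(2,1) this IH' IH] show ?thesis using wt_Sy[OF Sy.prems(1), of B] n(5) by linarith
  next
    assume "T \<in> Poly_Mapping.keys (gr (ev t) (ev u) :: ct \<Rightarrow>\<^sub>0 'k)"
    from gr_keys_wt(1)[OF n(1,2) this IH IH'] show ?thesis using wt_Sy[OF Sy.prems(1), of B] n(5) by linarith
  qed
qed

text \<open>Among normal forms of equal weight on the same labels the leading trees are triangular,
  even diagonal. For \<open>Sy\<close> the tree determines its two special children, for
  \<open>Br\<close> the chain determines its last letter, and comparing weights passes the claim to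
  the factors.\<close>

theorem ev_lookup_lt:
  assumes "normal N" "card (labs N) < B" "normal N'" "labs N' = labs N" "wt B (lt N') = wt B (lt N)"
  shows "Poly_Mapping.lookup (ev N :: ct \<Rightarrow>\<^sub>0 'k::field_char_0) (lt N') = (if N' = N then sg N else 0)"
  using assms
proof (induction N arbitrary: N')
  case (Lf s)
  show ?case
  proof (cases N')
    case (Lf s')
    then show ?thesis using Lf.prems by simp
  next
    case (Br t u)
    have "ordinary (lt N') \<noteq> {#}" "ordinary (unit_tree s) = {#}" using Br ordinary_ext by (simp_all add: unit_tree_def)
    then have "lt N' \<noteq> unit_tree s" by metis
    then show ?thesis using Br by (simp add: lookup_single when_def)
  next
    case (Sy t u)
    then show ?thesis by (simp add: lookup_single when_def unit_tree_def)
  qed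
next
  case (Sy t u)
  have n: "normal t" "normal u" "card (labs t) < B" "card (labs u) < B" "card (labs t) + card (labs u) < B"
    "labs t \<inter> labs u = {}" "first t < first u"
    using Sy.prems by (auto simp: card_labs_Un)
  have k: "lt N' \<notin> Poly_Mapping.keys (gr (ev t) (ev u) :: ct \<Rightarrow>\<^sub>0 'k)" "lt N' \<notin> Poly_Mapping.keys (gr (ev u) (ev t) :: ct \<Rightarrow>\<^sub>0 'k)"
  proof -
    have k1: "wt B (lt t) \<le> wt B X" if "X \<in> Poly_Mapping.keys (ev t :: ct \<Rightarrow>\<^sub>0 'k)" for X
      using ev_keys_wt[OF n(1,3) that] by blast
    have k2: "wt B (lt u) \<le> wt B X" if "X \<in> Poly_Mapping.keys (ev u :: ct \<Rightarrow>\<^sub>0 'k)" for X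
      using ev_keys_wt[OF n(2,4) that] by blast
    have less: "wt B (lt N') < wt B (lt t) + wt B (lt u)"
      using wt_Sy[OF Sy.prems(1), of B] Sy.prems(5) n(5) by linarith
    show "lt N' \<notin> Poly_Mapping.keys (gr (ev t) (ev u) :: ct \<Rightarrow>\<^sub>0 'k)"
    proof
      assume "lt N' \<in> Poly_Mapping.keys (gr (ev t) (ev u) :: ct \<Rightarrow>\<^sub>0 'k)"
      from gr_keys_wt(1)[OF n(1,2) this k1 k2] show False using less by linarith
    qed
    show "lt N' \<notin> Poly_Mapping.keys (gr (ev u) (ev t) :: ct \<Rightarrow>\<^sub>0 'k)"
    proof
      assume "lt N' \<in> Poly_Mapping.keys (gr (ev u) (ev t) :: ct \<Rightarrow>\<^sub>0 'k)"
      from gr_keys_wt(1)[OF n(2,1) this k2 k1] show False using less by linarith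
    qed
  qed
  have lk: "Poly_Mapping.lookup (ev (Sy t u) :: ct \<Rightarrow>\<^sub>0 'k) (lt N') = Poly_Mapping.lookup (mm (ev t) (ev u) :: ct \<Rightarrow>\<^sub>0 'k) (lt N')"
    using k by (simp add: lookup_add lookup_eq_0)
  show ?case
  proof (cases "\<exists>t' u'. N' = Sy t' u'")
    case False
    have "lt N' \<notin> Poly_Mapping.keys (mm (ev t) (ev u) :: ct \<Rightarrow>\<^sub>0 'k)"
    proof
      assume "lt N' \<in> Poly_Mapping.keys (mm (ev t) (ev u) :: ct \<Rightarrow>\<^sub>0 'k)"
      then obtain E where "lt N' = Black () E {#}"
        unfolding mm_def by (auto elim!: keys_bilin_extE split: if_splits)
      then show False using False ordinary_ext by (cases N') (auto simp: unit_tree_def dest: arg_cong[of _ _ ordinary])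
    qed
    then show ?thesis using False by (auto simp: lk lookup_eq_0 simp del: ev.simps)
  next
    case True
    then obtain t' u' where N': "N' = Sy t' u'" by blast
    have n': "normal t'" "normal u'" "first t' < first u'" "labs t' \<union> labs u' = labs t \<union> labs u" using Sy.prems N' by auto
    have *: "Poly_Mapping.lookup (mm (ev t) (ev u) :: ct \<Rightarrow>\<^sub>0 'k) (lt N') =
        Poly_Mapping.lookup (ev t) (lt t') * Poly_Mapping.lookup (ev u) (lt u')"
      unfolding mm_def
    proof (rule lookup_bilin_ext_unique)
      fix a b assume ab: "a \<in> Poly_Mapping.keys (ev t :: ct \<Rightarrow>\<^sub>0 'k)" "b \<in> Poly_Mapping.keys (ev u :: ct \<Rightarrow>\<^sub>0 'k)"
      \<comment> \<open>The special children are unordered, but the label sets of the factors and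
        the order of their first labels fix which one is which.\<close>
      have "\<not> (a = lt u' \<and> b = lt t')"
      proof
        assume "a = lt u' \<and> b = lt t'"
        then have "lt u' \<in> christoffel_trees (labs t)" "lt t' \<in> christoffel_trees (labs u)"
          using ab n ev_keysD by blast+
        then have "labs u' = labs t" "labs t' = labs u"
          using lt_christoffel[OF n'(1)] lt_christoffel[OF n'(2)] christoffel_trees_unique by blast+
          then show False
            using first_eq_Min[OF n(1)] first_eq_Min[OF n(2)] first_eq_Min[OF n'(1)] first_eq_Min[OF n'(2)] n(7) n'(3)
            by simp
      qed
      then show "Poly_Mapping.lookup (basis (Black () {#a, b#} {#}) :: ct \<Rightarrow>\<^sub>0 'k) (lt N') = of_bool (a = lt t' \<and> b = lt u')"
        by (auto simp: N' lookup_single when_def pair_mset_eq)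
    qed
    show ?thesis
    proof (cases "N' = Sy t u")
      case True
      then show ?thesis using lk * N' Sy.IH(1)[OF n(1,3), of t] Sy.IH(2)[OF n(2,4), of u] n by simp
    next
      case False
      have "Poly_Mapping.lookup (ev t :: ct \<Rightarrow>\<^sub>0 'k) (lt t') * Poly_Mapping.lookup (ev u :: ct \<Rightarrow>\<^sub>0 'k) (lt u') = 0"
      proof (rule ccontr)
        assume "\<not> ?thesis"
        then have nz: "Poly_Mapping.lookup (ev t :: ct \<Rightarrow>\<^sub>0 'k) (lt t') \<noteq> 0" "Poly_Mapping.lookup (ev u :: ct \<Rightarrow>\<^sub>0 'k) (lt u') \<noteq> 0" by auto
        then have k: "lt t' \<in> Poly_Mapping.keys (ev t :: ct \<Rightarrow>\<^sub>0 'k)" "lt u' \<in> Poly_Mapping.keys (ev u :: ct \<Rightarrow>\<^sub>0 'k)"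
          by (auto simp: in_keys_iff)
        have lab: "labs t' = labs t" "labs u' = labs u"
          using lt_christoffel[OF n'(1)] lt_christoffel[OF n'(2)] ev_keysD[OF n(1) k(1)] ev_keysD[OF n(2) k(2)]
            christoffel_trees_unique by blast+
        \<comment> \<open>Neither factor can be lighter than its leading tree and the sums agree, so
          both weights are equal and the induction hypotheses apply.\<close>
        have "wt B (lt t) \<le> wt B (lt t')" "wt B (lt u) \<le> wt B (lt u')"
          using ev_keys_wt[OF n(1,3) k(1)] ev_keys_wt[OF n(2,4) k(2)] by auto
        moreover have "wt B (lt t') + wt B (lt u') = wt B (lt t) + wt B (lt u)"
          using Sy.prems(5) wt_Sy[OF Sy.prems(1), of B] wt_Sy[OF Sy.prems(3)[unfolded N'], of B] lab by (simp add: N')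
        ultimately have "t' = t" "u' = u"
          using nz Sy.IH(1)[OF n(1,3) n'(1) lab(1)] Sy.IH(2)[OF n(2,4) n'(2) lab(2)] by (auto split: if_splits)
        then show False using False N' by simp
      qed
      then show ?thesis using lk * False by simp
    qed
  qed
next
  case (Br t u)
  have n: "normal t" "normal u" "card (labs t) < B" "card (labs u) < B" "\<not> is_Br u"
    "labs t \<inter> labs u = {}" "first t < first u"
    using Br.prems by (auto simp: card_labs_Un)
  have wtN: "wt B (lt N') = wt B (lt t) + wt B (lt u)" using Br.prems(5) wt_Br[OF Br.prems(1), of B] by simp
  \<comment> \<open>The smallest label lies in \<open>root_labels\<close> of every leading tree in
    play. The lightest trees of the other grafting, rooted in \<open>u\<close>, only have labels of
    \<open>u\<close> there and are thereby excluded.\<close>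
  have "first N' = first t"
    using first_eq_Min[OF Br.prems(1)] first_eq_Min[OF Br.prems(3)] Br.prems(4) by simp
  then have ft: "Some (first t) \<in># root_labels (lt N')" using lt_properties[OF Br.prems(3)] by simp
  have nt: "first t \<notin> labs u" using n first_in_labs by blast
  have k: "lt N' \<notin> Poly_Mapping.keys (gr (ev u) (ev t) :: ct \<Rightarrow>\<^sub>0 'k)"
  proof -
    have k1: "wt B (lt t) \<le> wt B X" if "X \<in> Poly_Mapping.keys (ev t :: ct \<Rightarrow>\<^sub>0 'k)" for X
      using ev_keys_wt[OF n(1,3) that] by blast
    have k2: "wt B (lt u) \<le> wt B X" if "X \<in> Poly_Mapping.keys (ev u :: ct \<Rightarrow>\<^sub>0 'k)" for X
      using ev_keys_wt[OF n(2,4) that] by blast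
    show ?thesis
    proof
      assume "lt N' \<in> Poly_Mapping.keys (gr (ev u) (ev t) :: ct \<Rightarrow>\<^sub>0 'k)"
      from gr_keys_wt(2)[OF n(2,1) this k2 k1] have "set_mset (root_labels (lt N')) \<subseteq> Some ` labs u" using wtN by simp
      then show False using ft nt by blast
    qed
  qed
  then have lk: "Poly_Mapping.lookup (ev (Br t u) :: ct \<Rightarrow>\<^sub>0 'k) (lt N') = - Poly_Mapping.lookup (gr (ev t) (ev u) :: ct \<Rightarrow>\<^sub>0 'k) (lt N')"
    by (simp add: lookup_minus lookup_eq_0)
  have gl: "Poly_Mapping.lookup (graft b a :: ct \<Rightarrow>\<^sub>0 'k) (lt N') \<noteq> 0 \<Longrightarrow>
      ladder a \<and> lt N' = ext b a \<and> ordinary b = {#} \<and> Poly_Mapping.lookup (graft b a :: ct \<Rightarrow>\<^sub>0 'k) (lt N') = 1"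
    if "a \<in> Poly_Mapping.keys (ev t :: ct \<Rightarrow>\<^sub>0 'k)" "b \<in> Poly_Mapping.keys (ev u :: ct \<Rightarrow>\<^sub>0 'k)" for a b
  proof -
    assume nz: "Poly_Mapping.lookup (graft b a :: ct \<Rightarrow>\<^sub>0 'k) (lt N') \<noteq> 0"
    then have kk: "lt N' \<in> Poly_Mapping.keys (graft b a :: ct \<Rightarrow>\<^sub>0 'k)" by (simp add: in_keys_iff)
    have ts: "two_special b" using ev_keysD[OF n(2) that(2)] by (simp add: christoffel_trees_iff)
    have ge: "wt B (lt t) \<le> wt B a" "wt B (lt u) \<le> wt B b" "wt B a + wt B b \<le> wt B (lt N')"
      using ev_keys_wt[OF n(1,3) that(1)] ev_keys_wt[OF n(2,4) that(2)] graft_wt(1)[OF kk ts, of B] by auto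
    then have eq: "wt B (lt N') = wt B a + wt B b" "wt B b = wt B (lt u)" using wtN by linarith+
    have "ordinary b = {#}" using ev_keys_wt[OF n(2,4) that(2)] eq(2) n(5) by simp
    moreover have "ladder (lt N')" using lt_properties Br.prems(3) by blast
    ultimately show ?thesis using graft_lookup_ladder[OF _ ts eq(1), where 'k = 'k] nz by (auto split: if_splits)
  qed
  show ?case
  proof (cases "\<exists>t' u'. N' = Br t' u'")
    case False
    then have o: "ordinary (lt N') = {#}" using lt_properties[OF Br.prems(3)] by (cases N') auto
    have "Poly_Mapping.lookup (graft b a :: ct \<Rightarrow>\<^sub>0 'k) (lt N') = 0"
      if "a \<in> Poly_Mapping.keys (ev t :: ct \<Rightarrow>\<^sub>0 'k)" "b \<in> Poly_Mapping.keys (ev u :: ct \<Rightarrow>\<^sub>0 'k)" for a b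
      using gl[OF that] o ordinary_ext[of b a] by metis
    then have "Poly_Mapping.lookup (gr (ev t) (ev u) :: ct \<Rightarrow>\<^sub>0 'k) (lt N') = 0"
      unfolding gr_def lookup_bilin_ext by (intro sum.neutral ballI) simp
    then show ?thesis using lk False by auto
  next
    case True
    then obtain t' u' where N': "N' = Br t' u'" by blast
    have n': "normal t'" "normal u'" "\<not> is_Br u'" using Br.prems N' by auto
    note p = lt_properties[OF n'(1)] lt_properties[OF n'(2)]
    have *: "Poly_Mapping.lookup (gr (ev t) (ev u) :: ct \<Rightarrow>\<^sub>0 'k) (lt N') =
        Poly_Mapping.lookup (ev t) (lt t') * Poly_Mapping.lookup (ev u) (lt u')"
      unfolding gr_def
    proof (rule lookup_bilin_ext_unique)
      fix a b assume ab: "a \<in> Poly_Mapping.keys (ev t :: ct \<Rightarrow>\<^sub>0 'k)" "b \<in> Poly_Mapping.keys (ev u :: ct \<Rightarrow>\<^sub>0 'k)"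
      show "Poly_Mapping.lookup (graft b a :: ct \<Rightarrow>\<^sub>0 'k) (lt N') = of_bool (a = lt t' \<and> b = lt u')"
      proof (cases "a = lt t' \<and> b = lt u'")
        case True
        then show ?thesis
          using graft_lookup_ladder[of "lt N'" "lt u'" B "lt t'", where 'k = 'k] p lt_properties[OF Br.prems(3)]
          by (simp add: N' wt_ext)
      next
        case False
        have "Poly_Mapping.lookup (graft b a :: ct \<Rightarrow>\<^sub>0 'k) (lt N') = 0"
        proof (rule ccontr)
          assume "\<not> ?thesis"
          then have "ladder a" "ext (lt u') (lt t') = ext b a" "ordinary b = {#}" using gl[OF ab] by (auto simp: N')
          then show False using ext_inj[of "lt t'" a "lt u'" b] p n'(3) False by auto
        qed
        then show ?thesis using False by simp
      qed
    qed
    show ?thesis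
    proof (cases "N' = Br t u")
      case True
      then show ?thesis using lk * N' Br.IH(1)[OF n(1,3), of t] Br.IH(2)[OF n(2,4), of u] n by simp
    next
      case False
      have "Poly_Mapping.lookup (ev t :: ct \<Rightarrow>\<^sub>0 'k) (lt t') * Poly_Mapping.lookup (ev u :: ct \<Rightarrow>\<^sub>0 'k) (lt u') = 0"
      proof (rule ccontr)
        assume "\<not> ?thesis"
        then have nz: "Poly_Mapping.lookup (ev t :: ct \<Rightarrow>\<^sub>0 'k) (lt t') \<noteq> 0" "Poly_Mapping.lookup (ev u :: ct \<Rightarrow>\<^sub>0 'k) (lt u') \<noteq> 0" by auto
        then have k: "lt t' \<in> Poly_Mapping.keys (ev t :: ct \<Rightarrow>\<^sub>0 'k)" "lt u' \<in> Poly_Mapping.keys (ev u :: ct \<Rightarrow>\<^sub>0 'k)"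
          by (auto simp: in_keys_iff)
        have lab: "labs t' = labs t" "labs u' = labs u"
          using lt_christoffel[OF n'(1)] lt_christoffel[OF n'(2)] ev_keysD[OF n(1) k(1)] ev_keysD[OF n(2) k(2)]
            christoffel_trees_unique by blast+
        have "wt B (lt t) \<le> wt B (lt t')" "wt B (lt u) \<le> wt B (lt u')"
          using ev_keys_wt[OF n(1,3) k(1)] ev_keys_wt[OF n(2,4) k(2)] by auto
        moreover have "wt B (lt t') + wt B (lt u') = wt B (lt t) + wt B (lt u)"
          using wtN wt_Br[OF Br.prems(3)[unfolded N'], of B] by (simp add: N')
        ultimately have "t' = t" "u' = u"
          using nz Br.IH(1)[OF n(1,3) n'(1) lab(1)] Br.IH(2)[OF n(2,4) n'(2) lab(2)] by (auto split: if_splits)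
        then show False using False N' by simp
      qed
      then show ?thesis using lk * False by simp
    qed
  qed
qed

section \<open>Coefficients of the derivation at trees with a binary diamond\<close>

text \<open>One-hole contexts around a single edge: above a white vertex, along a special edge, or
  along an ordinary edge of a black vertex. Lists of frames in \<open>fill\<close> start at the
  root.\<close>

datatype frame = FW "nat option" "ct multiset" | FS "ct multiset" "ct multiset" | FO "ct multiset" "ct multiset"

primrec plugf :: "frame \<Rightarrow> ct \<Rightarrow> ct" where
  "plugf (FW l R) c = White () l (add_mset c R)"
| "plugf (FS Y C) c = Black () (add_mset c Y) C"
| "plugf (FO E R) c = Black () E (add_mset c R)"

primrec fill :: "frame list \<Rightarrow> ct \<Rightarrow> ct" where
  "fill [] c = c"
| "fill (fr # K) c = plugf fr (fill K c)"

lemma fill_append [simp]: "fill (K @ K') c = fill K (fill K' c)"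
  by (induction K) simp_all

lemma plugf_inj: "plugf fr a = plugf fr b \<longleftrightarrow> a = b"
  by (cases fr) auto

text \<open>What coefficient extraction needs: every subtree has a label, so distinct labels make
  siblings different, and the absence of \<open>None\<close> makes a newly created diamond
  recognisable.\<close>

definition good :: "ct \<Rightarrow> bool" where
  "good T \<longleftrightarrow> two_special T \<and> None \<notin># white_labels T \<and> (\<forall>l. count (white_labels T) l \<le> 1)"

lemma christoffel_good: "T \<in> christoffel_trees S \<Longrightarrow> good T"
  unfolding good_def christoffel_trees_iff not_None_count
proof (intro conjI allI)
  fix l assume "two_special T \<and> count (white_labels T) None = 0 \<and> (\<forall>s. count (white_labels T) (Some s) = of_bool (s \<in> S))"
  then show "count (white_labels T) l \<le> 1" by (cases l) auto
qed auto

lemma good_White: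
  assumes "good (White i l C)"
  shows "l \<noteq> None" "\<forall>c\<in>#C. good c" "C = add_mset c R \<Longrightarrow> c \<notin># R"
proof -
  have *: "count (\<Sum>\<^sub># (image_mset white_labels C)) l' \<le> 1" for l'
  proof -
    have "count (white_labels (White i l C)) l' \<le> 1" using assms unfolding good_def by blast
    then show ?thesis by (auto split: if_splits)
  qed
  show "l \<noteq> None" using assms by (cases l) (auto simp: good_def)
  show "\<forall>c\<in>#C. good c"
  proof
    fix c assume "c \<in># C"
    then obtain R where R: "C = add_mset c R" by (meson multi_member_split)
    have "\<forall>l'. count (white_labels c) l' \<le> 1" using sum_image_le1(1)[of white_labels c R] * R by blast
    then show "good c" using assms by (auto simp: good_def R)
  qed
  show "c \<notin># R" if R: "C = add_mset c R"
  proof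
    assume "c \<in># R"
    moreover obtain l' where "l' \<in># white_labels c"
      using white_labels_nonempty[of c] assms by (auto simp: good_def R)
    ultimately show False using sum_image_le1(2)[of white_labels c R l' c] * R by blast
  qed
qed

lemma good_Black:
  assumes "good (Black i E C)"
  shows "\<forall>c\<in>#E + C. good c" "size E = 2" "E + C = add_mset c R \<Longrightarrow> c \<notin># R"
proof -
  have *: "\<forall>l'. count (\<Sum>\<^sub># (image_mset white_labels (E + C))) l' \<le> 1"
    using assms by (simp add: good_def)
  show "size E = 2" using assms by (simp add: good_def)
  show "\<forall>c\<in>#E + C. good c"
  proof
    fix c assume c: "c \<in># E + C"
    then obtain R where R: "E + C = add_mset c R" by (meson multi_member_split)
    have "\<forall>l'. count (white_labels c) l' \<le> 1" using sum_image_le1(1)[of white_labels c R] * R by auto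
    then show "good c" using assms c by (auto simp: good_def)
  qed
  show "c \<notin># R" if R: "E + C = add_mset c R"
  proof
    assume c: "c \<in># R"
    have "c \<in># E + C" by (simp add: R)
    then have "two_special c" using assms by (auto simp: good_def)
    then obtain l' where "l' \<in># white_labels c"
      using white_labels_nonempty[of c] by auto
    then show False using sum_image_le1(2)[of white_labels c R l' c] * R c by auto
  qed
qed

abbreviation dfree :: "ct \<Rightarrow> bool" where "dfree T \<equiv> None \<notin># white_labels T"

primrec frame_dfree :: "frame \<Rightarrow> bool" where
  "frame_dfree (FW l R) \<longleftrightarrow> l \<noteq> None \<and> (\<forall>r\<in>#R. dfree r)"
| "frame_dfree (FS Y C) \<longleftrightarrow> (\<forall>r\<in>#Y. dfree r) \<and> (\<forall>r\<in>#C. dfree r)"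
| "frame_dfree (FO E R) \<longleftrightarrow> (\<forall>r\<in>#E. dfree r) \<and> (\<forall>r\<in>#R. dfree r)"

lemma good_plugf: "good (plugf fr c) \<Longrightarrow> good c \<and> frame_dfree fr"
proof (cases fr)
  case (FW l R)
  assume "good (plugf fr c)"
  then have "good (White () l (add_mset c R))" by (simp add: FW)
  from good_White(1,2)[OF this] show ?thesis by (auto simp: FW good_def)
next
  case (FS Y C)
  assume "good (plugf fr c)"
  then have "good (Black () (add_mset c Y) C)" by (simp add: FS)
  from good_Black(1)[OF this] show ?thesis by (auto simp: FS good_def)
next
  case (FO E R)
  assume "good (plugf fr c)"
  then have "good (Black () E (add_mset c R))" by (simp add: FO)
  from good_Black(1)[OF this] show ?thesis by (auto simp: FO good_def)
qed

lemma good_fill: "good (fill K c) \<Longrightarrow> good c \<and> (\<forall>fr\<in>set K. frame_dfree fr)"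
proof (induction K)
  case (Cons fr K)
  then have "good (plugf fr (fill K c))" by simp
  from good_plugf[OF this] Cons.IH show ?case by auto
qed simp

lemma good_dfree: "good T \<Longrightarrow> dfree T"
  by (simp add: good_def)

lemma add_mset_eq_dfree:
  assumes "\<not> dfree z" "\<forall>r\<in>#R. dfree r"
  shows "add_mset t R = add_mset z R0 \<longleftrightarrow> t = z \<and> R = R0"
proof
  assume "add_mset t R = add_mset z R0"
  moreover have "z \<notin># R" using assms by blast
  ultimately show "t = z \<and> R = R0" by (auto simp: add_eq_conv_ex)
qed simp

lemma msum_if:
  shows "c0 \<notin># R0 \<Longrightarrow> msum (\<lambda>c R. if R = R0 then h c else 0) (add_mset c0 R0) = h c0"
    "(\<And>c. C \<noteq> add_mset c R0) \<Longrightarrow> msum (\<lambda>c R. if R = R0 then h c else 0) C = 0"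
proof -
  assume "c0 \<notin># R0"
  then have "msum (\<lambda>c R. if add_mset c0 R = R0 then h c else 0) R0 = msum (\<lambda>c R. 0) R0"
    by (intro msum_cong) auto
  then show "msum (\<lambda>c R. if R = R0 then h c else 0) (add_mset c0 R0) = h c0" by (simp add: msum_zero)
next
  assume "\<And>c. C \<noteq> add_mset c R0"
  then have "msum (\<lambda>c R. if R = R0 then h c else 0) C = msum (\<lambda>c R. 0) C"
    by (intro msum_cong) auto
  then show "msum (\<lambda>c R. if R = R0 then h c else 0) C = 0" by (simp add: msum_zero)
qed

lemma lookup_msum: "Poly_Mapping.lookup (msum f M) b = msum (\<lambda>x R. Poly_Mapping.lookup (f x R) b) M"
  by (simp add: msum_def lookup_sum_mset)

lemma lookup_lin_ext_none:
  "(\<And>a. b \<noteq> f a) \<Longrightarrow> Poly_Mapping.lookup (lin_ext (\<lambda>t. basis (f t)) x) b = 0"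
  by (rule lookup_eq_0) (auto elim!: keys_lin_ext_basisE)

text \<open>\<open>T\<close> has no diamond, so the diamond in \<open>z\<close> shows which child
  was modified: the one in the hole. As siblings differ, this happens in at most one way.\<close>

lemma lookup_dev_plugf:
  fixes p :: "ct \<Rightarrow> (ct \<Rightarrow>\<^sub>0 'k::field)"
  assumes T: "good T" and z: "\<not> dfree z" and fr: "frame_dfree fr"
  shows "T = plugf fr c \<Longrightarrow> Poly_Mapping.lookup (dev p T) (plugf fr z) = Poly_Mapping.lookup (p c) z"
    "(\<And>c. T \<noteq> plugf fr c) \<Longrightarrow> Poly_Mapping.lookup (dev p T) (plugf fr z) = 0"
proof -
  have *: "(\<forall>c. T = plugf fr c \<longrightarrow> Poly_Mapping.lookup (dev p T) (plugf fr z) = Poly_Mapping.lookup (p c) z) \<and>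
     ((\<forall>c. T \<noteq> plugf fr c) \<longrightarrow> Poly_Mapping.lookup (dev p T) (plugf fr z) = 0)"
  proof (cases T)
    case (White i l C)
    note g = good_White[OF T[unfolded White]]
    show ?thesis
    proof (cases "\<exists>R. fr = FW l R")
      case True
      then obtain R0 where fr: "fr = FW l R0" by blast
      have E: "Poly_Mapping.lookup (dev p T) (plugf fr z) = msum (\<lambda>c R. if R = R0 then Poly_Mapping.lookup (p c) z else 0) C"
        unfolding White dev_White lookup_msum
      proof (rule msum_cong)
        fix c R assume C: "C = add_mset c R"
        have df: "\<forall>r\<in>#R. dfree r" using g(2) C good_dfree by auto
        show "Poly_Mapping.lookup (lin_ext (\<lambda>t. basis (White i l (add_mset t R))) (p c)) (plugf fr z) =
          (if R = R0 then Poly_Mapping.lookup (p c) z else 0)"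
          using lookup_lin_ext_inj[of "\<lambda>t. White () l (add_mset t R)" "p c" z]
          by (auto simp: fr add_mset_eq_dfree[OF z df] eq_commute[of "add_mset z _"] intro!: lookup_lin_ext_none)
      qed
      show ?thesis
        unfolding E
      proof (intro conjI allI impI)
        fix c assume "T = plugf fr c"
        then have C: "C = add_mset c R0" by (simp add: White fr)
        show "msum (\<lambda>c R. if R = R0 then Poly_Mapping.lookup (p c) z else 0) C = Poly_Mapping.lookup (p c) z"
          unfolding C by (rule msum_if(1)) (rule g(3)[OF C])
      next
        assume "\<forall>c. T \<noteq> plugf fr c"
        then show "msum (\<lambda>c R. if R = R0 then Poly_Mapping.lookup (p c) z else 0) C = 0"
          by (intro msum_if(2)) (simp add: White fr)
      qed
    next
      case False
      have "Poly_Mapping.lookup (dev p T) (plugf fr z) = 0"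
      proof (rule lookup_eq_0, rule notI)
        assume "plugf fr z \<in> Poly_Mapping.keys (dev p T)"
        then show False by (cases rule: keys_devE) (use False White in \<open>cases fr; auto\<close>)+
      qed
      then show ?thesis using False White by (cases fr) auto
    qed
  next
    case (Black i E C)
    note g = good_Black[OF T[unfolded Black]]
    have dE: "\<forall>r\<in>#E. dfree r" and dC: "\<forall>r\<in>#C. dfree r" using g(1) good_dfree by auto
    show ?thesis
    proof (cases fr)
      case (FW l R)
      have "Poly_Mapping.lookup (dev p T) (plugf fr z) = 0"
      proof (rule lookup_eq_0, rule notI)
        assume "plugf fr z \<in> Poly_Mapping.keys (dev p T)"
        then show False by (cases rule: keys_devE) (use FW Black in auto)
      qed
      then show ?thesis using FW Black by auto
    next
      case (FS Y C0)
      have "Poly_Mapping.lookup (lin_ext (\<lambda>t. basis (Black i E (add_mset t R))) (p c)) (plugf fr z) = 0" for c R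
        by (rule lookup_lin_ext_none) (use dE z in \<open>auto simp: FS\<close>)
      moreover have "msum (\<lambda>c R. Poly_Mapping.lookup (lin_ext (\<lambda>t. basis (Black i (add_mset t R) C)) (p c)) (plugf fr z)) E =
          msum (\<lambda>c R. if R = Y then if C = C0 then Poly_Mapping.lookup (p c) z else 0 else 0) E"
      proof (rule msum_cong)
        fix c R assume C: "E = add_mset c R"
        have df: "\<forall>r\<in>#R. dfree r" using dE C by auto
        show "Poly_Mapping.lookup (lin_ext (\<lambda>t. basis (Black i (add_mset t R) C)) (p c)) (plugf fr z) =
          (if R = Y then if C = C0 then Poly_Mapping.lookup (p c) z else 0 else 0)"
          using lookup_lin_ext_inj[of "\<lambda>t. Black () (add_mset t R) C" "p c" z]
          by (auto simp: FS add_mset_eq_dfree[OF z df] eq_commute[of "add_mset z _"] intro!: lookup_lin_ext_none)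
      qed
      ultimately have M: "Poly_Mapping.lookup (dev p T) (plugf fr z) =
          msum (\<lambda>c R. if R = Y then if C = C0 then Poly_Mapping.lookup (p c) z else 0 else 0) E"
        unfolding Black dev_Black lookup_add lookup_msum by (simp add: msum_zero)
      show ?thesis
        unfolding M
      proof (intro conjI allI impI)
        fix c assume "T = plugf fr c"
        then have C: "E = add_mset c Y" "C = C0" by (simp_all add: Black FS)
        have "c \<notin># Y" using g(3)[of c "Y + C"] C(1) by auto
        then show "msum (\<lambda>c R. if R = Y then if C = C0 then Poly_Mapping.lookup (p c) z else 0 else 0) E = Poly_Mapping.lookup (p c) z"
          unfolding C(1) using msum_if(1)[of c Y "\<lambda>c. if C = C0 then Poly_Mapping.lookup (p c) z else 0"] C(2) by simp
      next
        assume n: "\<forall>c. T \<noteq> plugf fr c"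
        show "msum (\<lambda>c R. if R = Y then if C = C0 then Poly_Mapping.lookup (p c) z else 0 else 0) E = 0"
        proof (cases "C = C0")
          case True
          then show ?thesis using n by (intro msum_if(2)) (simp add: Black FS)
        next
          case False
          then have "msum (\<lambda>c R. if R = Y then if C = C0 then Poly_Mapping.lookup (p c) z else 0 else 0) E = msum (\<lambda>c R. 0) E" by (intro msum_cong) simp
          then show ?thesis by (simp only: msum_zero)
        qed
      qed
    next
      case (FO E0 R0)
      have "z \<in># E0 \<Longrightarrow> False" using fr z by (auto simp: FO)
      have n: "Poly_Mapping.lookup (lin_ext (\<lambda>t. basis (Black i (add_mset t R) C)) (p c)) (plugf fr z) = 0" for c R
        by (rule lookup_lin_ext_none) (use dC z in \<open>auto simp: FO\<close>)
      have "msum (\<lambda>c R. Poly_Mapping.lookup (lin_ext (\<lambda>t. basis (Black i E (add_mset t R))) (p c)) (plugf fr z)) C =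
          msum (\<lambda>c R. if R = R0 then if E = E0 then Poly_Mapping.lookup (p c) z else 0 else 0) C"
      proof (rule msum_cong)
        fix c R assume C: "C = add_mset c R"
        have df: "\<forall>r\<in>#R. dfree r" using dC C by auto
        show "Poly_Mapping.lookup (lin_ext (\<lambda>t. basis (Black i E (add_mset t R))) (p c)) (plugf fr z) =
          (if R = R0 then if E = E0 then Poly_Mapping.lookup (p c) z else 0 else 0)"
          using lookup_lin_ext_inj[of "\<lambda>t. Black () E (add_mset t R)" "p c" z]
          by (auto simp: FO add_mset_eq_dfree[OF z df] eq_commute[of "add_mset z _"] intro!: lookup_lin_ext_none)
      qed
      then have M: "Poly_Mapping.lookup (dev p T) (plugf fr z) =
          msum (\<lambda>c R. if R = R0 then if E = E0 then Poly_Mapping.lookup (p c) z else 0 else 0) C"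
        using n unfolding Black dev_Black lookup_add lookup_msum by (simp add: msum_zero)
      show ?thesis
        unfolding M
      proof (intro conjI allI impI)
        fix c assume "T = plugf fr c"
        then have C: "C = add_mset c R0" "E = E0" by (simp_all add: Black FO)
        have "c \<notin># R0" using g(3)[of c "E + R0"] C(1) by auto
        then show "msum (\<lambda>c R. if R = R0 then if E = E0 then Poly_Mapping.lookup (p c) z else 0 else 0) C = Poly_Mapping.lookup (p c) z"
          unfolding C(1) using msum_if(1)[of c R0 "\<lambda>c. if E = E0 then Poly_Mapping.lookup (p c) z else 0"] C(2) by simp
      next
        assume n: "\<forall>c. T \<noteq> plugf fr c"
        show "msum (\<lambda>c R. if R = R0 then if E = E0 then Poly_Mapping.lookup (p c) z else 0 else 0) C = 0"
        proof (cases "E = E0")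
          case True
          then show ?thesis using n by (intro msum_if(2)) (simp add: Black FO)
        next
          case False
          then have "msum (\<lambda>c R. if R = R0 then if E = E0 then Poly_Mapping.lookup (p c) z else 0 else 0) C = msum (\<lambda>c R. 0) C" by (intro msum_cong) simp
          then show ?thesis by (simp only: msum_zero)
        qed
      qed
    qed
  qed
  then show "T = plugf fr c \<Longrightarrow> Poly_Mapping.lookup (dev p T) (plugf fr z) = Poly_Mapping.lookup (p c) z"
    "(\<And>c. T \<noteq> plugf fr c) \<Longrightarrow> Poly_Mapping.lookup (dev p T) (plugf fr z) = 0" by blast+
qed

text \<open>The transpose of \<open>plugf fr\<close>: the coefficients of \<open>x\<close> at trees
  that fit the frame, read as a vector of fillings.\<close>

definition pull :: "frame \<Rightarrow> (ct \<Rightarrow>\<^sub>0 'k::field) \<Rightarrow> (ct \<Rightarrow>\<^sub>0 'k)" where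
  "pull fr x = Poly_Mapping.map_key (plugf fr) x"

lemma lookup_pull [simp]: "Poly_Mapping.lookup (pull fr x) c = Poly_Mapping.lookup x (plugf fr c)"
proof -
  have "inj (plugf fr)" by (auto simp: inj_def plugf_inj)
  then show ?thesis by (simp add: pull_def map_key.rep_eq)
qed

lemma keys_pull: "c \<in> Poly_Mapping.keys (pull fr x) \<longleftrightarrow> plugf fr c \<in> Poly_Mapping.keys x"
  by (simp add: in_keys_iff)

text \<open>Only the trees of \<open>x\<close> that fit the frame contribute, so the modification
  can be transferred from the whole tree to the filling.\<close>

lemma lookup_dev_pull:
  fixes p :: "ct \<Rightarrow> (ct \<Rightarrow>\<^sub>0 'k::field)"
  assumes x: "\<forall>T\<in>Poly_Mapping.keys x. good T" and z: "\<not> dfree z" and fr: "frame_dfree fr"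
  shows "Poly_Mapping.lookup (lin_ext (dev p) x) (plugf fr z) = Poly_Mapping.lookup (lin_ext p (pull fr x)) z"
proof -
  let ?f = "\<lambda>T. Poly_Mapping.lookup x T * Poly_Mapping.lookup (dev p T) (plugf fr z)"
  have "Poly_Mapping.lookup (lin_ext (dev p) x) (plugf fr z) = sum ?f (Poly_Mapping.keys x)"
    by (rule lookup_lin_ext)
  also have "\<dots> = sum ?f (plugf fr ` Poly_Mapping.keys (pull fr x))"
  proof (rule sum.mono_neutral_right)
    show "\<forall>T\<in>Poly_Mapping.keys x - plugf fr ` Poly_Mapping.keys (pull fr x). ?f T = 0"
    proof
      fix T assume T: "T \<in> Poly_Mapping.keys x - plugf fr ` Poly_Mapping.keys (pull fr x)"
      then have "T \<noteq> plugf fr c" for c using keys_pull[of c fr x] by blast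
      then show "?f T = 0" using lookup_dev_plugf(2)[of T z fr p] x T z fr by auto
    qed
  qed (use keys_pull in auto)
  also have "\<dots> = (\<Sum>c\<in>Poly_Mapping.keys (pull fr x). ?f (plugf fr c))"
    by (subst sum.reindex) (auto simp: inj_on_def plugf_inj)
  also have "\<dots> = (\<Sum>c\<in>Poly_Mapping.keys (pull fr x). Poly_Mapping.lookup (pull fr x) c * Poly_Mapping.lookup (p c) z)"
    using x z fr by (intro sum.cong refl) (simp add: keys_pull lookup_dev_plugf(1))
  finally show ?thesis by (simp add: lookup_lin_ext)
qed

lemma lookup_delta:
  "Poly_Mapping.lookup (lin_ext delta x) Z = Poly_Mapping.lookup (lin_ext qd x) Z + Poly_Mapping.lookup (lin_ext (dev delta) x) Z"
proof -
  have "lin_ext delta x = lin_ext qd x + lin_ext (dev delta) x"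
    unfolding delta_def by (subst loc.simps[abs_def]) (simp add: lin_ext_add)
  then show ?thesis by (simp add: lookup_add)
qed

lemma keys_qdE:
  fixes T :: ct
  assumes "t \<in> Poly_Mapping.keys (qd T :: ct \<Rightarrow>\<^sub>0 'k::field)"
  obtains M where "t = Dia M"
  | l C A B where "T = White () l C" "A + B = C" "t = White () l (add_mset (Dia A) B)"
  | E C A B where "T = Black () E C" "A + B = C" "t = Black () E (add_mset (Dia A) B)"
  | e R C A B where "T = Black () (add_mset e R) C" "A + B = C" "t = Black () (add_mset (Dia (add_mset e A)) R) B"
proof (cases T)
  case (White i l C)
  then show thesis using assms that(1,2)
    by (auto simp: qd_White elim!: keys_split2 keys_diffE split: if_splits)
next
  case (Black i E C)
  then have "t \<in> Poly_Mapping.keys (split2 (qBlack E) C + fscale 2 (basis (Dia (E + C))) :: ct \<Rightarrow>\<^sub>0 'k)"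
    using assms by (simp add: qd_Black)
  then consider "t \<in> Poly_Mapping.keys (split2 (qBlack E) C :: ct \<Rightarrow>\<^sub>0 'k)" | "t = Dia (E + C)"
    by (auto elim!: keys_addE dest!: subsetD[OF keys_fscale] split: if_splits)
  then show thesis
  proof cases
    case 1
    then obtain A B where AB: "t \<in> Poly_Mapping.keys (qBlack E A B :: ct \<Rightarrow>\<^sub>0 'k)" "A + B = C" by (elim keys_split2)
    then consider "t = Black () E (add_mset (Dia A) B)" | "t = Dia (add_mset (Black () E B) A)"
      | "t \<in> Poly_Mapping.keys (msum (\<lambda>e R. basis (Black () (add_mset (Dia (add_mset e A)) R) B)) E :: ct \<Rightarrow>\<^sub>0 'k)"
      unfolding qBlack_def by (auto elim!: keys_diffE keys_addE split: if_splits)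
    then show thesis
    proof cases
      case 3
      then show thesis using that(4) Black AB(2) by (auto dest!: keys_msum split: if_splits)
    qed (use that Black AB(2) in auto)
  qed (use that in auto)
qed

text \<open>\<open>qd\<close> creates its diamond at the root or as a child of the root; a diamond
  further up must come from a modification inside a child.\<close>

lemma lookup_qd_deep:
  assumes "good T" "\<not> dfree z" "\<And>M. z \<noteq> Dia M" "frame_dfree fr"
  shows "Poly_Mapping.lookup (qd T :: ct \<Rightarrow>\<^sub>0 'k::field) (plugf fr z) = 0"
proof (rule lookup_eq_0, rule notI)
  assume "plugf fr z \<in> Poly_Mapping.keys (qd T :: ct \<Rightarrow>\<^sub>0 'k)"
  then show False
  proof (cases rule: keys_qdE)
    case (1 M)
    then show False using assms(4) by (cases fr) auto
  next
    case (2 l C A B)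
    then have "\<forall>r\<in>#B. dfree r" using good_White(2)[of "()" l C] assms(1) good_dfree by auto
    then show False using 2 assms(2,3) by (cases fr) (auto simp: add_eq_conv_ex)
  next
    case (3 E C A B)
    then have "\<forall>r\<in>#E + B. dfree r" using good_Black(1)[of "()" E C] assms(1) good_dfree by auto
    then show False using 3 assms(2,3) by (cases fr) (auto simp: add_eq_conv_ex)
  next
    case (4 e R C A B)
    then have "\<forall>r\<in>#R + B. dfree r" using good_Black(1)[of "()" "add_mset e R" C] assms(1) good_dfree by auto
    then show False using 4 assms(2,3) by (cases fr) (auto simp: add_eq_conv_ex)
  qed
qed

lemma lookup_lin_ext_zero:
  "(\<And>T. T \<in> Poly_Mapping.keys x \<Longrightarrow> Poly_Mapping.lookup (f T) Z = 0) \<Longrightarrow> Poly_Mapping.lookup (lin_ext f x) Z = 0"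
  by (simp add: lookup_lin_ext)

lemma not_dfree_fill: "\<not> dfree z \<Longrightarrow> \<not> dfree (fill K z)"
proof (induction K)
  case (Cons fr K)
  then show ?case by (cases fr) auto
qed simp

lemma pull_good: "\<forall>T\<in>Poly_Mapping.keys x. good T \<Longrightarrow> \<forall>T\<in>Poly_Mapping.keys (pull fr x). good T"
proof
  fix T assume "\<forall>T\<in>Poly_Mapping.keys x. good T" "T \<in> Poly_Mapping.keys (pull fr x)"
  then have "good (plugf fr T)" by (simp add: keys_pull)
  then show "good T" using good_plugf by metis
qed

primrec pulls :: "frame list \<Rightarrow> (ct \<Rightarrow>\<^sub>0 'k::field) \<Rightarrow> (ct \<Rightarrow>\<^sub>0 'k)" where
  "pulls [] x = x"
| "pulls (fr # K) x = pulls K (pull fr x)"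

lemma lookup_pulls [simp]: "Poly_Mapping.lookup (pulls K x) c = Poly_Mapping.lookup x (fill K c)"
  by (induction K arbitrary: x) simp_all

lemma keys_pulls: "c \<in> Poly_Mapping.keys (pulls K x) \<longleftrightarrow> fill K c \<in> Poly_Mapping.keys x"
  by (simp add: in_keys_iff)

lemma pulls_good: "\<forall>T\<in>Poly_Mapping.keys x. good T \<Longrightarrow> \<forall>T\<in>Poly_Mapping.keys (pulls K x). good T"
proof
  fix T assume "\<forall>T\<in>Poly_Mapping.keys x. good T" "T \<in> Poly_Mapping.keys (pulls K x)"
  then have "good (fill K T)" by (simp add: keys_pulls)
  then show "good T" using good_fill by metis
qed

text \<open>As long as the hole is not filled by the diamond itself, \<open>lookup_qd_deep\<close>
  leaves only the terms inside the hole, and the frames can be stripped off one by one.\<close>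

lemma lookup_delta_fill:
  fixes x :: "ct \<Rightarrow>\<^sub>0 'k::field"
  assumes "\<forall>T\<in>Poly_Mapping.keys x. good T" "\<forall>fr\<in>set K. frame_dfree fr" "\<not> dfree z" "\<And>M. z \<noteq> Dia M"
  shows "Poly_Mapping.lookup (lin_ext delta x) (fill K z) = Poly_Mapping.lookup (lin_ext delta (pulls K x)) z"
  using assms(1,2)
proof (induction K arbitrary: x)
  case (Cons fr K)
  have nd: "fill K z \<noteq> Dia M" for M
  proof (cases K)
    case (Cons fr' K')
    then show ?thesis using Cons.prems(2) by (cases fr') auto
  qed (use assms(4) in simp)
  have "Poly_Mapping.lookup (lin_ext qd x) (fill (fr # K) z) = 0"
    using Cons.prems assms(3) nd by (auto intro!: lookup_lin_ext_zero lookup_qd_deep not_dfree_fill)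
  then have "Poly_Mapping.lookup (lin_ext delta x) (fill (fr # K) z) = Poly_Mapping.lookup (lin_ext delta (pull fr x)) (fill K z)"
    unfolding lookup_delta[of x] using lookup_dev_pull[of x "fill K z" fr delta] not_dfree_fill[OF assms(3), of K] Cons.prems by simp
  also have "\<dots> = Poly_Mapping.lookup (lin_ext delta (pulls K (pull fr x))) z"
    using Cons.IH[of "pull fr x"] pull_good Cons.prems by auto
  finally show ?case by simp
qed simp

section \<open>Coefficients of the local contribution \<open>qd\<close> at a binary diamond\<close>

lemma dst_add_mset_inner: "dst J H (add_mset c C) g = dst J (\<lambda>g. \<Sum>j\<in>#J. H (ins j c g)) C g"
proof (induction C arbitrary: g)
  case empty
  then show ?case by (simp add: dst_add_mset)
next
  case (add d C)
  show ?case
    by (subst add_mset_commute) (simp add: dst_add_mset[of _ _ d] add.IH)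
qed

lemma split2_add_mset: "split2 H (add_mset c C) = split2 (\<lambda>A B. H (add_mset c A) B + H A (add_mset c B)) C"
  by (simp add: split2_def dst_add_mset_inner fun_upd_same fun_upd_other add.commute)

lemma split2_zero: "split2 (\<lambda>A B. 0) C = 0"
  by (simp add: split2_def dst_zero)

lemma split2_plus: "split2 (\<lambda>A B. H A B + G A B) C = split2 H C + split2 G C"
  by (simp add: split2_def dst_plus)

lemma lookup_split2: "Poly_Mapping.lookup (split2 H C) Z = split2 (\<lambda>A B. Poly_Mapping.lookup (H A B) Z) C"
  unfolding split2_def by (rule dst_hom[of "\<lambda>v. Poly_Mapping.lookup v Z"]) (simp_all add: lookup_add)

lemma of_bool_disj_add: "\<not> (P \<and> Q) \<Longrightarrow> of_bool P + of_bool Q = (of_bool (P \<or> Q) :: 'k::field)"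
  by (cases P; cases Q) simp_all

text \<open>With different children, two prescribed parts arise from exactly one split.\<close>

lemma split2_indicator:
  assumes "\<forall>c. count C c \<le> 1"
  shows "split2 (\<lambda>A B. of_bool (A = A0 \<and> B = B0)) C = (of_bool (A0 + B0 = C) :: 'k::field)"
  using assms
proof (induction C arbitrary: A0 B0)
  case empty
  then show ?case by auto
next
  case (add c C)
  have cC: "c \<notin># C" using add.prems[rule_format, of c] by (simp add: not_in_iff)
  have "\<forall>c. count C c \<le> 1"
  proof
    fix d show "count C d \<le> 1" using add.prems[rule_format, of d] by (auto split: if_splits)
  qed
  note IH = add.IH[OF this]
  have 1: "split2 (\<lambda>A B. of_bool (add_mset c A = A0 \<and> B = B0)) C = (of_bool (c \<in># A0 \<and> A0 - {#c#} + B0 = C) :: 'k)"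
  proof (cases "c \<in># A0")
    case True
    then have "(\<lambda>A B. of_bool (add_mset c A = A0 \<and> B = B0) :: 'k) = (\<lambda>A B. of_bool (A = A0 - {#c#} \<and> B = B0))"
      by (intro ext) auto
    then show ?thesis using True IH by simp
  next
    case False
    then have "(\<lambda>A B. of_bool (add_mset c A = A0 \<and> B = B0) :: 'k) = (\<lambda>A B. 0)"
      by (intro ext) auto
    then show ?thesis using False by (simp add: split2_zero)
  qed
  have 2: "split2 (\<lambda>A B. of_bool (A = A0 \<and> add_mset c B = B0)) C = (of_bool (c \<in># B0 \<and> A0 + (B0 - {#c#}) = C) :: 'k)"
  proof (cases "c \<in># B0")
    case True
    then have "(\<lambda>A B. of_bool (A = A0 \<and> add_mset c B = B0) :: 'k) = (\<lambda>A B. of_bool (A = A0 \<and> B = B0 - {#c#}))"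
      by (intro ext) auto
    then show ?thesis using True IH by simp
  next
    case False
    then have "(\<lambda>A B. of_bool (A = A0 \<and> add_mset c B = B0) :: 'k) = (\<lambda>A B. 0)"
      by (intro ext) auto
    then show ?thesis using False by (simp add: split2_zero)
  qed
  have eq: "A0 + B0 = add_mset c C \<longleftrightarrow> (c \<in># A0 \<and> A0 - {#c#} + B0 = C) \<or> (c \<in># B0 \<and> A0 + (B0 - {#c#}) = C)"
  proof
    assume e: "A0 + B0 = add_mset c C"
    then have "c \<in># A0 + B0" by simp
    then consider "c \<in># A0" | "c \<in># B0" by auto
    then show "(c \<in># A0 \<and> A0 - {#c#} + B0 = C) \<or> (c \<in># B0 \<and> A0 + (B0 - {#c#}) = C)"
    proof cases
      case 1
      then obtain A1 where "A0 = add_mset c A1" by (meson multi_member_split)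
      then show ?thesis using e by simp
    next
      case 2
      then obtain B1 where "B0 = add_mset c B1" by (meson multi_member_split)
      then show ?thesis using e by simp
    qed
  next
    assume "(c \<in># A0 \<and> A0 - {#c#} + B0 = C) \<or> (c \<in># B0 \<and> A0 + (B0 - {#c#}) = C)"
    then show "A0 + B0 = add_mset c C"
    proof
      assume c: "c \<in># A0 \<and> A0 - {#c#} + B0 = C"
      then obtain A1 where "A0 = add_mset c A1" by (meson multi_member_split)
      then show ?thesis using c by simp
    next
      assume c: "c \<in># B0 \<and> A0 + (B0 - {#c#}) = C"
      then obtain B1 where "B0 = add_mset c B1" by (meson multi_member_split)
      then show ?thesis using c by simp
    qed
  qed
  have ne: "\<not> ((c \<in># A0 \<and> A0 - {#c#} + B0 = C) \<and> (c \<in># B0 \<and> A0 + (B0 - {#c#}) = C))"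
  proof
    assume "(c \<in># A0 \<and> A0 - {#c#} + B0 = C) \<and> (c \<in># B0 \<and> A0 + (B0 - {#c#}) = C)"
    then have "c \<in># B0" "A0 - {#c#} + B0 = C" by blast+
    then have "c \<in># C" by (metis union_iff)
    with cC show False ..
  qed
  show ?case unfolding split2_add_mset split2_plus 1 2 eq by (rule of_bool_disj_add[OF ne])
qed

lemma lookup_basis: "Poly_Mapping.lookup (basis a) b = of_bool (a = b)"
  by (simp add: lookup_single when_def)

lemma good_children_distinct:
  "good (White i l C) \<Longrightarrow> \<forall>c. count C c \<le> 1"
  "good (Black i E C) \<Longrightarrow> \<forall>c. count C c \<le> 1"
proof -
  have *: "count C c \<le> 1" if "\<And>R. C = add_mset c R \<Longrightarrow> c \<notin># R" for C c
  proof (cases "c \<in># C")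
    case True
    then obtain R where "C = add_mset c R" by (meson multi_member_split)
    then show ?thesis using that[of R] by (simp add: not_in_iff)
  next
    case False
    then have "count C c = 0" by (simp only: count_eq_zero_iff not_False_eq_True)
    then show ?thesis by simp
  qed
  show "\<forall>c. count C c \<le> 1" if g: "good (White i l C)"
    by (intro allI *) (rule good_White(3)[OF g])
  assume g: "good (Black i E C)"
  have "c \<notin># R" if "C = add_mset c R" for c R
    using good_Black(3)[OF g, where c = c and R = "E + R"] that by simp
  then show "\<forall>c. count C c \<le> 1" by (intro allI *)
qed

text \<open>A diamond below the old root has as children this root, with what remains on it, and the
  split-off part. So one of \<open>T0\<close> and \<open>T1\<close> contains the old root and the
  other was one of its children; \<open>X\<close> stands for a white or a black root.\<close>

lemma split2_root:
  assumes "\<forall>c. count C c \<le> 1" "T0 \<noteq> T1" "\<And>y B. addroot y (X B) = X (add_mset y B)"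
    and X: "\<And>B B'. X B = X B' \<longleftrightarrow> B = B'" and range: "\<And>y T B. addroot y T = X B \<Longrightarrow> \<exists>B'. T = X B'"
  shows "split2 (\<lambda>A B. of_bool (add_mset (X B) A = {#T0, T1#})) C =
    (of_bool (X C = addroot T1 T0) + of_bool (X C = addroot T0 T1) :: 'k::field)"
proof -
  have one: "split2 (\<lambda>A B. of_bool (X B = T0 \<and> A = {#T1#})) C = (of_bool (X C = addroot T1 T0) :: 'k)" for T0 T1
  proof (cases "\<exists>B0. T0 = X B0")
    case True
    then obtain B0 where B0: "T0 = X B0" by blast
    have "(\<lambda>A B. of_bool (X B = T0 \<and> A = {#T1#}) :: 'k) = (\<lambda>A B. of_bool (A = {#T1#} \<and> B = B0))"
      by (intro ext) (auto simp: B0 X)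
    moreover have "X C = addroot T1 T0 \<longleftrightarrow> {#T1#} + B0 = C"
      unfolding B0 assms(3) X by auto
    ultimately show ?thesis by (simp only: split2_indicator[OF assms(1)])
  next
    case False
    then have "(\<lambda>A B. of_bool (X B = T0 \<and> A = {#T1#}) :: 'k) = (\<lambda>A B. 0)"
      by (intro ext) auto
    moreover have "X C \<noteq> addroot T1 T0" using range[of T1 T0 C] False by auto
    ultimately show ?thesis by (simp add: split2_zero)
  qed
  have "(\<lambda>A B. of_bool (add_mset (X B) A = {#T0, T1#}) :: 'k) =
      (\<lambda>A B. of_bool (X B = T0 \<and> A = {#T1#}) + of_bool (X B = T1 \<and> A = {#T0#}))"
  proof (intro ext)
    fix A B
    have "add_mset (X B) A = {#T0, T1#} \<longleftrightarrow> (X B = T0 \<and> A = {#T1#}) \<or> (X B = T1 \<and> A = {#T0#})"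
      by (auto simp: add_eq_conv_ex)
    then show "(of_bool (add_mset (X B) A = {#T0, T1#}) :: 'k) = of_bool (X B = T0 \<and> A = {#T1#}) + of_bool (X B = T1 \<and> A = {#T0#})"
      using assms(2) by auto
  qed
  then show ?thesis by (simp only: split2_plus one)
qed

lemma lookup_qd_root:
  assumes T: "good T" and "T0 \<noteq> T1"
  shows "Poly_Mapping.lookup (qd T) (Dia {#T0, T1#}) =
    (2 * of_bool (T = Black () {#T0, T1#} {#}) - of_bool (T = addroot T1 T0) - of_bool (T = addroot T0 T1) :: 'k::field)"
proof (cases T)
  case (White i l C)
  have l: "l \<noteq> None" using good_White(1) T White by blast
  have r: "split2 (\<lambda>A B. of_bool (add_mset (White () l B) A = {#T0, T1#})) C =
    (of_bool (White () l C = addroot T1 T0) + of_bool (White () l C = addroot T0 T1) :: 'k)"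
  proof (rule split2_root[OF _ assms(2)])
    show "\<forall>c. count C c \<le> 1" using good_children_distinct(1)[of i l C] T White by simp
    show "addroot y T = White () l B \<Longrightarrow> \<exists>B'. T = White () l B'" for y T B by (cases T) auto
  qed auto
  have "Poly_Mapping.lookup (qd T) (Dia {#T0, T1#}) =
      split2 (\<lambda>A B. 0 - of_bool (add_mset (White () l B) A = {#T0, T1#}) :: 'k) C"
    using l by (auto simp: White qd_White lookup_split2 lookup_minus lookup_basis)
  also have "\<dots> = - split2 (\<lambda>A B. of_bool (add_mset (White () l B) A = {#T0, T1#}) :: 'k) C"
    by (simp only: split2_diff split2_zero) simp
  finally show ?thesis unfolding r by (simp add: White)
next
  case (Black i E C)
  have r: "split2 (\<lambda>A B. of_bool (add_mset (Black () E B) A = {#T0, T1#})) C =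
    (of_bool (Black () E C = addroot T1 T0) + of_bool (Black () E C = addroot T0 T1) :: 'k)"
  proof (rule split2_root[OF _ assms(2)])
    show "\<forall>c. count C c \<le> 1" using good_children_distinct(2)[of i E C] T Black by simp
    show "addroot y T = Black () E B \<Longrightarrow> \<exists>B'. T = Black () E B'" for y T B by (cases T) auto
  qed auto
  have 0: "Poly_Mapping.lookup (msum (\<lambda>e R. basis (Black () (add_mset (Dia (add_mset e A)) R) B)) E) (Dia {#T0, T1#}) = (0 :: 'k)" for A B
    by (rule lookup_eq_0) (auto dest!: keys_msum)
  have "size E = 2" using good_Black(2) T Black by blast
  then have e: "E + C = {#T0, T1#} \<longleftrightarrow> T = Black () {#T0, T1#} {#}"
  proof -
    assume sE: "size E = 2"
    have "C = {#}" if "E + C = {#T0, T1#}"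
    proof -
      have "size (E + C) = 2" using that by simp
      then show ?thesis using sE by simp
    qed
    then show ?thesis by (auto simp: Black)
  qed
  have "Poly_Mapping.lookup (qd T) (Dia {#T0, T1#}) =
      split2 (\<lambda>A B. 0 - of_bool (add_mset (Black () E B) A = {#T0, T1#}) :: 'k) C + 2 * of_bool (E + C = {#T0, T1#})"
    by (simp add: Black qd_Black qBlack_def lookup_add lookup_split2 lookup_minus lookup_basis 0)
  also have "split2 (\<lambda>A B. 0 - of_bool (add_mset (Black () E B) A = {#T0, T1#}) :: 'k) C =
      - split2 (\<lambda>A B. of_bool (add_mset (Black () E B) A = {#T0, T1#}) :: 'k) C"
    by (simp only: split2_diff split2_zero) simp
  finally show ?thesis unfolding r e by (simp add: Black)
qed

text \<open>The diamond is recognised among its siblings, so the split-off part consists of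
  \<open>T0\<close> and \<open>T1\<close>, and a split with this part is unique.\<close>

lemma lookup_qd_White:
  assumes T: "good T" and l: "l \<noteq> None" and R: "\<forall>r\<in>#R. dfree r"
  shows "Poly_Mapping.lookup (qd T) (White () l (add_mset (Dia {#T0, T1#}) R)) =
    (of_bool (T = White () l (add_mset T0 (add_mset T1 R))) :: 'k::field)"
proof (cases T)
  case (White i l' C)
  have d: "\<forall>c. count C c \<le> 1" using good_children_distinct(1)[of i l' C] T White by simp
  have *: "add_mset (Dia A) B = add_mset (Dia {#T0, T1#}) R \<longleftrightarrow> A = {#T0, T1#} \<and> B = R" for A B
    using add_mset_eq_dfree[of "Dia A" R "Dia {#T0, T1#}" B] R by auto
  have "Poly_Mapping.lookup (qd T) (White () l (add_mset (Dia {#T0, T1#}) R)) =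
      split2 (\<lambda>A B. if l' = l then of_bool (A = {#T0, T1#} \<and> B = R) else 0 :: 'k) C"
    unfolding White qd_White lookup_split2
    by (rule arg_cong[where f = "\<lambda>H. split2 H C"], intro ext) (use l in \<open>auto simp: lookup_minus lookup_basis *\<close>)
  also have "\<dots> = (if l' = l then of_bool ({#T0, T1#} + R = C) else 0)"
    by (simp add: split2_zero split2_indicator[OF d])
  finally show ?thesis by (auto simp: White)
next
  case (Black i E C)
  have "White () l (add_mset (Dia {#T0, T1#}) R) \<notin> Poly_Mapping.keys (qd T :: ct \<Rightarrow>\<^sub>0 'k)"
    using l Black by (auto elim!: keys_qdE)
  then show ?thesis by (simp add: lookup_eq_0 Black)
qed

lemma lookup_qd_ordinary:
  assumes T: "good T" and E0: "\<forall>r\<in>#E0. dfree r" and R: "\<forall>r\<in>#R. dfree r"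
  shows "Poly_Mapping.lookup (qd T) (Black () E0 (add_mset (Dia {#T0, T1#}) R)) =
    (of_bool (T = Black () E0 (add_mset T0 (add_mset T1 R))) :: 'k::field)"
proof (cases T)
  case (White i l' C)
  have "Black () E0 (add_mset (Dia {#T0, T1#}) R) \<notin> Poly_Mapping.keys (qd T :: ct \<Rightarrow>\<^sub>0 'k)"
    using White by (auto elim!: keys_qdE)
  then show ?thesis by (simp add: lookup_eq_0 White)
next
  case (Black i E C)
  let ?Z = "Black () E0 (add_mset (Dia {#T0, T1#}) R)"
  have d: "\<forall>c. count C c \<le> 1" using good_children_distinct(2)[of i E C] T Black by simp
  have *: "add_mset (Dia A) B = add_mset (Dia {#T0, T1#}) R \<longleftrightarrow> A = {#T0, T1#} \<and> B = R" for A B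
    using add_mset_eq_dfree[of "Dia A" R "Dia {#T0, T1#}" B] R by auto
  have 0: "Poly_Mapping.lookup (msum (\<lambda>e R. basis (Black () (add_mset (Dia (add_mset e A)) R) B)) E) ?Z = (0 :: 'k)" for A B
  proof (rule lookup_eq_0, rule notI)
    assume "?Z \<in> Poly_Mapping.keys (msum (\<lambda>e R. basis (Black () (add_mset (Dia (add_mset e A)) R) B)) E :: ct \<Rightarrow>\<^sub>0 'k)"
    then obtain e R where "E0 = add_mset (Dia (add_mset e A)) R" by (auto dest!: keys_msum split: if_splits)
    then show False using E0 by simp
  qed
  have "Poly_Mapping.lookup (qd T) ?Z = split2 (\<lambda>A B. if E = E0 then of_bool (A = {#T0, T1#} \<and> B = R) else 0 :: 'k) C"
    unfolding Black qd_Black lookup_add lookup_split2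
    by (simp add: lookup_basis)
      (rule arg_cong[where f = "\<lambda>H. split2 H C"], intro ext, simp add: qBlack_def lookup_add lookup_minus lookup_basis * 0)
  also have "\<dots> = (if E = E0 then of_bool ({#T0, T1#} + R = C) else 0)"
    by (simp add: split2_zero split2_indicator[OF d])
  finally show ?thesis by (auto simp: Black)
qed

text \<open>The trees named here are lighter than the ones compared in \<open>move_root\<close>, so
  knowing which trees occur suffices there.\<close>

lemma lookup_qd_special:
  assumes T: "good T" and Y: "\<forall>r\<in>#Y. dfree r"
    and nz: "Poly_Mapping.lookup (qd T :: ct \<Rightarrow>\<^sub>0 'k::field) (Black () (add_mset (Dia {#T0, T1#}) Y) C0) \<noteq> 0"
  shows "T = Black () (add_mset T0 Y) (add_mset T1 C0) \<or> T = Black () (add_mset T1 Y) (add_mset T0 C0)"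
proof -
  have "Black () (add_mset (Dia {#T0, T1#}) Y) C0 \<in> Poly_Mapping.keys (qd T :: ct \<Rightarrow>\<^sub>0 'k)"
    using nz by (simp add: in_keys_iff)
  then show ?thesis
  proof (cases rule: keys_qdE)
    case (3 E C A B)
    then have "\<forall>r\<in>#E. dfree r" using good_Black(1)[of "()" E C] T good_dfree by auto
    then show ?thesis using 3 by auto
  next
    case (4 e R C A B)
    then have "\<forall>r\<in>#R. dfree r" using good_Black(1)[of "()" "add_mset e R" C] T good_dfree by auto
    moreover have "add_mset (Dia (add_mset e A)) R = add_mset (Dia {#T0, T1#}) Y" "C0 = B" using 4(3) by simp_all
    ultimately have "Dia (add_mset e A) = Dia {#T0, T1#}" and RY: "R = Y" "B = C0"
      using add_mset_eq_dfree[of "Dia {#T0, T1#}" R "Dia (add_mset e A)" Y] by simp_all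
    then have "(e = T0 \<and> A = {#T1#}) \<or> (e = T1 \<and> A = {#T0#})" by (auto simp: add_eq_conv_ex)
    then show ?thesis using 4(1,2) RY by auto
  qed auto
qed

lemma lookup_lin_ext_indicator:
  assumes "\<And>T. T \<in> Poly_Mapping.keys x \<Longrightarrow> Poly_Mapping.lookup (f T) Z = of_bool (T = a)"
  shows "Poly_Mapping.lookup (lin_ext f x) Z = Poly_Mapping.lookup x a"
proof -
  have "Poly_Mapping.lookup (lin_ext f x) Z = (\<Sum>T\<in>Poly_Mapping.keys x. if T = a then Poly_Mapping.lookup x T else 0)"
    unfolding lookup_lin_ext by (intro sum.cong refl) (simp add: assms)
  then show ?thesis by (simp add: in_keys_iff)
qed

text \<open>Modifications inside a child keep the root, which is never a diamond in a good tree; so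
  the whole coefficient is given by \<open>lookup_qd_root\<close>.\<close>

lemma lookup_delta_root:
  fixes y :: "ct \<Rightarrow>\<^sub>0 'k::field"
  assumes y: "\<forall>T\<in>Poly_Mapping.keys y. good T" and "T0 \<noteq> T1"
  shows "Poly_Mapping.lookup (lin_ext delta y) (Dia {#T0, T1#}) =
    2 * Poly_Mapping.lookup y (Black () {#T0, T1#} {#}) - Poly_Mapping.lookup y (addroot T1 T0) - Poly_Mapping.lookup y (addroot T0 T1)"
proof -
  have "Poly_Mapping.lookup (lin_ext (dev delta) y) (Dia {#T0, T1#}) = 0"
  proof (rule lookup_lin_ext_zero, rule lookup_eq_0, rule notI)
    fix T assume "T \<in> Poly_Mapping.keys y" "Dia {#T0, T1#} \<in> Poly_Mapping.keys (dev delta T :: ct \<Rightarrow>\<^sub>0 'k)"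
    from this(2) show False
    proof (cases rule: keys_devE)
      case (white i l c R u)
      have "good T" using y \<open>T \<in> Poly_Mapping.keys y\<close> by blast
      then show False using white good_White(1)[of i l "add_mset c R"] by simp
    qed auto
  qed
  moreover have "Poly_Mapping.lookup (lin_ext qd y) (Dia {#T0, T1#}) =
     2 * Poly_Mapping.lookup y (Black () {#T0, T1#} {#}) - Poly_Mapping.lookup y (addroot T1 T0) - Poly_Mapping.lookup y (addroot T0 T1)"
  proof -
    have s: "(\<Sum>T\<in>Poly_Mapping.keys y. Poly_Mapping.lookup y T * of_bool (T = a)) = Poly_Mapping.lookup y a" for a
    proof -
      have "(\<Sum>T\<in>Poly_Mapping.keys y. Poly_Mapping.lookup y T * of_bool (T = a)) =
          (\<Sum>T\<in>Poly_Mapping.keys y. if T = a then Poly_Mapping.lookup y T else 0)"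
        by (intro sum.cong refl) simp
      then show ?thesis by (simp add: in_keys_iff)
    qed
    have "Poly_Mapping.lookup (lin_ext qd y) (Dia {#T0, T1#}) =
       (\<Sum>T\<in>Poly_Mapping.keys y. 2 * (Poly_Mapping.lookup y T * of_bool (T = Black () {#T0, T1#} {#})) -
         Poly_Mapping.lookup y T * of_bool (T = addroot T1 T0) - Poly_Mapping.lookup y T * of_bool (T = addroot T0 T1))"
      unfolding lookup_lin_ext
      by (intro sum.cong refl) (use y in \<open>simp add: lookup_qd_root[OF _ assms(2)] algebra_simps\<close>)
    then show ?thesis by (simp only: sum_subtractf sum_distrib_left[symmetric] s)
  qed
  ultimately show ?thesis by (simp add: lookup_delta)
qed

section \<open>Vanishing of the derivation forces a normal form in the lightest part\<close>

primrec binary_dia :: "ct \<Rightarrow> bool" where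
  "binary_dia (White i l C) \<longleftrightarrow> (l = None \<longrightarrow> size C = 2) \<and> (\<forall>b\<in>#image_mset binary_dia C. b)"
| "binary_dia (Black i E C) \<longleftrightarrow> (\<forall>b\<in>#image_mset binary_dia E. b) \<and> (\<forall>b\<in>#image_mset binary_dia C. b)"

lemma dfree_binary: "dfree T \<Longrightarrow> binary_dia T"
  by (induction T) auto

lemma graft_dia_not_binary: "t \<in> Poly_Mapping.keys (graft (Dia {#}) T :: ct \<Rightarrow>\<^sub>0 'k::field) \<Longrightarrow> \<not> binary_dia t"
proof (induction rule: graft_keys_induct)
  case (root T)
  then show ?case by (cases T) auto
qed auto

text \<open>The commutator with \<open>dia\<close> creates diamonds with at most one child, so at
  trees whose diamonds are all binary only \<open>delta\<close> is visible.\<close>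

lemma D_zero_delta:
  assumes "D x = 0" "binary_dia Z"
  shows "Poly_Mapping.lookup (lin_ext delta x) Z = 0"
proof -
  have "lin_ext delta x = gr x dia - gr dia x" using assms(1) by (simp add: D_eq)
  moreover have "Z \<notin> Poly_Mapping.keys (gr x dia)"
    using assms(2) graft_dia_not_binary by (auto simp: gr_def bilin_ext_right_basis elim!: keys_lin_extE)
  moreover have "Z \<notin> Poly_Mapping.keys (gr dia x)"
    using assms(2) by (auto simp: gr_def bilin_ext_left_basis graft_White elim!: keys_lin_extE split: if_splits)
  ultimately show ?thesis by (simp add: lookup_minus lookup_eq_0)
qed

lemma binary_fill:
  assumes "\<forall>fr\<in>set K. frame_dfree fr" "dfree T0" "dfree T1"
  shows "binary_dia (fill K (Dia {#T0, T1#}))"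
  using assms
proof (induction K)
  case Nil
  then show ?case by (simp add: dfree_binary)
next
  case (Cons fr K)
  then show ?case by (cases fr) (auto intro: dfree_binary)
qed

lemma white_labels_fill: "\<exists>W. \<forall>c. white_labels (fill K c) = white_labels c + W"
proof (induction K)
  case (Cons fr K)
  then obtain W where W: "\<And>c. white_labels (fill K c) = white_labels c + W" by blast
  obtain V where "\<And>c. white_labels (plugf fr c) = white_labels c + V"
  proof (cases fr)
    case (FW l R)
    then show thesis using that[of "add_mset l (\<Sum>\<^sub># (image_mset white_labels R))"] by simp
  next
    case (FS Y C)
    then show thesis using that[of "\<Sum>\<^sub># (image_mset white_labels Y) + \<Sum>\<^sub># (image_mset white_labels C)"] by simp
  next
    case (FO E R)
    then show thesis using that[of "\<Sum>\<^sub># (image_mset white_labels E) + \<Sum>\<^sub># (image_mset white_labels R)"] by simp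
  qed
  then have "\<forall>c. white_labels (fill (fr # K) c) = white_labels c + (W + V)" by (simp add: W)
  then show ?case ..
qed simp

text \<open>A context notices its filling only through the weight and, at special edges, through the
  number of labels.\<close>

lemma wt_fill:
  assumes "size (white_labels a) = size (white_labels b)"
  shows "wt B (fill K a) - wt B a = wt B (fill K b) - wt B b"
proof (induction K)
  case (Cons fr K)
  obtain W where W: "\<And>c. white_labels (fill K c) = white_labels c + W" using white_labels_fill by blast
  have *: "wt B (plugf fr c) - wt B c - int (size (white_labels c)) = wt B (plugf fr d) - wt B d - int (size (white_labels d)) \<or>
     wt B (plugf fr c) - wt B c = wt B (plugf fr d) - wt B d" for c d by (cases fr) simp_all
  show ?case using *[of "fill K a" "fill K b"] Cons assms by (simp add: W)
qed simp

lemma wt_addroot [simp]: "wt B (addroot y T) = wt B y + wt B T"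
  by (cases T) simp_all

primrec extend :: "frame \<Rightarrow> ct \<Rightarrow> frame" where
  "extend (FW l R) a = FW l (add_mset a R)"
| "extend (FS Y C) a = FS Y (add_mset a C)"
| "extend (FO E R) a = FO E (add_mset a R)"

lemma good_addroot:
  assumes "good (addroot T1 T0)"
  shows "good T0" "good T1" "T0 \<noteq> T1"
proof -
  have c: "count (white_labels T1) l + count (white_labels T0) l \<le> 1" for l
    using assms by (simp add: good_def)
  then have "count (white_labels T1) l \<le> 1" "count (white_labels T0) l \<le> 1" for l by (meson add_leD1 add_leD2)+
  then show "good T0" "good T1" using assms by (auto simp: good_def)
  then obtain l where "l \<in># white_labels T0" using white_labels_nonempty[of T0] by (auto simp: good_def)
  then have "count (white_labels T0) l \<ge> 1" by simp
  then have "count (white_labels T0) l \<noteq> count (white_labels T1) l" using c[of l] by linarith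
  then show "T0 \<noteq> T1" by auto
qed

locale kernel_element =
  fixes x :: "ct \<Rightarrow>\<^sub>0 'k::field" and S :: "nat set" and B :: nat and w :: int
  assumes x: "x \<in> nT S" and Dx: "D x = 0" and B: "card S < B"
    and minimal: "T \<in> Poly_Mapping.keys x \<Longrightarrow> w \<le> wt B T"
begin

text \<open>As \<open>w\<close> is only a lower bound, there may be no such tree;
  \<open>kernel_subset_span\<close> arranges for exactly this and then raises
  \<open>w\<close>.\<close>

definition light :: "ct \<Rightarrow> bool" where
  "light T \<longleftrightarrow> T \<in> Poly_Mapping.keys x \<and> wt B T = w"

lemma keys_good: "\<forall>T\<in>Poly_Mapping.keys x. good T"
  using x christoffel_good by (auto simp: trees_span_def)

lemma light_good: "light T \<Longrightarrow> good T"
  using keys_good by (simp add: light_def)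

lemma light_labels: "light T \<Longrightarrow> T \<in> christoffel_trees S"
  using x by (auto simp: light_def trees_span_def)

lemma light_fill_labels: "light (fill K a) \<Longrightarrow> light (fill K b) \<Longrightarrow> white_labels a = white_labels b"
proof -
  assume "light (fill K a)" "light (fill K b)"
  then have "white_labels (fill K a) = white_labels (fill K b)"
    using light_labels by (auto simp: christoffel_trees_mset)
  moreover obtain W where "\<forall>c. white_labels (fill K c) = white_labels c + W" using white_labels_fill by blast
  ultimately show ?thesis by simp
qed

lemma light_fill_size: "light (fill K a) \<Longrightarrow> size (white_labels a) < B"
proof -
  assume "light (fill K a)"
  then have "size (white_labels (fill K a)) = card S" using light_labels size_christoffel by blast
  moreover obtain W where "\<forall>c. white_labels (fill K c) = white_labels c + W" using white_labels_fill by blast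
  ultimately show ?thesis using B by simp
qed

lemma lookup_lighter: "wt B T < w \<Longrightarrow> Poly_Mapping.lookup x T = 0"
  using minimal[of T] by (auto simp: in_keys_iff)

lemma light_iff: "wt B T = w \<Longrightarrow> light T \<longleftrightarrow> Poly_Mapping.lookup x T \<noteq> 0"
  by (simp add: light_def in_keys_iff)

text \<open>The black vertex adds the number of labels of \<open>T0\<close> and \<open>T1\<close> to
  the weight and removes \<open>B\<close>, which is larger.\<close>

lemma lookup_merged:
  assumes "light (fill K T)" "white_labels T = white_labels T0 + white_labels T1" "wt B T = wt B T0 + wt B T1"
  shows "Poly_Mapping.lookup x (fill K (Black () {#T0, T1#} {#})) = 0"
proof (rule lookup_lighter)
  have "wt B (Black () {#T0, T1#} {#}) < wt B T"
    using light_fill_size[OF assms(1)] assms(2,3) by simp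
  then have "wt B (fill K (Black () {#T0, T1#} {#})) < wt B (fill K T)"
    using wt_fill[of "Black () {#T0, T1#} {#}" T B K] assms(2) by simp
  then show "wt B (fill K (Black () {#T0, T1#} {#})) < w" using assms(1) by (simp add: light_def)
qed

text \<open>
  The coefficient of \<open>D x\<close> at the tree with a diamond over \<open>T0\<close> and \<open>T1\<close> relates the coefficients of
  \<open>x\<close> at the trees with \<open>T1\<close> attached to the root of \<open>T0\<close>, with \<open>T0\<close> attached to the root of \<open>T1\<close>,
  and with both joined by a black vertex; the last tree is too light to occur.
\<close>

lemma move_root:
  assumes K: "K = [] \<or> (\<exists>K' Y C. K = K' @ [FS Y C])" and l: "light (fill K (addroot T1 T0))"
  shows "light (fill K (addroot T0 T1))"
proof -
  have g: "good (addroot T1 T0)" "\<forall>fr\<in>set K. frame_dfree fr" using good_fill light_good l by blast+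
  have t: "T0 \<noteq> T1" "dfree T0" "dfree T1" using good_addroot[OF g(1)] good_dfree by auto
  have b: "binary_dia (fill K (Dia {#T0, T1#}))" using binary_fill g(2) t by blast
  have "wt B (fill K (addroot T0 T1)) = wt B (fill K (addroot T1 T0))"
    using wt_fill[of "addroot T0 T1" "addroot T1 T0" B K] by simp
  then have w: "wt B (fill K (addroot T0 T1)) = w" using l by (simp add: light_def)
  have m: "Poly_Mapping.lookup x (fill K (Black () {#T0, T1#} {#})) = 0"
    by (rule lookup_merged[OF l]) simp_all
  have "Poly_Mapping.lookup (lin_ext delta (pulls K x)) (Dia {#T0, T1#}) = 0"
    using K
  proof
    assume "K = []"
    then show ?thesis using D_zero_delta[OF Dx b] by simp
  next
    assume "\<exists>K' Y C. K = K' @ [FS Y C]"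
    then obtain K' Y C where K: "K = K' @ [FS Y C]" by blast
    let ?x' = "pulls K' x"
    have gx: "\<forall>T\<in>Poly_Mapping.keys ?x'. good T" using pulls_good[OF keys_good] .
    have YC: "frame_dfree (FS Y C)" using g(2) K by simp
    have nd: "\<not> dfree (plugf (FS Y C) (Dia {#T0, T1#}))" by simp
    have "Poly_Mapping.lookup (lin_ext delta ?x') (plugf (FS Y C) (Dia {#T0, T1#})) = 0"
    proof -
      have "Poly_Mapping.lookup (lin_ext delta x) (fill K' (plugf (FS Y C) (Dia {#T0, T1#}))) = 0"
        using D_zero_delta[OF Dx b] by (simp add: K)
      then show ?thesis
        using lookup_delta_fill[OF keys_good _ nd, of K'] g(2) K by simp
    qed
    \<comment> \<open>The diamond might also have been created by the black vertex below it, from a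
      tree with one of \<open>T0\<close> and \<open>T1\<close> on an ordinary edge. Such a tree
      saves part of the cost of the special edge, so it is lighter than \<open>w\<close> and absent
      from \<open>x\<close>.\<close>
    moreover have "Poly_Mapping.lookup (lin_ext qd ?x') (plugf (FS Y C) (Dia {#T0, T1#})) = 0"
    proof (rule lookup_lin_ext_zero, rule ccontr)
      fix T assume T: "T \<in> Poly_Mapping.keys ?x'" "Poly_Mapping.lookup (qd T :: ct \<Rightarrow>\<^sub>0 'k) (plugf (FS Y C) (Dia {#T0, T1#})) \<noteq> 0"
      have "T = Black () (add_mset T0 Y) (add_mset T1 C) \<or> T = Black () (add_mset T1 Y) (add_mset T0 C)"
        by (rule lookup_qd_special[where 'k = 'k]) (use T gx YC in auto)
      moreover have "0 < size (white_labels T0)" "0 < size (white_labels T1)"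
        using good_addroot(1,2)[OF g(1)] size_white_labels_pos by (auto simp: good_def)
      ultimately have "wt B T < wt B (Black () (add_mset (addroot T1 T0) Y) C)"
        "size (white_labels T) = size (white_labels (Black () (add_mset (addroot T1 T0) Y) C))"
        by auto
      then have "wt B (fill K' T) < wt B (fill K (addroot T1 T0))"
        using wt_fill[of T "Black () (add_mset (addroot T1 T0) Y) C" B K'] by (simp add: K)
      then have "wt B (fill K' T) < w" using l by (simp add: light_def)
      moreover have "fill K' T \<in> Poly_Mapping.keys x" using T(1) by (simp add: keys_pulls)
      ultimately show False using minimal by fastforce
    qed
    ultimately have "Poly_Mapping.lookup (lin_ext (dev delta) ?x') (plugf (FS Y C) (Dia {#T0, T1#})) = 0"
      by (simp add: lookup_delta)
    then have "Poly_Mapping.lookup (lin_ext delta (pull (FS Y C) ?x')) (Dia {#T0, T1#}) = 0"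
      using lookup_dev_pull[OF gx _ YC, of "Dia {#T0, T1#}" delta] by simp
    moreover have "pulls K x = pull (FS Y C) ?x'"
      by (rule poly_mapping_eqI) (simp add: K)
    ultimately show ?thesis by simp
  qed
  then have "Poly_Mapping.lookup x (fill K (addroot T0 T1)) = - Poly_Mapping.lookup x (fill K (addroot T1 T0))"
    using lookup_delta_root[OF pulls_good[OF keys_good] t(1), of K] m by (simp add: eq_neg_iff_add_eq_0 add.commute)
  moreover have "Poly_Mapping.lookup x (fill K (addroot T1 T0)) \<noteq> 0" using l by (simp add: light_def in_keys_iff)
  ultimately show ?thesis using light_iff[OF w] by simp
qed

text \<open>
  Below an ordinary edge, the same coefficient also involves the tree with \<open>T0\<close> and \<open>T1\<close> as ordinary
  siblings, so if this tree occurs then one of the trees with the siblings stacked occurs as well.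
\<close>

lemma merge_siblings:
  assumes fr: "\<And>Y C. fr \<noteq> FS Y C" and l: "light (fill K (plugf (extend fr T0) T1))"
  shows "light (fill K (plugf fr (addroot T1 T0))) \<or> light (fill K (plugf fr (addroot T0 T1)))"
proof -
  have g: "good (plugf (extend fr T0) T1)" "\<forall>fr\<in>set K. frame_dfree fr" using good_fill light_good l by blast+
  have "plugf (extend fr T1) T0 = plugf (extend fr T0) T1" using fr by (cases fr) (auto simp: add_mset_commute)
  then have g': "good T0" "good T1" "frame_dfree (extend fr T0)"
    using good_plugf[OF g(1)] good_plugf[of "extend fr T1" T0] g(1) by simp_all
  have d: "dfree T0" "dfree T1" "frame_dfree fr" using g' good_dfree by (blast, blast, cases fr) simp_all
  have "T0 \<noteq> T1"
  proof (cases fr)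
    case (FW l R)
    then show ?thesis using good_White(3)[of "()" l "add_mset T1 (add_mset T0 R)" T1 "add_mset T0 R"] g(1) by auto
  next
    case (FO E R)
    then show ?thesis using good_Black(3)[of "()" E "add_mset T1 (add_mset T0 R)" T1 "E + add_mset T0 R"] g(1) by auto
  qed (use fr in blast)
  let ?x' = "pulls K x" and ?Z = "plugf fr (Dia {#T0, T1#})"
  have gx: "\<forall>T\<in>Poly_Mapping.keys ?x'. good T" using pulls_good[OF keys_good] .
  have b: "binary_dia (fill K ?Z)" using binary_fill[of "K @ [fr]"] g(2) d by simp
  have nd: "\<not> dfree ?Z" by (cases fr) auto
  have nD: "?Z \<noteq> Dia M" for M using d(3) by (cases fr) auto
  have "Poly_Mapping.lookup (lin_ext delta ?x') ?Z = 0"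
    using lookup_delta_fill[OF keys_good g(2) nd nD] D_zero_delta[OF Dx b] by simp
  moreover have "Poly_Mapping.lookup (lin_ext qd ?x') ?Z = Poly_Mapping.lookup x (fill K (plugf (extend fr T0) T1))"
  proof -
    have "Poly_Mapping.lookup (lin_ext qd ?x') ?Z = Poly_Mapping.lookup ?x' (plugf (extend fr T0) T1)"
    proof (rule lookup_lin_ext_indicator)
      fix T assume "T \<in> Poly_Mapping.keys ?x'"
      then have "good T" using gx by blast
      then show "Poly_Mapping.lookup (qd T) ?Z = (of_bool (T = plugf (extend fr T0) T1) :: 'k)"
      proof (cases fr)
        case (FW l R)
        then show ?thesis using lookup_qd_White[of T l R T0 T1] \<open>good T\<close> d(3) by (simp add: add_mset_commute)
      next
        case (FO E R)
        then show ?thesis using lookup_qd_ordinary[of T E R T0 T1] \<open>good T\<close> d(3) by (simp add: add_mset_commute)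
      qed (use fr in blast)
    qed
    then show ?thesis by simp
  qed
  moreover have "Poly_Mapping.lookup (lin_ext (dev delta) ?x') ?Z =
     - Poly_Mapping.lookup x (fill K (plugf fr (addroot T1 T0))) - Poly_Mapping.lookup x (fill K (plugf fr (addroot T0 T1)))"
  proof -
    have "Poly_Mapping.lookup x (fill K (plugf fr (Black () {#T0, T1#} {#}))) = 0"
    proof (rule lookup_lighter)
      let ?b = "plugf fr (Black () {#T0, T1#} {#})" and ?p = "plugf (extend fr T0) T1"
      have "size (white_labels T0) + size (white_labels T1) < B"
        using light_fill_size[OF l] fr by (cases fr) auto
      then have "wt B ?b < wt B ?p" "size (white_labels ?b) = size (white_labels ?p)" using fr by (cases fr; simp)+
      then have "wt B (fill K ?b) < wt B (fill K ?p)" using wt_fill[of ?b ?p B K] by simp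
      then show "wt B (fill K ?b) < w" using l by (simp add: light_def)
    qed
    then have "Poly_Mapping.lookup (lin_ext delta (pull fr ?x')) (Dia {#T0, T1#}) =
       - Poly_Mapping.lookup x (fill K (plugf fr (addroot T1 T0))) - Poly_Mapping.lookup x (fill K (plugf fr (addroot T0 T1)))"
      using lookup_delta_root[OF pull_good[OF gx] \<open>T0 \<noteq> T1\<close>, of fr] by simp
    then show ?thesis using lookup_dev_pull[OF gx _ d(3), of "Dia {#T0, T1#}" delta] by simp
  qed
  ultimately have "Poly_Mapping.lookup x (fill K (plugf (extend fr T0) T1)) =
      Poly_Mapping.lookup x (fill K (plugf fr (addroot T1 T0))) + Poly_Mapping.lookup x (fill K (plugf fr (addroot T0 T1)))"
    by (simp add: lookup_delta algebra_simps add_eq_0_iff)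
  moreover have "Poly_Mapping.lookup x (fill K (plugf (extend fr T0) T1)) \<noteq> 0" using l by (simp add: light_def in_keys_iff)
  moreover have "wt B (fill K (plugf fr (addroot T1 T0))) = w \<and> wt B (fill K (plugf fr (addroot T0 T1))) = w"
  proof -
    let ?p = "plugf (extend fr T0) T1"
    have "wt B (plugf fr (addroot T1 T0)) = wt B ?p" "size (white_labels (plugf fr (addroot T1 T0))) = size (white_labels ?p)"
      "wt B (plugf fr (addroot T0 T1)) = wt B ?p" "size (white_labels (plugf fr (addroot T0 T1))) = size (white_labels ?p)"
      using fr by (cases fr; simp)+
    then show ?thesis
      using wt_fill[of "plugf fr (addroot T1 T0)" ?p B K] wt_fill[of "plugf fr (addroot T0 T1)" ?p B K] l
      by (simp add: light_def)
  qed
  ultimately show ?thesis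
    using light_iff[of "fill K (plugf fr (addroot T1 T0))"] light_iff[of "fill K (plugf fr (addroot T0 T1))"] by auto
qed

end

section \<open>Words of letters and their chains\<close>

abbreviation letter :: "bt \<Rightarrow> bool" where "letter a \<equiv> normal a \<and> \<not> is_Br a"

text \<open>The chain through the leading trees of the letters of a word, first letter at the root.
  By \<open>bracket_word\<close> it is the leading tree of the left-normed bracket if the first
  letter has the smallest label.\<close>

fun ladt :: "bt list \<Rightarrow> ct" where
  "ladt [] = undefined"
| "ladt [a] = lt a"
| "ladt (a # b # bs) = addroot (ladt (b # bs)) (lt a)"

lemma lt_letter:
  assumes "letter a"
  obtains l where "lt a = White () l {#}" | E where "lt a = Black () E {#}"
  using assms lt_properties[of a] by (cases "lt a") auto

text \<open>\<open>ladt\<close> is recursive at the root, whereas brackets grow at the top of the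
  chain; this reconciles the two.\<close>

lemma ladt_snoc: "\<forall>x\<in>set (a # bs). letter x \<Longrightarrow> ladt (a # bs @ [b]) = ext (lt b) (ladt (a # bs))"
proof (induction bs arbitrary: a)
  case Nil
  then have "letter a" by simp
  then show ?case by (rule lt_letter) simp_all
next
  case (Cons c bs)
  then have "letter a" by simp
  then show ?case
    by (rule lt_letter) (use Cons in simp_all)
qed

lemma white_labels_ladt: "as \<noteq> [] \<Longrightarrow> white_labels (ladt as) = (\<Sum>a\<leftarrow>as. white_labels (lt a))"
  by (induction as rule: ladt.induct) (simp_all add: ac_simps)

lemma in_sum_list_map: "x \<in> set xs \<Longrightarrow> l \<in># f x \<Longrightarrow> l \<in># (\<Sum>x\<leftarrow>xs. f x)"
  by (induction xs) auto

lemma root_labels_ladt: "root_labels (ladt (a # as)) = root_labels (lt a)"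
proof (cases as)
  case (Cons b bs)
  then show ?thesis by (cases "lt a") simp_all
qed simp

lemma lt_labels: "normal N \<Longrightarrow> Some s \<in># white_labels (lt N) \<longleftrightarrow> s \<in> labs N"
  using lt_properties finite_labs by auto

lemma disjoint_labs:
  assumes "\<forall>l. count (white_labels (lt t)) l + count (white_labels (lt u)) l \<le> 1" "normal t" "normal u"
  shows "labs t \<inter> labs u = {}"
proof (rule ccontr)
  assume "labs t \<inter> labs u \<noteq> {}"
  then obtain s where "s \<in> labs t" "s \<in> labs u" by blast
  then have "Some s \<in># white_labels (lt t)" "Some s \<in># white_labels (lt u)" using lt_labels assms by blast+
  then have "1 \<le> count (white_labels (lt t)) (Some s)" "1 \<le> count (white_labels (lt u)) (Some s)"
    by (simp_all add: Suc_leI)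
  then show False using assms(1)[rule_format, of "Some s"] by linarith
qed

text \<open>Left-normed brackets append letters on the right, hence the induction from the end of
  the word. Distinct labels turn the weak inequalities between first labels into the strict ones of
  \<open>normal\<close>.\<close>

lemma bracket_word:
  assumes "\<forall>x\<in>set (a # bs). letter x" "\<forall>l. count (white_labels (ladt (a # bs))) l \<le> 1" "\<forall>b\<in>set bs. first a \<le> first b"
  shows "normal (foldl Br a bs) \<and> lt (foldl Br a bs) = ladt (a # bs) \<and> first (foldl Br a bs) = first a"
  using assms
proof (induction bs rule: rev_induct)
  case (snoc b bs)
  let ?N = "foldl Br a bs"
  have c: "count (white_labels (ladt (a # bs))) l + count (white_labels (lt b)) l \<le> 1" for l
    using snoc.prems(2) by (simp add: white_labels_ladt add.assoc)
  then have "\<forall>l. count (white_labels (ladt (a # bs))) l \<le> 1" by (meson add_leD1)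
  then have N: "normal ?N" "lt ?N = ladt (a # bs)" "first ?N = first a" using snoc by auto
  have b: "letter b" "first a \<le> first b" using snoc.prems by auto
  have d: "labs ?N \<inter> labs b = {}" using disjoint_labs[of ?N b] c N b by simp
  then have "first ?N \<noteq> first b" using first_in_labs[of ?N] first_in_labs[of b] by auto
  then have "normal (Br ?N b)" using N b d by auto
  moreover have "lt (Br ?N b) = ladt (a # bs @ [b])"
    using ladt_snoc[of a bs b] snoc.prems(1) N by simp
  ultimately show ?case using N by simp
qed simp

lemma ordinary_child:
  assumes "l \<in># white_labels T" "l \<notin># root_labels T"
  obtains c T0 where "T = addroot c T0" "l \<in># white_labels c" "root_labels T0 = root_labels T"
    "size (white_labels c) \<le> size (white_labels T)"
proof (cases T)
  case (White i l' C)
  then obtain c where "c \<in># C" "l \<in># white_labels c" using assms by auto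
  then obtain R where "C = add_mset c R" by (meson multi_member_split)
  then show thesis using that[of c "White i l' R"] \<open>l \<in># white_labels c\<close> by (simp add: White)
next
  case (Black i E C)
  then obtain c where "c \<in># C" "l \<in># white_labels c" using assms by auto
  then obtain R where "C = add_mset c R" by (meson multi_member_split)
  then show thesis using that[of c "Black i E R"] \<open>l \<in># white_labels c\<close> by (simp add: Black)
qed

lemma root_labels_addroot [simp]: "root_labels (addroot y T) = root_labels T"
  by (cases T) simp_all

context kernel_element
begin

text \<open>The positions at which \<open>move_root\<close> applies: the whole tree, or a subtree on
  a special edge.\<close>

definition special_context :: "frame list \<Rightarrow> bool" where
  "special_context K \<longleftrightarrow> K = [] \<or> (\<exists>K' Y C. K = K' @ [FS Y C])"

text \<open>The root moves towards \<open>l\<close>: if \<open>l\<close> lies in an ordinary child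
  \<open>c'\<close> of the root, \<open>move_root\<close> makes \<open>c'\<close> the part with the
  root and hangs everything else from it. The part that carries the root shrinks each time.\<close>

lemma reroot_addroot:
  assumes "special_context K"
  shows "light (fill K (addroot U c)) \<Longrightarrow> l \<in># white_labels c \<Longrightarrow> \<exists>T'. light (fill K T') \<and> l \<in># root_labels T'"
proof (induction "size (white_labels c)" arbitrary: U c rule: less_induct)
  case less
  show ?case
  proof (cases "l \<in># root_labels c")
    case True
    then show ?thesis using less.prems by (intro exI[of _ "addroot U c"]) simp
  next
    case False
    then obtain c' c0 where c: "c = addroot c' c0" "l \<in># white_labels c'" using ordinary_child less.prems(2) by metis
    have "light (fill K (addroot c' (addroot U c0)))" using less.prems(1) by (simp add: c addroot_commute)
    then have l: "light (fill K (addroot (addroot U c0) c'))" using move_root[of K] assms by (simp add: special_context_def)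
    have "good (addroot (addroot U c0) c')" using light_good good_fill l by blast
    then have "good (addroot U c0)" using good_addroot by blast
    then have "good c0" using good_addroot by blast
    then have "0 < size (white_labels c0)" using size_white_labels_pos by (auto simp: good_def)
    then have "size (white_labels c') < size (white_labels c)" by (simp add: c)
    then show ?thesis using less.hyps l c(2) by blast
  qed
qed

lemma reroot:
  assumes K: "special_context K" and l: "light (fill K T)" and "l \<in># white_labels T"
  shows "\<exists>T'. light (fill K T') \<and> l \<in># root_labels T'"
proof (cases "l \<in># root_labels T")
  case False
  then obtain c T0 where c: "T = addroot c T0" "l \<in># white_labels c" using ordinary_child assms(3) by metis
  then have "light (fill K (addroot T0 c))" using move_root[of K] K l by (simp add: special_context_def)
  then show ?thesis using reroot_addroot[OF K] c(2) by blast
qed (use l in blast)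

text \<open>Keeping \<open>root_labels\<close> is essential: it ensures that the smallest label,
  once moved to the root, ends up in the first letter.\<close>

definition word_of :: "frame list \<Rightarrow> ct \<Rightarrow> bt list \<Rightarrow> bool" where
  "word_of K T as \<longleftrightarrow> as \<noteq> [] \<and> (\<forall>a\<in>set as. letter a) \<and> light (fill K (ladt as)) \<and> root_labels (ladt as) = root_labels T"

text \<open>First \<open>reroot\<close> brings the smallest label to the root, then the tree is
  rewritten as a word with this label in its first letter, and \<open>bracket_word\<close> applies.
  Words are a hypothesis here, because \<open>light_word\<close> uses this lemma for smaller trees
  in its own induction.\<close>

lemma light_normal_form:
  assumes K: "special_context K" and l: "light (fill K T)"
    and word: "\<And>T'. white_labels T' = white_labels T \<Longrightarrow> light (fill K T') \<Longrightarrow> \<exists>as. word_of K T' as"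
  shows "\<exists>N. normal N \<and> light (fill K (lt N))"
proof -
  have g: "good T" using l light_good good_fill by blast
  define L where "L = {s. Some s \<in># white_labels T}"
  have L: "l \<in># white_labels T \<longleftrightarrow> l \<in> Some ` L" for l
    using g by (cases l) (auto simp: L_def good_def)
  have "Some ` L = set_mset (white_labels T)" using L by blast
  then have "finite (Some ` L)" by simp
  then have "finite L" by (simp add: finite_image_iff)
  moreover have "L \<noteq> {}" using L white_labels_nonempty[of T] g by (auto simp: good_def)
  ultimately have m: "Min L \<in> L" "\<And>s. s \<in> L \<Longrightarrow> Min L \<le> s" by simp_all
  then obtain T' where T': "light (fill K T')" "Some (Min L) \<in># root_labels T'"
    using reroot[OF K l, of "Some (Min L)"] L by blast
  have lab: "white_labels U = white_labels T" if "light (fill K U)" for U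
    using light_fill_labels[OF that l] .
  obtain as where "word_of K T' as" using word[OF lab[OF T'(1)] T'(1)] by blast
  then obtain a bs where as: "\<forall>x\<in>set (a # bs). letter x" "light (fill K (ladt (a # bs)))" "root_labels (lt a) = root_labels T'"
    by (cases as) (auto simp: word_of_def root_labels_ladt)
  have sub: "s \<in> L" if "x \<in> set (a # bs)" "s \<in> labs x" for x s
  proof -
    have "normal x" using as(1) that(1) by blast
    then have "Some s \<in># white_labels (lt x)" using lt_labels that(2) by blast
    then have "Some s \<in># white_labels (ladt (a # bs))"
      using in_sum_list_map[OF that(1)] by (simp add: white_labels_ladt del: list.map)
    then show ?thesis using lab[OF as(2)] by (simp add: L_def)
  qed
  have "Some (Min L) \<in># root_labels (lt a)" using T'(2) as(3) by simp
  then have "Some (Min L) \<in># white_labels (lt a)" by (cases "lt a") auto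
  then have "Min L \<in> labs a" using lt_labels as(1) by simp
  then have "first a \<le> Min L" using first_le as(1) by simp
  then have "\<forall>b\<in>set bs. first a \<le> first b"
    using sub first_in_labs m(2) by (meson list.set_intros(2) order_trans)
  moreover have "\<forall>l. count (white_labels (ladt (a # bs))) l \<le> 1"
    using lab[OF as(2)] g by (simp add: good_def)
  ultimately show ?thesis using bracket_word[OF as(1)] as(2) by (intro exI[of _ "foldl Br a bs"]) simp
qed

text \<open>Each use of \<open>merge_siblings\<close> stacks two ordinary children of a vertex, so
  at most one is left; \<open>H\<close> and \<open>fr\<close> cover white and black vertices
  alike.\<close>

lemma merge_all:
  assumes "\<And>R c. plugf (fr R) c = H (add_mset c R)" "\<And>R Y C. fr R \<noteq> FS Y C" "\<And>R a. extend (fr R) a = fr (add_mset a R)"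
  shows "light (fill K (H C)) \<Longrightarrow> \<exists>C'. size C' \<le> 1 \<and> light (fill K (H C'))"
proof (induction "size C" arbitrary: C rule: less_induct)
  case less
  show ?case
  proof (cases "size C \<le> 1")
    case False
    then obtain T0 T1 R where C: "C = add_mset T1 (add_mset T0 R)"
      by (metis One_nat_def le_zero_eq multiset_cases not_less_eq_eq size_add_mset size_empty zero_le_one)
    then have "light (fill K (plugf (extend (fr R) T0) T1))" using less.prems by (simp add: assms(1,3))
    from merge_siblings[OF assms(2) this]
    have "\<exists>y. light (fill K (H (add_mset y R)))" by (auto simp: assms(1))
    then obtain y where y: "light (fill K (H (add_mset y R)))" by blast
    have "size (add_mset y R) < size C" by (simp add: C)
    then show ?thesis using less.hyps y by blast
  qed (use less.prems in blast)
qed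

lemma size_le_1: "size C \<le> 1 \<longleftrightarrow> C = {#} \<or> (\<exists>c. C = {#c#})"
  using size_cases[of C] by auto

text \<open>After \<open>merge_all\<close> the root has at most one ordinary child. The root becomes
  the first letter: a label if it is white, and if it is black the commutative product of normal
  forms found for its two special children. The remaining child provides the rest of the
  word.\<close>

lemma light_word: "light (fill K T) \<Longrightarrow> \<exists>as. word_of K T as"
proof (induction "size (white_labels T)" arbitrary: K T rule: less_induct)
  case less
  have gT: "good U" if "light (fill K U)" for K U using that light_good good_fill by blast
  have lab: "size (white_labels U) = size (white_labels T)" if "light (fill K U)" for U
    using light_fill_labels[OF that less.prems] by simp
  \<comment> \<open>Puts the letter \<open>a\<close> in front of a word for the only ordinary child
    \<open>c\<close>; that child is smaller because \<open>a\<close> has labels.\<close>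
  have add: "\<exists>as. word_of K T as"
    if a: "letter a" "root_labels (lt a) = root_labels T" and l: "light (fill K (addroot c (lt a)))" and fr: "\<And>c. plugf fr c = addroot c (lt a)"
    for a c fr
  proof -
    have "size (white_labels (addroot c (lt a))) = size (white_labels T)" using lab l .
    moreover have "0 < size (white_labels (lt a))" using size_white_labels_pos lt_properties a(1) by blast
    ultimately have "size (white_labels c) < size (white_labels T)" by simp
    moreover have "light (fill (K @ [fr]) c)" using l by (simp add: fr)
    ultimately obtain as where as: "word_of (K @ [fr]) c as" using less.hyps by blast
    then obtain b bs where "as = b # bs" by (cases as) (auto simp: word_of_def)
    then have "word_of K T (a # as)" using as a by (auto simp: word_of_def fr)
    then show ?thesis by blast
  qed
  show ?case
  proof (cases T)
    case (White i l C)
    then have "l \<noteq> None" using gT[OF less.prems] good_White(1) by blast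
    then obtain s where l: "l = Some s" by blast
    have lt: "lt (Lf s) = White () l {#}" by (simp add: unit_tree_def l)
    have lt': "ladt [Lf s] = White () l {#}" using lt by simp
    obtain C' where C': "size C' \<le> 1" "light (fill K (White () l C'))"
      using merge_all[of "FW l" "White () l" K C] less.prems by (auto simp: White)
    then consider "C' = {#}" | c where "C' = {#c#}" using size_le_1[of C'] by blast
    then show ?thesis
    proof cases
      case 1
      then have "word_of K T [Lf s]" using C' lt' by (simp add: word_of_def White del: ladt.simps)
      then show ?thesis by blast
    next
      case 2
      then show ?thesis using add[of "Lf s" c "FW l {#}"] C'(2) unfolding lt by (simp add: White)
    qed
  next
    case (Black i E C)
    obtain C' where C': "size C' \<le> 1" "light (fill K (Black () E C'))"
      using merge_all[of "FO E" "Black () E" K C] less.prems by (auto simp: Black)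
    have "size E = 2" using gT[OF C'(2)] good_Black(2) by blast
    then obtain X Y where E: "E = {#X, Y#}" by (rule size_2E)
    have g: "good X" "good Y" using good_Black(1)[OF gT[OF C'(2)]] by (simp_all add: E)
    then have pos: "0 < size (white_labels X)" "0 < size (white_labels Y)" using size_white_labels_pos by (auto simp: good_def)
    have sz: "size (white_labels X) + size (white_labels Y) \<le> size (white_labels T)"
      by (simp add: Black E)
    \<comment> \<open>The special children have fewer labels than \<open>T\<close>, so the induction
      provides their words, and they sit in special contexts, where rerooting is possible.\<close>
    have nf: "\<exists>N. normal N \<and> light (fill K' (lt N))"
      if "special_context K'" "light (fill K' U)" "size (white_labels U) < size (white_labels T)" for K' U
      by (rule light_normal_form[OF that(1,2)]) (use less.hyps that(3) in simp)
    have lX: "light (fill (K @ [FS {#Y#} C']) X)" using C'(2) by (simp add: E)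
    obtain N where N: "normal N" "light (fill (K @ [FS {#Y#} C']) (lt N))"
      using nf[OF _ lX] sz pos by (auto simp: special_context_def)
    \<comment> \<open>The first special child has already been replaced, so the second one is
      treated in the changed context.\<close>
    have lY: "light (fill (K @ [FS {#lt N#} C']) Y)" using N(2) by (simp add: add_mset_commute)
    obtain N' where N': "normal N'" "light (fill (K @ [FS {#lt N#} C']) (lt N'))"
      using nf[OF _ lY] sz pos by (auto simp: special_context_def)
    have eq: "white_labels (lt N) = white_labels X" "white_labels (lt N') = white_labels Y"
      using light_fill_labels[OF N(2) lX] light_fill_labels[OF N'(2) lY] .
    have lt: "light (fill K (Black () {#lt N, lt N'#} C'))" using N'(2) by (simp add: add_mset_commute)
    have "count (white_labels (lt N)) l + count (white_labels (lt N')) l \<le> 1" for l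
    proof -
      have "count (white_labels (Black () {#lt N, lt N'#} C')) l \<le> 1" using gT[OF lt] unfolding good_def by blast
      then show ?thesis by simp
    qed
    then have d: "labs N \<inter> labs N' = {}" by (intro disjoint_labs allI N N')
    then have "first N \<noteq> first N'" using first_in_labs[of N] first_in_labs[of N'] by auto
    then have "letter (if first N < first N' then Sy N N' else Sy N' N)" using N N' d by auto
    moreover have "lt (if first N < first N' then Sy N N' else Sy N' N) = Black () {#lt N, lt N'#} {#}"
      by (simp add: add_mset_commute)
    ultimately obtain a where a: "letter a" "lt a = Black () {#lt N, lt N'#} {#}" by blast
    have rl: "root_labels (lt a) = root_labels T" by (simp add: a(2) Black E eq)
    from C'(1) consider "C' = {#}" | c where "C' = {#c#}" using size_le_1[of C'] by blast
    then show ?thesis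
    proof cases
      case 1
      then have "word_of K T [a]" using lt a rl by (simp add: word_of_def)
      then show ?thesis by blast
    next
      case 2
      then show ?thesis using add[of a c "FO {#lt N, lt N'#} {#}"] a rl lt by simp
    qed
  qed
qed

theorem lightest_normal_form:
  assumes "light T"
  shows "\<exists>N\<in>NF S. light (lt N)"
proof -
  have "\<exists>N. normal N \<and> light (fill [] (lt N))"
    by (rule light_normal_form) (use assms light_word in \<open>auto simp: special_context_def\<close>)
  then obtain N where N: "normal N" "light (lt N)" by auto
  then have "labs N = S" using christoffel_trees_unique[OF lt_christoffel light_labels] by blast
  then show ?thesis using N by (auto simp: NF_def)
qed

end

section \<open>Normal forms are a basis of the kernel\<close>

text \<open>An upper bound for the weight on a component is what stops the induction in
  \<open>kernel_subset_span\<close>. Squares are superadditive, and their cross terms pay for the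
  special edges.\<close>

lemma wt_le_size_square: "two_special T \<Longrightarrow> wt B T \<le> (int (size (white_labels T)))\<^sup>2"
proof (induction T)
  have forest: "\<Sum>\<^sub># (image_mset (wt B) M) \<le> (int (size (\<Sum>\<^sub># (image_mset white_labels M))))\<^sup>2"
    if "\<And>c. c \<in># M \<Longrightarrow> wt B c \<le> (int (size (white_labels c)))\<^sup>2" for M
    using that
  proof (induction M)
    case (add c M)
    then have "wt B c \<le> (int (size (white_labels c)))\<^sup>2"
      "\<Sum>\<^sub># (image_mset (wt B) M) \<le> (int (size (\<Sum>\<^sub># (image_mset white_labels M))))\<^sup>2" by auto
    moreover have "a\<^sup>2 + b\<^sup>2 \<le> (a + b)\<^sup>2" if "0 \<le> a" "0 \<le> b" for a b :: int
      using that by (simp add: power2_sum)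
    note this[of "int (size (white_labels c))" "int (size (\<Sum>\<^sub># (image_mset white_labels M)))"]
    ultimately have "wt B c + \<Sum>\<^sub># (image_mset (wt B) M) \<le>
        (int (size (white_labels c)) + int (size (\<Sum>\<^sub># (image_mset white_labels M))))\<^sup>2" by linarith
    then show ?case by simp
  qed simp
  {
    case (White i l C)
    then have "\<Sum>\<^sub># (image_mset (wt B) C) \<le> (int (size (\<Sum>\<^sub># (image_mset white_labels C))))\<^sup>2"
      by (intro forest) auto
    also have "\<dots> \<le> (int (size (white_labels (White i l C))))\<^sup>2" by (intro power_mono of_nat_mono of_nat_0_le_iff) (simp only: white_labels.simps size_add_mset le_SucI order_refl)
    finally show ?case by simp
  next
    case (Black i E C)
    then obtain X Y where E: "E = {#X, Y#}" by (auto elim: size_2E)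
    define a b c where "a = int (size (white_labels X))" and "b = int (size (white_labels Y))"
      and "c = int (size (\<Sum>\<^sub># (image_mset white_labels C)))"
    have "\<Sum>\<^sub># (image_mset (wt B) C) \<le> c\<^sup>2"
      unfolding c_def by (rule forest) (use Black in auto)
    moreover have "wt B X \<le> a\<^sup>2" "wt B Y \<le> b\<^sup>2" using Black by (auto simp: E a_def b_def)
    moreover have "0 \<le> c" unfolding c_def by (rule of_nat_0_le_iff)
    moreover have "1 \<le> a" "1 \<le> b"
      using size_white_labels_pos[of X] size_white_labels_pos[of Y] Black.prems by (auto simp: E a_def b_def)
    \<comment> \<open>Both special children have labels, so already \<open>2 * a * b\<close> is at
      least \<open>a + b\<close>, the cost of the two special edges.\<close>
    moreover have "a + b \<le> 2 * a * b + 2 * a * c + 2 * b * c"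
    proof -
      have "0 \<le> (a - 1) * b + a * (b - 1)" "0 \<le> a * c" "0 \<le> b * c" using \<open>1 \<le> a\<close> \<open>1 \<le> b\<close> \<open>0 \<le> c\<close> by simp_all
      then show ?thesis by (simp add: algebra_simps)
    qed
    ultimately have "wt B X + wt B Y + (a + b) + \<Sum>\<^sub># (image_mset (wt B) C) - int B \<le> (a + b + c)\<^sup>2"
      by (simp add: power2_eq_square algebra_simps)
    then show ?case by (simp add: E a_def b_def c_def)
  }
qed

lemma span_ev_kernel:
  "z \<in> fvs.span (ev ` NF S) \<Longrightarrow> z \<in> (nT S :: (ct \<Rightarrow>\<^sub>0 'k::field_char_0) set) \<and> D z = 0"
proof (induction rule: fvs.span_induct_alt)
  case (step c e w)
  then obtain N where N: "N \<in> NF S" "e = ev N" by blast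
  have "e \<in> nT S" using ev_nT N by (auto simp: NF_def)
  moreover have "D e = 0" using D_phi[OF evM_NF_MT[OF N(1)]] by (simp add: N(2) phi_evM)
  ultimately show ?case using step by (simp add: trees_span_arith D_add D_scale)
qed (simp add: trees_span_arith D_zero)

lemma NF_wt:
  assumes "N \<in> NF S"
  shows "T \<in> Poly_Mapping.keys (ev N :: ct \<Rightarrow>\<^sub>0 'k::field_char_0) \<Longrightarrow> wt (Suc (card S)) (lt N) \<le> wt (Suc (card S)) T"
    "N' \<in> NF S \<Longrightarrow> wt (Suc (card S)) (lt N') = wt (Suc (card S)) (lt N) \<Longrightarrow>
      Poly_Mapping.lookup (ev N :: ct \<Rightarrow>\<^sub>0 'k) (lt N') = (if N' = N then sg N else 0)"
  using ev_keys_wt[of N "Suc (card S)"] ev_lookup_lt[of N "Suc (card S)" N'] assms by (auto simp: NF_def)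

theorem kernel_subset_span:
  fixes x :: "ct \<Rightarrow>\<^sub>0 'k::field_char_0"
  assumes "x \<in> nT S" "D x = 0"
  shows "x \<in> fvs.span (ev ` NF S)"
proof -
  define B where "B = Suc (card S)"
  have sg: "sg N \<noteq> (0 :: 'k)" for N by (rule sg_nonzero)
  have "x \<in> fvs.span (ev ` NF S)" if "x \<in> nT S" "D x = 0" "\<And>T. T \<in> Poly_Mapping.keys x \<Longrightarrow> w \<le> wt B T"
    for x :: "ct \<Rightarrow>\<^sub>0 'k" and w
    using that
  \<comment> \<open>No weight on this component exceeds the square of \<open>card S\<close>; the
    summand 1 keeps the measure positive as long as \<open>w\<close> can still be raised.\<close>
  proof (induction "nat ((int (card S))\<^sup>2 + 1 - w)" arbitrary: x w rule: less_induct)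
    case less
    show ?case
    proof (cases "x = 0")
      case False
      then obtain T where T: "T \<in> Poly_Mapping.keys x" by (meson all_not_in_conv keys_eq_empty)
      then have T': "T \<in> christoffel_trees S" using less.prems(1) by (simp add: trees_span_def)
      then have "wt B T \<le> (int (card S))\<^sup>2"
        using wt_le_size_square[of T B] size_christoffel[OF T'] by (simp add: christoffel_trees_iff)
      then have w: "w \<le> (int (card S))\<^sup>2" using less.prems(3)[OF T] by simp
      define A where "A = {N \<in> NF S. wt B (lt N) = w \<and> lt N \<in> Poly_Mapping.keys x}"
      have ev_lt: "Poly_Mapping.lookup (ev N) (lt N') = (if N' = N then sg N else 0 :: 'k)"
        if "N \<in> NF S" "N' \<in> NF S" "wt B (lt N) = w" "wt B (lt N') = w" for N N'
        using NF_wt(2)[OF that(1,2)] that(3,4) by (simp add: B_def)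
      have "inj_on lt A"
      proof (rule inj_onI)
        fix N N' assume "N \<in> A" "N' \<in> A" "lt N = lt N'"
        then have "(if N' = N then sg N else 0) = (sg N :: 'k)"
          using ev_lt[of N N'] ev_lt[of N N] by (simp add: A_def)
        then show "N = N'" using sg[of N] by (simp split: if_splits)
      qed
      moreover have "lt ` A \<subseteq> Poly_Mapping.keys x" by (auto simp: A_def)
      ultimately have fin: "finite A" by (meson finite_imageD finite_keys finite_subset)
      \<comment> \<open>By \<open>ev_lt\<close> the leading coefficients form a diagonal matrix, so
        one combination removes all leading trees of weight \<open>w\<close> at once.\<close>
      define z where "z = (\<Sum>N\<in>A. fscale (Poly_Mapping.lookup x (lt N) / sg N) (ev N))"
      have z: "z \<in> fvs.span (ev ` NF S)"
        unfolding z_def by (intro fvs.span_sum fvs.span_scale fvs.span_base) (auto simp: A_def)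
      have lz: "Poly_Mapping.lookup z t = (\<Sum>N\<in>A. Poly_Mapping.lookup x (lt N) / sg N * Poly_Mapping.lookup (ev N) t)" for t
        by (simp add: z_def lookup_sum)
      define y where "y = x - z"
      have y: "y \<in> nT S" "D y = 0"
      proof -
        show "y \<in> nT S" unfolding y_def using less.prems(1) span_ev_kernel[OF z] by (intro trees_span_arith(3)) blast+
        have "D y = D x - D z" unfolding y_def by (rule lmap_diff[OF lmap_D[OF lmap_ident]])
        then show "D y = 0" using less.prems(2) span_ev_kernel[OF z] by simp
      qed
      have low: "w \<le> wt B t" if "t \<in> Poly_Mapping.keys y" for t
      proof -
        have "t \<in> Poly_Mapping.keys x \<or> t \<in> Poly_Mapping.keys z" using that keys_diff[of x z] unfolding y_def by blast
        moreover have "w \<le> wt B t" if "t \<in> Poly_Mapping.keys z"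
        proof -
          have "\<exists>N\<in>A. Poly_Mapping.lookup (ev N :: ct \<Rightarrow>\<^sub>0 'k) t \<noteq> 0"
          proof (rule ccontr)
            assume "\<not> ?thesis"
            then have "Poly_Mapping.lookup z t = 0" unfolding lz by simp
            then show False using that by (simp add: in_keys_iff)
          qed
          then obtain N where N: "N \<in> A" "t \<in> Poly_Mapping.keys (ev N :: ct \<Rightarrow>\<^sub>0 'k)" by (auto simp: in_keys_iff)
          then show ?thesis using NF_wt(1)[OF _ N(2), of S] by (simp add: A_def B_def)
        qed
        ultimately show ?thesis using less.prems(3) by blast
      qed
      interpret kernel_element y S B w
        by unfold_locales (use y low in \<open>auto simp: B_def\<close>)
      \<comment> \<open>A tree of weight \<open>w\<close> left in \<open>y\<close> would yield a
        leading tree of weight \<open>w\<close> in \<open>y\<close> by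
        \<open>lightest_normal_form\<close>, but all of these have been removed.\<close>
      have "w + 1 \<le> wt B t" if t: "t \<in> Poly_Mapping.keys y" for t
      proof (rule ccontr)
        assume "\<not> w + 1 \<le> wt B t"
        then have "light t" using t low[OF t] by (simp add: light_def)
        then obtain N where N: "N \<in> NF S" "light (lt N)" using lightest_normal_form by blast
        then have Nw: "wt B (lt N) = w" "Poly_Mapping.lookup y (lt N) \<noteq> 0" by (simp_all add: light_def in_keys_iff)
        have "Poly_Mapping.lookup z (lt N) = (\<Sum>N'\<in>A. if N' = N then Poly_Mapping.lookup x (lt N') else 0)"
          unfolding lz
        proof (intro sum.cong refl)
          fix N' assume "N' \<in> A"
          then have "Poly_Mapping.lookup (ev N') (lt N) = (if N = N' then sg N' else 0 :: 'k)"
            using ev_lt[of N' N] N Nw by (simp add: A_def)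
          then show "Poly_Mapping.lookup x (lt N') / sg N' * Poly_Mapping.lookup (ev N') (lt N) = (if N' = N then Poly_Mapping.lookup x (lt N') else 0)"
            using sg[of N'] by auto
        qed
        also have "\<dots> = Poly_Mapping.lookup x (lt N)"
          using fin N(1) Nw(1) by (auto simp: A_def in_keys_iff)
        finally show False using Nw(2) by (simp add: y_def lookup_minus)
      qed
      moreover have "nat ((int (card S))\<^sup>2 + 1 - (w + 1)) < nat ((int (card S))\<^sup>2 + 1 - w)" using w by simp
      ultimately have "y \<in> fvs.span (ev ` NF S)" using less.hyps y by blast
      then have "y + z \<in> fvs.span (ev ` NF S)" using z by (rule fvs.span_add)
      then show ?thesis by (simp add: y_def)
    qed (simp add: fvs.span_zero)
  qed
  \<comment> \<open>For \<open>x = 0\<close> this minimum is taken over the empty set, but then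
    there is no tree to bound.\<close>
  from this[OF assms, of "Min (wt B ` Poly_Mapping.keys x)"] show ?thesis by simp
qed

lemma span_image_lin_ext:
  fixes z :: "'b \<Rightarrow>\<^sub>0 'k::field"
  shows "z \<in> fvs.span (f ` A) \<Longrightarrow> \<exists>u. Poly_Mapping.keys u \<subseteq> A \<and> z = lin_ext f u"
proof (induction rule: fvs.span_induct_alt)
  case base
  then show ?case by (intro exI[of _ 0]) (simp add: lin_ext_def)
next
  case (step c e z)
  then obtain u a where u: "Poly_Mapping.keys u \<subseteq> A" "z = lin_ext f u" "a \<in> A" "e = f a" by blast
  have "Poly_Mapping.keys (fscale c (basis a) + u) \<subseteq> A"
    using u keys_add[of "fscale c (basis a)" u] keys_fscale[of c "basis a :: 'a \<Rightarrow>\<^sub>0 'k"] by (auto split: if_splits)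
  moreover have "fscale c e + z = lin_ext f (fscale c (basis a) + u)"
    by (simp add: u lmap_add[OF lmap_lin_ext] lmap_scale[OF lmap_lin_ext])
  ultimately show ?case by blast
qed

text \<open>Take a normal form of \<open>u\<close> whose leading tree is lightest. Heavier normal
  forms contain no tree of this weight, and those of the same weight miss this tree.\<close>

theorem ev_independent:
  fixes u :: "bt \<Rightarrow>\<^sub>0 'k::field_char_0"
  assumes u: "Poly_Mapping.keys u \<subseteq> NF S" and 0: "lin_ext ev u = 0"
  shows "u = 0"
proof (rule ccontr)
  assume "u \<noteq> 0"
  let ?wt = "\<lambda>N. wt (Suc (card S)) (lt N)"
  have "Poly_Mapping.keys u \<noteq> {}" using \<open>u \<noteq> 0\<close> by simp
  then obtain N where N: "N \<in> Poly_Mapping.keys u" "\<And>N'. N' \<in> Poly_Mapping.keys u \<Longrightarrow> ?wt N \<le> ?wt N'"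
    using finite_keys[of u] ex_min_if_finite[of "?wt ` Poly_Mapping.keys u"] by (fastforce simp: not_less)
  have "Poly_Mapping.lookup (lin_ext ev u) (lt N) = (\<Sum>N'\<in>Poly_Mapping.keys u. if N' = N then Poly_Mapping.lookup u N * sg N else 0)"
    unfolding lookup_lin_ext
  proof (intro sum.cong refl)
    fix N' assume N': "N' \<in> Poly_Mapping.keys u"
    have NF: "N \<in> NF S" "N' \<in> NF S" using N(1) N' u by auto
    show "Poly_Mapping.lookup u N' * Poly_Mapping.lookup (ev N') (lt N) = (if N' = N then Poly_Mapping.lookup u N * sg N else 0)"
    proof (cases "?wt N = ?wt N'")
      case True
      then show ?thesis using NF_wt(2)[OF NF(2,1), where 'k = 'k] by auto
    next
      case False
      then have "\<not> ?wt N' \<le> ?wt N" using N(2)[OF N'] by simp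
      then have "Poly_Mapping.lookup (ev N' :: ct \<Rightarrow>\<^sub>0 'k) (lt N) = 0"
        using NF_wt(1)[OF NF(2)] by (auto simp: in_keys_iff)
      then show ?thesis using False by auto
    qed
  qed
  also have "\<dots> = Poly_Mapping.lookup u N * sg N" using N(1) by simp
  moreover have "sg N \<noteq> (0 :: 'k)" by (rule sg_nonzero)
  ultimately show False using 0 N(1) by (simp add: in_keys_iff)
qed

lemma phi_lin_ext_evM: "phi (lin_ext evM u) = (lin_ext ev u :: ct \<Rightarrow>\<^sub>0 'k::field_char_0)"
  by (simp add: lmap_lin_ext_comp[OF lmap_phi[OF lmap_ident]] phi_evM)

text \<open>Modulo the ideal \<open>x\<close> is a combination of normal forms; the ideal maps to
  zero and normal forms have independent images, so this combination is zero.\<close>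

theorem phi_kernel:
  fixes x :: "magma_tree \<Rightarrow>\<^sub>0 'k::field_char_0"
  assumes "x \<in> MT S" "phi x = 0"
  shows "LI S x"
proof -
  obtain z where z: "z \<in> fvs.span (evM ` NF S)" "LI S (x - z)" using MT_Sp[OF assms(1)] by (auto simp: Sp_def)
  obtain u where u: "Poly_Mapping.keys u \<subseteq> NF S" "z = lin_ext evM u" using span_image_lin_ext[OF z(1)] by blast
  have "phi (x - z) = 0" using LI_phi[OF z(2)] by simp
  then have "lin_ext ev u = 0" using assms(2) by (simp add: phi_diff u(2) phi_lin_ext_evM)
  then have "u = 0" using ev_independent u(1) by blast
  then have "z = 0" by (simp add: u(2) lin_ext_def)
  then show ?thesis using z(2) by simp
qed

lemma phi_image: "phi ` MT S = {x \<in> (nT S :: (ct \<Rightarrow>\<^sub>0 'k::field_char_0) set). D x = 0}"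
proof
  show "phi ` MT S \<subseteq> {x \<in> (nT S :: (ct \<Rightarrow>\<^sub>0 'k) set). D x = 0}" using phi_nT D_phi by auto
  show "{x \<in> (nT S :: (ct \<Rightarrow>\<^sub>0 'k) set). D x = 0} \<subseteq> phi ` MT S"
  proof
    fix x :: "ct \<Rightarrow>\<^sub>0 'k" assume "x \<in> {x \<in> nT S. D x = 0}"
    then have "x \<in> fvs.span (ev ` NF S)" using kernel_subset_span by blast
    then obtain u where u: "Poly_Mapping.keys u \<subseteq> NF S" "x = lin_ext ev u" using span_image_lin_ext by blast
    have "lin_ext evM u \<in> MT S"
      by (rule lin_ext_in_trees_span[where P = "\<lambda>N. N \<in> NF S"]) (use u(1) evM_NF_MT in \<open>auto simp: trees_span_def\<close>)
    moreover have "x = phi (lin_ext evM u)" using u(2) phi_lin_ext_evM[of u] by simp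
    ultimately show "x \<in> phi ` MT S" by blast
  qed
qed

theorem kernel_eq_span_iterated:
  "{x \<in> (nT S :: (ct \<Rightarrow>\<^sub>0 'k::field_char_0) set). D x = 0} = fvs.span {x. iterated nablaTrees nabla S x}"
proof
  show "{x \<in> (nT S :: (ct \<Rightarrow>\<^sub>0 'k) set). D x = 0} \<subseteq> fvs.span {x. iterated nablaTrees nabla S x}"
    unfolding phi_image[symmetric]
  proof
    fix y :: "ct \<Rightarrow>\<^sub>0 'k" assume "y \<in> phi ` MT S"
    then obtain x where x: "x \<in> MT S" "y = phi x" by blast
    show "y \<in> fvs.span {x. iterated nablaTrees nabla S x}"
      unfolding x(2) phi_def lin_ext_def
    proof (rule fvs.span_sum, rule fvs.span_scale, rule fvs.span_base, rule CollectI)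
      fix t assume "t \<in> Poly_Mapping.keys x"
      then have "distinct (leaves t)" "set (leaves t) = S" using x(1) by (auto simp: trees_span_def)
      then show "iterated nablaTrees nabla S (phi_tree t :: ct \<Rightarrow>\<^sub>0 'k)" using iterated_phi_tree by blast
    qed
  qed
  show "fvs.span {x. iterated nablaTrees nabla S x} \<subseteq> {x \<in> (nT S :: (ct \<Rightarrow>\<^sub>0 'k) set). D x = 0}"
  proof
    fix x :: "ct \<Rightarrow>\<^sub>0 'k" assume "x \<in> fvs.span {x. iterated nablaTrees nabla S x}"
    then show "x \<in> {x \<in> nT S. D x = 0}"
      by (induction rule: fvs.span_induct_alt)
        (auto simp: trees_span_arith D_add D_scale D_zero dest: iterated_kernel)
  qed
qed

section \<open>The isomorphism\<close>

text \<open>\<open>phi\<close> is constant on cosets of the ideal, so any representative will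
  do.\<close>

definition Phi :: "(magma_tree \<Rightarrow>\<^sub>0 'k::field) set \<Rightarrow> (ct \<Rightarrow>\<^sub>0 'k)" where
  "Phi X = phi (SOME x. x \<in> X)"

lemma Phi_eq: "X \<noteq> {} \<Longrightarrow> (\<And>x. x \<in> X \<Longrightarrow> phi x = a) \<Longrightarrow> Phi X = a"
  unfolding Phi_def by (rule someI2_ex) auto

lemma mem_coset: "y \<in> coset Mag LI S x \<longleftrightarrow> LI S (y - x)"
  unfolding coset_def by (auto simp: algebra_simps intro: exI[of _ "y - x"])

lemma coset_self: "x \<in> coset Mag LI S x"
  by (simp add: mem_coset LI_intros)

lemma coset_phi:
  fixes x :: "magma_tree \<Rightarrow>\<^sub>0 'k::field_char_0"
  assumes "y \<in> coset Mag LI S x"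
  shows "phi y = phi x" "x \<in> MT S \<Longrightarrow> y \<in> MT S"
proof -
  have "y - x \<in> MT S" "phi (y - x) = 0" using LI_phi[of S "y - x"] assms by (auto simp: mem_coset)
  then show "phi y = phi x" "x \<in> MT S \<Longrightarrow> y \<in> MT S"
    using trees_span_arith(2)[of "y - x" _ x] by (simp_all add: phi_diff)
qed

lemma Phi_coset: "Phi (coset Mag LI S x) = (phi x :: ct \<Rightarrow>\<^sub>0 'k::field_char_0)"
  using coset_self[of x S] by (intro Phi_eq coset_phi(1)) auto

text \<open>Operations of the quotient are unions of cosets over all representatives; it suffices
  that \<open>phi\<close> takes a single value on the results.\<close>

lemma Phi_UN_coset:
  fixes X :: "(magma_tree \<Rightarrow>\<^sub>0 'k::field_char_0) set" and f :: "_ \<Rightarrow> magma_tree \<Rightarrow>\<^sub>0 'k"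
  assumes "X \<noteq> {}" "\<And>x. x \<in> X \<Longrightarrow> phi (f x) = a"
  shows "Phi (\<Union>x\<in>X. coset Mag LI S (f x)) = a"
proof (rule Phi_eq)
  obtain x where "x \<in> X" using assms(1) by blast
  then show "(\<Union>x\<in>X. coset Mag LI S (f x)) \<noteq> {}" using coset_self[of "f x" S] by blast
  fix z assume "z \<in> (\<Union>x\<in>X. coset Mag LI S (f x))"
  then obtain x where "x \<in> X" "z \<in> coset Mag LI S (f x)" by blast
  then show "phi z = a" using coset_phi(1)[of z S "f x"] assms(2)[of x] by simp
qed

lemma Phi_UN2_coset:
  fixes X Y :: "(magma_tree \<Rightarrow>\<^sub>0 'k::field_char_0) set" and f :: "_ \<Rightarrow> _ \<Rightarrow> magma_tree \<Rightarrow>\<^sub>0 'k"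
  assumes "X \<noteq> {}" "Y \<noteq> {}" "\<And>x y. x \<in> X \<Longrightarrow> y \<in> Y \<Longrightarrow> phi (f x y) = a"
  shows "Phi (\<Union>x\<in>X. \<Union>y\<in>Y. coset Mag LI S (f x y)) = a"
proof (rule Phi_eq)
  obtain x y where "x \<in> X" "y \<in> Y" using assms(1,2) by blast
  then show "(\<Union>x\<in>X. \<Union>y\<in>Y. coset Mag LI S (f x y)) \<noteq> {}" using coset_self[of "f x y" S] by blast
  fix z assume "z \<in> (\<Union>x\<in>X. \<Union>y\<in>Y. coset Mag LI S (f x y))"
  then obtain x y where "x \<in> X" "y \<in> Y" "z \<in> coset Mag LI S (f x y)" by blast
  then show "phi z = a" using coset_phi(1)[of z S "f x y"] assms(3)[of x y] by simp
qed

lemma LieAdm_simps: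
  "op_space LieAdm S = coset Mag LI S ` MT S"
  "op_add LieAdm S X Y = (\<Union>x\<in>X. \<Union>y\<in>Y. coset Mag LI S (x + y))"
  "op_scale LieAdm S c X = (\<Union>x\<in>X. coset Mag LI S (fscale c x))"
  "op_act LieAdm S \<sigma> X = (\<Union>x\<in>X. coset Mag LI (\<sigma> ` S) (mact \<sigma> x))"
  "op_comp LieAdm S v T X Y = (\<Union>x\<in>X. \<Union>y\<in>Y. coset Mag LI ((S - {v}) \<union> T) (mcomp v x y))"
  "op_unit LieAdm s = coset Mag LI {s} (basis (Leaf s))"
  by (simp_all add: LieAdm_def quotient_operad_def)

theorem operad_iso_Phi:
  "operad_iso LieAdm (ker_Phi_geo :: ('k::field_char_0, ct \<Rightarrow>\<^sub>0 'k) operad) (\<lambda>S. Phi)"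
  unfolding operad_iso_def
proof (intro conjI allI ballI impI)
  fix S
  \<comment> \<open>Elements with the same image differ by an element of the ideal, by
    \<open>phi_kernel\<close>, and hence have the same coset.\<close>
  have "inj_on Phi (coset Mag LI S ` (MT S :: (magma_tree \<Rightarrow>\<^sub>0 'k) set))"
  proof (rule inj_onI, clarify)
    fix x y :: "magma_tree \<Rightarrow>\<^sub>0 'k"
    assume xy: "x \<in> MT S" "y \<in> MT S" and "Phi (coset Mag LI S x) = Phi (coset Mag LI S y)"
    then have "phi (x - y) = 0" by (simp add: Phi_coset phi_diff)
    then have l: "LI S (x - y)" using xy by (intro phi_kernel trees_span_arith)
    have "LI S (z - x) \<longleftrightarrow> LI S (z - y)" for z
      using LI_intros(3)[OF _ l, of "z - x"] LI_diff[OF _ l, of "z - y"] by auto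
    then show "coset Mag LI S x = coset Mag LI S y" by (auto simp: mem_coset)
  qed
  moreover have "Phi ` coset Mag LI S ` (MT S :: (magma_tree \<Rightarrow>\<^sub>0 'k) set) = phi ` MT S"
    by (auto simp: image_image Phi_coset)
  ultimately show "bij_betw Phi (op_space LieAdm S) (op_space (ker_Phi_geo :: ('k, ct \<Rightarrow>\<^sub>0 'k) operad) S)"
    by (simp add: bij_betw_def LieAdm_simps phi_image)
next
  fix S and X Y :: "(magma_tree \<Rightarrow>\<^sub>0 'k) set"
  assume "X \<in> op_space LieAdm S" "Y \<in> op_space LieAdm S"
  then obtain x y where xy: "X = coset Mag LI S x" "Y = coset Mag LI S y" by (auto simp: LieAdm_simps)
  have "phi (x' + y') = phi x + phi y" if "x' \<in> X" "y' \<in> Y" for x' y'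
    using coset_phi(1)[OF that(1)[unfolded xy]] coset_phi(1)[OF that(2)[unfolded xy]] by (simp add: phi_add)
  then show "Phi (op_add LieAdm S X Y) = op_add ker_Phi_geo S (Phi X) (Phi Y)"
    unfolding LieAdm_simps
    by (intro Phi_UN2_coset) (use coset_self[of x S] coset_self[of y S] in \<open>auto simp: xy Phi_coset\<close>)
next
  fix S c and X :: "(magma_tree \<Rightarrow>\<^sub>0 'k) set"
  assume "X \<in> op_space LieAdm S"
  then obtain x where x: "X = coset Mag LI S x" by (auto simp: LieAdm_simps)
  have "phi (fscale c x') = fscale c (phi x)" if "x' \<in> X" for x'
    using coset_phi(1)[OF that[unfolded x]] by (simp add: phi_scale)
  then show "Phi (op_scale LieAdm S c X) = op_scale ker_Phi_geo S c (Phi X)"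
    unfolding LieAdm_simps
    by (intro Phi_UN_coset) (use coset_self[of x S] in \<open>auto simp: x Phi_coset\<close>)
next
  fix S \<sigma> and X :: "(magma_tree \<Rightarrow>\<^sub>0 'k) set"
  assume "X \<in> op_space LieAdm S"
  then obtain x where x: "X = coset Mag LI S x" by (auto simp: LieAdm_simps)
  have "phi (mact \<sigma> x') = act \<sigma> (phi x)" if "x' \<in> X" for x'
    using coset_phi(1)[OF that[unfolded x]] by (simp add: phi_act)
  then show "Phi (op_act LieAdm S \<sigma> X) = op_act ker_Phi_geo S \<sigma> (Phi X)"
    unfolding LieAdm_simps
    by (intro Phi_UN_coset) (use coset_self[of x S] in \<open>auto simp: x Phi_coset\<close>)
next
  fix S v T and X Y :: "(magma_tree \<Rightarrow>\<^sub>0 'k) set"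
  assume "X \<in> op_space LieAdm S" "Y \<in> op_space LieAdm T" and v: "composable S v T"
  then obtain x y where xy: "X = coset Mag LI S x" "Y = coset Mag LI T y" "x \<in> MT S" "y \<in> MT T"
    by (auto simp: LieAdm_simps)
  have "op_comp nablaTrees S v T (phi x) (phi y) = sub (Some v) (phi y) (phi x)"
    using comp_eq_sub(1)[OF nT_dT[OF phi_nT[OF xy(3)]]] v by blast
  moreover have "phi (mcomp v x' y') = sub (Some v) (phi y) (phi x)" if "x' \<in> X" "y' \<in> Y" for x' y'
    using that coset_phi[of x' S x] coset_phi[of y' T y] phi_comp[of x' S v y'] v xy by simp
  ultimately show "Phi (op_comp LieAdm S v T X Y) = op_comp ker_Phi_geo S v T (Phi X) (Phi Y)"
    unfolding LieAdm_simps
    by (intro Phi_UN2_coset) (use coset_self[of x S] coset_self[of y T] xy in \<open>auto simp: Phi_coset\<close>)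
next
  fix s show "Phi (op_unit LieAdm s) = op_unit (ker_Phi_geo :: ('k, ct \<Rightarrow>\<^sub>0 'k) operad) s"
    by (simp add: LieAdm_simps Phi_coset)
qed

theorem theorem1p3:
  shows "\<exists>\<phi> :: nat set \<Rightarrow> (magma_tree \<Rightarrow>\<^sub>0 'k::field_char_0) set \<Rightarrow> (christoffel_tree \<Rightarrow>\<^sub>0 'k).
    operad_iso LieAdm ker_Phi_geo \<phi> \<and>
    \<phi> {1, 2} LieAdm_product = nabla \<and>
    (\<forall>S. op_space (ker_Phi_geo :: ('k, christoffel_tree \<Rightarrow>\<^sub>0 'k) operad) S =
           fvs.span {x. iterated nablaTrees nabla S x})"
proof (intro exI[of _ "\<lambda>S. Phi"] conjI allI)
  show "Phi LieAdm_product = (nabla :: ct \<Rightarrow>\<^sub>0 'k)"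
    by (simp add: LieAdm_product_def Phi_coset nabla_eq)
qed (simp_all only: operad_iso_Phi ker_Phi_geo_simps kernel_eq_span_iterated)

end
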